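(* Let $H$, $\mu$, $\alpha$, $\sigma$, $L$, $(M_n)$, $\{X_{nj}\}$, $S_n=\sum_{j=1}^nX_{nj}$ and $\mathcal V$ be as in the context (soft truncation regime). Let $k\ge2$ be an integer and assume that $$P(L>x)=o\left(P(\|H\|>x)^{k-1}\right)\qquad\text{as }x\to\infty.$$ For $A\subset\mathcal S$ define $$\Gamma_k(A):=\frac1{k!}\sum_{s\in A}P(\langle s,\mathcal V\rangle\ge0)\,\sigma(\{s\})^k.$$ Then for every closed set $F\subset\mathcal S$, $$\limsup_{n\to\infty}\frac{P\left(\|S_n\|>kM_n,\ \frac{S_n}{\|S_n\|}\in F\right)}{\{nP(\|H\|>M_n)\}^k}\le\Gamma_k(F).$$ If, in addition, for every $s\in\mathcal S$, $$\liminf_{t\to\infty}\frac{P\left(\|H\|>t,\ \frac H{\|H\|}=s\right)}{P(\|H\|>t)}\ge\sigma(\{s\})$$ and $$P(\langle s,\mathcal V\rangle=0)\,\sigma(\{s\})=0,$$ then, as $n\to\infty$, $$\frac{P\left(\|S_n\|>kM_n,\ \frac{S_n}{\|S_n\|}\in\cdot\right)}{\{nP(\|H\|>M_n)\}^k}\ \stackrel{w}{\longrightarrow}\ \Gamma_k(\cdot)$$ weakly (as finite measures) on $\mathcal S$.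
   Context: Notation: $\|\cdot\|$ is the Euclidean norm and $\langle\cdot,\cdot\rangle$ the Euclidean inner product on $\mathbb R^d$; $B_r:=\{x\in\mathbb R^d:\|x\|\le r\}$ for $r\ge0$, and complements of such balls are denoted $B_r^c$; $\mathcal S:=\{x\in\mathbb R^d:\|x\|=1\}$. $\overline{\mathbb R^d}$ is the compact set obtained by adding to $\mathbb R^d$ a sphere of infinite radius centered at the origin; $\stackrel{v}{\longrightarrow}$ denotes vague convergence of Radon measures. Setup: $H$ is an $\mathbb R^d$-valued random vector for which there are a non-null Radon measure $\mu$ on $\mathbb R^d\setminus\{0\}$, extended by $\mu(\overline{\mathbb R^d}\setminus\mathbb R^d)=0$, and a sequence $a_n\to\infty$ with $nP(a_n^{-1}H\in\cdot)\stackrel{v}{\longrightarrow}\mu(\cdot)$ on $\overline{\mathbb R^d}\setminus\{0\}$. Then there is $\alpha>0$ with $\mu(cA)=c^{-\alpha}\mu(A)$ for all $c>0$ and Borel $A$, and $P(\|H\|>\cdot)$ is regularly varying with index $-\alpha$. If $\alpha=1$, $H$ is assumed to have a symmetric distribution; if $\alpha>1$, $E(H)=0$. $H_1,H_2,\ldots$ are i.i.d. copies of $H$; $L,L_1,L_2,\ldots$ are i.i.d. $[0,\infty)$-valued random variables independent of $(H,H_1,H_2,\ldots)$; $(M_n)$ is a sequence of positive numbers with $M_n\to\infty$; and for $1\le j\le n$ $$X_{nj}:=H_j\mathbf 1(\|H_j\|\le M_n)+\frac{H_j}{\|H_j\|}(M_n+L_j)\mathbf 1(\|H_j\|>M_n).$$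 Soft truncation regime (standing assumptions): $\lim_{n\to\infty}nP(\|H\|>M_n)=0$; moreover, if $\alpha=2$, $\lim_n M_n/\sqrt{n^{1+\gamma}}=\infty$ for some $\gamma>0$; and if $\alpha>2$, $\lim_n M_n/\sqrt{n\log M_n}=\infty$. $\sigma$ is the probability measure on $\mathcal S$ given by $\sigma(A):=\frac1{\mu(B_1^c)}\mu\left(\left\{x\in\mathbb R^d:\|x\|\ge1,\ x/\|x\|\in A\right\}\right)$. $\mathcal V$ is the $(\alpha\wedge2)$-stable random vector in $\mathbb R^d$ such that, for some sequence $B_n\to\infty$ of positive numbers, $B_n^{-1}\sum_{j=1}^nH_j$ converges in distribution to $\mathcal V$ (such $(B_n)$ and $\mathcal V$ exist under the assumptions on $H$; the numbers $B_n$ are not to be confused with the balls $B_r$). *)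

theory Defs
  imports "HOL-Probability.Probability" "HOL-Library.Landau_Symbols"
begin

text \<open>
  The Euclidean space \<open>\<real>\<^sup>d\<close> is a type of class \<open>euclidean_space\<close>. The direction
  \<open>x / \<parallel>x\<parallel>\<close> is \<open>sgn x\<close>, with \<open>sgn 0 = 0\<close>. A measure on a Borel subset \<open>S\<close> of
  \<open>\<real>\<^sup>d\<close> is a measure whose \<open>\<sigma>\<close>-algebra is that of \<open>restrict_space borel S\<close>.
\<close>

section \<open>Vague and weak convergence\<close>

text \<open>
  On the locally compact subsets \<open>S\<close> of \<open>\<real>\<^sup>d\<close> considered here, which are
  second countable, a Borel measure that is finite on compact sets is automatically regular.
\<close>

definition radon_on :: "'a::euclidean_space set \<Rightarrow> 'a measure \<Rightarrow> bool" where
  "radon_on S \<nu> \<longleftrightarrow>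
     sets \<nu> = sets (restrict_space borel S) \<and>
     (\<forall>K. compact K \<and> K \<subseteq> S \<longrightarrow> emeasure \<nu> K < \<infinity>)"

definition vague_conv_on ::
    "'a::euclidean_space set \<Rightarrow> (nat \<Rightarrow> 'a measure) \<Rightarrow> 'a measure \<Rightarrow> bool" where
  "vague_conv_on S \<nu> \<mu> \<longleftrightarrow>
     (\<forall>n. radon_on S (\<nu> n)) \<and> radon_on S \<mu> \<and>
     (\<forall>f :: 'a \<Rightarrow> real.
        continuous_on S f \<and> (\<exists>K. compact K \<and> K \<subseteq> S \<and> (\<forall>x\<in>S - K. f x = 0)) \<longrightarrow>
        (\<lambda>n. \<integral>x. f x \<partial>\<nu> n) \<longlonglongrightarrow> (\<integral>x. f x \<partial>\<mu>))"

definition weak_conv_on ::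
    "'a::euclidean_space set \<Rightarrow> (nat \<Rightarrow> 'a measure) \<Rightarrow> 'a measure \<Rightarrow> bool" where
  "weak_conv_on S \<nu> \<mu> \<longleftrightarrow>
     (\<forall>n. sets (\<nu> n) = sets (restrict_space borel S) \<and> finite_measure (\<nu> n)) \<and>
     sets \<mu> = sets (restrict_space borel S) \<and> finite_measure \<mu> \<and>
     (\<forall>f :: 'a \<Rightarrow> real. continuous_on S f \<and> bounded (f ` S) \<longrightarrow>
        (\<lambda>n. \<integral>x. f x \<partial>\<nu> n) \<longlonglongrightarrow> (\<integral>x. f x \<partial>\<mu>))"

section \<open>The compactification of \<open>\<real>\<^sup>d\<close> by a sphere at infinity\<close>

text \<open>
  The map below is a homeomorphism of \<open>\<real>\<^sup>d\<close> onto the open unit ball that preserves directions.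
  The closed unit ball therefore models the compactification, with the unit
  sphere as the sphere of infinite radius and with \<open>0\<close> corresponding to \<open>0\<close>.
\<close>

definition compactify :: "'a::euclidean_space \<Rightarrow> 'a" where
  "compactify x = x /\<^sub>R (1 + norm x)"

abbreviation punctured_compactification :: "'a::euclidean_space set" where
  "punctured_compactification \<equiv> cball 0 1 - {0}"

text \<open>
  For a measure \<open>\<mu>\<close> on \<open>\<real>\<^sup>d - {0}\<close>, the push-forward along \<open>compactify\<close> is its extension
  by zero to the sphere at infinity.
\<close>

definition extend_by_zero :: "'a::euclidean_space measure \<Rightarrow> 'a measure" where
  "extend_by_zero \<mu> = distr \<mu> (restrict_space borel punctured_compactification) compactify"

definition scaled_law :: "'w measure \<Rightarrow> ('w \<Rightarrow> 'a::euclidean_space) \<Rightarrow> (nat \<Rightarrow> real) \<Rightarrow> nat \<Rightarrow> 'a measure"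
  where
  "scaled_law P H a n =
     restrict_space (scale_measure (of_nat n) (distr P borel (\<lambda>w. compactify (H w /\<^sub>R a n))))
       punctured_compactification"

section \<open>Stable laws\<close>

text \<open>Point masses, which satisfy the stability relation trivially, are excluded.\<close>

definition stable_law :: "real \<Rightarrow> 'a::euclidean_space measure \<Rightarrow> bool" where
  "stable_law p \<nu> \<longleftrightarrow>
     prob_space \<nu> \<and> sets \<nu> = sets borel \<and> (\<forall>c. \<nu> \<noteq> return borel c) \<and>
     (\<forall>a>0. \<forall>b>0. \<exists>D.
        distr (\<nu> \<Otimes>\<^sub>M \<nu>) borel (\<lambda>(x, y). a *\<^sub>R x + b *\<^sub>R y) =
        distr \<nu> borel (\<lambda>x. ((a powr p + b powr p) powr (1 / p)) *\<^sub>R x + D))"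

section \<open>The softly truncated sums\<close>

definition soft_truncate :: "real \<Rightarrow> 'a::euclidean_space \<Rightarrow> real \<Rightarrow> 'a" where
  "soft_truncate m h l = (if norm h \<le> m then h else (m + l) *\<^sub>R sgn h)"

definition trunc_sum ::
    "(nat \<Rightarrow> real) \<Rightarrow> (nat \<Rightarrow> 'w \<Rightarrow> 'a::euclidean_space) \<Rightarrow> (nat \<Rightarrow> 'w \<Rightarrow> real) \<Rightarrow> nat \<Rightarrow> 'w \<Rightarrow> 'a"
  where
  "trunc_sum M Hs Ls n w = (\<Sum>j=1..n. soft_truncate (M n) (Hs j w) (Ls j w))"

section \<open>Measures on the unit sphere\<close>

text \<open>
  \<open>measure_of\<close> returns the null measure if the given set function is not countably additive;
  the lemmas below show that this does not happen where \<open>sphere_measure\<close> is used.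
\<close>

definition sphere_measure :: "('a::euclidean_space set \<Rightarrow> ennreal) \<Rightarrow> 'a measure" where
  "sphere_measure m = measure_of (sphere 0 1) (sets (restrict_space borel (sphere 0 1))) m"

definition spectral_measure :: "'a::euclidean_space measure \<Rightarrow> 'a measure" where
  "spectral_measure \<mu> =
     sphere_measure (\<lambda>A. emeasure \<mu> {x. 1 \<le> norm x \<and> sgn x \<in> A} / emeasure \<mu> (- cball 0 1))"

definition overshoot_ratio ::
    "'w measure \<Rightarrow> ('w \<Rightarrow> 'a::euclidean_space) \<Rightarrow> (nat \<Rightarrow> real) \<Rightarrow> (nat \<Rightarrow> 'w \<Rightarrow> 'a) \<Rightarrow>
     nat \<Rightarrow> nat \<Rightarrow> 'a set \<Rightarrow> real" where
  "overshoot_ratio P H M S k n A =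
     \<P>(w in P. norm (S n w) > real k * M n \<and> sgn (S n w) \<in> A) /
     (real n * \<P>(w in P. norm (H w) > M n)) ^ k"

definition Gamma_fun ::
    "'w measure \<Rightarrow> ('w \<Rightarrow> 'a::euclidean_space) \<Rightarrow> 'a measure \<Rightarrow> nat \<Rightarrow> 'a set \<Rightarrow> real" where
  "Gamma_fun P V \<sigma> k A =
     1 / fact k * (\<Sum>\<^sub>\<infinity>s\<in>A. \<P>(w in P. s \<bullet> V w \<ge> 0) * measure \<sigma> {s} ^ k)"

lemma sets_sphere_measure [simp]:
  "sets (sphere_measure m) = sets (restrict_space borel (sphere 0 1))"
  unfolding sphere_measure_def
  by (metis sets.sigma_sets_eq sets_measure_of sets.space_closed space_restrict_space2
      sets.sets_into_space Int_UNIV_right space_borel space_restrict_space)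

lemma space_sphere_measure [simp]: "space (sphere_measure m) = sphere 0 1"
  using sets_eq_imp_space_eq[OF sets_sphere_measure[of m]] by (simp add: space_restrict_space)

lemma emeasure_sphere_measure:
  fixes N :: "'a::euclidean_space measure"
  assumes sets: "sets N = sets (restrict_space borel (sphere 0 1))"
    and eq: "\<And>B. B \<in> sets N \<Longrightarrow> m B = emeasure N B" and A: "A \<in> sets N"
  shows "emeasure (sphere_measure m) A = m A"
proof -
  have sp: "space N = sphere 0 1"
    using sets_eq_imp_space_eq[OF sets] by (simp add: space_restrict_space)
  have "sphere_measure m = measure_of (space N) (sets N) (emeasure N)"
    unfolding sphere_measure_def sets[symmetric] sp
    using sets.space_closed[of N] sp by (intro measure_of_eq) (auto simp: eq sets.sigma_sets_eq[of N, unfolded sp])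
  then show ?thesis
    using eq[OF A] by (simp add: measure_of_of_measure)
qed

lemma sgn_vimage_sphere_measurable:
  fixes N :: "'w measure" and g :: "'w \<Rightarrow> 'a::euclidean_space"
  assumes g: "g \<in> borel_measurable N" and E: "E \<in> sets N"
    and nz: "\<And>w. w \<in> E \<Longrightarrow> g w \<noteq> 0"
  shows "(\<lambda>w. sgn (g w)) \<in> measurable (restrict_space N E) (restrict_space borel (sphere 0 1))"
proof (rule measurable_restrict_space2)
  show "(\<lambda>w. sgn (g w)) \<in> space (restrict_space N E) \<rightarrow> sphere 0 1"
    using nz by (auto simp: space_restrict_space norm_sgn)
  have "(\<lambda>w. sgn (g w)) \<in> borel_measurable N"
    using g unfolding sgn_div_norm by measurable
  then show "(\<lambda>w. sgn (g w)) \<in> borel_measurable (restrict_space N E)"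
    by (rule measurable_restrict_space1)
qed

lemma emeasure_spectral_measure:
  fixes \<mu> :: "'a::euclidean_space measure"
  assumes \<mu>: "sets \<mu> = sets (restrict_space borel (- {0}))"
    and A: "A \<in> sets (restrict_space borel (sphere 0 1))"
  shows "emeasure (spectral_measure \<mu>) A =
           emeasure \<mu> {x. 1 \<le> norm x \<and> sgn x \<in> A} / emeasure \<mu> (- cball 0 1)"
proof -
  have sp: "space \<mu> = - {0}"
    using sets_eq_imp_space_eq[OF \<mu>] by (simp add: space_restrict_space)
  define E :: "'a set" where "E = {x. 1 \<le> norm x}"
  have "E \<in> sets borel" unfolding E_def by measurable
  then have E: "E \<in> sets \<mu>"
    unfolding \<mu> by (subst sets_restrict_space_iff) (auto simp: E_def)
  have id: "(\<lambda>x. x) \<in> borel_measurable \<mu>"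
    by (subst measurable_cong_sets[OF \<mu> refl]) (simp add: measurable_restrict_space1)
  have m: "sgn \<in> measurable (restrict_space \<mu> E) (restrict_space borel (sphere 0 1))"
  proof (rule sgn_vimage_sphere_measurable[OF id E])
    show "x \<noteq> 0" if "x \<in> E" for x using that by (auto simp: E_def)
  qed
  define N where "N = scale_measure (inverse (emeasure \<mu> (- cball 0 1)))
    (distr (restrict_space \<mu> E) (restrict_space borel (sphere 0 1)) sgn)"
  have sN: "sets N = sets (restrict_space borel (sphere 0 1))" by (simp add: N_def)
  have "emeasure N B = emeasure \<mu> {x. 1 \<le> norm x \<and> sgn x \<in> B} / emeasure \<mu> (- cball 0 1)"
    if "B \<in> sets N" for B
  proof -
    have B: "B \<in> sets (restrict_space borel (sphere 0 1))" using that sN by simp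
    have "emeasure (distr (restrict_space \<mu> E) (restrict_space borel (sphere 0 1)) sgn) B
        = emeasure (restrict_space \<mu> E) (sgn -` B \<inter> space (restrict_space \<mu> E))"
      by (rule emeasure_distr[OF m B])
    also have "\<dots> = emeasure \<mu> (sgn -` B \<inter> space (restrict_space \<mu> E))"
      by (rule emeasure_restrict_space) (use E in \<open>auto simp: space_restrict_space\<close>)
    also have "sgn -` B \<inter> space (restrict_space \<mu> E) = {x. 1 \<le> norm x \<and> sgn x \<in> B}"
      by (auto simp: space_restrict_space E_def sp)
    finally show ?thesis
      by (simp add: N_def divide_ennreal_def mult.commute)
  qed
  then show ?thesis
    unfolding spectral_measure_def using A sN by (subst emeasure_sphere_measure[OF sN]) simp_all
qed

lemma emeasure_overshoot_ratio:
  fixes P :: "'w measure" and S :: "nat \<Rightarrow> 'w \<Rightarrow> 'a::euclidean_space"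
  assumes P: "prob_space P" and S: "S n \<in> borel_measurable P" and M: "M n \<ge> 0"
    and A: "A \<in> sets (restrict_space borel (sphere 0 1))"
  shows "emeasure (sphere_measure (\<lambda>A. ennreal (overshoot_ratio P H M S k n A))) A =
           ennreal (overshoot_ratio P H M S k n A)"
proof -
  interpret prob_space P by (rule P)
  define E where "E = {w \<in> space P. norm (S n w) > real k * M n}"
  define c where "c = (real n * \<P>(w in P. norm (H w) > M n)) ^ k"
  have c: "c \<ge> 0" by (simp add: c_def)
  have E: "E \<in> sets P" unfolding E_def using S by measurable
  have nz: "S n w \<noteq> 0" if "w \<in> E" for w
  proof -
    have "real k * M n \<ge> 0" using M by simp
    then have "norm (S n w) > 0" using that unfolding E_def by (auto intro: le_less_trans)
    then show ?thesis by simp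
  qed
  note m = sgn_vimage_sphere_measurable[OF S E nz]
  define N where "N = scale_measure (ennreal (inverse c))
    (distr (restrict_space P E) (restrict_space borel (sphere 0 1)) (\<lambda>w. sgn (S n w)))"
  have sN: "sets N = sets (restrict_space borel (sphere 0 1))" by (simp add: N_def)
  have eq: "emeasure N B = ennreal (overshoot_ratio P H M S k n B)" if "B \<in> sets N" for B
  proof -
    have B: "B \<in> sets (restrict_space borel (sphere 0 1))" using that sN by simp
    let ?g = "\<lambda>w. sgn (S n w)"
    have "emeasure (distr (restrict_space P E) (restrict_space borel (sphere 0 1)) ?g) B
        = emeasure (restrict_space P E) (?g -` B \<inter> space (restrict_space P E))"
      by (rule emeasure_distr[OF m B])
    also have "\<dots> = emeasure P (?g -` B \<inter> space (restrict_space P E))"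
      by (rule emeasure_restrict_space) (use E in \<open>auto simp: space_restrict_space\<close>)
    also have "?g -` B \<inter> space (restrict_space P E) =
        {w \<in> space P. norm (S n w) > real k * M n \<and> sgn (S n w) \<in> B}"
      by (auto simp: space_restrict_space E_def)
    finally show ?thesis
      using c by (simp add: N_def overshoot_ratio_def c_def[symmetric] emeasure_eq_measure
          ennreal_mult[symmetric] divide_inverse mult.commute)
  qed
  show ?thesis
    using A sN eq by (subst emeasure_sphere_measure[OF sN]) simp_all
qed

lemma emeasure_Gamma:
  fixes V :: "'w \<Rightarrow> 'a::euclidean_space" and \<sigma> :: "'a measure"
  assumes P: "prob_space P"
    and \<sigma>: "finite_measure \<sigma>" "sets \<sigma> = sets (restrict_space borel (sphere 0 1))"
    and k: "k \<ge> 1" and A: "A \<in> sets (restrict_space borel (sphere 0 1))"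
  shows "emeasure (sphere_measure (\<lambda>A. ennreal (Gamma_fun P V \<sigma> k A))) A =
           ennreal (Gamma_fun P V \<sigma> k A)"
proof -
  interpret P: prob_space P by (rule P)
  interpret \<sigma>: finite_measure \<sigma> by (rule \<sigma>(1))
  define f where "f = (\<lambda>s. \<P>(w in P. s \<bullet> V w \<ge> 0) * measure \<sigma> {s} ^ k)"
  define T where "T = measure \<sigma> (space \<sigma>)"
  have f0: "f s \<ge> 0" for s by (simp add: f_def)
  have fle: "f s \<le> T ^ (k - 1) * measure \<sigma> {s}" for s
  proof -
    have "f s \<le> 1 * measure \<sigma> {s} ^ k" unfolding f_def by (rule mult_right_mono) auto
    also have "\<dots> = measure \<sigma> {s} ^ (k - 1) * measure \<sigma> {s}"
      using k by (cases k) auto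
    also have "\<dots> \<le> T ^ (k - 1) * measure \<sigma> {s}"
      unfolding T_def by (intro mult_right_mono power_mono \<sigma>.bounded_measure) auto
    finally show ?thesis .
  qed
  have bound: "sum f F \<le> T ^ (k - 1) * T" if F: "finite F" "F \<subseteq> sphere 0 1" for F
  proof -
    have sing: "{s} \<in> sets \<sigma>" if "s \<in> F" for s
      unfolding \<sigma>(2) by (subst sets_restrict_space_iff) (use that F in auto)
    have "sum f F \<le> (\<Sum>s\<in>F. T ^ (k - 1) * measure \<sigma> {s})" by (rule sum_mono) (rule fle)
    also have "\<dots> = T ^ (k - 1) * (\<Sum>s\<in>F. measure \<sigma> {s})" by (simp add: sum_distrib_left)
    also have "(\<Sum>s\<in>F. measure \<sigma> {s}) = measure \<sigma> F"
      using sing F by (simp add: \<sigma>.finite_measure_eq_sum_singleton)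
    also have "\<dots> \<le> T" unfolding T_def by (rule \<sigma>.bounded_measure)
    finally show ?thesis by (simp add: T_def mult_left_mono)
  qed
  have summ: "f summable_on B" if "B \<subseteq> sphere 0 1" for B
    by (rule nonneg_bounded_partial_sums_imp_summable_on[where C = "T ^ (k - 1) * T"])
      (use f0 bound that in \<open>auto intro!: eventually_finite_subsets_at_top_weakI\<close>)
  define N where "N = scale_measure (ennreal (1 / fact k))
    (distr (density (count_space (sphere 0 1)) (\<lambda>s. ennreal (f s)))
      (restrict_space borel (sphere 0 1)) (\<lambda>s. s))"
  have sN: "sets N = sets (restrict_space borel (sphere 0 1))" by (simp add: N_def)
  have eq: "emeasure N B = ennreal (Gamma_fun P V \<sigma> k B)" if "B \<in> sets N" for B
  proof -
    have B: "B \<in> sets (restrict_space borel (sphere 0 1))" using that sN by simp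
    have Bs: "B \<subseteq> sphere 0 1" using sets.sets_into_space[OF B] by (simp add: space_restrict_space)
    have norm_f: "(\<lambda>s. norm (f s)) = f"
      using f0 by auto
    have abs: "Infinite_Set_Sum.abs_summable_on f B"
      using summ[OF Bs] by (subst abs_summable_equivalent[symmetric]) (simp only: norm_f)
    then have int: "integrable (count_space B) f"
      by (simp add: abs_summable_on_def)
    have "emeasure (distr (density (count_space (sphere 0 1)) (\<lambda>s. ennreal (f s)))
        (restrict_space borel (sphere 0 1)) (\<lambda>s. s)) B
      = emeasure (density (count_space (sphere 0 1)) (\<lambda>s. ennreal (f s))) B"
      using Bs B by (subst emeasure_distr) (auto simp: space_restrict_space Int_absorb2)
    also have "\<dots> = (\<integral>\<^sup>+s. ennreal (f s) * indicator B s \<partial>count_space (sphere 0 1))"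
      using Bs by (subst emeasure_density) auto
    also have "\<dots> = (\<integral>\<^sup>+s. ennreal (f s) \<partial>count_space B)"
      using Bs by (auto simp: nn_integral_count_space_indicator mult.assoc indicator_def
          intro!: nn_integral_cong)
    also have "\<dots> = ennreal (\<integral>s. f s \<partial>count_space B)"
      using int f0 by (intro nn_integral_eq_integral) auto
    also have "(\<integral>s. f s \<partial>count_space B) = infsum f B"
      using abs by (simp add: infsetsum_infsum flip: infsetsum_def)
    finally show ?thesis
      using f0 by (simp add: N_def Gamma_fun_def f_def[symmetric] ennreal_mult[symmetric] infsum_nonneg)
  qed
  show ?thesis
    using A sN eq by (subst emeasure_sphere_measure[OF sN]) simp_all
qed

end

theory Submission
  imports Defs "HOL-Real_Asymp.Real_Asymp"
begin

text \<open>
  Write \<open>G t = P(\<parallel>H\<parallel> > t)\<close>. An overshoot of \<open>k M\<^sub>n\<close> needs exactly \<open>k\<close> summands with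
  \<open>\<parallel>H\<^sub>j\<parallel> > M\<^sub>n\<close>: more of them are too unlikely, and with fewer of them either an excess \<open>L\<^sub>j\<close> is of
  order \<open>M\<^sub>n\<close>, or some \<open>\<parallel>H\<^sub>j\<parallel>\<close> lies just below \<open>M\<^sub>n\<close>, or the small summands
  add up to order \<open>M\<^sub>n\<close>. The latter is excluded by an exponential inequality whose parameter is
  proportional to \<open>- ln (n G(M\<^sub>n)) / M\<^sub>n\<close>. This choice covers all \<open>\<alpha>\<close> at once, by Potter and Karamata
  type bounds obtained by induction over dyadic scales.

  Given \<open>k\<close> large summands with directions \<open>\<theta>\<^sub>j\<close>, the sum is
  \<open>M\<^sub>n \<Sum>\<theta>\<^sub>j + B\<^sub>n (v + y)\<close>, where \<open>v\<close> is close to \<open>\<V>\<close> in law, \<open>y\<close> is negligible and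
  \<open>B\<^sub>n / M\<^sub>n \<longlonglongrightarrow> 0\<close> because \<open>\<V> \<noteq> 0\<close>. Its norm exceeds \<open>k M\<^sub>n\<close> only if the \<open>\<theta>\<^sub>j\<close> nearly coincide and \<open>v\<close>
  nearly lies in the half-space that they determine. By independence the limiting probability is
  \<open>\<integral>\<^sub>F \<sigma>{s}\<^bsup>k-1\<^esup> P(\<langle>s, \<V>\<rangle> \<ge> 0) d\<sigma>(s)\<close>, which is a sum over the atoms of \<open>\<sigma>\<close>. If the law of \<open>H / \<parallel>H\<parallel>\<close>
  charges these atoms before the limit, the total masses converge as well, and the bounds on closed
  sets give weak convergence.
\<close>

text \<open>Three points lie behind these steps. The direction of the first large summand is random,
  so limits at each fixed direction do not suffice. Indicators are therefore replaced by Lipschitz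
  cutoffs, for which the upper bounds become uniform on the sphere; widths and radii stay fixed
  while \<open>n\<close> grows and are sent to their limits only afterwards. The growth conditions
  on \<open>M\<close> for \<alpha> = 2 and \<alpha> > 2 serve to make the variance term of the
  exponential inequality negligible; for \<alpha> < 2 the condition on \<open>n G(M n)\<close>
  already does so. Symmetry and centering keep the truncated mean at level \<open>t\<close> of order
  \<open>t G(t)\<close>, so that it contributes no drift at scale \<open>M n\<close>. The exponent
  \<open>k - 1\<close> in the condition on \<open>L\<close> is explained by counting: an excess acts
  only on a summand that is already large, which costs \<open>n G(M n)\<close>. An excess of order
  \<open>M n\<close> then has total cost \<open>n G(M n)\<close> times
  o(\<open>G(M n) ^ (k - 1)\<close>), which is o(\<open>(n G(M n)) ^ k\<close>).\<close>

lemma halving_induct [consumes 1, case_names pos base step]: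
  fixes t t0 :: real
  assumes "t \<ge> t0 / 2" and t0: "t0 > 0"
    and base: "\<And>t. t0 / 2 \<le> t \<Longrightarrow> t < t0 \<Longrightarrow> Q t"
    and step: "\<And>t. t \<ge> t0 \<Longrightarrow> Q (t / 2) \<Longrightarrow> Q t"
  shows "Q t"
proof -
  \<comment> \<open>Halving sends points below \<open>t0 * 2 ^ Suc m\<close> to points below
    \<open>t0 * 2 ^ m\<close>, and from \<open>t \<ge> t0\<close> it cannot fall below
    \<open>t0 / 2\<close>.\<close>
  have *: "Q t" if "t0 / 2 \<le> t" "t < t0 * 2 ^ m" for m t
    using that
  proof (induction m arbitrary: t)
    case 0
    then show ?case using base by simp
  next
    case (Suc m)
    show ?case
    proof (cases "t < t0")
      case True
      then show ?thesis using base Suc.prems by simp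
    next
      case False
      then have "Q (t / 2)" using Suc.prems by (intro Suc.IH) auto
      with False show ?thesis using step[of t] by simp
    qed
  qed
  obtain m where "t / t0 < 2 ^ m"
    using real_arch_pow[of 2 "t / t0"] by auto
  then have "t < t0 * 2 ^ m" using t0 by (simp add: field_simps)
  with assms(1) show ?thesis by (rule *)
qed

section \<open>Regularly varying tails\<close>

locale regularly_varying_tail =
  fixes G :: "real \<Rightarrow> real" and \<alpha> :: real
  assumes G_antimono: "\<And>s t. s \<le> t \<Longrightarrow> G t \<le> G s"
    and G_pos: "\<And>t. G t > 0"
    and G_rv: "\<And>c. c > 0 \<Longrightarrow> ((\<lambda>t. G (c * t) / G t) \<longlongrightarrow> c powr (- \<alpha>)) at_top"
    and \<alpha>_pos: "\<alpha> > 0"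
begin

text \<open>The strict gap between the limiting ratio and \<open>r\<close> is what turns asymptotics
  into an inequality that can be iterated over dyadic scales.\<close>

lemma G_scale_le:
  assumes "c > 0" "c powr (- \<alpha>) < r"
  shows "\<exists>t0>0. \<forall>t\<ge>t0. G (c * t) \<le> r * G t"
proof -
  have "eventually (\<lambda>t. G (c * t) / G t < r) at_top"
    using G_rv[OF assms(1)] assms(2) by (rule order_tendstoD)
  then obtain N where N: "\<And>t. t \<ge> N \<Longrightarrow> G (c * t) / G t < r"
    by (auto simp: eventually_at_top_linorder)
  have "G (c * t) \<le> r * G t" if "t \<ge> max 1 N" for t
    using N[of t] that G_pos[of t] by (simp add: field_simps)
  then show ?thesis by (intro exI[of _ "max 1 N"]) auto
qed

text \<open>One halving of the argument costs asymptotically 2 to the power \<alpha>, hence at most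
  \<open>K\<close>; about log2(t / s) halvings multiply up to the power of \<open>t / s\<close>. The
  threshold \<open>t0\<close> does not depend on \<open>s\<close>, so the bound may be used with
  both points moving.\<close>

lemma potter_bound:
  "\<exists>t0>0. \<forall>s t. t0 \<le> s \<longrightarrow> s \<le> t \<longrightarrow> G s \<le> 2 powr (\<alpha> + 1) * (t / s) powr (\<alpha> + 1) * G t"
proof -
  define K where "K = (2::real) powr (\<alpha> + 1)"
  have "(1/2) powr (- \<alpha>) < K"
    unfolding K_def by (simp add: powr_divide powr_minus)
  then obtain t0 where t0: "t0 > 0" "\<And>t. t \<ge> t0 \<Longrightarrow> G (1/2 * t) \<le> K * G t"
    using G_scale_le[of "1/2" K] by auto
  have K0: "K > 0" unfolding K_def by simp
  have "G s \<le> K * (t / s) powr (\<alpha> + 1) * G t" if s: "t0 \<le> s" and "s \<le> t" for s t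
  proof -
    from \<open>s \<le> t\<close> have "t \<ge> (2 * s) / 2" by simp
    then show ?thesis
    proof (induction rule: halving_induct)
      case pos
      show ?case using t0 s by simp
    next
      case (base t)
      then have st: "s \<le> t" "t < 2 * s" by auto
      have sp: "s > 0" using t0 s by linarith
      \<comment> \<open>The induction has threshold \<open>2 * s\<close>, so its base block starts
        at \<open>s\<close>. Crossing that block costs one factor \<open>K\<close>, the prefactor of
        the bound.\<close>
      have "G s \<le> K * G (2 * s)" using t0(2)[of "2 * s"] s t0(1) by simp
      also have "\<dots> \<le> K * G t" using st K0 by (intro mult_left_mono G_antimono) auto
      also have "\<dots> = K * 1 * G t" by simp
      also have "\<dots> \<le> K * (t / s) powr (\<alpha> + 1) * G t"
        using st sp K0 \<alpha>_pos G_pos[of t]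
        by (intro mult_right_mono mult_left_mono ge_one_powr_ge_zero) (auto simp: less_imp_le)
      finally show ?case .
    next
      case (step t)
      have sp: "s > 0" using t0 s by linarith
      then have tp: "t > 0" using step by linarith
      have "G s \<le> K * (t / 2 / s) powr (\<alpha> + 1) * G (t / 2)" by (rule step)
      also have "\<dots> \<le> K * (t / 2 / s) powr (\<alpha> + 1) * (K * G t)"
        using t0(2)[of t] step s sp K0 by (intro mult_left_mono) auto
      also have "(t / 2 / s) powr (\<alpha> + 1) = (t / s) powr (\<alpha> + 1) / K"
        using sp tp unfolding K_def by (simp add: powr_divide powr_mult divide_simps)
      finally show ?case using K0 by (simp add: mult_ac)
    qed
  qed
  then show ?thesis using t0 unfolding K_def by auto
qed

lemma G_scale_bounded:
  assumes "c > 0"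
  shows "\<exists>C>0. \<forall>\<^sub>F t in at_top. G (c * t) \<le> C * G t"
proof -
  from G_scale_le[OF assms, of "c powr (- \<alpha>) + 1"] obtain t0 where
    "t0 > 0" "\<forall>t\<ge>t0. G (c * t) \<le> (c powr (- \<alpha>) + 1) * G t" by auto
  then show ?thesis
    by (intro exI[of _ "c powr (- \<alpha>) + 1"]) (auto simp: eventually_at_top_linorder add_nonneg_pos)
qed

text \<open>With the lower point fixed, the Potter bound keeps \<open>G t\<close> above a constant
  times \<open>t powr - (\<alpha> + 1)\<close>. The extra unit in \<open>\<alpha> + 2\<close>
  absorbs the constant \<open>D\<close>.\<close>

lemma neg_ln_G_le:
  "\<exists>C>0. \<forall>\<^sub>F t in at_top. - ln (G t) \<le> C * ln t"
proof -
  obtain t0 where t0: "t0 > 0"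
    "\<And>s t. t0 \<le> s \<Longrightarrow> s \<le> t \<Longrightarrow> G s \<le> 2 powr (\<alpha> + 1) * (t / s) powr (\<alpha> + 1) * G t"
    using potter_bound by blast
  define s where "s = max 1 t0"
  define D where "D = (\<alpha> + 1) * ln 2 - ln (G s)"
  have "\<forall>\<^sub>F t in at_top. t \<ge> s \<and> t > 1 \<and> D \<le> ln t"
    using filterlim_at_top[THEN iffD1, OF ln_at_top, rule_format, of D]
    by (intro eventually_conj eventually_ge_at_top eventually_gt_at_top) simp_all
  then have "\<forall>\<^sub>F t in at_top. - ln (G t) \<le> (\<alpha> + 2) * ln t"
  proof eventually_elim
    case (elim t)
    have s: "s \<ge> 1" "s \<ge> t0" by (auto simp: s_def)
    have "G s \<le> 2 powr (\<alpha> + 1) * (t / s) powr (\<alpha> + 1) * G t"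
      using elim s by (intro t0) auto
    then have "ln (G s) \<le> ln (2 powr (\<alpha> + 1) * (t / s) powr (\<alpha> + 1) * G t)"
      using G_pos[of s] G_pos[of t] elim s by (subst ln_le_cancel_iff) auto
    also have "\<dots> = (\<alpha> + 1) * ln 2 + (\<alpha> + 1) * ln (t / s) + ln (G t)"
      using G_pos[of t] elim s by (simp add: ln_mult ln_powr)
    finally have "ln (G s) \<le> (\<alpha> + 1) * ln 2 + (\<alpha> + 1) * ln (t / s) + ln (G t)" .
    moreover have "ln (t / s) \<le> ln t" using s elim by (simp add: ln_div)
    ultimately show ?case using elim mult_left_mono[of "ln (t / s)" "ln t" "\<alpha> + 1"] \<alpha>_pos by (simp
        add: D_def algebra_simps)
  qed
  then show ?thesis using \<alpha>_pos by (intro exI[of _ "\<alpha> + 2"]) auto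
qed

text \<open>Doubling the argument multiplies \<open>G\<close> by at most the factor by which the
  power function changes, so the constant found on the first dyadic block persists.\<close>

lemma G_le_powr:
  assumes "\<eta> > 0"
  shows "\<exists>C>0. \<exists>t0>0. \<forall>t\<ge>t0. G t \<le> C * t powr (\<eta> - \<alpha>)"
proof -
  define r where "r = 2 powr (\<eta> - \<alpha>)"
  have "2 powr (- \<alpha>) < r" unfolding r_def using assms by simp
  then obtain t0 where t0: "t0 > 0" "\<And>t. t \<ge> t0 \<Longrightarrow> G (2 * t) \<le> r * G t"
    using G_scale_le[of 2 r] by auto
  \<comment> \<open>The sign of \<open>\<alpha> - \<eta>\<close> is not known, so the power may
    increase or decrease on the block; the maximum over the two end points covers both.\<close>
  define C where "C = G t0 * max (t0 powr (\<alpha> - \<eta>)) ((2 * t0) powr (\<alpha> - \<eta>))"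
  have C0: "C > 0" unfolding C_def using G_pos[of t0] t0 by (intro mult_pos_pos) (auto simp:
      less_max_iff_disj)
  have "G t \<le> C * t powr (\<eta> - \<alpha>)" if "t \<ge> t0" for t
  proof -
    from that have "t \<ge> (2 * t0) / 2" by simp
    then show ?thesis
    proof (induction rule: halving_induct)
      case pos
      show ?case using t0 by simp
    next
      case (base t)
      then have t: "t0 \<le> t" "t < 2 * t0" "t > 0" using t0 by auto
      have "t powr (\<alpha> - \<eta>) \<le> max (t0 powr (\<alpha> - \<eta>)) ((2 * t0) powr (\<alpha> - \<eta>))"
      proof (cases "\<alpha> \<ge> \<eta>")
        case True
        then have "t powr (\<alpha> - \<eta>) \<le> (2 * t0) powr (\<alpha> - \<eta>)"
          using t by (intro powr_mono2) auto
        then show ?thesis by simp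
      next
        case False
        then have "t powr (\<alpha> - \<eta>) \<le> t0 powr (\<alpha> - \<eta>)"
          using t t0 by (intro powr_mono2') auto
        then show ?thesis by simp
      qed
      then have "G t0 * t powr (\<alpha> - \<eta>) \<le> C"
        unfolding C_def using G_pos[of t0] by (intro mult_left_mono) (auto simp: less_imp_le)
      then have "G t0 * t powr (\<alpha> - \<eta>) * t powr (\<eta> - \<alpha>) \<le> C * t powr (\<eta> - \<alpha>)"
        by (intro mult_right_mono) auto
      then have "G t0 \<le> C * t powr (\<eta> - \<alpha>)"
        using t by (simp add: mult.assoc powr_add[symmetric])
      with G_antimono[OF t(1)] show ?case by simp
    next
      case (step t)
      have "G t \<le> r * G (t / 2)" using t0(2)[of "t / 2"] step by simp
      also have "\<dots> \<le> r * (C * (t / 2) powr (\<eta> - \<alpha>))" using step by (intro mult_left_mono) (auto simp: r_def)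
      also have "\<dots> = C * t powr (\<eta> - \<alpha>)"
        unfolding r_def using step t0 by (simp add: powr_divide)
      finally show ?case .
    qed
  qed
  then show ?thesis using C0 t0 by blast
qed

end

section \<open>Truncated moments\<close>

locale regularly_varying_vector = prob_space P for P :: "'w measure" +
  fixes H :: "'w \<Rightarrow> 'a::euclidean_space" and \<alpha> :: real
  assumes H_measurable [measurable]: "H \<in> borel_measurable P"
    and tail_rv: "regularly_varying_tail (\<lambda>t. \<P>(w in P. norm (H w) > t)) \<alpha>"
begin

abbreviation tail :: "real \<Rightarrow> real" where
  "tail t \<equiv> \<P>(w in P. norm (H w) > t)"

sublocale regularly_varying_tail tail \<alpha>
  by (rule tail_rv)

definition trunc_moment :: "nat \<Rightarrow> real \<Rightarrow> real" where
  "trunc_moment b t = expectation (\<lambda>w. if norm (H w) \<le> t then norm (H w) ^ b else 0)"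

lemma integrable_trunc_moment [simp]:
  "integrable P (\<lambda>w. if norm (H w) \<le> t then norm (H w) ^ b else 0)"
  by (rule integrable_const_bound[where B = "max 0 t ^ b"]) (auto intro!: AE_I2 power_mono)

lemma integrable_trunc [simp]: "integrable P (\<lambda>w. if norm (H w) \<le> t then H w else 0)"
  by (rule integrable_const_bound[where B = "max 0 t"]) (auto intro!: AE_I2)

lemma integrable_tail_indicator [simp]:
  "integrable P (indicat_real {w \<in> space P. norm (H w) > t})"
  by (intro integrable_real_indicator) (auto simp: emeasure_eq_measure)

lemma trunc_moment_nonneg: "trunc_moment b t \<ge> 0"
  unfolding trunc_moment_def by (rule Bochner_Integration.integral_nonneg) auto

lemma trunc_moment_le_power:
  assumes "t \<ge> 0"
  shows "trunc_moment b t \<le> t ^ b"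
proof -
  have "trunc_moment b t \<le> expectation (\<lambda>w. t ^ b)"
    unfolding trunc_moment_def using assms by (intro integral_mono) (auto intro!: power_mono)
  then show ?thesis by (simp add: prob_space)
qed

lemma trunc_moment_split:
  assumes "0 \<le> s" "s \<le> t"
  shows "trunc_moment b t \<le> trunc_moment b s + t ^ b * tail s"
proof -
  have "trunc_moment b t \<le> expectation (\<lambda>w. (if norm (H w) \<le> s then norm (H w) ^ b else 0)
      + t ^ b * indicator {w \<in> space P. norm (H w) > s} w)"
    unfolding trunc_moment_def using assms
    by (intro integral_mono Bochner_Integration.integrable_add integrable_mult_right)
      (auto intro!: power_mono split: split_indicator)
  also have "\<dots> = trunc_moment b s + t ^ b * tail s"
    unfolding trunc_moment_def by (subst Bochner_Integration.integral_add) auto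
  finally show ?thesis .
qed

text \<open>Since \<open>b\<close> exceeds \<alpha>, halving the argument shrinks
  \<open>t ^ b * tail t\<close> by a factor \<open>r < 1\<close>. The contributions of the dyadic
  annuli therefore form a geometric series dominated by the outermost one.\<close>

lemma trunc_moment_karamata:
  assumes b: "\<alpha> < real b"
  shows "\<exists>C>0. \<exists>t0>0. \<forall>t\<ge>t0. trunc_moment b t \<le> C * t ^ b * tail t"
proof -
  define r where "r = (1 + 2 powr (\<alpha> - b)) / 2"
  have r0: "2 powr (\<alpha> - b) < 1" using b by (simp add: powr_less_one)
  have r: "0 < r" "r < 1" "2 powr (\<alpha> - b) < r"
    using r0 unfolding r_def by (auto simp: add_pos_pos)
  have "(1/2) powr (- \<alpha>) < r * 2 ^ b"
    using r(3) by (simp add: powr_diff powr_realpow powr_divide powr_minus field_simps)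
  then obtain t0 where t0: "t0 > 0" "\<And>t. t \<ge> t0 \<Longrightarrow> tail (1/2 * t) \<le> r * 2 ^ b * tail t"
    using G_scale_le[of "1/2" "r * 2 ^ b"] by auto
  \<comment> \<open>The first summand settles the base block, the second makes the induction close:
    \<open>(C + 2 ^ b) * r \<le> C\<close>.\<close>
  define C where "C = 2 ^ b / tail t0 + 2 ^ b * r / (1 - r)"
  have C0: "C > 0" unfolding C_def using r G_pos[of t0] by (intro add_pos_pos divide_pos_pos) auto
  have Cr: "(C + 2 ^ b) * r \<le> C"
  proof -
    have "2 ^ b * r / (1 - r) \<le> C" unfolding C_def using G_pos[of t0] by simp
    then show ?thesis using r by (simp add: field_simps)
  qed
  have "trunc_moment b t \<le> C * t ^ b * tail t" if "t \<ge> t0" for t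
  proof -
    from that t0 have "t \<ge> t0 / 2" by simp
    then show ?thesis
    proof (induction rule: halving_induct)
      case pos
      show ?case by (rule t0)
    next
      case (base t)
      have "trunc_moment b t \<le> t ^ b" using base t0 by (intro trunc_moment_le_power) simp
      also have "\<dots> \<le> t ^ b * (C * tail t)"
      proof -
        have "1 \<le> 2 ^ b / tail t0 * tail t"
          using G_antimono[of t t0] base G_pos[of t0] mult_mono[of 1 "2 ^ b" "tail t0" "tail t"]
          by (simp add: field_simps)
        also have "\<dots> \<le> C * tail t"
          unfolding C_def using r by (intro mult_right_mono) auto
        finally show ?thesis using base t0 mult_left_mono[of 1 "C * tail t" "t ^ b"] by simp
      qed
      finally show ?case by (simp add: mult_ac)
    next
      case (step t)
      have tp: "t > 0" using step t0 by simp
      have "trunc_moment b t \<le> trunc_moment b (t / 2) + t ^ b * tail (t / 2)"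
        using tp by (intro trunc_moment_split) auto
      also have "\<dots> \<le> C * (t / 2) ^ b * tail (t / 2) + t ^ b * tail (t / 2)"
        using step by simp
      also have "\<dots> = (C / 2 ^ b + 1) * t ^ b * tail (t / 2)"
        by (simp add: power_divide field_simps)
      also have "\<dots> \<le> (C / 2 ^ b + 1) * t ^ b * (r * 2 ^ b * tail t)"
        using t0(2)[of t] step tp C0 by (intro mult_left_mono) auto
      also have "\<dots> = ((C + 2 ^ b) * r) * t ^ b * tail t"
        by (simp add: field_simps)
      also have "\<dots> \<le> C * t ^ b * tail t"
        using Cr tp by (intro mult_right_mono) auto
      finally show ?case .
    qed
  qed
  then show ?thesis using C0 t0 by blast
qed

text \<open>At the critical index the truncated variance may diverge, but each annulus adds at most
  a multiple of \<open>t powr \<eta>\<close>, and such increments sum geometrically.\<close>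

lemma trunc_moment_2_powr:
  assumes "\<alpha> = 2" "\<eta> > 0"
  shows "\<exists>C>0. \<exists>t0>0. \<forall>t\<ge>t0. trunc_moment 2 t \<le> C * t powr \<eta>"
proof -
  obtain C t0 where C: "C > 0" and t0: "t0 > 0" and *: "\<And>t. t \<ge> t0 \<Longrightarrow> tail t \<le> C * t powr (\<eta> - 2)"
    using G_le_powr[OF assms(2)] assms(1) by auto
  define C' where "C' = C * (1/2) powr (\<eta> - 2)"
  have C': "C' > 0" unfolding C'_def using C by simp
  define r :: real where "r = (1/2) powr \<eta>"
  have r: "0 < r" "r < 1" unfolding r_def using assms using powr_less_mono2[of \<eta> "1/2" 1] by auto
  \<comment> \<open>As before, one summand covers the base block and the other gives
    \<open>K * r + C' \<le> K\<close>, where \<open>r\<close> is the effect of a halving on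
    \<open>t powr \<eta>\<close>.\<close>
  define K where "K = C' / (1 - r) + (2*t0)\<^sup>2 / t0 powr \<eta>"
  have K: "K > 0" "K * r + C' \<le> K"
  proof -
    show "K > 0" unfolding K_def using C' r t0 by (intro add_pos_pos divide_pos_pos) auto
    have "C' / (1 - r) \<le> K" unfolding K_def by simp
    then show "K * r + C' \<le> K" using r by (simp add: field_simps)
  qed
  have "trunc_moment 2 t \<le> K * t powr \<eta>" if "t \<ge> t0" for t
  proof -
    from that t0 have "t \<ge> (2 * t0) / 2" by simp
    then show ?thesis
    proof (induction rule: halving_induct)
      case pos
      show ?case using t0 by simp
    next
      case (base t)
      then have t: "t0 \<le> t" "t \<le> 2 * t0" "0 < t" using t0 by auto
      have "trunc_moment 2 t \<le> t\<^sup>2" using t by (intro trunc_moment_le_power) simp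
      also have "\<dots> \<le> (2 * t0)\<^sup>2" using t by (intro power_mono) auto
      also have "\<dots> = (2*t0)\<^sup>2 / t0 powr \<eta> * t0 powr \<eta>" using t0 by simp
      also have "\<dots> \<le> K * t powr \<eta>"
        unfolding K_def using C' r t t0 assms by (intro mult_mono powr_mono2) auto
      finally show ?case .
    next
      case (step t)
      have tp: "t > 0" using step t0 by simp
      have "trunc_moment 2 t \<le> trunc_moment 2 (t / 2) + t\<^sup>2 * tail (t / 2)"
        using tp by (intro trunc_moment_split) auto
      also have "\<dots> \<le> K * (t / 2) powr \<eta> + t\<^sup>2 * (C * (t / 2) powr (\<eta> - 2))"
        using step *[of "t / 2"] by (intro add_mono mult_left_mono) auto
      also have "\<dots> = (K * r + C') * t powr \<eta>"
        using tp unfolding r_def C'_def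
        by (simp add: powr_divide powr_diff field_simps)
      also have "\<dots> \<le> K * t powr \<eta>" using K by (intro mult_right_mono) auto
      finally show ?case .
    qed
  qed
  then show ?thesis using K t0 by blast
qed

text \<open>A plain constant bound would not survive the induction, because every annulus adds
  something positive. The bound proved is \<open>K - D * t powr (- \<eta>)\<close>, whose growth
  pays for the annuli.\<close>

lemma trunc_moment_2_bounded:
  assumes "\<alpha> > 2"
  shows "\<exists>C>0. \<forall>t. trunc_moment 2 t \<le> C"
proof -
  define \<eta> where "\<eta> = (\<alpha> - 2) / 2"
  have \<eta>: "\<eta> > 0" "\<eta> - \<alpha> = - 2 - \<eta>" unfolding \<eta>_def using assms by (auto simp: field_simps)
  obtain C t0 where C: "C > 0" and t0: "t0 > 0" and *: "\<And>t. t \<ge> t0 \<Longrightarrow> tail t \<le> C * t powr (- 2 - \<eta>)"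
    using G_le_powr[OF \<eta>(1)] \<eta>(2) by auto
  define C' where "C' = C * (1/2) powr (- 2 - \<eta>)"
  have C': "C' > 0" unfolding C'_def using C by simp
  define r :: real where "r = 2 powr \<eta>"
  have r: "r > 1" unfolding r_def using \<eta> by simp
  \<comment> \<open>Chosen so that passing from \<open>t / 2\<close> to \<open>t\<close> releases
    exactly \<open>C' * t powr (- \<eta>)\<close>, the bound for the mass of the annulus.\<close>
  define D where "D = C' / (r - 1)"
  have D: "D > 0" "D * r = D + C'" unfolding D_def using C' r by (auto simp: field_simps)
  define K where "K = (2*t0)\<^sup>2 + D * t0 powr (- \<eta>)"
  have K0: "K > 0" unfolding K_def using D t0 by (intro add_pos_pos) auto
  have "trunc_moment 2 t \<le> K - D * t powr (- \<eta>)" if "t \<ge> t0" for t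
  proof -
    from that t0 have "t \<ge> (2 * t0) / 2" by simp
    then show ?thesis
    proof (induction rule: halving_induct)
      case pos
      show ?case using t0 by simp
    next
      case (base t)
      then have t: "t0 \<le> t" "t \<le> 2 * t0" "0 < t" using t0 by auto
      have "trunc_moment 2 t \<le> t\<^sup>2" using t by (intro trunc_moment_le_power) simp
      also have "\<dots> \<le> (2 * t0)\<^sup>2" using t by (intro power_mono) auto
      finally have "trunc_moment 2 t \<le> (2 * t0)\<^sup>2" .
      moreover have "D * t powr (- \<eta>) \<le> D * t0 powr (- \<eta>)"
        using t t0 D \<eta> by (intro mult_left_mono powr_mono2') auto
      ultimately show ?case by (simp add: K_def)
    next
      case (step t)
      have tp: "t > 0" using step t0 by simp
      have "trunc_moment 2 t \<le> trunc_moment 2 (t / 2) + t\<^sup>2 * tail (t / 2)"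
        using tp by (intro trunc_moment_split) auto
      also have "\<dots> \<le> (K - D * (t / 2) powr (- \<eta>)) + t\<^sup>2 * (C * (t / 2) powr (- 2 - \<eta>))"
        using step *[of "t / 2"] by (intro add_mono mult_left_mono) auto
      also have "\<dots> = K - (D * r - C') * t powr (- \<eta>)"
        using tp unfolding r_def C'_def
        by (simp add: powr_divide powr_diff powr_minus field_simps)
      finally show ?case using D by simp
    qed
  qed
  then have b: "trunc_moment 2 t \<le> K" if "t \<ge> t0" for t
    using that D by (smt (verit) mult_nonneg_nonneg powr_ge_zero)
  have "trunc_moment 2 t \<le> K" for t
  proof (cases "t \<ge> t0")
    case False
    have "trunc_moment 2 t \<le> trunc_moment 2 t0"
      unfolding trunc_moment_def using False by (intro integral_mono) auto
    with b[of t0] show ?thesis by simp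
  qed (rule b)
  then show ?thesis using K0 by blast
qed

definition tail_moment :: "real \<Rightarrow> real" where
  "tail_moment t = expectation (\<lambda>w. if norm (H w) > t then norm (H w) else 0)"

text \<open>Here the dyadic recursion runs outwards: \<open>t * tail t\<close> shrinks by a factor
  \<open>r < 1\<close> at each doubling. The remainder at scale \<open>2 ^ m * t\<close> has no a
  priori bound in terms of tails and is removed by dominated convergence, which is why integrability
  is required.\<close>

lemma tail_moment_karamata:
  assumes "\<alpha> > 1" and int: "integrable P H"
  shows "\<exists>C>0. \<exists>t0>0. \<forall>t\<ge>t0. tail_moment t \<le> C * t * tail t"
proof -
  have int': "integrable P (\<lambda>w. if norm (H w) > t then norm (H w) else 0)" for t
    by (rule Bochner_Integration.integrable_bound[OF integrable_norm[OF int]]) auto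
  have split: "tail_moment t \<le> 2 * t * tail t + tail_moment (2 * t)" if "t \<ge> 0" for t
  proof -
    have "tail_moment t \<le> expectation (\<lambda>w. 2 * t * indicator {w \<in> space P. norm (H w) > t} w
        + (if norm (H w) > 2 * t then norm (H w) else 0))"
      unfolding tail_moment_def using that
      by (intro integral_mono int' Bochner_Integration.integrable_add integrable_mult_right)
        (auto split: split_indicator)
    also have "\<dots> = 2 * t * tail t + tail_moment (2 * t)"
      unfolding tail_moment_def by (subst Bochner_Integration.integral_add[OF _ int']) auto
    finally show ?thesis .
  qed
  define r where "r = (1 + 2 powr (1 - \<alpha>)) / 2"
  have r0: "2 powr (1 - \<alpha>) < 1" using assms by (simp add: powr_less_one)
  have r: "0 < r" "r < 1" "2 powr (1 - \<alpha>) < r"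
    using r0 unfolding r_def by (auto simp: add_pos_pos)
  have "2 powr (- \<alpha>) < r / 2"
    using r(3) by (simp add: powr_diff powr_minus field_simps)
  then obtain t0 where t0: "t0 > 0" "\<And>t. t \<ge> t0 \<Longrightarrow> tail (2 * t) \<le> r / 2 * tail t"
    using G_scale_le[of 2 "r / 2"] by auto
  have iter: "(2 ^ m * t) * tail (2 ^ m * t) \<le> r ^ m * (t * tail t)" if "t \<ge> t0" for m t
  proof (induction m)
    case (Suc m)
    have "2 ^ m * t \<ge> 1 * t" using that t0 by (intro mult_right_mono) auto
    then have "2 ^ m * t \<ge> t0" using that by simp
    then have "2 * (2 ^ m * t) * tail (2 * (2 ^ m * t)) \<le> 2 * (2 ^ m * t) * (r / 2 * tail (2 ^ m * t))"
      using t0(1) by (intro mult_left_mono t0(2)) auto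
    also have "\<dots> = r * ((2 ^ m * t) * tail (2 ^ m * t))" by simp
    also have "\<dots> \<le> r * (r ^ m * (t * tail t))" using Suc r by (intro mult_left_mono) auto
    finally show ?case by (simp add: mult_ac)
  qed simp
  have sum: "tail_moment t \<le> 2 * (t * tail t) * (\<Sum>i<m. r ^ i) + tail_moment (2 ^ m * t)"
    if "t \<ge> t0" for m t
  proof (induction m)
    case (Suc m)
    have "tail_moment (2 ^ m * t) \<le> 2 * (2 ^ m * t) * tail (2 ^ m * t) + tail_moment (2 * (2 ^ m * t))"
      using that t0 by (intro split) auto
    also have "2 * (2 ^ m * t) * tail (2 ^ m * t) \<le> 2 * (r ^ m * (t * tail t))"
      using iter[OF that, of m] by simp
    finally show ?case using Suc by (simp add: algebra_simps)
  qed simp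
  have "tail_moment t \<le> 2 / (1 - r) * t * tail t" if t: "t \<ge> t0" for t
  proof -
    have tp: "t > 0" using t t0 by simp
    have lim: "(\<lambda>m. tail_moment (2 ^ m * t)) \<longlonglongrightarrow> expectation (\<lambda>w. 0)"
      unfolding tail_moment_def
    proof (rule integral_dominated_convergence[where w = "\<lambda>w. norm (H w)"])
      show "integrable P (\<lambda>w. norm (H w))" using int by (rule integrable_norm)
      show "AE w in P. (\<lambda>m. if norm (H w) > 2 ^ m * t then norm (H w) else 0) \<longlonglongrightarrow> 0"
      proof (rule AE_I2)
        fix w
        obtain m0 where m0: "norm (H w) / t < 2 ^ m0"
          using real_arch_pow[of 2 "norm (H w) / t"] by auto
        have "\<not> norm (H w) > 2 ^ m * t" if "m \<ge> m0" for m
        proof -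
          have "norm (H w) < 2 ^ m0 * t" using m0 tp by (simp add: field_simps)
          also have "\<dots> \<le> 2 ^ m * t" using that tp by (intro mult_right_mono power_increasing) auto
          finally show ?thesis by simp
        qed
        then have "eventually (\<lambda>m. (if norm (H w) > 2 ^ m * t then norm (H w) else 0) = 0) sequentially"
          by (auto simp: eventually_sequentially)
        then show "(\<lambda>m. if norm (H w) > 2 ^ m * t then norm (H w) else 0) \<longlonglongrightarrow> 0"
          by (rule tendsto_eventually)
      qed
    qed auto
    have "tail_moment t - tail_moment (2 ^ m * t) \<le> 2 * (t * tail t) * (1 / (1 - r))" for m
    proof -
      have "(\<Sum>i<m. r ^ i) \<le> 1 / (1 - r)"
        using r by (simp add: sum_gp_strict divide_right_mono)
      then have "2 * (t * tail t) * (\<Sum>i<m. r ^ i) \<le> 2 * (t * tail t) * (1 / (1 - r))"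
        using tp by (intro mult_left_mono) auto
      with sum[OF t, of m] show ?thesis by linarith
    qed
    moreover have "(\<lambda>m. tail_moment t - tail_moment (2 ^ m * t)) \<longlonglongrightarrow> tail_moment t - 0"
      using lim by (intro tendsto_diff tendsto_const) simp
    ultimately have "tail_moment t - 0 \<le> 2 * (t * tail t) * (1 / (1 - r))"
      by (intro LIMSEQ_le_const2) auto
    then show ?thesis by (simp add: mult_ac)
  qed
  then show ?thesis using r t0 by (intro exI[of _ "2 / (1 - r)"]) auto
qed

text \<open>Below index 1 the first truncated moment itself has this order. Above 1 centering
  replaces the truncated mean by minus the mean of the discarded part. At index 1 neither Karamata
  bound applies, and symmetry makes the truncated mean vanish.\<close>

lemma trunc_mean_bound:
  assumes sym: "\<alpha> = 1 \<Longrightarrow> distr P borel (\<lambda>w. - H w) = distr P borel H"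
    and cent: "\<alpha> > 1 \<Longrightarrow> has_bochner_integral P H 0"
  shows "\<exists>C>0. \<exists>t0>0. \<forall>t\<ge>t0.
    norm (expectation (\<lambda>w. if norm (H w) \<le> t then H w else 0)) \<le> C * t * tail t"
proof -
  let ?m = "\<lambda>t. expectation (\<lambda>w. if norm (H w) \<le> t then H w else 0)"
  consider "\<alpha> < 1" | "\<alpha> = 1" | "\<alpha> > 1" by linarith
  then show ?thesis
  proof cases
    case 1
    have "norm (?m t) \<le> trunc_moment 1 t" for t
    proof -
      have "norm (?m t) \<le> expectation (\<lambda>w. norm (if norm (H w) \<le> t then H w else 0))"
        by (rule integral_norm_bound)
      also have "\<dots> = trunc_moment 1 t"
        unfolding trunc_moment_def by (rule Bochner_Integration.integral_cong) auto
      finally show ?thesis .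
    qed
    with trunc_moment_karamata[of 1] 1 show ?thesis by simp (meson order_trans)
  next
    case 2
    have "?m t = 0" for t
    proof -
      let ?f = "\<lambda>x::'a. if norm x \<le> t then x else 0"
      have "?m t = integral\<^sup>L (distr P borel H) ?f" by (subst integral_distr) auto
      also have "\<dots> = integral\<^sup>L (distr P borel (\<lambda>w. - H w)) ?f" using sym[OF 2] by simp
      also have "\<dots> = expectation (\<lambda>w. ?f (- H w))" by (subst integral_distr) auto
      also have "\<dots> = expectation (\<lambda>w. - (if norm (H w) \<le> t then H w else 0))"
        by (rule Bochner_Integration.integral_cong) auto
      also have "\<dots> = - ?m t" by simp
      finally have "?m t + ?m t = 0" by (simp add: eq_neg_iff_add_eq_0)
      then show ?thesis by (simp add: scaleR_2[symmetric])
    qed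
    then show ?thesis by (intro exI[of _ 1]) (auto intro!: exI[of _ 1])
  next
    case 3
    have int: "integrable P H" and mean: "expectation H = 0"
      using cent[OF 3] by (auto simp: has_bochner_integral_iff)
    have "norm (?m t) \<le> tail_moment t" for t
    proof -
      have i2: "integrable P (\<lambda>w. if norm (H w) > t then H w else 0)"
        by (rule Bochner_Integration.integrable_bound[OF int]) auto
      have "expectation H = expectation (\<lambda>w. (if norm (H w) \<le> t then H w else 0)
          + (if norm (H w) > t then H w else 0))"
        by (rule Bochner_Integration.integral_cong) auto
      also have "\<dots> = ?m t + expectation (\<lambda>w. if norm (H w) > t then H w else 0)"
        by (rule Bochner_Integration.integral_add[OF integrable_trunc i2])
      finally have "?m t = - expectation (\<lambda>w. if norm (H w) > t then H w else 0)"
        using mean by (simp add: eq_neg_iff_add_eq_0)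
      then have "norm (?m t) = norm (expectation (\<lambda>w. if norm (H w) > t then H w else 0))" by simp
      also have "\<dots> \<le> expectation (\<lambda>w. norm (if norm (H w) > t then H w else 0))"
        by (rule integral_norm_bound)
      also have "\<dots> = tail_moment t"
        unfolding tail_moment_def by (rule Bochner_Integration.integral_cong) auto
      finally show ?thesis .
    qed
    with tail_moment_karamata[OF 3 int] show ?thesis by (meson order_trans)
  qed
qed

end

section \<open>Deviations of truncated sums\<close>

lemma exp_le_quadratic:
  fixes z :: real
  assumes "\<bar>z\<bar> \<le> 1"
  shows "exp z \<le> 1 + z + z\<^sup>2"
proof (cases "z \<ge> 0")
  case True
  then show ?thesis using assms exp_bound[of z] by auto
next
  case False
  define u where "u = - z"
  have u: "u \<ge> 0" "u \<le> 1" "z = - u" using False assms by (auto simp: u_def)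
  \<comment> \<open>The claim amounts to \<open>1 \<le> (1 - u + u\<^sup>2) * exp u\<close>; the
    quadratic Taylor minorant of the exponential suffices, since the odd and negative terms of the
    product cancel in its favour.\<close>
  have "1 \<le> (1 - u + u\<^sup>2) * (1 + u + u\<^sup>2 / 2)"
  proof -
    have "(1 - u + u\<^sup>2) * (1 + u + u\<^sup>2 / 2) = 1 + u\<^sup>2 / 2 + u ^ 3 / 2 + u ^ 4 / 2"
      by (simp add: algebra_simps power2_eq_square power3_eq_cube power4_eq_xxxx field_simps)
    then show ?thesis using u by simp
  qed
  also have "\<dots> \<le> (1 - u + u\<^sup>2) * exp u"
  proof (intro mult_left_mono exp_lower_Taylor_quadratic u)
    show "0 \<le> 1 - u + u\<^sup>2" using u by simp
  qed
  finally show ?thesis using u by (simp add: exp_minus field_simps)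
qed

text \<open>The exponent is small where \<open>norm x \<le> 1 / \<rho>\<close>, and a quadratic
  expansion applies; elsewhere the crude bound \<open>exp (\<rho> * y)\<close> is paid. The linear
  term is kept at the full cut \<open>y\<close>, so that its expectation is a truncated mean to
  which symmetry or centering applies.\<close>

lemma exp_truncated_inner_le:
  fixes b x :: "'a::euclidean_space"
  assumes "norm b \<le> 1" "\<rho> > 0" "y > 0"
  shows "exp (\<rho> * (b \<bullet> (if norm x \<le> y then x else 0))) \<le>
    1 + \<rho> * (b \<bullet> (if norm x \<le> y then x else 0)) +
    \<rho>\<^sup>2 * (if norm x \<le> 1 / \<rho> then (norm x)\<^sup>2 else 0) +
    exp (\<rho> * y) * indicator {x. norm x > 1 / \<rho>} x"
proof -
  define u where "u = (if norm x \<le> y then x else 0)"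
  define z where "z = \<rho> * (b \<bullet> u)"
  have bu: "\<bar>b \<bullet> u\<bar> \<le> norm u"
    using Cauchy_Schwarz_ineq2[of b u] assms(1) mult_right_mono[of "norm b" 1 "norm u"] by simp
  have zx: "\<bar>z\<bar> \<le> \<rho> * norm x"
    unfolding z_def abs_mult using bu assms(2) by (auto intro!: mult_mono simp: u_def split: if_splits)
  have zy: "\<bar>z\<bar> \<le> \<rho> * y"
    unfolding z_def abs_mult using bu assms(2,3) by (auto intro!: mult_mono simp: u_def split: if_splits)
  have "exp z \<le> 1 + z + \<rho>\<^sup>2 * (if norm x \<le> 1 / \<rho> then (norm x)\<^sup>2 else 0) +
    exp (\<rho> * y) * indicator {x. norm x > 1 / \<rho>} x"
  proof (cases "norm x \<le> 1 / \<rho>")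
    case True
    then have "\<rho> * norm x \<le> 1" using assms(2) by (simp add: field_simps)
    with zx have "exp z \<le> 1 + z + z\<^sup>2" by (intro exp_le_quadratic) simp
    also have "z\<^sup>2 \<le> (\<rho> * norm x)\<^sup>2" using zx power_mono[OF zx, of 2] by simp
    finally show ?thesis using True by (simp add: power_mult_distrib)
  next
    case False
    have e: "exp (\<rho> * y) \<ge> 1 + \<rho> * y" by (rule exp_ge_add_one_self)
    \<comment> \<open>A negative linear term is compensated by
      \<open>exp (\<rho> * y) \<ge> 1 + \<rho> * y\<close> together with
      \<open>\<bar>z\<bar> \<le> \<rho> * y\<close>.\<close>
    consider "\<bar>z\<bar> \<le> 1" | "z > 1" | "z < -1" by linarith
    then have "exp z \<le> 1 + z + exp (\<rho> * y)"
    proof cases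
      case 1
      have "exp z \<le> 1 + z + z\<^sup>2" using 1 by (rule exp_le_quadratic)
      moreover have "z\<^sup>2 \<le> 1" using 1 by (simp add: abs_square_le_1)
      moreover have "\<rho> * y \<ge> 0" using assms by simp
      ultimately show ?thesis using e by linarith
    next
      case 2
      have "exp z \<le> exp (\<rho> * y)" using zy by simp
      with 2 show ?thesis by linarith
    next
      case 3
      have "exp z \<le> 1" using 3 by simp
      then show ?thesis using e zy by linarith
    qed
    then show ?thesis using False by simp
  qed
  then show ?thesis by (simp add: z_def u_def)
qed

section \<open>Exponential inequality for independent copies truncated at a fixed level\<close>

locale heavy_tailed_sample = regularly_varying_vector P H \<alpha>
  for P :: "'w measure" and H :: "'w \<Rightarrow> 'a::euclidean_space" and \<alpha> :: real +
  fixes Hs :: "nat \<Rightarrow> 'w \<Rightarrow> 'a"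
  assumes Hs_indep: "indep_vars (\<lambda>_. borel) Hs {1..}"
    and Hs_law: "\<And>j. j \<ge> 1 \<Longrightarrow> distr P borel (Hs j) = distr P borel H"
begin

lemma Hs_measurable: "j \<ge> 1 \<Longrightarrow> Hs j \<in> borel_measurable P"
  using Hs_indep by (auto simp: indep_vars_def)

lemma expectation_Hs:
  fixes f :: "'a \<Rightarrow> 'b::{banach, second_countable_topology}"
  assumes "j \<ge> 1" "f \<in> borel_measurable borel"
  shows "expectation (\<lambda>w. f (Hs j w)) = expectation (\<lambda>w. f (H w))"
  using assms Hs_measurable[OF assms(1)] Hs_law[OF assms(1)]
  by (metis H_measurable integral_distr)

lemma prob_Hs:
  assumes "j \<ge> 1" "B \<in> sets borel"
  shows "prob {w \<in> space P. Hs j w \<in> B} = prob {w \<in> space P. H w \<in> B}"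
proof -
  have "prob {w \<in> space P. Hs j w \<in> B} = measure (distr P borel (Hs j)) B"
    using assms Hs_measurable[OF assms(1)] by (subst measure_distr) (auto intro!: arg_cong[where f = prob])
  also have "\<dots> = measure (distr P borel H) B" using assms by (simp add: Hs_law)
  also have "\<dots> = prob {w \<in> space P. H w \<in> B}"
    using assms by (subst measure_distr) (auto intro!: arg_cong[where f = prob])
  finally show ?thesis .
qed

lemma prob_Hs_tail: "j \<ge> 1 \<Longrightarrow> prob {w \<in> space P. norm (Hs j w) > t} = tail t"
  using prob_Hs[of j "{x. norm x > t}"] by simp

text \<open>Markov's inequality for the exponential, with the moment generating function factorised
  by independence. The mean enters through its norm, so one bound serves all directions
  \<open>b\<close>.\<close>

lemma truncated_sum_chernoff:
  assumes b: "norm b \<le> 1" and \<rho>: "\<rho> > 0" and y: "y > 0"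
  shows "prob {w \<in> space P. b \<bullet> (\<Sum>j=1..n. if norm (Hs j w) \<le> y then Hs j w else 0) \<ge> x} \<le>
    exp (- \<rho> * x + real n * (\<rho> * norm (expectation (\<lambda>w. if norm (H w) \<le> y then H w else 0))
      + \<rho>\<^sup>2 * trunc_moment 2 (1 / \<rho>) + exp (\<rho> * y) * tail (1 / \<rho>)))"
proof -
  let ?t = "\<lambda>x::'a. if norm x \<le> y then x else 0"
  let ?e = "\<lambda>x. exp (\<rho> * (b \<bullet> ?t x))"
  have t_meas [measurable]: "?t \<in> borel_measurable borel" by measurable
  define c where "c = \<rho> * norm (expectation (\<lambda>w. ?t (H w))) + \<rho>\<^sup>2 * trunc_moment 2 (1 / \<rho>)
    + exp (\<rho> * y) * tail (1 / \<rho>)"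
  have bt: "b \<bullet> ?t x \<le> y" for x
  proof -
    have "b \<bullet> ?t x \<le> norm b * norm (?t x)" by (rule norm_cauchy_schwarz)
    also have "\<dots> \<le> 1 * y" using b y by (intro mult_mono) auto
    finally show ?thesis by simp
  qed
  have e_bound: "norm (?e x) \<le> exp (\<rho> * y)" for x using bt[of x] \<rho> by simp
  have int_e: "integrable P (\<lambda>w. ?e (Hs j w))" if "j \<ge> 1" for j
    using Hs_measurable[OF that] e_bound by (intro integrable_const_bound[where B = "exp (\<rho> * y)"]) auto
  have "expectation (\<lambda>w. ?e (H w)) \<le> expectation (\<lambda>w. 1 + \<rho> * (b \<bullet> ?t (H w)) +
    \<rho>\<^sup>2 * (if norm (H w) \<le> 1 / \<rho> then (norm (H w))\<^sup>2 else 0) +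
    exp (\<rho> * y) * indicator {w \<in> space P. norm (H w) > 1 / \<rho>} w)"
  proof (rule integral_mono)
    show "integrable P (\<lambda>w. ?e (H w))"
      using e_bound by (intro integrable_const_bound[where B = "exp (\<rho> * y)"]) auto
    show "integrable P (\<lambda>w. 1 + \<rho> * (b \<bullet> ?t (H w)) +
      \<rho>\<^sup>2 * (if norm (H w) \<le> 1 / \<rho> then (norm (H w))\<^sup>2 else 0) +
      exp (\<rho> * y) * indicator {w \<in> space P. norm (H w) > 1 / \<rho>} w)"
      by (intro Bochner_Integration.integrable_add integrable_mult_right integrable_inner_right
        integrable_trunc integrable_trunc_moment integrable_tail_indicator) auto
    fix w assume "w \<in> space P"
    then show "?e (H w) \<le> 1 + \<rho> * (b \<bullet> ?t (H w)) +
      \<rho>\<^sup>2 * (if norm (H w) \<le> 1 / \<rho> then (norm (H w))\<^sup>2 else 0) +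
      exp (\<rho> * y) * indicator {w \<in> space P. norm (H w) > 1 / \<rho>} w"
      using exp_truncated_inner_le[OF b \<rho> y, of "H w"] by (simp add: indicator_def)
  qed
  also have "\<dots> = 1 + \<rho> * (b \<bullet> expectation (\<lambda>w. ?t (H w))) + \<rho>\<^sup>2 * trunc_moment 2 (1 / \<rho>)
      + exp (\<rho> * y) * tail (1 / \<rho>)"
    unfolding trunc_moment_def
    by (subst Bochner_Integration.integral_add
        Bochner_Integration.integral_mult_right_zero integral_inner_right[symmetric];
        (intro Bochner_Integration.integrable_add integrable_mult_right integrable_inner_right
        integrable_trunc integrable_trunc_moment integrable_tail_indicator)?; simp add: prob_space)+
  also have "\<dots> \<le> 1 + c"
  proof -
    have "b \<bullet> expectation (\<lambda>w. ?t (H w)) \<le> 1 * norm (expectation (\<lambda>w. ?t (H w)))"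
      using norm_cauchy_schwarz b by (rule order_trans[OF _ mult_right_mono]) auto
    then show ?thesis using \<rho> by (simp add: c_def)
  qed
  also have "\<dots> \<le> exp c" by (rule exp_ge_add_one_self)
  finally have one: "expectation (\<lambda>w. ?e (H w)) \<le> exp c" .
  let ?S = "\<lambda>w. b \<bullet> (\<Sum>j=1..n. ?t (Hs j w))"
  have prod_eq: "(\<Prod>j=1..n. ?e (Hs j w)) = exp (\<rho> * ?S w)" for w
    by (simp add: exp_sum inner_sum_right sum_distrib_left)
  have ind: "indep_vars (\<lambda>_. borel) (\<lambda>j w. ?e (Hs j w)) {1..n}"
    by (rule indep_vars_compose2[OF indep_vars_subset[OF Hs_indep]]) auto
  have S_meas: "?S \<in> borel_measurable P"
    by (intro borel_measurable_inner borel_measurable_const borel_measurable_sum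
        measurable_compose[OF Hs_measurable t_meas]) auto
  have int: "integrable P (\<lambda>w. exp (\<rho> * ?S w))"
    unfolding prod_eq[symmetric] using int_e by (intro indep_vars_integrable ind) auto
  have "expectation (\<lambda>w. exp (\<rho> * ?S w)) = (\<Prod>j=1..n. expectation (\<lambda>w. ?e (Hs j w)))"
    unfolding prod_eq[symmetric] using int_e by (intro indep_vars_lebesgue_integral ind) auto
  also have "\<dots> = (\<Prod>j=1..n. expectation (\<lambda>w. ?e (H w)))"
    by (intro prod.cong refl expectation_Hs) auto
  also have "\<dots> \<le> exp c ^ n"
    using one by (simp add: power_mono)
  finally have mgf: "expectation (\<lambda>w. exp (\<rho> * ?S w)) \<le> exp (real n * c)"
    by (simp add: exp_of_nat_mult)
  have "prob {w \<in> space P. ?S w \<ge> x} = expectation (indicator {w \<in> space P. ?S w \<ge> x})"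
    using S_meas by simp
  also have "\<dots> \<le> expectation (\<lambda>w. exp (- \<rho> * x) * exp (\<rho> * ?S w))"
  proof (rule integral_mono)
    show "integrable P (indicat_real {w \<in> space P. ?S w \<ge> x})"
      using S_meas by (intro integrable_real_indicator) (auto simp: emeasure_eq_measure)
    show "integrable P (\<lambda>w. exp (- \<rho> * x) * exp (\<rho> * ?S w))"
      by (rule integrable_mult_right[OF int])
    fix w
    show "indicat_real {w \<in> space P. ?S w \<ge> x} w \<le> exp (- \<rho> * x) * exp (\<rho> * ?S w)"
      using \<rho> by (auto simp: indicator_def exp_add[symmetric])
  qed
  also have "\<dots> \<le> exp (- \<rho> * x) * exp (real n * c)"
    using mgf by simp
  also have "\<dots> = exp (- \<rho> * x + real n * c)" by (simp add: exp_add[symmetric])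
  finally show ?thesis by (simp add: c_def)
qed

text \<open>A vector of norm above \<open>x\<close> has a coordinate of absolute value at least
  \<open>x\<close> divided by the dimension, by comparison with the l1 norm; a union bound runs over
  the signed basis vectors.\<close>

lemma truncated_sum_norm_bound:
  assumes \<rho>: "\<rho> > 0" and y: "y > 0"
  shows "prob {w \<in> space P. norm (\<Sum>j=1..n. if norm (Hs j w) \<le> y then Hs j w else 0) > x} \<le>
    2 * DIM('a) *
    exp (- \<rho> * (x / DIM('a)) + real n * (\<rho> * norm (expectation (\<lambda>w. if norm (H w) \<le> y then H w else 0))
      + \<rho>\<^sup>2 * trunc_moment 2 (1 / \<rho>) + exp (\<rho> * y) * tail (1 / \<rho>)))"
    (is "_ \<le> _ * ?E")
proof -
  define S where "S = (\<lambda>w. \<Sum>j=1..n. if norm (Hs j w) \<le> y then Hs j w else 0)"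
  define D where "D = (Basis :: 'a set) \<union> uminus ` Basis"
  have fin: "finite D" by (simp add: D_def)
  have card: "card D \<le> 2 * DIM('a)"
    unfolding D_def by (rule order_trans[OF card_Un_le]) (simp add: card_image_le mult_2)
  have meas: "(\<lambda>x. if norm x \<le> y then x else 0 :: 'a) \<in> borel_measurable borel" by measurable
  have S_meas [measurable]: "S \<in> borel_measurable P"
    unfolding S_def
    by (intro borel_measurable_sum measurable_compose[OF Hs_measurable meas]) auto
  have m: "{w \<in> space P. b \<bullet> S w \<ge> c} \<in> sets P" for b c
    by measurable
  have "{w \<in> space P. norm (S w) > x} \<subseteq> (\<Union>b\<in>D. {w \<in> space P. b \<bullet> S w \<ge> x / DIM('a)})"
  proof
    fix w assume w: "w \<in> {w \<in> space P. norm (S w) > x}"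
    have "x < (\<Sum>b\<in>Basis. \<bar>S w \<bullet> b\<bar>)"
      using w norm_le_l1[of "S w"] by simp
    then obtain b where b: "b \<in> Basis" "\<bar>S w \<bullet> b\<bar> \<ge> x / DIM('a)"
      using sum_bounded_above[of Basis "\<lambda>b. \<bar>S w \<bullet> b\<bar>" "x / DIM('a)"] by force
    then have "b \<bullet> S w \<ge> x / DIM('a) \<or> (- b) \<bullet> S w \<ge> x / DIM('a)"
      by (auto simp: inner_commute abs_if split: if_splits)
    with w b(1) show "w \<in> (\<Union>b\<in>D. {w \<in> space P. b \<bullet> S w \<ge> x / DIM('a)})"
      unfolding D_def by blast
  qed
  then have "prob {w \<in> space P. norm (S w) > x} \<le> prob (\<Union>b\<in>D. {w \<in> space P. b \<bullet> S w \<ge> x / DIM('a)})"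
    using fin m by (intro finite_measure_mono sets.finite_UN)
  also have "\<dots> \<le> (\<Sum>b\<in>D. prob {w \<in> space P. b \<bullet> S w \<ge> x / DIM('a)})"
    using fin m by (intro finite_measure_subadditive_finite) auto
  also have "\<dots> \<le> (\<Sum>b\<in>D. ?E)"
    unfolding S_def by (intro sum_mono truncated_sum_chernoff \<rho> y) (auto simp: D_def)
  also have "\<dots> = card D * ?E" by simp
  also have "\<dots> \<le> (2 * DIM('a)) * ?E"
    using card by (intro mult_right_mono) (auto simp del: of_nat_mult simp: of_nat_mono)
  finally show ?thesis by (simp add: S_def)
qed

end

section \<open>The exponential inequality in the soft truncation regime\<close>

locale softly_truncated_sample = heavy_tailed_sample P H \<alpha> Hs
  for P :: "'w measure" and H :: "'w \<Rightarrow> 'a::euclidean_space" and \<alpha> :: real and Hs +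
  fixes M :: "nat \<Rightarrow> real"
  assumes H_symmetric: "\<alpha> = 1 \<Longrightarrow> distr P borel (\<lambda>w. - H w) = distr P borel H"
    and H_centered: "\<alpha> > 1 \<Longrightarrow> has_bochner_integral P H 0"
    and M_pos: "\<And>n. n \<ge> 1 \<Longrightarrow> M n > 0"
    and M_lim: "filterlim M at_top sequentially"
    and soft: "(\<lambda>n. real n * tail (M n)) \<longlonglongrightarrow> 0"
    and soft_eq_2: "\<alpha> = 2 \<Longrightarrow>
          \<exists>\<gamma>>0. filterlim (\<lambda>n. M n / sqrt (real n powr (1 + \<gamma>))) at_top sequentially"
    and soft_gt_2: "\<alpha> > 2 \<Longrightarrow>
          filterlim (\<lambda>n. M n / sqrt (real n * ln (M n))) at_top sequentially"
begin

definition exc :: "nat \<Rightarrow> real" where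
  "exc n = real n * tail (M n)"

definition lexc :: "nat \<Rightarrow> real" where
  "lexc n = - ln (exc n)"

lemma exc_pos: "n \<ge> 1 \<Longrightarrow> exc n > 0"
  unfolding exc_def using G_pos[of "M n"] by simp

lemma exc_nonneg: "exc n \<ge> 0"
  unfolding exc_def by simp

lemma exc_lim: "exc \<longlonglongrightarrow> 0"
  unfolding exc_def[abs_def] by (rule soft)

lemma eventually_ge_1: "eventually (\<lambda>n. n \<ge> (1::nat)) sequentially"
  by (rule eventually_ge_at_top)

lemma exc_at_right: "filterlim exc (at_right 0) sequentially"
  unfolding filterlim_at using exc_lim exc_pos
  by (auto intro!: eventually_mono[OF eventually_ge_1] simp: less_imp_neq[symmetric])

lemma exp_lexc: "n \<ge> 1 \<Longrightarrow> exp (- lexc n) = exc n"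
  unfolding lexc_def using exc_pos by simp

lemma lexc_at_top: "filterlim lexc at_top sequentially"
  unfolding lexc_def[abs_def]
  by (rule filterlim_compose[OF filterlim_uminus_at_top_at_bot filterlim_compose[OF ln_at_0 exc_at_right]])

lemma eventually_tail_scale:
  assumes "c > 0"
  shows "\<exists>C>0. eventually (\<lambda>n. tail (c * M n) \<le> C * tail (M n)) sequentially"
proof -
  obtain C where "C > 0" "\<forall>\<^sub>F t in at_top. tail (c * t) \<le> C * tail t"
    using G_scale_bounded[OF assms] by auto
  then show ?thesis using filterlim_iff[THEN iffD1, OF M_lim] by blast
qed

lemma tail_ratio_lim:
  assumes "c > 0"
  shows "(\<lambda>n. tail (c * M n) / tail (M n)) \<longlonglongrightarrow> c powr (- \<alpha>)"
  by (rule filterlim_compose[OF G_rv[OF assms] M_lim])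

text \<open>For \<open>n \<ge> 1\<close> one has \<open>exc n \<ge> tail (M n)\<close>, and tails
  decay at most polynomially.\<close>

lemma lexc_le_ln: "\<exists>C>0. eventually (\<lambda>n. lexc n \<le> C * ln (M n)) sequentially"
proof -
  obtain C where C: "C > 0" "\<forall>\<^sub>F t in at_top. - ln (tail t) \<le> C * ln t"
    using neg_ln_G_le by auto
  have "eventually (\<lambda>n. - ln (tail (M n)) \<le> C * ln (M n)) sequentially"
    using filterlim_iff[THEN iffD1, OF M_lim] C(2) by blast
  then have "eventually (\<lambda>n. lexc n \<le> C * ln (M n)) sequentially"
    using eventually_ge_1
  proof eventually_elim
    case (elim n)
    have "ln (tail (M n)) \<le> ln (exc n)"
      using elim G_pos[of "M n"] exc_pos[of n] unfolding exc_def
      by (subst ln_le_cancel_iff) auto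
    then show ?case using elim by (simp add: lexc_def)
  qed
  then show ?thesis using C by blast
qed

text \<open>This level is \<open>1 / \<rho>\<close> for the Chernoff parameter
  \<open>\<rho> = A * lexc n / M n\<close>. It diverges because \<open>lexc n\<close> is at most
  logarithmic in \<open>M n\<close>, so tail and moment asymptotics apply there.\<close>

lemma level_at_top:
  assumes "A > 0"
  shows "filterlim (\<lambda>n. M n / (A * lexc n)) at_top sequentially"
proof -
  obtain C where C: "C > 0" "eventually (\<lambda>n. lexc n \<le> C * ln (M n)) sequentially"
    using lexc_le_ln by auto
  have "filterlim (\<lambda>x::real. x / (A * (C * ln x))) at_top at_top"
    using assms C(1) by real_asymp
  then have "filterlim (\<lambda>n. M n / (A * (C * ln (M n)))) at_top sequentially"
    by (rule filterlim_compose[OF _ M_lim])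
  moreover have "eventually (\<lambda>n. M n / (A * (C * ln (M n))) \<le> M n / (A * lexc n)) sequentially"
    using C(2) eventually_ge_1 filterlim_at_top_dense[THEN iffD1, OF lexc_at_top, rule_format, of 0]
  proof eventually_elim
    case (elim n)
    then have "0 < C * ln (M n)" by linarith
    then have "0 < A * (C * ln (M n)) * (A * lexc n)"
      using elim(3) assms by (metis mult_pos_pos)
    with elim show ?case using M_pos[of n] assms by (intro divide_left_mono mult_left_mono) auto
  qed
  ultimately show ?thesis by (rule filterlim_at_top_mono)
qed

text \<open>Lowering the level from \<open>M n\<close> by the factor \<open>A * lexc n\<close> costs
  a power of \<open>lexc n\<close> by the Potter bound. Of \<open>exc n = exp (- lexc n)\<close> one
  half pays for the exponential factor, and the other half beats that power.\<close>

lemma small_level_tail: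
  assumes "A > 0"
  shows "(\<lambda>n. real n * exp (lexc n / 2) * tail (M n / (A * lexc n))) \<longlonglongrightarrow> 0"
proof -
  obtain t0 where t0: "t0 > 0"
    "\<And>s t. t0 \<le> s \<Longrightarrow> s \<le> t \<Longrightarrow> tail s \<le> 2 powr (\<alpha> + 1) * (t / s) powr (\<alpha> + 1) * tail t"
    using potter_bound by blast
  define K where "K = (2::real) powr (\<alpha> + 1)"
  have "eventually (\<lambda>n. M n / (A * lexc n) \<ge> t0) sequentially"
    using filterlim_at_top[THEN iffD1, OF level_at_top[OF assms]] by blast
  moreover have "eventually (\<lambda>n. lexc n \<ge> max (1 / A) 1) sequentially"
    using filterlim_at_top[THEN iffD1, OF lexc_at_top] by blast
  ultimately have "eventually (\<lambda>n. norm (real n * exp (lexc n / 2) * tail (M n / (A * lexc n)))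
      \<le> K * (A * lexc n) powr (\<alpha> + 1) * exp (- (lexc n / 2))) sequentially"
    using eventually_ge_1
  proof eventually_elim
    case (elim n)
    have l: "lexc n \<ge> 1" "A * lexc n \<ge> 1" using elim assms by (auto simp: field_simps)
    have Mn: "M n > 0" using elim M_pos by simp
    have "M n / (A * lexc n) \<le> M n / 1" using l Mn by (intro divide_left_mono) auto
    then have "tail (M n / (A * lexc n)) \<le> K * (M n / (M n / (A * lexc n))) powr (\<alpha> + 1) * tail (M n)"
      unfolding K_def using elim by (intro t0) auto
    also have "M n / (M n / (A * lexc n)) = A * lexc n" using Mn l by simp
    finally have "real n * exp (lexc n / 2) * tail (M n / (A * lexc n)) \<le>
        real n * exp (lexc n / 2) * (K * (A * lexc n) powr (\<alpha> + 1) * tail (M n))"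
      by (intro mult_left_mono) auto
    also have "\<dots> = K * (A * lexc n) powr (\<alpha> + 1) * exp (lexc n / 2) * exc n"
      by (simp add: exc_def)
    also have "\<dots> = K * (A * lexc n) powr (\<alpha> + 1) * (exp (lexc n / 2) * exp (- lexc n))"
      using exp_lexc elim by simp
    also have "exp (lexc n / 2) * exp (- lexc n) = exp (- (lexc n / 2))"
      by (simp add: exp_add[symmetric])
    finally show ?case by simp
  qed
  moreover have "(\<lambda>n. K * (A * lexc n) powr (\<alpha> + 1) * exp (- (lexc n / 2))) \<longlonglongrightarrow> 0"
  proof (rule filterlim_compose[OF _ lexc_at_top])
    show "((\<lambda>l. K * (A * l) powr (\<alpha> + 1) * exp (- (l / 2))) \<longlongrightarrow> 0) at_top"
      using assms \<alpha>_pos by real_asymp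
  qed
  ultimately show ?thesis by (rule Lim_null_comparison)
qed

text \<open>This is the variance part of the Chernoff exponent, measured in units of
  \<open>lexc n\<close>. The three ranges of \<alpha> differ in the growth of the truncated
  variance, and the growth conditions on \<open>M\<close> enter here.\<close>

lemma small_level_variance:
  assumes A: "A > 0"
  shows "(\<lambda>n. real n * (A * lexc n / M n)\<^sup>2 * trunc_moment 2 (M n / (A * lexc n)) / lexc n) \<longlonglongrightarrow> 0"
proof -
  define r where "r = (\<lambda>n. M n / (A * lexc n))"
  have r_lim: "filterlim r at_top sequentially" unfolding r_def by (rule level_at_top[OF A])
  have l_ge: "eventually (\<lambda>n. lexc n \<ge> max (1 / A) 1) sequentially"
    using filterlim_at_top[THEN iffD1, OF lexc_at_top] by blast
  obtain C2 where C2: "C2 > 0" "eventually (\<lambda>n. lexc n \<le> C2 * ln (M n)) sequentially"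
    using lexc_le_ln by auto
  have eq: "A * lexc n / M n = 1 / r n" for n by (simp add: r_def)
  have nn: "norm (real n * (A * lexc n / M n)\<^sup>2 * trunc_moment 2 (r n) / lexc n) =
      real n * (1 / r n)\<^sup>2 * trunc_moment 2 (r n) / lexc n" if "lexc n \<ge> 1" for n
    using that trunc_moment_nonneg[of 2 "r n"] by (simp add: eq)
  consider "\<alpha> < 2" | "\<alpha> = 2" | "\<alpha> > 2" by linarith
  then have "(\<lambda>n. real n * (A * lexc n / M n)\<^sup>2 * trunc_moment 2 (r n) / lexc n) \<longlonglongrightarrow> 0"
  proof cases
    case 1
    then obtain C t0 where C: "C > 0" "t0 > 0" "\<And>t. t \<ge> t0 \<Longrightarrow> trunc_moment 2 t \<le> C * t\<^sup>2 * tail t"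
      using trunc_moment_karamata[of 2] by auto
    have "eventually (\<lambda>n. r n \<ge> t0) sequentially"
      using filterlim_at_top[THEN iffD1, OF r_lim] by blast
    then have "eventually (\<lambda>n. norm (real n * (A * lexc n / M n)\<^sup>2 * trunc_moment 2 (r n) / lexc n)
        \<le> C * (real n * exp (lexc n / 2) * tail (r n))) sequentially"
      using l_ge
    proof eventually_elim
      case (elim n)
      have rp: "r n > 0" using elim C by simp
      have l1: "lexc n \<ge> 1" using elim by simp
      have "real n * (1 / r n)\<^sup>2 * trunc_moment 2 (r n) / lexc n
          \<le> real n * (1 / r n)\<^sup>2 * (C * (r n)\<^sup>2 * tail (r n)) / lexc n"
        using elim C l1 by (intro divide_right_mono mult_left_mono) auto
      also have "\<dots> = C * (real n * (1 / lexc n) * tail (r n))"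
        using rp by (simp add: field_simps)
      also have "\<dots> \<le> C * (real n * exp (lexc n / 2) * tail (r n))"
      proof -
        have "1 / lexc n \<le> 1" using l1 by simp
        also have "1 \<le> exp (lexc n / 2)" using l1 by simp
        finally show ?thesis using C by (intro mult_left_mono mult_right_mono) auto
      qed
      finally show ?case using nn[OF l1] by simp
    qed
    moreover have "(\<lambda>n. C * (real n * exp (lexc n / 2) * tail (r n))) \<longlonglongrightarrow> 0"
      unfolding r_def using tendsto_mult_right_zero[OF small_level_tail[OF A]] .
    ultimately show ?thesis by (rule Lim_null_comparison)
  next
    case 2
    then obtain \<gamma> where \<gamma>: "\<gamma> > 0"
      "filterlim (\<lambda>n. M n / sqrt (real n powr (1 + \<gamma>))) at_top sequentially"
      using soft_eq_2 by auto
    \<comment> \<open>The growth condition gives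
      \<open>n \<le> M n powr (2 / (1 + \<gamma>))\<close>, and this exponent equals
      \<open>2 - 2 * \<eta>\<close>. With variance growth \<open>\<eta>\<close> a net factor
      \<open>M n powr (- \<eta>)\<close> remains, which beats the logarithms.\<close>
    define \<eta> where "\<eta> = \<gamma> / (1 + \<gamma>)"
    have \<eta>: "0 < \<eta>" "\<eta> < 1" using \<gamma> by (auto simp: \<eta>_def)
    obtain C t0 where C: "C > 0" "t0 > 0" "\<And>t. t \<ge> t0 \<Longrightarrow> trunc_moment 2 t \<le> C * t powr \<eta>"
      using trunc_moment_2_powr[OF 2 \<eta>(1)] by auto
    have "eventually (\<lambda>n. r n \<ge> t0) sequentially"
      using filterlim_at_top[THEN iffD1, OF r_lim] by blast
    moreover have "eventually (\<lambda>n. M n / sqrt (real n powr (1 + \<gamma>)) \<ge> 1) sequentially"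
      using filterlim_at_top[THEN iffD1, OF \<gamma>(2)] by blast
    moreover have "eventually (\<lambda>n. M n \<ge> 1) sequentially"
      using filterlim_at_top[THEN iffD1, OF M_lim] by blast
    ultimately have "eventually (\<lambda>n. norm (real n * (A * lexc n / M n)\<^sup>2 * trunc_moment 2 (r n) / lexc n)
        \<le> C * (A * (C2 * ln (M n)))\<^sup>2 * M n powr (- \<eta>)) sequentially"
      using l_ge C2(2) eventually_ge_1
    proof eventually_elim
      case (elim n)
      have rp: "r n > 0" using elim C by simp
      have l1: "lexc n \<ge> 1" "A * lexc n \<ge> 1" using elim A by (auto simp: field_simps)
      have Mn: "M n \<ge> 1" "M n > 0" using elim by auto
      have n0: "real n > 0" using elim by simp
      have nM: "real n \<le> M n powr (2 / (1 + \<gamma>))"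
      proof -
        have "sqrt (real n powr (1 + \<gamma>)) \<le> M n" using elim n0 by (simp add: field_simps)
        then have "real n powr (1 + \<gamma>) \<le> (M n)\<^sup>2"
          by (rule sqrt_le_D)
        then have "(real n powr (1 + \<gamma>)) powr (1 / (1 + \<gamma>)) \<le> ((M n)\<^sup>2) powr (1 / (1 + \<gamma>))"
          using \<gamma> by (intro powr_mono2) auto
        also have "(M n)\<^sup>2 = M n powr 2" using Mn by (simp add: powr_numeral)
        finally show ?thesis using n0 \<gamma> by (simp add: powr_powr)
      qed
      have "real n * (1 / r n)\<^sup>2 * trunc_moment 2 (r n) / lexc n
          \<le> real n * (1 / r n)\<^sup>2 * (C * r n powr \<eta>) / 1"
        using elim C l1 trunc_moment_nonneg[of 2 "r n"]
        by (intro frac_le mult_left_mono) auto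
      also have "\<dots> = C * real n * (1 / r n) powr (2 - \<eta>)"
      proof -
        have "(1 / r n) powr (2 - \<eta>) = (1 / r n)\<^sup>2 * r n powr \<eta>"
          using rp by (simp add: powr_diff powr_divide powr_numeral power_divide)
        then show ?thesis by simp
      qed
      also have "\<dots> = C * real n * ((A * lexc n) powr (2 - \<eta>) * M n powr (- (2 - \<eta>)))"
        unfolding eq[symmetric] using powr_divide[of "A * lexc n" "M n" "2 - \<eta>"]
          powr_minus[of "M n" "2 - \<eta>"] l1 Mn by (simp add: divide_inverse)
      also have "\<dots> \<le> C * M n powr (2 / (1 + \<gamma>)) * ((A * (C2 * ln (M n)))\<^sup>2 * M n powr (- (2 - \<eta>)))"
      proof (intro mult_mono nM order_refl)
        have "(A * lexc n) powr (2 - \<eta>) \<le> (A * lexc n) powr 2"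
          using l1 \<eta> by (intro powr_mono) auto
        also have "\<dots> = (A * lexc n)\<^sup>2" using l1 by (simp add: powr_numeral)
        also have "\<dots> \<le> (A * (C2 * ln (M n)))\<^sup>2"
          using l1 elim A by (intro power_mono mult_left_mono) auto
        finally show "(A * lexc n) powr (2 - \<eta>) \<le> (A * (C2 * ln (M n)))\<^sup>2" .
      qed (use C in auto)
      also have "\<dots> = C * (A * (C2 * ln (M n)))\<^sup>2 * (M n powr (2 / (1 + \<gamma>)) * M n powr (- (2 - \<eta>)))"
        by (simp add: mult_ac)
      also have "M n powr (2 / (1 + \<gamma>)) * M n powr (- (2 - \<eta>)) = M n powr (- \<eta>)"
      proof -
        have "2 / (1 + \<gamma>) + - (2 - \<eta>) = - \<eta>"
          using \<gamma>(1) unfolding \<eta>_def by (simp add: divide_simps) (simp add: algebra_simps)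
        then show ?thesis unfolding powr_add[symmetric] by (simp only:)
      qed
      finally show ?case using nn[OF l1(1)] by simp
    qed
    moreover have "(\<lambda>n. C * (A * (C2 * ln (M n)))\<^sup>2 * M n powr (- \<eta>)) \<longlonglongrightarrow> 0"
    proof (rule filterlim_compose[OF _ M_lim])
      show "((\<lambda>x. C * (A * (C2 * ln x))\<^sup>2 * x powr (- \<eta>)) \<longlongrightarrow> 0) at_top"
        using \<eta> C(1) C2(1) A by real_asymp
    qed
    ultimately show ?thesis by (rule Lim_null_comparison)
  next
    case 3
    obtain C where C: "C > 0" "\<And>t. trunc_moment 2 t \<le> C"
      using trunc_moment_2_bounded[OF 3] by auto
    \<comment> \<open>With bounded variance the quantity is of order
      \<open>n * lexc n / (M n)\<^sup>2\<close>; since \<open>lexc n\<close> is at most a multiple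
      of \<open>ln (M n)\<close>, this is bounded by a multiple of the inverse square of
      \<open>g n\<close>.\<close>
    define g where "g = (\<lambda>n. M n / sqrt (real n * ln (M n)))"
    have g: "filterlim g at_top sequentially" unfolding g_def by (rule soft_gt_2[OF 3])
    have "eventually (\<lambda>n. M n \<ge> 1) sequentially"
      using filterlim_at_top[THEN iffD1, OF M_lim] by blast
    with C2(2) l_ge eventually_ge_1 have "eventually (\<lambda>n. norm (real n * (A * lexc n / M n)\<^sup>2 *
        trunc_moment 2 (r n) / lexc n)
        \<le> C * A\<^sup>2 * C2 * inverse ((g n)\<^sup>2)) sequentially"
    proof eventually_elim
      case (elim n)
      have l1: "lexc n \<ge> 1" using elim by (auto simp: field_simps)
      have Mn: "M n \<ge> 1" "M n > 0" using elim by auto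
      have "real n * (A * lexc n / M n)\<^sup>2 * trunc_moment 2 (r n) / lexc n
          \<le> real n * (A * lexc n / M n)\<^sup>2 * C / lexc n"
        using C l1 by (intro divide_right_mono mult_left_mono) auto
      also have "\<dots> = C * A\<^sup>2 * (real n * lexc n / (M n)\<^sup>2)"
        using l1 Mn by (simp add: power2_eq_square field_simps)
      also have "\<dots> \<le> C * A\<^sup>2 * (real n * (C2 * ln (M n)) / (M n)\<^sup>2)"
        using C elim by (intro mult_left_mono divide_right_mono) auto
      also have "\<dots> = C * A\<^sup>2 * C2 * inverse ((g n)\<^sup>2)"
        using Mn by (simp add: g_def power_divide)
      finally show ?case using nn[OF l1] eq by simp
    qed
    moreover have "(\<lambda>n. C * A\<^sup>2 * C2 * inverse ((g n)\<^sup>2)) \<longlonglongrightarrow> 0"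
    proof (rule filterlim_compose[OF _ g])
      show "((\<lambda>x. C * A\<^sup>2 * C2 * inverse (x\<^sup>2)) \<longlongrightarrow> 0) at_top"
        using C(1) C2(1) A by real_asymp
    qed
    ultimately show ?thesis by (rule Lim_null_comparison)
  qed
  then show ?thesis by (simp add: r_def)
qed

lemma truncated_mean_negligible:
  assumes c: "c > 0"
  shows "(\<lambda>n. real n * norm (expectation (\<lambda>w. if norm (H w) \<le> c * M n then H w else 0)) / M n) \<longlonglongrightarrow> 0"
proof -
  obtain C t0 where C: "C > 0" "t0 > 0" "\<And>t. t \<ge> t0 \<Longrightarrow>
      norm (expectation (\<lambda>w. if norm (H w) \<le> t then H w else 0)) \<le> C * t * tail t"
    using trunc_mean_bound[OF H_symmetric H_centered] by auto
  obtain D where D: "D > 0" "eventually (\<lambda>n. tail (c * M n) \<le> D * tail (M n)) sequentially"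
    using eventually_tail_scale[OF c] by auto
  have "eventually (\<lambda>n. M n \<ge> t0 / c) sequentially"
    using filterlim_at_top[THEN iffD1, OF M_lim] by blast
  with D(2) eventually_ge_1
  have "eventually (\<lambda>n. norm (real n * norm (expectation (\<lambda>w. if norm (H w) \<le> c * M n then H w else 0)) / M n)
      \<le> C * c * D * exc n) sequentially"
  proof eventually_elim
    case (elim n)
    have Mn: "M n > 0" using elim M_pos by auto
    have "norm (expectation (\<lambda>w. if norm (H w) \<le> c * M n then H w else 0)) \<le> C * (c * M n) * tail (c * M n)"
      using elim c by (intro C) (simp add: field_simps)
    also have "\<dots> \<le> C * (c * M n) * (D * tail (M n))"
      using elim C c Mn by (intro mult_left_mono) auto
    finally have "real n * norm (expectation (\<lambda>w. if norm (H w) \<le> c * M n then H w else 0)) / M n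
        \<le> real n * (C * (c * M n) * (D * tail (M n))) / M n"
      using Mn by (intro divide_right_mono mult_left_mono) auto
    also have "\<dots> = C * c * D * exc n" using Mn by (simp add: exc_def field_simps)
    finally show ?case using Mn by simp
  qed
  moreover have "(\<lambda>n. C * c * D * exc n) \<longlonglongrightarrow> 0"
    using tendsto_mult_right_zero[OF exc_lim] .
  ultimately show ?thesis by (rule Lim_null_comparison)
qed

text \<open>
  The Chernoff parameter is \<open>A / M n\<close> times \<open>- ln (exc n)\<close>, so that the exponential bound is a
  large power of \<open>exc n\<close>; the cut at \<open>1 / (2 * A)\<close> times \<open>M n\<close> keeps the exponential moment
  of the largest admissible summands below \<open>exc n powr (- 1 / 2)\<close>.
\<close>

lemma truncated_sum_deviation:
  assumes \<delta>: "\<delta> > 0"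
  shows "\<exists>\<epsilon>>0. \<epsilon> < 1 \<and> (\<lambda>n. prob {w \<in> space P.
    norm (\<Sum>j=1..n. if norm (Hs j w) \<le> \<epsilon> * M n then Hs j w else 0) > \<delta> * M n} / exc n ^ k) \<longlonglongrightarrow> 0"
proof -
  define d where "d = real DIM('a)"
  have d: "d \<ge> 1" unfolding d_def by (simp add: Suc_leI)
  \<comment> \<open>The linear term of the exponent then yields at least
    \<open>(k + 2) * lexc n\<close>. One unit covers the error terms, so
    \<open>exc n ^ (k + 1)\<close> is left, one power more than needed. The maximum with 1 keeps the
    cut below \<open>M n\<close>.\<close>
  define A where "A = max 1 ((real k + 2) * d / \<delta>)"
  have A: "A > 0" "A \<ge> 1" unfolding A_def by auto
  have Ad: "real k + 2 \<le> A * \<delta> / d"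
  proof -
    have "(real k + 2) * d / \<delta> \<le> A" unfolding A_def by simp
    then show ?thesis using \<delta> d by (simp add: field_simps)
  qed
  define \<epsilon> where "\<epsilon> = 1 / (2 * A)"
  have \<epsilon>: "\<epsilon> > 0" "\<epsilon> < 1" "\<epsilon> * A = 1 / 2" unfolding \<epsilon>_def using A by (auto simp: field_simps)
  define m where "m = (\<lambda>n. norm (expectation (\<lambda>w. if norm (H w) \<le> \<epsilon> * M n then H w else 0)))"
  \<comment> \<open>The error terms of the exponent relative to \<open>lexc n\<close>; the last one
    is left undivided, which only enlarges it once \<open>lexc n \<ge> 1\<close>.\<close>
  define X where "X = (\<lambda>n. A * (real n * m n / M n)
    + real n * (A * lexc n / M n)\<^sup>2 * trunc_moment 2 (M n / (A * lexc n)) / lexc n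
    + real n * exp (lexc n / 2) * tail (M n / (A * lexc n)))"
  have "X \<longlonglongrightarrow> A * 0 + 0 + 0"
    unfolding X_def m_def using \<epsilon> A
    by (intro tendsto_add tendsto_mult tendsto_const small_level_tail small_level_variance
        truncated_mean_negligible)
  then have "eventually (\<lambda>n. X n < 1) sequentially" by (rule order_tendstoD) simp
  moreover have "eventually (\<lambda>n. lexc n \<ge> 1) sequentially"
    using filterlim_at_top[THEN iffD1, OF lexc_at_top] by blast
  ultimately have "eventually (\<lambda>n. norm (prob {w \<in> space P.
      norm (\<Sum>j=1..n. if norm (Hs j w) \<le> \<epsilon> * M n then Hs j w else 0) > \<delta> * M n} / exc n ^ k)
      \<le> 2 * d * exc n) sequentially"
    using eventually_ge_1
  proof eventually_elim
    case (elim n)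
    have Mn: "M n > 0" using elim M_pos by auto
    have l1: "lexc n \<ge> 1" using elim by simp
    define l where "l = A * lexc n / M n"
    have l: "l > 0" using A l1 Mn by (simp add: l_def)
    have l_inv: "1 / l = M n / (A * lexc n)" by (simp add: l_def)
    have ly: "l * (\<epsilon> * M n) = lexc n / 2"
      using \<epsilon>(3) Mn by (simp add: l_def) (metis mult.assoc mult.commute times_divide_eq_left mult_1)
    have "prob {w \<in> space P. norm (\<Sum>j=1..n. if norm (Hs j w) \<le> \<epsilon> * M n then Hs j w else 0) > \<delta> * M n}
      \<le> 2 * d * exp (- l * (\<delta> * M n / d) + real n * (l * m n + l\<^sup>2 * trunc_moment 2 (1 / l)
         + exp (l * (\<epsilon> * M n)) * tail (1 / l)))"
      using truncated_sum_norm_bound[of l "\<epsilon> * M n" "\<delta> * M n" n] Mn \<epsilon> l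
      unfolding d_def m_def by simp
    also have "\<dots> \<le> 2 * d * exp (- (real k + 1) * lexc n)"
    proof -
      define T where "T = real n * exp (lexc n / 2) * tail (M n / (A * lexc n))"
      define U where "U = trunc_moment 2 (M n / (A * lexc n))"
      have "T \<ge> 0" by (simp add: T_def)
      then have T: "T \<le> lexc n * T"
        using l1 mult_right_mono[of 1 "lexc n" T] by simp
      have "real n * (l * m n + l\<^sup>2 * trunc_moment 2 (1 / l) + exp (l * (\<epsilon> * M n)) * tail (1 / l))
          = lexc n * (A * (real n * m n / M n)) + real n * l\<^sup>2 * U + T"
        unfolding ly l_inv T_def U_def by (simp add: l_def distrib_left mult_ac)
      also have "real n * l\<^sup>2 * U = lexc n * (real n * l\<^sup>2 * U / lexc n)"
        using l1 by simp
      finally have "real n * (l * m n + l\<^sup>2 * trunc_moment 2 (1 / l) + exp (l * (\<epsilon> * M n)) * tail (1 / l))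
          \<le> lexc n * X n"
        using T by (simp add: X_def T_def U_def l_def distrib_left)
      also have "\<dots> \<le> lexc n * 1" using elim l1 by (intro mult_left_mono) auto
      finally have 1: "real n * (l * m n + l\<^sup>2 * trunc_moment 2 (1 / l) + exp (l * (\<epsilon> * M n)) * tail (1 / l))
          \<le> lexc n" by simp
      have "l * (\<delta> * M n / d) = (A * \<delta> / d) * lexc n" using Mn by (simp add: l_def)
      also have "\<dots> \<ge> (real k + 2) * lexc n" using Ad l1 by (intro mult_right_mono) auto
      finally have "- l * (\<delta> * M n / d) \<le> - ((real k + 2) * lexc n)" by simp
      with 1 have "- l * (\<delta> * M n / d) + real n * (l * m n + l\<^sup>2 * trunc_moment 2 (1 / l)
          + exp (l * (\<epsilon> * M n)) * tail (1 / l)) \<le> - (real k + 1) * lexc n"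
        by (simp add: algebra_simps)
      then show ?thesis using d by simp
    qed
    also have "exp (- (real k + 1) * lexc n) = exp (- lexc n) ^ Suc k"
      by (subst exp_of_nat_mult[symmetric]) (simp add: algebra_simps)
    also have "\<dots> = exc n * exc n ^ k" using elim exp_lexc by simp
    finally show ?case using exc_pos[of n] elim by (simp add: divide_le_eq mult.assoc)
  qed
  moreover have "(\<lambda>n. 2 * d * exc n) \<longlonglongrightarrow> 0" using tendsto_mult_right_zero[OF exc_lim] .
  ultimately have "(\<lambda>n. prob {w \<in> space P.
    norm (\<Sum>j=1..n. if norm (Hs j w) \<le> \<epsilon> * M n then Hs j w else 0) > \<delta> * M n} / exc n ^ k) \<longlonglongrightarrow> 0"
    by (rule Lim_null_comparison)
  with \<epsilon> show ?thesis by blast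
qed

end

section \<open>Regular variation from vague convergence\<close>

lemma integral_scale_measure_nonneg:
  fixes f :: "'b \<Rightarrow> real"
  assumes "f \<in> borel_measurable N" "\<And>x. f x \<ge> 0" "r \<ge> 0"
  shows "integral\<^sup>L (scale_measure (ennreal r) N) f = r * integral\<^sup>L N f"
  using assms by (subst (1 2) integral_eq_nn_integral)
    (auto simp: nn_integral_scale_measure enn2real_mult)

lemma norm_compactify: "norm (compactify x) = norm x / (1 + norm x)"
  unfolding compactify_def by (simp add: add_nonneg_pos divide_inverse mult.commute)

lemma sgn_compactify: "sgn (compactify x) = sgn x"
  unfolding compactify_def using add_pos_nonneg[of 1 "norm x"] by (simp add: sgn_scaleR)

lemma continuous_on_compactify: "continuous_on S compactify"
  unfolding compactify_def[abs_def]
  by (intro continuous_intros) (auto simp: add_nonneg_eq_0_iff)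

lemma compactify_eq_0_iff [simp]: "compactify x = 0 \<longleftrightarrow> x = 0"
  unfolding compactify_def by (auto simp: add_nonneg_eq_0_iff)

lemma compactify_0 [simp]: "compactify 0 = 0"
  by simp

lemma compactify_measurable [measurable]: "compactify \<in> borel_measurable borel"
  by (rule borel_measurable_continuous_onI[OF continuous_on_compactify])

lemma compactify_in_cball: "compactify x \<in> cball 0 1"
  by (simp add: norm_compactify divide_le_eq_1 add_pos_nonneg)

lemma norm_compactify_le_iff:
  assumes "c > 0"
  shows "c / (1 + c) \<le> norm (compactify x) \<longleftrightarrow> c \<le> norm x"
proof -
  have "1 + norm x > 0" by (simp add: add_pos_nonneg)
  then show ?thesis using assms by (simp add: norm_compactify field_simps)
qed

locale vaguely_convergent_scalings = prob_space P for P :: "'w measure" +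
  fixes H :: "'w \<Rightarrow> 'a::euclidean_space" and \<mu> :: "'a measure" and a :: "nat \<Rightarrow> real" and \<alpha> :: real
  assumes H_rv [measurable]: "H \<in> borel_measurable P"
    and mu_radon: "radon_on (- {0}) \<mu>"
    and mu_nonnull: "emeasure \<mu> (space \<mu>) \<noteq> 0"
    and a_lim: "filterlim a at_top sequentially"
    and H_reg_var: "vague_conv_on punctured_compactification (scaled_law P H a) (extend_by_zero \<mu>)"
    and alpha_pos: "\<alpha> > 0"
    and mu_homogeneous: "\<And>c A. c > 0 \<Longrightarrow> A \<in> sets \<mu> \<Longrightarrow>
          emeasure \<mu> ((\<lambda>x. c *\<^sub>R x) ` A) = ennreal (c powr (- \<alpha>)) * emeasure \<mu> A"
begin

lemma sets_mu: "sets \<mu> = sets (restrict_space borel (- {0}))"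
  using mu_radon by (simp add: radon_on_def)

lemma space_mu: "space \<mu> = - {0}"
  using sets_eq_imp_space_eq[OF sets_mu] by (simp add: space_restrict_space)

lemma in_sets_mu: "A \<in> sets borel \<Longrightarrow> 0 \<notin> A \<Longrightarrow> A \<in> sets \<mu>"
  unfolding sets_mu by (subst sets_restrict_space_iff) auto

lemma measurable_mu:
  fixes f :: "'a \<Rightarrow> 'b::topological_space"
  shows "f \<in> borel_measurable borel \<Longrightarrow> f \<in> borel_measurable \<mu>"
  by (subst measurable_cong_sets[OF sets_mu refl]) (rule measurable_restrict_space1)

lemma compactify_measurable_mu:
  "compactify \<in> measurable \<mu> (restrict_space borel punctured_compactification)"
proof (rule measurable_restrict_space2)
  show "compactify \<in> borel_measurable \<mu>" by (rule measurable_mu) measurable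
  show "compactify \<in> space \<mu> \<rightarrow> punctured_compactification"
    using compactify_in_cball by (auto simp: space_mu)
qed

lemma compact_annulus: "c > 0 \<Longrightarrow> compact (cball 0 1 - ball (0::'a) c)"
  by (intro compact_diff) auto

text \<open>The exterior of a ball is not compact in the punctured space, so local finiteness of
  \<mu> there says nothing about it. In the compactification it lies in a compact annulus that
  includes the sphere at infinity.\<close>

lemma emeasure_outside_finite:
  assumes "c > 0"
  shows "emeasure \<mu> {x. norm x \<ge> c} < \<infinity>"
proof -
  define \<kappa> where "\<kappa> = c / (1 + c)"
  define K :: "'a set" where "K = cball 0 1 - ball 0 \<kappa>"
  have \<kappa>: "\<kappa> > 0" using assms by (simp add: \<kappa>_def)
  have K: "compact K" "K \<subseteq> punctured_compactification"
    using compact_annulus[OF \<kappa>] \<kappa> by (auto simp: K_def)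
  then have "emeasure (extend_by_zero \<mu>) K < \<infinity>"
    using H_reg_var by (auto simp: vague_conv_on_def radon_on_def)
  moreover have "emeasure (extend_by_zero \<mu>) K = emeasure \<mu> (compactify -` K \<inter> space \<mu>)"
    unfolding extend_by_zero_def
  proof (rule emeasure_distr[OF compactify_measurable_mu])
    show "K \<in> sets (restrict_space borel punctured_compactification)"
      using K compact_imp_closed[OF K(1)] by (subst sets_restrict_space_iff) auto
  qed
  moreover have "compactify -` K \<inter> space \<mu> = {x. norm x \<ge> c}"
  proof -
    have "\<kappa> \<le> norm (compactify x) \<longleftrightarrow> c \<le> norm x" for x :: 'a
      using norm_compactify_le_iff[OF assms] by (simp add: \<kappa>_def)
    then show ?thesis
      using assms compactify_in_cball by (auto simp: K_def space_mu not_less)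
  qed
  ultimately show ?thesis by simp
qed

lemma emeasure_outside_finite':
  assumes "c > 0" "A \<subseteq> {x. norm x \<ge> c}"
  shows "emeasure \<mu> A < \<infinity>"
proof -
  have "emeasure \<mu> A \<le> emeasure \<mu> {x. norm x \<ge> c}"
    using assms by (intro emeasure_mono in_sets_mu) auto
  with emeasure_outside_finite[OF assms(1)] show ?thesis by (rule order_le_less_trans[rotated])
qed

lemma emeasure_outside_open_finite:
  "c > 0 \<Longrightarrow> emeasure \<mu> {x. norm x > c} < \<infinity>"
  by (rule emeasure_outside_finite') auto

lemma test_function_convergence:
  fixes \<phi> :: "'a \<Rightarrow> real"
  assumes cont: "continuous_on (- {0}) \<phi>" and meas [measurable]: "\<phi> \<in> borel_measurable borel"
    and nn: "\<And>y. \<phi> y \<ge> 0" and c: "c > 0" and zero: "\<And>y. norm y < c \<Longrightarrow> \<phi> y = 0"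
  shows "(\<lambda>n. real n * expectation (\<lambda>w. \<phi> (compactify (H w /\<^sub>R a n)))) \<longlonglongrightarrow> (\<integral>x. \<phi> (compactify x) \<partial>\<mu>)"
proof -
  let ?S = "punctured_compactification :: 'a set"
  have S [measurable]: "?S \<in> sets borel" by (intro sets.Diff) auto
  have "\<exists>K. compact K \<and> K \<subseteq> ?S \<and> (\<forall>x\<in>?S - K. \<phi> x = 0)"
    using compact_annulus[OF c] c zero by (intro exI[of _ "cball 0 1 - ball 0 c"]) auto
  moreover have "continuous_on ?S \<phi>" using cont by (rule continuous_on_subset) auto
  ultimately have "(\<lambda>n. \<integral>x. \<phi> x \<partial>scaled_law P H a n) \<longlonglongrightarrow> (\<integral>x. \<phi> x \<partial>extend_by_zero \<mu>)"
    using H_reg_var by (auto simp: vague_conv_on_def)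
  moreover have "(\<integral>x. \<phi> x \<partial>extend_by_zero \<mu>) = (\<integral>x. \<phi> (compactify x) \<partial>\<mu>)"
    unfolding extend_by_zero_def
    by (rule integral_distr[OF compactify_measurable_mu]) (simp add: measurable_restrict_space1)
  moreover have "(\<integral>x. \<phi> x \<partial>scaled_law P H a n) = real n * expectation (\<lambda>w. \<phi> (compactify (H w /\<^sub>R a
      n)))" for n
  proof -
    let ?D = "distr P borel (\<lambda>w. compactify (H w /\<^sub>R a n))"
    have "(\<integral>x. \<phi> x \<partial>scaled_law P H a n)
        = (\<integral>x. indicator ?S x *\<^sub>R \<phi> x \<partial>scale_measure (ennreal (real n)) ?D)"
      unfolding scaled_law_def ennreal_of_nat_eq_real_of_nat by (rule integral_restrict_space) auto
    also have "\<dots> = real n * (\<integral>x. indicator ?S x *\<^sub>R \<phi> x \<partial>?D)"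
      using nn by (intro integral_scale_measure_nonneg) auto
    also have "(\<integral>x. indicator ?S x *\<^sub>R \<phi> x \<partial>?D)
        = expectation (\<lambda>w. indicator ?S (compactify (H w /\<^sub>R a n)) *\<^sub>R \<phi> (compactify (H w /\<^sub>R a n)))"
      by (rule integral_distr) auto
    also have "\<dots> = expectation (\<lambda>w. \<phi> (compactify (H w /\<^sub>R a n)))"
      using compactify_in_cball zero[of 0] c
      by (intro Bochner_Integration.integral_cong) (auto simp: indicator_def)
    finally show ?thesis .
  qed
  ultimately show ?thesis by simp
qed

text \<open>The portmanteau upper bound for a closed cone truncated away from the origin, through
  continuous majorants whose limit is the indicator. Nonemptiness matters because
  \<open>infdist\<close> to the empty set is 0.\<close>

lemma limsup_cone_tail:
  assumes c: "c > 0" and F: "closed F" "F \<noteq> {}" and e: "e > 0"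
  shows "eventually (\<lambda>n. real n * prob {w \<in> space P. norm (H w) \<ge> c * a n \<and> sgn (H w) \<in> F}
      < measure \<mu> {x. norm x \<ge> c \<and> sgn x \<in> F} + e) sequentially"
proof -
  define \<kappa> where "\<kappa> = c / (1 + c)"
  have \<kappa>: "\<kappa> > 0" "\<kappa> < 1" using c by (auto simp: \<kappa>_def)
  \<comment> \<open>The slope \<open>2 / \<kappa>\<close> already present at \<open>m = 0\<close>
    makes all majorants vanish on the ball of radius \<open>\<kappa> / 2\<close>, so they share one
    compact support and one integrable dominating function.\<close>
  define \<phi> where "\<phi> = (\<lambda>m y::'a. max 0 (1 - (2 / \<kappa> + real m) * max 0 (\<kappa> - norm y)) *
    max 0 (1 - real m * infdist (sgn y) F))"
  have [measurable]: "(\<lambda>y::'a. infdist (sgn y) F) \<in> borel_measurable borel"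
    by (rule measurable_compose[OF borel_measurable_sgn borel_measurable_continuous_onI])
      (intro continuous_intros)
  have meas [measurable]: "\<phi> m \<in> borel_measurable borel" for m
    unfolding \<phi>_def by measurable
  have nn: "\<phi> m y \<ge> 0" for m y unfolding \<phi>_def by simp
  have le1: "\<phi> m y \<le> 1" for m y
    unfolding \<phi>_def using \<kappa> infdist_nonneg[of "sgn y" F] by (intro mult_le_one) auto
  have zero: "\<phi> m y = 0" if "norm y < \<kappa> / 2" for m y
  proof -
    have "(2 / \<kappa>) * (\<kappa> / 2) \<le> (2 / \<kappa> + real m) * max 0 (\<kappa> - norm y)"
      using that \<kappa> by (intro mult_mono) auto
    then show ?thesis using \<kappa> by (simp add: \<phi>_def)
  qed
  have one: "\<phi> m (compactify x) = 1" if "norm x \<ge> c" "sgn x \<in> F" for m x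
    using that norm_compactify_le_iff[OF c, of x] by (simp add: \<phi>_def sgn_compactify \<kappa>_def)
  have cont: "continuous_on (- {0}) (\<phi> m)" for m
    unfolding \<phi>_def by (intro continuous_intros continuous_on_sgn) auto
  let ?A = "{x. norm x \<ge> c \<and> sgn x \<in> F}"
  \<comment> \<open>The radius that \<open>compactify\<close> maps to
    \<open>\<kappa> / 2\<close>.\<close>
  define d where "d = (\<kappa> / 2) / (1 - \<kappa> / 2)"
  have d: "d > 0" "d / (1 + d) = \<kappa> / 2"
    using \<kappa> by (auto simp: d_def divide_simps)
  have Fm [measurable]: "F \<in> sets borel" using F by simp
  have A: "?A \<in> sets \<mu>" using c by (intro in_sets_mu) auto
  have "(\<lambda>m. \<integral>x. \<phi> m (compactify x) \<partial>\<mu>) \<longlonglongrightarrow> (\<integral>x. indicator ?A x \<partial>\<mu>)"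
  proof (rule integral_dominated_convergence[where w = "indicator {x. norm x \<ge> d}"])
    show "indicator ?A \<in> borel_measurable \<mu>" using A by simp
    show "(\<lambda>x. \<phi> m (compactify x)) \<in> borel_measurable \<mu>" for m
      by (rule measurable_mu) measurable
    show "integrable \<mu> (indicator {x. norm x \<ge> d} :: 'a \<Rightarrow> real)"
      using emeasure_outside_finite[OF d(1)] d by (intro integrable_real_indicator in_sets_mu) auto
    show "AE x in \<mu>. norm (\<phi> m (compactify x)) \<le> indicator {x. norm x \<ge> d} x" for m
    proof (rule AE_I2)
      fix x
      show "norm (\<phi> m (compactify x)) \<le> indicator {x. norm x \<ge> d} x"
      proof (cases "norm x \<ge> d")
        case False
        then have "norm (compactify x) < \<kappa> / 2"
          using norm_compactify_le_iff[OF d(1), of x] d by simp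
        then show ?thesis by (simp add: zero)
      qed (use nn le1 in auto)
    qed
    show "AE x in \<mu>. (\<lambda>m. \<phi> m (compactify x)) \<longlonglongrightarrow> indicator ?A x"
    proof (rule AE_I2)
      fix x
      consider "x \<in> ?A" | "norm x < c" | "sgn x \<notin> F" by force
      then show "(\<lambda>m. \<phi> m (compactify x)) \<longlonglongrightarrow> indicator ?A x"
      proof cases
        case 1
        then show ?thesis by (simp add: one)
      next
        case 2
        define u where "u = \<kappa> - norm (compactify x)"
        have u: "u > 0" using 2 norm_compactify_le_iff[OF c, of x] by (simp add: u_def \<kappa>_def)
        obtain m0 where m0: "1 / u < real m0" using reals_Archimedean2 by blast
        have "\<phi> m (compactify x) = 0" if "m \<ge> m0" for m
        proof -
          have "1 \<le> real m0 * u" using m0 u by (simp add: field_simps)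
          also have "\<dots> \<le> (2 / \<kappa> + real m) * u" using that u \<kappa> by (intro mult_right_mono) (auto
              intro: add_increasing)
          finally show ?thesis using u by (simp add: \<phi>_def u_def[symmetric])
        qed
        then have "eventually (\<lambda>m. \<phi> m (compactify x) = indicator ?A x) sequentially"
          using 2 by (auto simp: eventually_sequentially)
        then show ?thesis by (rule tendsto_eventually)
      next
        case 3
        define u where "u = infdist (sgn x) F"
        have u: "u > 0" using 3 F infdist_pos_not_in_closed[of F "sgn x"] by (simp add: u_def)
        obtain m0 where m0: "1 / u < real m0" using reals_Archimedean2 by blast
        have "\<phi> m (compactify x) = 0" if "m \<ge> m0" for m
        proof -
          have "1 \<le> real m0 * u" using m0 u by (simp add: field_simps)
          also have "\<dots> \<le> real m * u" using that u by (intro mult_right_mono) auto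
          finally show ?thesis using u by (simp add: \<phi>_def u_def[symmetric] sgn_compactify)
        qed
        then have "eventually (\<lambda>m. \<phi> m (compactify x) = indicator ?A x) sequentially"
          using 3 by (auto simp: eventually_sequentially)
        then show ?thesis by (rule tendsto_eventually)
      qed
    qed
  qed
  then have "(\<lambda>m. \<integral>x. \<phi> m (compactify x) \<partial>\<mu>) \<longlonglongrightarrow> measure \<mu> ?A"
    using A sets.sets_into_space[OF A] by (simp add: Int_absorb2)
  then have "eventually (\<lambda>m. (\<integral>x. \<phi> m (compactify x) \<partial>\<mu>) < measure \<mu> ?A + e) sequentially"
    by (rule order_tendstoD) (use e in simp)
  then obtain m where m: "(\<integral>x. \<phi> m (compactify x) \<partial>\<mu>) < measure \<mu> ?A + e"
    by (auto simp: eventually_sequentially)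
  have "(\<lambda>n. real n * expectation (\<lambda>w. \<phi> m (compactify (H w /\<^sub>R a n)))) \<longlonglongrightarrow> (\<integral>x. \<phi> m (compactify x) \<partial>\<mu>)"
    using \<kappa> by (intro test_function_convergence[where c = "\<kappa> / 2"] cont meas nn zero) auto
  then have "eventually (\<lambda>n. real n * expectation (\<lambda>w. \<phi> m (compactify (H w /\<^sub>R a n)))
      < measure \<mu> ?A + e) sequentially"
    by (rule order_tendstoD) (rule m)
  moreover have "eventually (\<lambda>n. a n > 0) sequentially"
    using filterlim_at_top_dense[THEN iffD1, OF a_lim] by blast
  ultimately show ?thesis
  proof eventually_elim
    case (elim n)
    have "prob {w \<in> space P. norm (H w) \<ge> c * a n \<and> sgn (H w) \<in> F}
        = expectation (indicator {w \<in> space P. norm (H w) \<ge> c * a n \<and> sgn (H w) \<in> F})"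
      by simp
    also have "\<dots> \<le> expectation (\<lambda>w. \<phi> m (compactify (H w /\<^sub>R a n)))"
    proof (rule integral_mono)
      show "integrable P (indicat_real {w \<in> space P. norm (H w) \<ge> c * a n \<and> sgn (H w) \<in> F})"
        by (intro integrable_real_indicator) (measurable, simp add: emeasure_eq_measure)
      show "integrable P (\<lambda>w. \<phi> m (compactify (H w /\<^sub>R a n)))"
        using nn le1 by (intro integrable_const_bound[where B = 1]) auto
      fix w
      show "indicat_real {w \<in> space P. norm (H w) \<ge> c * a n \<and> sgn (H w) \<in> F} w
          \<le> \<phi> m (compactify (H w /\<^sub>R a n))"
      proof (cases "norm (H w) \<ge> c * a n \<and> sgn (H w) \<in> F")
        case True
        then have "\<phi> m (compactify (H w /\<^sub>R a n)) = 1"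
          using elim by (intro one) (auto simp: sgn_scaleR field_simps)
        then show ?thesis by (simp add: indicator_def)
      qed (use nn in auto)
    qed
    finally have "real n * prob {w \<in> space P. norm (H w) \<ge> c * a n \<and> sgn (H w) \<in> F}
        \<le> real n * expectation (\<lambda>w. \<phi> m (compactify (H w /\<^sub>R a n)))"
      by (intro mult_left_mono) auto
    with elim show ?case by linarith
  qed
qed

text \<open>The dual bound, by continuous minorants of an open exterior. Exteriors of balls suffice
  from below, since this bound is used to identify the tail of the norm.\<close>

lemma liminf_ball_tail:
  assumes c: "c > 0" and e: "e > 0"
  shows "eventually (\<lambda>n. real n * prob {w \<in> space P. norm (H w) > c * a n}
      > measure \<mu> {x. norm x > c} - e) sequentially"
proof -
  define \<kappa> where "\<kappa> = c / (1 + c)"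
  have \<kappa>: "\<kappa> > 0" "\<kappa> < 1" using c by (auto simp: \<kappa>_def)
  define \<phi> where "\<phi> = (\<lambda>m y::'a. min 1 (real m * max 0 (norm y - \<kappa>)))"
  have meas [measurable]: "\<phi> m \<in> borel_measurable borel" for m
    unfolding \<phi>_def by measurable
  have nn: "\<phi> m y \<ge> 0" for m y unfolding \<phi>_def by simp
  have le1: "\<phi> m y \<le> 1" for m y unfolding \<phi>_def by simp
  have zero: "\<phi> m y = 0" if "norm y \<le> \<kappa>" for m y
    using that by (simp add: \<phi>_def)
  have zero': "\<phi> m (compactify x) = 0" if "norm x \<le> c" for m x
  proof (rule zero)
    have "1 + norm x > 0" by (simp add: add_pos_nonneg)
    then show "norm (compactify x) \<le> \<kappa>"
      using that c by (simp add: norm_compactify \<kappa>_def field_simps)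
  qed
  have cont: "continuous_on (- {0}) (\<phi> m)" for m
    unfolding \<phi>_def by (intro continuous_intros)
  let ?A = "{x::'a. norm x > c}"
  have A: "?A \<in> sets \<mu>" using c by (intro in_sets_mu) auto
  have "(\<lambda>m. \<integral>x. \<phi> m (compactify x) \<partial>\<mu>) \<longlonglongrightarrow> (\<integral>x. indicator ?A x \<partial>\<mu>)"
  proof (rule integral_dominated_convergence[where w = "indicator ?A"])
    show "indicator ?A \<in> borel_measurable \<mu>" using A by simp
    show "(\<lambda>x. \<phi> m (compactify x)) \<in> borel_measurable \<mu>" for m
      by (rule measurable_mu) measurable
    show "integrable \<mu> (indicator ?A :: 'a \<Rightarrow> real)"
      using emeasure_outside_open_finite[OF c] A by (intro integrable_real_indicator) auto
    show "AE x in \<mu>. norm (\<phi> m (compactify x)) \<le> indicator ?A x" for m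
      using nn le1 zero' by (intro AE_I2) (auto simp: indicator_def not_less)
    show "AE x in \<mu>. (\<lambda>m. \<phi> m (compactify x)) \<longlonglongrightarrow> indicator ?A x"
    proof (rule AE_I2)
      fix x
      show "(\<lambda>m. \<phi> m (compactify x)) \<longlonglongrightarrow> indicator ?A x"
      proof (cases "norm x > c")
        case True
        define u where "u = norm (compactify x) - \<kappa>"
        have "1 + norm x > 0" by (simp add: add_pos_nonneg)
        then have "\<kappa> < norm (compactify x)" using True c by (simp add: norm_compactify \<kappa>_def field_simps)
        then have u: "u > 0" by (simp add: u_def)
        obtain m0 where m0: "1 / u < real m0" using reals_Archimedean2 by blast
        have "\<phi> m (compactify x) = 1" if "m \<ge> m0" for m
        proof -
          have "1 \<le> real m0 * u" using m0 u by (simp add: field_simps)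
          also have "\<dots> \<le> real m * u" using that u by (intro mult_right_mono) auto
          finally show ?thesis using u by (simp add: \<phi>_def u_def[symmetric])
        qed
        then have "eventually (\<lambda>m. \<phi> m (compactify x) = indicator ?A x) sequentially"
          using True by (auto simp: eventually_sequentially)
        then show ?thesis by (rule tendsto_eventually)
      qed (simp add: zero' not_less)
    qed
  qed
  then have "(\<lambda>m. \<integral>x. \<phi> m (compactify x) \<partial>\<mu>) \<longlonglongrightarrow> measure \<mu> ?A"
    using A sets.sets_into_space[OF A] by (simp add: Int_absorb2)
  then have "eventually (\<lambda>m. (\<integral>x. \<phi> m (compactify x) \<partial>\<mu>) > measure \<mu> ?A - e) sequentially"
    by (rule order_tendstoD) (use e in simp)
  then obtain m where m: "(\<integral>x. \<phi> m (compactify x) \<partial>\<mu>) > measure \<mu> ?A - e"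
    by (auto simp: eventually_sequentially)
  have "(\<lambda>n. real n * expectation (\<lambda>w. \<phi> m (compactify (H w /\<^sub>R a n)))) \<longlonglongrightarrow> (\<integral>x. \<phi> m (compactify x) \<partial>\<mu>)"
    using \<kappa> by (intro test_function_convergence[where c = "\<kappa>"] cont meas nn zero) auto
  then have "eventually (\<lambda>n. real n * expectation (\<lambda>w. \<phi> m (compactify (H w /\<^sub>R a n)))
      > measure \<mu> ?A - e) sequentially"
    by (rule order_tendstoD) (rule m)
  moreover have "eventually (\<lambda>n. a n > 0) sequentially"
    using filterlim_at_top_dense[THEN iffD1, OF a_lim] by blast
  ultimately show ?thesis
  proof eventually_elim
    case (elim n)
    have "expectation (\<lambda>w. \<phi> m (compactify (H w /\<^sub>R a n)))
      \<le> expectation (indicator {w \<in> space P. norm (H w) > c * a n})"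
    proof (rule integral_mono)
      show "integrable P (indicat_real {w \<in> space P. norm (H w) > c * a n})"
        by (intro integrable_real_indicator) (measurable, simp add: emeasure_eq_measure)
      show "integrable P (\<lambda>w. \<phi> m (compactify (H w /\<^sub>R a n)))"
        using nn le1 by (intro integrable_const_bound[where B = 1]) auto
      fix w assume w: "w \<in> space P"
      show "\<phi> m (compactify (H w /\<^sub>R a n)) \<le> indicat_real {w \<in> space P. norm (H w) > c * a n} w"
      proof (cases "norm (H w) > c * a n")
        case False
        then have "\<phi> m (compactify (H w /\<^sub>R a n)) = 0"
          using elim by (intro zero') (auto simp: field_simps)
        then show ?thesis by simp
      qed (use w le1 in auto)
    qed
    also have "\<dots> = prob {w \<in> space P. norm (H w) > c * a n}" by simp
    finally have "real n * expectation (\<lambda>w. \<phi> m (compactify (H w /\<^sub>R a n)))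
        \<le> real n * prob {w \<in> space P. norm (H w) > c * a n}"
      by (intro mult_left_mono) auto
    with elim show ?case by linarith
  qed
qed

section \<open>Homogeneity of the limit measure and passage from the scales \<open>a n\<close> to
  all large levels\<close>

definition total_mass :: real where
  "total_mass = measure \<mu> {x. norm x > 1}"

lemma measure_scale:
  assumes c: "c > 0" and A: "A \<in> sets borel" "0 \<notin> A"
  shows "measure \<mu> ((\<lambda>x. c *\<^sub>R x) ` A) = c powr (- \<alpha>) * measure \<mu> A"
  using mu_homogeneous[OF c in_sets_mu[OF A]] by (simp add: measure_def enn2real_mult)

lemma measure_outside_open:
  assumes c: "c > 0"
  shows "measure \<mu> {x. norm x > c} = c powr (- \<alpha>) * total_mass"
proof -
  have "(\<lambda>x. c *\<^sub>R x) ` {x::'a. norm x > 1} = {x. norm x > c}"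
  proof (intro equalityI subsetI)
    fix x :: 'a assume "x \<in> {x. norm x > c}"
    then have "x = c *\<^sub>R (x /\<^sub>R c)" "norm (x /\<^sub>R c) > 1" using c by (auto simp: field_simps)
    then show "x \<in> (\<lambda>x. c *\<^sub>R x) ` {x::'a. norm x > 1}" by blast
  qed (use c in auto)
  with measure_scale[OF c, of "{x. norm x > 1}"] show ?thesis by (simp add: total_mass_def)
qed

text \<open>Homogeneity lets the mass of the exterior of radius \<open>c\<close> tend to
  \<open>total_mass\<close> as \<open>c\<close> increases to 1, so the unit sphere carries no
  mass.\<close>

lemma measure_outside_closed:
  "measure \<mu> {x. norm x \<ge> 1} = total_mass"
proof (rule antisym)
  have "eventually (\<lambda>c. measure \<mu> {x. norm x \<ge> 1} \<le> c powr (- \<alpha>) * total_mass) (at_left (1::real))"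
    unfolding eventually_at_left_field
  proof (intro exI[of _ "1/2"] conjI allI impI)
    fix c :: real assume c: "c > 1/2" "c < 1"
    have "measure \<mu> {x. norm x \<ge> 1} \<le> measure \<mu> {x. norm x > c}"
    proof (rule measure_mono_fmeasurable)
      show "{x::'a. norm x > c} \<in> fmeasurable \<mu>"
        using c emeasure_outside_open_finite[of c] by (intro fmeasurableI in_sets_mu) auto
    qed (use c in \<open>auto intro!: in_sets_mu\<close>)
    then show "measure \<mu> {x. norm x \<ge> 1} \<le> c powr (- \<alpha>) * total_mass"
      using measure_outside_open[of c] c by simp
  qed simp
  moreover have "((\<lambda>c. c powr (- \<alpha>) * total_mass) \<longlongrightarrow> 1 powr (- \<alpha>) * total_mass) (at_left 1)"
    by (intro tendsto_intros) auto
  ultimately show "measure \<mu> {x. norm x \<ge> 1} \<le> total_mass"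
    by (intro tendsto_lowerbound[of "\<lambda>c. c powr (- \<alpha>) * total_mass" total_mass "at_left (1::real)"]) auto
  show "total_mass \<le> measure \<mu> {x. norm x \<ge> 1}"
    unfolding total_mass_def
  proof (rule measure_mono_fmeasurable)
    show "{x::'a. norm x \<ge> 1} \<in> fmeasurable \<mu>"
      using emeasure_outside_finite[of 1] by (intro fmeasurableI in_sets_mu) auto
  qed (auto intro!: in_sets_mu)
qed

text \<open>Otherwise scaling would make the exterior of every ball null, and countably many of
  these exhaust the punctured space.\<close>

lemma total_mass_pos: "total_mass > 0"
proof (rule ccontr)
  assume "\<not> total_mass > 0"
  then have t0: "total_mass = 0" unfolding total_mass_def by (simp add: not_less measure_le_0_iff)
  have "emeasure \<mu> {x. norm x > 1 / real (Suc n)} = 0" for n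
  proof -
    have "emeasure \<mu> {x. norm x > 1 / real (Suc n)} < \<infinity>"
      by (rule emeasure_outside_open_finite) simp
    moreover have "measure \<mu> {x. norm x > 1 / real (Suc n)} = 0"
      using measure_outside_open[of "1 / real (Suc n)"] t0 by simp
    ultimately show ?thesis by (auto simp: measure_def enn2real_eq_0_iff)
  qed
  then have "emeasure \<mu> (\<Union>n. {x. norm x > 1 / real (Suc n)}) = 0"
    by (intro emeasure_UN_eq_0) (auto intro!: in_sets_mu)
  moreover have "(\<Union>n. {x::'a. norm x > 1 / real (Suc n)}) = space \<mu>"
  proof -
    have "\<exists>n. norm x > 1 / real (Suc n)" if "x \<noteq> 0" for x :: 'a
      using that reals_Archimedean[of "norm x"] by (auto simp: inverse_eq_divide)
    moreover have "\<not> norm (0::'a) > 1 / real (Suc n)" for n by simp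
    ultimately show ?thesis unfolding space_mu by blast
  qed
  ultimately show False using mu_nonnull by simp
qed

text \<open>The lower bound for the open exterior and the upper bound for the closed one meet,
  because spheres are null. With the whole sphere as set of directions, the cone condition merely
  excludes the origin.\<close>

lemma tail_at_scale:
  assumes c: "c > 0"
  shows "(\<lambda>n. real n * prob {w \<in> space P. norm (H w) > c * a n}) \<longlonglongrightarrow> c powr (- \<alpha>) * total_mass"
proof (rule order_tendstoI)
  fix y assume "y < c powr (- \<alpha>) * total_mass"
  then show "eventually (\<lambda>n. real n * prob {w \<in> space P. norm (H w) > c * a n} > y) sequentially"
    using liminf_ball_tail[OF c, of "c powr (- \<alpha>) * total_mass - y"] by (simp add: measure_outside_open[OF c])
next
  fix y assume y: "c powr (- \<alpha>) * total_mass < y"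
  have closed_eq: "measure \<mu> {x. norm x \<ge> c \<and> sgn x \<in> sphere 0 1} = c powr (- \<alpha>) * total_mass"
  proof -
    have "(\<lambda>x. c *\<^sub>R x) ` {x::'a. norm x \<ge> 1} = {x. norm x \<ge> c \<and> sgn x \<in> sphere 0 1}"
    proof (intro equalityI subsetI)
      fix x :: 'a assume "x \<in> {x. norm x \<ge> c \<and> sgn x \<in> sphere 0 1}"
      then have "x = c *\<^sub>R (x /\<^sub>R c)" "norm (x /\<^sub>R c) \<ge> 1" using c by (auto simp: field_simps)
      then show "x \<in> (\<lambda>x. c *\<^sub>R x) ` {x::'a. norm x \<ge> 1}" by blast
    qed (use c in \<open>auto simp: norm_sgn\<close>)
    with measure_scale[OF c, of "{x. norm x \<ge> 1}"] show ?thesis by (simp add: measure_outside_closed)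
  qed
  have "eventually (\<lambda>n. real n * prob {w \<in> space P. norm (H w) \<ge> c * a n \<and> sgn (H w) \<in> sphere 0 1} <
      y) sequentially"
  proof -
    have "(sphere 0 1 :: 'a set) \<noteq> {}" by simp
    from limsup_cone_tail[OF c closed_sphere this, of "y - c powr (- \<alpha>) * total_mass"] y show ?thesis
      unfolding closed_eq by simp
  qed
  moreover have "eventually (\<lambda>n. a n > 0) sequentially"
    using filterlim_at_top_dense[THEN iffD1, OF a_lim] by blast
  ultimately show "eventually (\<lambda>n. real n * prob {w \<in> space P. norm (H w) > c * a n} < y) sequentially"
  proof eventually_elim
    case (elim n)
    have [measurable]: "sphere (0::'a) 1 \<in> sets borel" by (rule borel_closed) simp
    have "prob {w \<in> space P. norm (H w) > c * a n}
        \<le> prob {w \<in> space P. norm (H w) \<ge> c * a n \<and> sgn (H w) \<in> sphere 0 1}"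
    proof (rule finite_measure_mono)
      show "{w \<in> space P. norm (H w) > c * a n} \<subseteq> {w \<in> space P. norm (H w) \<ge> c * a n \<and> sgn (H w) \<in>
          sphere 0 1}"
      proof
        fix w assume w: "w \<in> {w \<in> space P. norm (H w) > c * a n}"
        have "c * a n > 0" using c elim by simp
        then have "H w \<noteq> 0" using w by auto
        then show "w \<in> {w \<in> space P. norm (H w) \<ge> c * a n \<and> sgn (H w) \<in> sphere 0 1}"
          using w by (simp add: norm_sgn)
      qed
    qed measurable
    then have "real n * prob {w \<in> space P. norm (H w) > c * a n}
      \<le> real n * prob {w \<in> space P. norm (H w) \<ge> c * a n \<and> sgn (H w) \<in> sphere 0 1}"
      by (intro mult_left_mono) auto
    with elim show ?case by linarith
  qed
qed

text \<open>The index \<open>n\<close> with \<open>a n \<le> t < a (Suc n)\<close> transfers statements along \<open>a\<close> to all large \<open>t\<close>.\<close>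

definition index_of :: "real \<Rightarrow> nat" where
  "index_of t = (LEAST n. a (Suc n) > t)"

lemma less_index_of: "t < a (Suc (index_of t))"
proof -
  have "eventually (\<lambda>n. a n > t) sequentially"
    using filterlim_at_top_dense[THEN iffD1, OF a_lim] by blast
  then obtain n where "a (Suc n) > t"
    by (auto simp: eventually_sequentially intro: le_SucI)
  then show ?thesis unfolding index_of_def by (rule LeastI)
qed

text \<open>Minimality gives information about the preceding index, so nothing can be said when the
  index is 0. Monotonicity of \<open>a\<close> is not assumed.\<close>

lemma index_of_le: "index_of t > 0 \<Longrightarrow> a (index_of t) \<le> t"
  using not_less_Least[of "index_of t - 1" "\<lambda>n. a (Suc n) > t"] unfolding index_of_def
  by (cases "LEAST n. t < a (Suc n)") auto

lemma index_of_at_top: "filterlim index_of at_top at_top"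
  unfolding filterlim_at_top
proof
  fix K
  show "eventually (\<lambda>t. index_of t \<ge> K) at_top"
  proof -
    have "index_of t \<ge> K" if "t \<ge> Max (a ` {..K})" for t
    proof (rule ccontr)
      assume "\<not> index_of t \<ge> K"
      then have "a (Suc (index_of t)) \<le> Max (a ` {..K})" by (intro Max_ge) auto
      with that less_index_of[of t] show False by linarith
    qed
    then show ?thesis unfolding eventually_at_top_linorder by blast
  qed
qed

text \<open>Monotonicity of the tail sandwiches \<open>t\<close> between two consecutive scales; the
  mismatch between \<open>n\<close> and \<open>Suc n\<close> disappears since their ratio tends to
  1.\<close>

lemma tail_at_index:
  assumes c: "c > 0"
  shows "((\<lambda>t. real (index_of t) * prob {w \<in> space P. norm (H w) > c * t}) \<longlongrightarrow> c powr (- \<alpha>) *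
      total_mass) at_top"
proof -
  let ?p = "\<lambda>t. prob {w \<in> space P. norm (H w) > t}"
  have mono: "?p t \<le> ?p s" if "s \<le> t" for s t
    using that by (intro finite_measure_mono) auto
  show ?thesis
  proof (rule tendsto_sandwich)
    have "(\<lambda>n. real n / real (Suc n) * (real (Suc n) * ?p (c * a (Suc n)))) \<longlonglongrightarrow> 1 * (c powr (- \<alpha>) * total_mass)"
      by (intro tendsto_mult LIMSEQ_n_over_Suc_n LIMSEQ_Suc[OF tail_at_scale[OF c]])
    then have "(\<lambda>n. real n * ?p (c * a (Suc n))) \<longlonglongrightarrow> c powr (- \<alpha>) * total_mass"
      by (simp add: field_simps del: of_nat_Suc)
    then show "((\<lambda>t. real (index_of t) * ?p (c * a (Suc (index_of t)))) \<longlongrightarrow> c powr (- \<alpha>) * total_mass) at_top"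
      by (rule filterlim_compose[OF _ index_of_at_top])
    show "((\<lambda>t. real (index_of t) * ?p (c * a (index_of t))) \<longlongrightarrow> c powr (- \<alpha>) * total_mass) at_top"
      by (rule filterlim_compose[OF tail_at_scale[OF c] index_of_at_top])
    show "eventually (\<lambda>t. real (index_of t) * ?p (c * a (Suc (index_of t))) \<le> real (index_of t) * ?p
        (c * t)) at_top"
      using c less_index_of by (intro always_eventually allI mult_left_mono mono) (auto simp: less_imp_le)
    have "eventually (\<lambda>t. index_of t \<ge> 1) at_top"
      using filterlim_at_top[THEN iffD1, OF index_of_at_top] by blast
    then show "eventually (\<lambda>t. real (index_of t) * ?p (c * t) \<le> real (index_of t) * ?p (c * a
        (index_of t))) at_top"
      by eventually_elim (use c index_of_le in \<open>auto intro!: mult_left_mono mono\<close>)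
  qed
qed

lemma tail_pos: "prob {w \<in> space P. norm (H w) > t} > 0"
proof -
  have "eventually (\<lambda>t. real (index_of t) * prob {w \<in> space P. norm (H w) > 1 * t} > 0) at_top"
    using total_mass_pos by (intro order_tendstoD[OF tail_at_index[of 1]]) auto
  then obtain T where T: "\<And>t. t \<ge> T \<Longrightarrow> real (index_of t) * prob {w \<in> space P. norm (H w) > t} > 0"
    by (auto simp: eventually_at_top_linorder)
  have "prob {w \<in> space P. norm (H w) > max t T} > 0"
    using T[of "max t T"] by (simp add: zero_less_mult_iff)
  also have "prob {w \<in> space P. norm (H w) > max t T} \<le> prob {w \<in> space P. norm (H w) > t}"
    by (intro finite_measure_mono) auto
  finally show ?thesis .
qed

lemma regularly_varying: "regularly_varying_vector P H \<alpha>"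
proof
  let ?p = "\<lambda>t. prob {w \<in> space P. norm (H w) > t}"
  show "H \<in> borel_measurable P" by (rule H_rv)
  show "?p t \<le> ?p s" if "s \<le> t" for s t
    using that by (intro finite_measure_mono) auto
  show "?p t > 0" for t by (rule tail_pos)
  show "\<alpha> > 0" by (rule alpha_pos)
  fix c :: real assume c: "c > 0"
  have "((\<lambda>t. (real (index_of t) * ?p (c * t)) / (real (index_of t) * ?p (1 * t)))
      \<longlongrightarrow> (c powr (- \<alpha>) * total_mass) / (1 powr (- \<alpha>) * total_mass)) at_top"
    using c total_mass_pos by (intro tendsto_divide tail_at_index) auto
  then have lim: "((\<lambda>t. (real (index_of t) * ?p (c * t)) / (real (index_of t) * ?p t))
      \<longlongrightarrow> c powr (- \<alpha>)) at_top"
    using total_mass_pos by simp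
  have "eventually (\<lambda>t. index_of t \<ge> 1) at_top"
    using filterlim_at_top[THEN iffD1, OF index_of_at_top] by blast
  then have "eventually (\<lambda>t. (real (index_of t) * ?p (c * t)) / (real (index_of t) * ?p t)
      = ?p (c * t) / ?p t) at_top"
    by eventually_elim simp
  with lim show "((\<lambda>t. ?p (c * t) / ?p t) \<longlongrightarrow> c powr (- \<alpha>)) at_top"
    by (rule Lim_transform_eventually)
qed

lemma measure_spectral_measure:
  assumes "A \<in> sets (restrict_space borel (sphere 0 1))"
  shows "measure (spectral_measure \<mu>) A = measure \<mu> {x. norm x \<ge> 1 \<and> sgn x \<in> A} / total_mass"
proof -
  have 1: "- cball 0 1 = {x::'a. norm x > 1}" by auto
  have 2: "emeasure \<mu> {x. norm x > 1} = ennreal total_mass"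
    using emeasure_outside_open_finite[of 1]
    by (simp add: emeasure_eq_ennreal_measure total_mass_def less_top[symmetric])
  have "emeasure \<mu> {x. norm x \<ge> 1 \<and> sgn x \<in> A} < \<infinity>"
    by (rule emeasure_outside_finite'[of 1]) auto
  then have 3: "emeasure \<mu> {x. norm x \<ge> 1 \<and> sgn x \<in> A} = ennreal (measure \<mu> {x. norm x \<ge> 1 \<and> sgn x \<in> A})"
    by (subst emeasure_eq_ennreal_measure) auto
  show ?thesis
    using emeasure_spectral_measure[OF sets_mu assms] total_mass_pos
    by (simp add: measure_def[of "spectral_measure \<mu>"] 1 2 3 divide_ennreal)
qed

text \<open>The numerator uses the closed and the denominator the open exterior of the unit ball;
  both have mass \<open>total_mass\<close>.\<close>

lemma prob_space_spectral_measure: "prob_space (spectral_measure \<mu>)"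
proof (rule prob_spaceI)
  have s: "sphere 0 1 \<in> sets (restrict_space borel (sphere (0::'a) 1))"
    using sets.top[of "restrict_space borel (sphere (0::'a) 1)"] by (simp add: space_restrict_space)
  have 1: "{x::'a. norm x \<ge> 1 \<and> sgn x \<in> sphere 0 1} = {x. norm x \<ge> 1}"
    by (auto simp: norm_sgn)
  have 2: "- cball 0 1 = {x::'a. norm x > 1}" by auto
  have f: "emeasure \<mu> {x. norm x \<ge> 1} = ennreal total_mass" "emeasure \<mu> {x. norm x > 1} = ennreal total_mass"
    using emeasure_outside_finite[of 1] emeasure_outside_open_finite[of 1]
    by (auto simp: emeasure_eq_ennreal_measure measure_outside_closed total_mass_def[symmetric]
        less_top[symmetric])
  have "emeasure (spectral_measure \<mu>) (sphere 0 1) = 1"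
    using emeasure_spectral_measure[OF sets_mu s, unfolded 1 2 f] total_mass_pos
    by (simp add: divide_ennreal)
  then show "emeasure (spectral_measure \<mu>) (space (spectral_measure \<mu>)) = 1"
    by (simp add: spectral_measure_def)
qed

text \<open>For closed sets of directions vague convergence gives an upper bound only: mass may
  approach an atom of the spectral measure without ever sitting on it. This is why the lower bound
  later needs its own hypothesis on atoms.\<close>

lemma limsup_directions:
  assumes F: "closed F" "F \<subseteq> sphere 0 1" and e: "e > 0"
  shows "eventually (\<lambda>t. prob {w \<in> space P. norm (H w) > t \<and> sgn (H w) \<in> F}
    \<le> (measure (spectral_measure \<mu>) F + e) * prob {w \<in> space P. norm (H w) > t}) at_top"
proof (cases "F = {}")
  case True
  then show ?thesis using e by simp
next
  case False
  let ?p = "\<lambda>t. prob {w \<in> space P. norm (H w) > t}"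
  let ?q = "\<lambda>t. prob {w \<in> space P. norm (H w) > t \<and> sgn (H w) \<in> F}"
  let ?s = "measure (spectral_measure \<mu>) F"
  have Fm [measurable]: "F \<in> sets borel" using F by simp
  have "F \<in> sets (restrict_space borel (sphere 0 1))"
    using F by (subst sets_restrict_space_iff) auto
  from measure_spectral_measure[OF this] have s: "measure \<mu> {x. norm x \<ge> 1 \<and> sgn x \<in> F} = ?s * total_mass"
    using total_mass_pos by simp
  have "eventually (\<lambda>n. real n * prob {w \<in> space P. norm (H w) \<ge> 1 * a n \<and> sgn (H w) \<in> F}
      < ?s * total_mass + e * total_mass / 2) sequentially"
    using limsup_cone_tail[of 1 F "e * total_mass / 2"] F False e total_mass_pos s by simp
  then have "eventually (\<lambda>n. real n * prob {w \<in> space P. norm (H w) \<ge> a n \<and> sgn (H w) \<in> F}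
      < ?s * total_mass + e * total_mass / 2) sequentially" by simp
  from eventually_compose_filterlim[OF this index_of_at_top]
  have 1: "eventually (\<lambda>t. real (index_of t) * prob {w \<in> space P. norm (H w) \<ge> a (index_of t) \<and> sgn (H w) \<in> F}
      < ?s * total_mass + e * total_mass / 2) at_top" .
  have "((\<lambda>t. (?s + e) * (real (index_of t) * ?p (1 * t))) \<longlongrightarrow> (?s + e) * (1 powr (- \<alpha>) * total_mass)) at_top"
    by (intro tendsto_mult tendsto_const tail_at_index) auto
  then have "eventually (\<lambda>t. (?s + e) * (real (index_of t) * ?p (1 * t)) > ?s * total_mass + e *
      total_mass / 2) at_top"
    by (rule order_tendstoD) (use e total_mass_pos in \<open>simp add: distrib_right\<close>)
  then have 2: "eventually (\<lambda>t. (?s + e) * (real (index_of t) * ?p t) > ?s * total_mass + e *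
      total_mass / 2) at_top"
    by simp
  have "eventually (\<lambda>t. index_of t \<ge> 1) at_top"
    using filterlim_at_top[THEN iffD1, OF index_of_at_top] by blast
  with 1 2 show ?thesis
  proof eventually_elim
    case (elim t)
    have "?q t \<le> prob {w \<in> space P. norm (H w) \<ge> a (index_of t) \<and> sgn (H w) \<in> F}"
      using index_of_le[of t] elim by (intro finite_measure_mono) (auto, measurable)
    then have "real (index_of t) * ?q t \<le> real (index_of t) *
        prob {w \<in> space P. norm (H w) \<ge> a (index_of t) \<and> sgn (H w) \<in> F}"
      by (intro mult_left_mono) auto
    also have "\<dots> \<le> (?s + e) * (real (index_of t) * ?p t)" using elim by linarith
    also have "\<dots> = real (index_of t) * ((?s + e) * ?p t)" by simp
    finally show ?case using elim by simp
  qed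
qed

end

section \<open>Independence\<close>

context prob_space
begin

lemma indep_vars_reindex_inj:
  assumes h: "inj_on h J" "h ` J \<subseteq> I" and X: "indep_vars M' X I"
  shows "indep_vars (\<lambda>j. M' (h j)) (\<lambda>j. X (h j)) J"
  unfolding indep_vars_def2
proof (intro conjI ballI)
  fix j assume "j \<in> J"
  then show "random_variable (M' (h j)) (X (h j))"
    using X h by (auto simp: indep_vars_def2)
next
  let ?F = "\<lambda>i. {X i -` A \<inter> space M |A. A \<in> sets (M' i)}"
  have X': "indep_sets ?F I" using X by (simp add: indep_vars_def2)
  show "indep_sets (\<lambda>j. ?F (h j)) J"
  proof (rule indep_setsI)
    show "?F (h j) \<subseteq> events" if "j \<in> J" for j
      using X' that h by (auto simp: indep_sets_def)
    fix A K assume K: "K \<noteq> {}" "K \<subseteq> J" "finite K" "\<forall>j\<in>K. A j \<in> ?F (h j)"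
    define g where "g = inv_into J h"
    have g: "g (h j) = j" if "j \<in> K" for j
      using that K h by (auto simp: g_def)
    have hI: "h j \<in> I" if "j \<in> K" for j
      using that K(2) h(2) by auto
    have "prob (\<Inter>i\<in>h ` K. A (g i)) = (\<Prod>i\<in>h ` K. prob (A (g i)))"
      by (rule indep_setsD[OF X']) (use K hI g in auto)
    moreover have "(\<Inter>i\<in>h ` K. A (g i)) = (\<Inter>j\<in>K. A j)" using g by auto
    moreover have "(\<Prod>i\<in>h ` K. prob (A (g i))) = (\<Prod>j\<in>K. prob (A j))"
      using inj_on_subset[OF h(1) K(2)] g by (subst prod.reindex) (auto intro!: prod.cong)
    ultimately show "prob (\<Inter>j\<in>K. A j) = (\<Prod>j\<in>K. prob (A j))" by simp
  qed
qed

text \<open>The inner variable \<open>w'\<close> acts as an independent copy, so \<open>Y\<close> is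
  integrated out with \<open>X\<close> frozen while everything stays on one probability
  space.\<close>

lemma indep_var_integral_iterated:
  fixes f :: "'b \<times> 'b \<Rightarrow> real"
  assumes ind: "indep_var S X T Y" and f [measurable]: "f \<in> borel_measurable (S \<Otimes>\<^sub>M T)"
    and bound: "\<And>z. \<bar>f z\<bar> \<le> B"
  shows "expectation (\<lambda>w. f (X w, Y w)) = expectation (\<lambda>w. expectation (\<lambda>w'. f (X w, Y w')))"
proof -
  have X [measurable]: "random_variable S X" and Y [measurable]: "random_variable T Y"
    using indep_var_rv1[OF ind] indep_var_rv2[OF ind] .
  interpret X: prob_space "distr M S X" by (rule prob_space_distr) fact
  interpret Y: prob_space "distr M T Y" by (rule prob_space_distr) fact
  interpret XY: pair_prob_space "distr M S X" "distr M T Y" ..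
  have f' [measurable]: "f \<in> borel_measurable (distr M S X \<Otimes>\<^sub>M distr M T Y)"
    by (subst measurable_cong_sets[OF sets_pair_measure_cong refl, of _ S _ T]) auto
  have "expectation (\<lambda>w. f (X w, Y w)) = integral\<^sup>L (distr M (S \<Otimes>\<^sub>M T) (\<lambda>w. (X w, Y w))) f"
    by (subst integral_distr) auto
  also have "\<dots> = integral\<^sup>L (distr M S X \<Otimes>\<^sub>M distr M T Y) f"
    using ind by (simp add: indep_var_distribution_eq)
  also have "\<dots> = (\<integral>x. \<integral>y. f (x, y) \<partial>distr M T Y \<partial>distr M S X)"
    by (rule XY.integral_fst'[symmetric], rule XY.integrable_const_bound[where B = B])
      (use bound in auto)
  also have "\<dots> = (\<integral>x. expectation (\<lambda>w'. f (x, Y w')) \<partial>distr M S X)"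
    by (rule Bochner_Integration.integral_cong) (auto intro!: integral_distr)
  also have "\<dots> = expectation (\<lambda>w. expectation (\<lambda>w'. f (X w, Y w')))"
    by (rule integral_distr) auto
  finally show ?thesis .
qed

end

section \<open>Exchangeability and factorisation for the sample\<close>

context heavy_tailed_sample
begin

lemma Hs_sum_measurable: "C \<subseteq> {1..} \<Longrightarrow> (\<lambda>w. \<Sum>j\<in>C. Hs j w) \<in> borel_measurable P"
  by (intro borel_measurable_sum Hs_measurable) auto

text \<open>The joint laws over \<open>C\<close> and over its bijective image \<open>C'\<close> are
  the same product of the law of \<open>H\<close>. Whichever indices are large, the remaining sum
  can thus be compared with the first \<open>n - k\<close> terms.\<close>

lemma distr_sum_card:
  assumes C: "finite C" "C \<subseteq> {1..}" and C': "finite C'" "C' \<subseteq> {1..}" and card: "card C = card C'"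
  shows "distr P borel (\<lambda>w. \<Sum>j\<in>C. Hs j w) = distr P borel (\<lambda>w. \<Sum>j\<in>C'. Hs j w)"
proof (cases "C = {}")
  case True
  then show ?thesis using card C' by simp
next
  case False
  obtain h where h: "bij_betw h C C'"
    using finite_same_card_bij[OF C(1) C'(1) card] by auto
  have hC: "inj_on h C" "h ` C = C'" using h by (auto simp: bij_betw_def)
  let ?N = "\<lambda>_::nat. borel :: 'a measure"
  have 1: "indep_vars ?N Hs C" using C by (intro indep_vars_subset[OF Hs_indep]) auto
  have 2: "indep_vars ?N (\<lambda>j. Hs (h j)) C"
    using indep_vars_reindex_inj[of h C "{1..}" ?N Hs] Hs_indep hC C' by auto
  have rv1: "Hs j \<in> borel_measurable P" "Hs (h j) \<in> borel_measurable P" if "j \<in> C" for j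
    using that C C' hC by (auto intro!: Hs_measurable)
  have d1: "distr P (PiM C ?N) (\<lambda>w. \<lambda>j\<in>C. Hs j w) = PiM C (\<lambda>j. distr P borel (Hs j))"
    using indep_vars_iff_distr_eq_PiM'[OF False rv1(1)] 1 by simp
  have d2: "distr P (PiM C ?N) (\<lambda>w. \<lambda>j\<in>C. Hs (h j) w) = PiM C (\<lambda>j. distr P borel (Hs (h j)))"
    using indep_vars_iff_distr_eq_PiM'[OF False rv1(2)] 2 by simp
  have d: "PiM C (\<lambda>j. distr P borel (Hs j)) = PiM C (\<lambda>j. distr P borel (Hs (h j)))"
  proof (intro PiM_cong refl)
    fix j assume "j \<in> C"
    then have "j \<ge> 1" "h j \<ge> 1" using C(2) C'(2) hC(2) by auto
    then show "distr P borel (Hs j) = distr P borel (Hs (h j))" by (simp only: Hs_law)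
  qed
  have m1: "(\<lambda>w. \<lambda>j\<in>C. Hs j w) \<in> measurable P (PiM C ?N)"
    using rv1 by (intro measurable_restrict) auto
  have m2: "(\<lambda>w. \<lambda>j\<in>C. Hs (h j) w) \<in> measurable P (PiM C ?N)"
    using rv1 by (intro measurable_restrict) auto
  have s: "(\<lambda>x. \<Sum>j\<in>C. x j) \<in> borel_measurable (PiM C ?N)" by measurable
  have "distr P borel (\<lambda>w. \<Sum>j\<in>C. Hs j w)
      = distr (distr P (PiM C ?N) (\<lambda>w. \<lambda>j\<in>C. Hs j w)) borel (\<lambda>x. \<Sum>j\<in>C. x j)"
    by (subst distr_distr[OF s m1]) (simp add: comp_def)
  also have "\<dots> = distr (distr P (PiM C ?N) (\<lambda>w. \<lambda>j\<in>C. Hs (h j) w)) borel (\<lambda>x. \<Sum>j\<in>C. x j)"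
    unfolding d1 d2 d ..
  also have "\<dots> = distr P borel (\<lambda>w. \<Sum>j\<in>C. Hs (h j) w)"
    by (subst distr_distr[OF s m2]) (simp add: comp_def)
  also have "(\<lambda>w. \<Sum>j\<in>C. Hs (h j) w) = (\<lambda>w. \<Sum>j\<in>C'. Hs j w)"
    using hC by (auto simp: fun_eq_iff sum.reindex[symmetric] hC(2)[symmetric] sum.reindex)
  finally show ?thesis .
qed

lemma expectation_sum_card:
  fixes f :: "'a \<Rightarrow> real"
  assumes C: "finite C" "C \<subseteq> {1..}" and C': "finite C'" "C' \<subseteq> {1..}" and card: "card C = card C'"
    and f: "f \<in> borel_measurable borel"
  shows "expectation (\<lambda>w. f (\<Sum>j\<in>C. Hs j w)) = expectation (\<lambda>w. f (\<Sum>j\<in>C'. Hs j w))"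
proof -
  have "expectation (\<lambda>w. f (\<Sum>j\<in>C. Hs j w)) = integral\<^sup>L (distr P borel (\<lambda>w. \<Sum>j\<in>C. Hs j w)) f"
    using f Hs_sum_measurable[OF C(2)] by (subst integral_distr) auto
  also have "\<dots> = integral\<^sup>L (distr P borel (\<lambda>w. \<Sum>j\<in>C'. Hs j w)) f"
    by (simp add: distr_sum_card[OF C C' card])
  also have "\<dots> = expectation (\<lambda>w. f (\<Sum>j\<in>C'. Hs j w))"
    using f Hs_sum_measurable[OF C'(2)] by (subst integral_distr) auto
  finally show ?thesis .
qed

lemma expectation_split:
  fixes a b :: "'a \<Rightarrow> real"
  assumes J: "finite J" "J \<subseteq> {1..}" and C: "finite C" "C \<subseteq> {1..}" and disj: "J \<inter> C = {}"
    and [measurable]: "a \<in> borel_measurable borel" "b \<in> borel_measurable borel"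
    and bound: "\<And>x. \<bar>a x\<bar> \<le> 1" "\<And>x. \<bar>b x\<bar> \<le> 1"
  shows "expectation (\<lambda>w. (\<Prod>j\<in>J. a (Hs j w)) * b (\<Sum>j\<in>C. Hs j w)) =
    expectation (\<lambda>w. a (H w)) ^ card J * expectation (\<lambda>w. b (\<Sum>j\<in>C. Hs j w))"
proof -
  note m = Hs_measurable
  have "indep_var (PiM J (\<lambda>_. borel)) (\<lambda>w. restrict (\<lambda>i. Hs i w) J)
      (PiM C (\<lambda>_. borel)) (\<lambda>w. restrict (\<lambda>i. Hs i w) C)"
    by (rule indep_var_restrict[OF Hs_indep disj]) fact+
  then have "indep_var borel ((\<lambda>x. \<Prod>j\<in>J. a (x j)) \<circ> (\<lambda>w. restrict (\<lambda>i. Hs i w) J))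
      borel ((\<lambda>x. b (\<Sum>j\<in>C. x j)) \<circ> (\<lambda>w. restrict (\<lambda>i. Hs i w) C))"
    by (rule indep_var_compose) measurable
  then have ind: "indep_var borel (\<lambda>w. \<Prod>j\<in>J. a (Hs j w)) borel (\<lambda>w. b (\<Sum>j\<in>C. Hs j w))"
    by (simp add: comp_def)
  have b1: "\<bar>\<Prod>j\<in>J. a (Hs j w)\<bar> \<le> 1" for w
    unfolding abs_prod using bound by (intro prod_le_1) auto
  have 1: "integrable P (\<lambda>w. \<Prod>j\<in>J. a (Hs j w))"
    using b1 J m by (intro integrable_const_bound[where B = 1] borel_measurable_prod
        measurable_compose[OF m]) auto
  have 2: "integrable P (\<lambda>w. b (\<Sum>j\<in>C. Hs j w))"
    using bound C by (intro integrable_const_bound[where B = 1]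
        measurable_compose[OF Hs_sum_measurable]) auto
  have "expectation (\<lambda>w. (\<Prod>j\<in>J. a (Hs j w)) * b (\<Sum>j\<in>C. Hs j w)) =
      expectation (\<lambda>w. \<Prod>j\<in>J. a (Hs j w)) * expectation (\<lambda>w. b (\<Sum>j\<in>C. Hs j w))"
    by (rule indep_var_lebesgue_integral[OF ind 1 2])
  also have "expectation (\<lambda>w. \<Prod>j\<in>J. a (Hs j w)) = (\<Prod>j\<in>J. expectation (\<lambda>w. a (Hs j w)))"
  proof (rule indep_vars_lebesgue_integral[OF J(1)])
    show "indep_vars (\<lambda>_. borel) (\<lambda>j w. a (Hs j w)) J"
      by (rule indep_vars_compose2[OF indep_vars_subset[OF Hs_indep J(2)]]) measurable
    show "integrable P (\<lambda>w. a (Hs j w))" if "j \<in> J" for j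
      using that J bound by (intro integrable_const_bound[where B = 1] measurable_compose[OF m]) auto
  qed
  also have "\<dots> = (\<Prod>j\<in>J. expectation (\<lambda>w. a (H w)))"
    using J by (intro prod.cong refl expectation_Hs) auto
  finally show ?thesis by simp
qed

text \<open>Index \<open>i\<close> is singled out because its direction is the parameter of all
  other factors. Once it is frozen, the factors over \<open>J\<close> and the sum over
  \<open>C\<close> are independent of each other.\<close>

lemma expectation_split_leading:
  fixes c :: "'a \<Rightarrow> real" and a b :: "'a \<Rightarrow> 'a \<Rightarrow> real"
  assumes i: "i \<ge> 1" "i \<notin> J" "i \<notin> C"
    and J: "finite J" "J \<subseteq> {1..}" and C: "finite C" "C \<subseteq> {1..}" and disj: "J \<inter> C = {}"
    and c [measurable]: "c \<in> borel_measurable borel"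
    and a [measurable]: "(\<lambda>z. a (fst z) (snd z)) \<in> borel_measurable borel"
    and b [measurable]: "(\<lambda>z. b (fst z) (snd z)) \<in> borel_measurable borel"
    and bound: "\<And>x. \<bar>c x\<bar> \<le> 1" "\<And>x y. \<bar>a x y\<bar> \<le> 1" "\<And>x y. \<bar>b x y\<bar> \<le> 1"
  shows "expectation (\<lambda>w. c (Hs i w) * ((\<Prod>j\<in>J. a (Hs i w) (Hs j w)) * b (Hs i w) (\<Sum>j\<in>C. Hs j w))) =
    expectation (\<lambda>w. c (H w) * (expectation (\<lambda>w'. a (H w) (H w')) ^ card J *
      expectation (\<lambda>w'. b (H w) (\<Sum>j\<in>C. Hs j w'))))"
proof -
  let ?N = "PiM (J \<union> C) (\<lambda>_. borel :: 'a measure)"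
  let ?Y = "\<lambda>w. restrict (\<lambda>i. Hs i w) (J \<union> C)"
  have a' [measurable]: "(\<lambda>z. a (fst z) (snd z)) \<in> borel_measurable (borel \<Otimes>\<^sub>M borel)"
    and b' [measurable]: "(\<lambda>z. b (fst z) (snd z)) \<in> borel_measurable (borel \<Otimes>\<^sub>M borel)"
    using a b by (simp_all add: borel_prod)
  have a1 [measurable]: "a x \<in> borel_measurable borel" and b1 [measurable]: "b x \<in> borel_measurable
      borel" for x
    using measurable_compose[OF measurable_Pair1' a'] measurable_compose[OF measurable_Pair1' b'] by auto
  define F where "F = (\<lambda>z::(nat \<Rightarrow> 'a) \<times> (nat \<Rightarrow> 'a). c (fst z i) * ((\<Prod>j\<in>J. a (fst z i) (snd z j)) *
      b (fst z i) (\<Sum>j\<in>C. snd z j)))"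
  let ?M = "PiM {i} (\<lambda>_. borel :: 'a measure)"
  let ?X = "\<lambda>w. restrict (\<lambda>i. Hs i w) {i}"
  have ind: "indep_var ?M ?X ?N ?Y"
    using i J C by (intro indep_var_restrict[OF Hs_indep]) auto
  have F: "F \<in> borel_measurable (?M \<Otimes>\<^sub>M ?N)"
  proof -
    have 1: "(\<lambda>z. (fst z i, snd z j)) \<in> measurable (?M \<Otimes>\<^sub>M ?N) (borel \<Otimes>\<^sub>M borel)" if "j \<in> J" for j
      using that by (intro measurable_Pair measurable_compose[OF measurable_fst
          measurable_component_singleton]
          measurable_compose[OF measurable_snd measurable_component_singleton]) auto
    have 2: "(\<lambda>z. (fst z i, \<Sum>j\<in>C. snd z j)) \<in> measurable (?M \<Otimes>\<^sub>M ?N) (borel \<Otimes>\<^sub>M borel)"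
      by measurable
    have 3: "(\<lambda>z. fst z i) \<in> measurable (?M \<Otimes>\<^sub>M ?N) borel"
      by measurable
    show ?thesis
      unfolding F_def using measurable_compose[OF 1 a'] measurable_compose[OF 2 b']
      by (intro borel_measurable_times borel_measurable_prod measurable_compose[OF 3 c]) auto
  qed
  have Fb: "\<bar>F z\<bar> \<le> 1" for z
    unfolding F_def abs_mult abs_prod using bound
    by (intro mult_le_one prod_le_1 mult_nonneg_nonneg prod_nonneg) auto
  have "expectation (\<lambda>w. c (Hs i w) * ((\<Prod>j\<in>J. a (Hs i w) (Hs j w)) * b (Hs i w) (\<Sum>j\<in>C. Hs j w)))
      = expectation (\<lambda>w. F (?X w, ?Y w))"
    by (simp add: F_def)
  also have "\<dots> = expectation (\<lambda>w. expectation (\<lambda>w'. F (?X w, ?Y w')))"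
    by (rule indep_var_integral_iterated[OF ind F Fb])
  also have "\<dots> = expectation (\<lambda>w. c (Hs i w) * (expectation (\<lambda>w'. a (Hs i w) (H w')) ^ card J *
      expectation (\<lambda>w'. b (Hs i w) (\<Sum>j\<in>C. Hs j w'))))"
  proof (rule Bochner_Integration.integral_cong[OF refl])
    fix w
    have "expectation (\<lambda>w'. F (?X w, ?Y w')) = c (Hs i w) *
        expectation (\<lambda>w'. (\<Prod>j\<in>J. a (Hs i w) (Hs j w')) * b (Hs i w) (\<Sum>j\<in>C. Hs j w'))"
      by (simp add: F_def)
    also have "expectation (\<lambda>w'. (\<Prod>j\<in>J. a (Hs i w) (Hs j w')) * b (Hs i w) (\<Sum>j\<in>C. Hs j w'))
        = expectation (\<lambda>w'. a (Hs i w) (H w')) ^ card J * expectation (\<lambda>w'. b (Hs i w) (\<Sum>j\<in>C. Hs j w'))"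
      using bound by (intro expectation_split J C disj) auto
    finally show "expectation (\<lambda>w'. F (?X w, ?Y w')) = c (Hs i w) *
      (expectation (\<lambda>w'. a (Hs i w) (H w')) ^ card J * expectation (\<lambda>w'. b (Hs i w) (\<Sum>j\<in>C. Hs j w')))" .
  qed
  also have "\<dots> = expectation (\<lambda>w. c (H w) * (expectation (\<lambda>w'. a (H w) (H w')) ^ card J *
      expectation (\<lambda>w'. b (H w) (\<Sum>j\<in>C. Hs j w'))))"
  proof (rule expectation_Hs[OF i(1)])
    have 1: "(\<lambda>z. a (fst z) (H (snd z))) \<in> borel_measurable (borel \<Otimes>\<^sub>M P)"
      by (rule measurable_compose[OF _ a', of "\<lambda>z. (fst z, H (snd z))", simplified]) measurable
    have 2: "(\<lambda>z. b (fst z) (\<Sum>j\<in>C. Hs j (snd z))) \<in> borel_measurable (borel \<Otimes>\<^sub>M P)"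
    proof (rule measurable_compose[OF _ b', of "\<lambda>z. (fst z, \<Sum>j\<in>C. Hs j (snd z))", simplified])
      show "(\<lambda>z. (fst z, \<Sum>j\<in>C. Hs j (snd z))) \<in> measurable (borel \<Otimes>\<^sub>M P) (borel \<Otimes>\<^sub>M borel)"
        by (intro measurable_Pair measurable_fst measurable_compose[OF measurable_snd
            Hs_sum_measurable[OF C(2)]])
    qed
    have "(\<lambda>x. expectation (\<lambda>w'. a x (H w'))) \<in> borel_measurable borel"
      "(\<lambda>x. expectation (\<lambda>w'. b x (\<Sum>j\<in>C. Hs j w'))) \<in> borel_measurable borel"
      using 1 2 by (auto intro!: borel_measurable_lebesgue_integral simp: split_beta')
    then show "(\<lambda>x. c x * (expectation (\<lambda>w'. a x (H w')) ^ card J *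
      expectation (\<lambda>w'. b x (\<Sum>j\<in>C. Hs j w')))) \<in> borel_measurable borel"
      by measurable
  qed
  finally show ?thesis .
qed

lemma prob_exists_le:
  assumes C: "finite C" "C \<subseteq> {1..}"
  shows "prob {w \<in> space P. \<exists>j\<in>C. norm (Hs j w) > t} \<le> card C * tail t"
proof -
  have m: "{w \<in> space P. norm (Hs j w) > t} \<in> sets P" if "j \<in> C" for j
    using that C Hs_measurable[of j] by (auto intro!: borel_measurable_less)
  have "{w \<in> space P. \<exists>j\<in>C. norm (Hs j w) > t} = (\<Union>j\<in>C. {w \<in> space P. norm (Hs j w) > t})"
    by auto
  also have "prob \<dots> \<le> (\<Sum>j\<in>C. prob {w \<in> space P. norm (Hs j w) > t})"
    using C m by (intro finite_measure_subadditive_finite) auto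
  also have "\<dots> = (\<Sum>j\<in>C. tail t)"
    using C by (intro sum.cong prob_Hs_tail) auto
  finally show ?thesis by simp
qed

end

section \<open>Weak convergence\<close>

text \<open>The levels below \<open>y\<close> number one more than the floor of
  \<open>m * y\<close>, capped at \<open>m\<close>; the cap causes no loss since
  \<open>y \<le> 1\<close>.\<close>

lemma sum_indicator_levels_ge:
  fixes y :: real
  assumes y: "0 \<le> y" "y \<le> 1" and m: "m > 0"
  shows "real m * y \<le> (\<Sum>i<m. if real i / real m \<le> y then 1 else 0)"
    and "(\<Sum>i<m. if real i / real m \<le> y then 1 else 0) \<le> 1 + real m * y"
proof -
  have eq: "(\<Sum>i<m. if real i / real m \<le> y then 1 else 0::real) = card {i. i < m \<and> real i / real m \<le> y}"
    by (subst sum.inter_filter[symmetric]) (auto intro!: arg_cong[where f = card])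
  have ge: "real i / real m \<le> y \<longleftrightarrow> i \<le> nat \<lfloor>real m * y\<rfloor>" for i
    using m y by (simp add: field_simps le_nat_iff le_floor_iff)
  show "(\<Sum>i<m. if real i / real m \<le> y then 1 else 0) \<le> 1 + real m * y"
  proof -
    have "card {i. i < m \<and> real i / real m \<le> y} \<le> card {..nat \<lfloor>real m * y\<rfloor>}"
      using ge by (intro card_mono) auto
    then have "real (card {i. i < m \<and> real i / real m \<le> y}) \<le> 1 + real (nat \<lfloor>real m * y\<rfloor>)"
      by simp
    also have "real (nat \<lfloor>real m * y\<rfloor>) \<le> real m * y" using m y by simp
    finally show ?thesis unfolding eq by simp
  qed
  show "real m * y \<le> (\<Sum>i<m. if real i / real m \<le> y then 1 else 0)"
  proof (cases "nat \<lfloor>real m * y\<rfloor> < m")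
    case True
    then have "{i. i < m \<and> real i / real m \<le> y} = {..nat \<lfloor>real m * y\<rfloor>}" using ge by auto
    then have "real (card {i. i < m \<and> real i / real m \<le> y}) = 1 + real (nat \<lfloor>real m * y\<rfloor>)" by simp
    moreover have "real (nat \<lfloor>real m * y\<rfloor>) = of_int \<lfloor>real m * y\<rfloor>" using y by simp
    then have "real m * y \<le> 1 + real (nat \<lfloor>real m * y\<rfloor>)"
      using floor_correct[of "real m * y"] by linarith
    ultimately show ?thesis unfolding eq by linarith
  next
    case False
    have "real i / real m \<le> y" if "i < m" for i
      unfolding ge using False that by linarith
    then have "{i. i < m \<and> real i / real m \<le> y} = {..<m}" by blast
    then have "real (card {i. i < m \<and> real i / real m \<le> y}) = real m" by simp
    moreover have "real m * y \<le> real m" using y(2) by (rule mult_left_le) simp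
    ultimately show ?thesis unfolding eq by linarith
  qed
qed

text \<open>Up to \<open>1 / m\<close>, a function with values in the unit interval is the mean of
  the indicators of its closed level sets. The factor \<open>c n\<close> and the map
  \<open>X n\<close> allow an application to conditional laws of directions without forming them as
  measures.\<close>

lemma portmanteau_upper:
  fixes N :: "nat \<Rightarrow> 'b measure" and X :: "nat \<Rightarrow> 'b \<Rightarrow> 'a::euclidean_space" and N0 :: "'a measure"
  assumes K: "closed K" and fin: "\<And>n. finite_measure (N n)" and c: "\<And>n. c n \<ge> (0::real)"
    and X [measurable]: "\<And>n. X n \<in> measurable (N n) (restrict_space borel K)"
    and N0: "finite_measure N0" "sets N0 = sets (restrict_space borel K)"
    and lim: "\<And>F e. closed F \<Longrightarrow> F \<subseteq> K \<Longrightarrow> e > 0 \<Longrightarrow>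
      eventually (\<lambda>n. c n * measure (N n) (X n -` F \<inter> space (N n)) \<le> measure N0 F + e) sequentially"
    and f: "continuous_on K f" "\<And>x. x \<in> K \<Longrightarrow> 0 \<le> f x \<and> f x \<le> (1::real)" and e: "e > 0"
  shows "eventually (\<lambda>n. c n * (\<integral>x. f (X n x) \<partial>N n) \<le> (\<integral>x. f x \<partial>N0) + e) sequentially"
proof -
  interpret N0: finite_measure N0 by (rule N0)
  have sp0: "space N0 = K" using sets_eq_imp_space_eq[OF N0(2)] by (simp add: space_restrict_space)
  have Kb: "K \<in> sets borel" using K by simp
  have f_meas [measurable]: "f \<in> borel_measurable (restrict_space borel K)"
    using f(1) by (rule borel_measurable_continuous_on_restrict)
  have f_meas0: "f \<in> borel_measurable N0"
    by (subst measurable_cong_sets[OF N0(2) refl]) (rule f_meas)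
  define T where "T = measure N0 K"
  \<comment> \<open>The additive 1 in the level count integrates to \<open>T\<close>, and this
    \<open>m\<close> makes \<open>T\<close> at most \<open>m * (e / 2)\<close>.\<close>
  obtain m :: nat where m: "T / (e / 2) < real m" using reals_Archimedean2 by blast
  have m0: "m > 0" using m e by (intro Nat.gr0I) (simp add: T_def divide_less_0_iff)
  define F where "F = (\<lambda>i. {x \<in> K. real i / real m \<le> f x})"
  have F: "closed (F i)" "F i \<subseteq> K" for i
    unfolding F_def using continuous_closed_preimage[OF f(1) K, of "{real i / real m..}"]
    by (auto simp: vimage_def Int_def)
  have F_sets: "F i \<in> sets (restrict_space borel K)" for i
    using F[of i] Kb by (subst sets_restrict_space_iff) auto
  have F_sets0: "F i \<in> sets N0" for i using F_sets N0(2) by simp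
  have "eventually (\<lambda>n. \<forall>i\<in>{..<m}. c n * measure (N n) (X n -` F i \<inter> space (N n))
      \<le> measure N0 (F i) + e / 2) sequentially"
    using F e by (intro eventually_ball_finite ballI lim) auto
  then show ?thesis
  proof eventually_elim
    case (elim n)
    interpret Nn: finite_measure "N n" by (rule fin)
    have XK: "X n x \<in> K" if "x \<in> space (N n)" for x
      using measurable_space[OF X that] by (simp add: space_restrict_space)
    have ind_int: "integrable (N n) (\<lambda>x. \<Sum>i<m. indicat_real (X n -` F i \<inter> space (N n)) x)"
      using measurable_sets[OF X F_sets]
      by (intro Bochner_Integration.integrable_sum integrable_real_indicator) (auto simp:
          Nn.emeasure_eq_measure)
    have "real m * (\<integral>x. f (X n x) \<partial>N n) = (\<integral>x. real m * f (X n x) \<partial>N n)" by simp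
    also have "\<dots> \<le> (\<integral>x. (\<Sum>i<m. indicat_real (X n -` F i \<inter> space (N n)) x) \<partial>N n)"
    proof (rule integral_mono)
      show "integrable (N n) (\<lambda>x. real m * f (X n x))"
        using f(2) XK m0 by (intro Nn.integrable_const_bound[where B = "real m"] AE_I2) (auto simp:
            mult_left_le)
      show "real m * f (X n x) \<le> (\<Sum>i<m. indicat_real (X n -` F i \<inter> space (N n)) x)"
        if "x \<in> space (N n)" for x
      proof -
        have "(\<Sum>i<m. indicat_real (X n -` F i \<inter> space (N n)) x) = (\<Sum>i<m. if real i / real m \<le> f (X n
            x) then 1 else 0)"
          using that XK by (intro sum.cong) (auto simp: F_def)
        then show ?thesis using sum_indicator_levels_ge(1)[OF _ _ m0, of "f (X n x)"] f(2)[OF XK[OF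
            that]] by simp
      qed
    qed (rule ind_int)
    also have "\<dots> = (\<Sum>i<m. measure (N n) (X n -` F i \<inter> space (N n)))"
      using measurable_sets[OF X F_sets]
      by (subst Bochner_Integration.integral_sum) (auto simp: Nn.emeasure_eq_measure intro!:
          integrable_real_indicator)
    finally have "c n * (real m * (\<integral>x. f (X n x) \<partial>N n)) \<le> c n * (\<Sum>i<m. measure (N n) (X n -` F i \<inter>
        space (N n)))"
      using c by (intro mult_left_mono)
    also have "\<dots> = (\<Sum>i<m. c n * measure (N n) (X n -` F i \<inter> space (N n)))"
      by (rule sum_distrib_left)
    also have "\<dots> \<le> (\<Sum>i<m. measure N0 (F i) + e / 2)"
      using elim by (intro sum_mono) auto
    also have "\<dots> = (\<Sum>i<m. measure N0 (F i)) + real m * (e / 2)"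
      by (simp add: sum.distrib)
    also have "(\<Sum>i<m. measure N0 (F i)) = (\<integral>x. (\<Sum>i<m. indicat_real (F i) x) \<partial>N0)"
      using F_sets0 sets.sets_into_space[OF F_sets0]
      by (subst Bochner_Integration.integral_sum)
        (auto simp: N0.emeasure_eq_measure Int_absorb2 intro!: integrable_real_indicator)
    also have "\<dots> \<le> (\<integral>x. 1 + real m * f x \<partial>N0)"
    proof (rule integral_mono)
      show "integrable N0 (\<lambda>x. \<Sum>i<m. indicat_real (F i) x)"
        using F_sets0 by (intro Bochner_Integration.integrable_sum integrable_real_indicator)
          (auto simp: N0.emeasure_eq_measure)
      show "integrable N0 (\<lambda>x. 1 + real m * f x)"
        using f(2) f_meas0 by (intro N0.integrable_const_bound[where B = "1 + real m"] AE_I2)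
          (auto simp: sp0 mult_left_le)
      fix x assume "x \<in> space N0"
      then have x: "x \<in> K" by (simp add: sp0)
      have "(\<Sum>i<m. indicat_real (F i) x) = (\<Sum>i<m. if real i / real m \<le> f x then 1 else 0)"
        using x by (intro sum.cong) (auto simp: F_def)
      then show "(\<Sum>i<m. indicat_real (F i) x) \<le> 1 + real m * f x"
        using sum_indicator_levels_ge(2)[OF _ _ m0, of "f x"] f(2)[OF x] by simp
    qed
    also have "\<dots> = T + real m * (\<integral>x. f x \<partial>N0)"
      using f(2) f_meas0 by (subst Bochner_Integration.integral_add)
        (auto simp: T_def sp0 intro!: N0.integrable_const_bound[where B = 1])
    also have "T \<le> real m * (e / 2)" using m e by (simp add: field_simps)
    finally have "real m * (c n * (\<integral>x. f (X n x) \<partial>N n)) \<le> real m * ((\<integral>x. f x \<partial>N0) + e)"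
      by (simp add: algebra_simps)
    then show ?case using m0 by simp
  qed
qed

text \<open>A finite net in \<open>K\<close> suffices because all functions share one Lipschitz
  constant. Uniformity is needed since the empirical factors are evaluated at a random
  direction.\<close>

lemma equi_lipschitz_upper_uniform:
  fixes u :: "'a::euclidean_space \<Rightarrow> real"
  assumes K: "compact K" and D: "D \<ge> 0"
    and un: "\<And>n s t. s \<in> K \<Longrightarrow> t \<in> K \<Longrightarrow> \<bar>v n s - v n t\<bar> \<le> D * dist s t"
    and u: "\<And>s t. s \<in> K \<Longrightarrow> t \<in> K \<Longrightarrow> \<bar>u s - u t\<bar> \<le> D * dist s t"
    and lim: "\<And>s e. s \<in> K \<Longrightarrow> e > 0 \<Longrightarrow> eventually (\<lambda>n. v n s \<le> u s + e) sequentially"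
    and e: "e > 0"
  shows "eventually (\<lambda>n. \<forall>s\<in>K. v n s \<le> u s + e) sequentially"
proof -
  define r where "r = e / (4 * (D + 1))"
  have r: "r > 0" "D * r \<le> e / 4"
  proof -
    have "r * (D + 1) = e / 4" unfolding r_def using D by (simp add: field_simps)
    moreover show "r > 0" unfolding r_def using e D by simp
    ultimately show "D * r \<le> e / 4" by (simp add: algebra_simps)
  qed
  obtain T where T: "finite T" "T \<subseteq> K" "K \<subseteq> (\<Union>t\<in>T. ball t r)"
    using compactE_image[OF K, of K "\<lambda>t. ball t r"] r by (metis UN_I centre_in_ball open_ball subsetI)
  have "eventually (\<lambda>n. \<forall>t\<in>T. v n t \<le> u t + e / 2) sequentially"
    using T e by (intro eventually_ball_finite ballI lim) auto
  then show ?thesis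
  proof eventually_elim
    case (elim n)
    show ?case
    proof
      fix s assume s: "s \<in> K"
      then obtain t where t: "t \<in> T" "dist t s < r" using T by auto
      then have tK: "t \<in> K" using T by auto
      have d: "D * dist s t \<le> D * r" using t D by (intro mult_left_mono) (auto simp: dist_commute)
      have "v n s \<le> v n t + e / 4" using un[OF s tK, of n] d r by linarith
      moreover have "u t \<le> u s + e / 4" using u[OF s tK] d r by linarith
      moreover have "v n t \<le> u t + e / 2" using elim t by auto
      ultimately show "v n s \<le> u s + e" by linarith
    qed
  qed
qed

section \<open>The stable limit of the untruncated sums\<close>

locale stably_attracted_sample = softly_truncated_sample P H \<alpha> Hs M
  for P :: "'w measure" and H :: "'w \<Rightarrow> 'a::euclidean_space" and \<alpha> :: real and Hs M +
  fixes V :: "'w \<Rightarrow> 'a" and B :: "nat \<Rightarrow> real"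
  assumes V_rv [measurable]: "V \<in> borel_measurable P"
    and V_nonzero: "\<not> (AE w in P. V w = 0)"
    and B_pos: "\<And>n. B n > 0"
    and B_lim: "filterlim B at_top sequentially"
    and V_conv: "weak_conv_on UNIV (\<lambda>n. distr P borel (\<lambda>w. (\<Sum>j=1..n. Hs j w) /\<^sub>R B n)) (distr P borel V)"
begin

lemma expectation_stable_limit:
  fixes f :: "'a \<Rightarrow> real"
  assumes f: "continuous_on UNIV f" "\<And>x. \<bar>f x\<bar> \<le> C"
  shows "(\<lambda>n. expectation (\<lambda>w. f ((\<Sum>j=1..n. Hs j w) /\<^sub>R B n))) \<longlonglongrightarrow> expectation (\<lambda>w. f (V w))"
proof -
  have fm: "f \<in> borel_measurable borel" using f(1) by (rule borel_measurable_continuous_onI)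
  have "bounded (f ` UNIV)" using f(2) by (auto simp: bounded_iff)
  then have "(\<lambda>n. \<integral>x. f x \<partial>distr P borel (\<lambda>w. (\<Sum>j=1..n. Hs j w) /\<^sub>R B n)) \<longlonglongrightarrow> (\<integral>x. f x \<partial>distr P borel V)"
    using V_conv f(1) unfolding weak_conv_on_def by blast
  moreover have "(\<integral>x. f x \<partial>distr P borel V) = expectation (\<lambda>w. f (V w))"
    using fm by (intro integral_distr) auto
  moreover have "(\<integral>x. f x \<partial>distr P borel (\<lambda>w. (\<Sum>j=1..n. Hs j w) /\<^sub>R B n))
      = expectation (\<lambda>w. f ((\<Sum>j=1..n. Hs j w) /\<^sub>R B n))" for n
    using fm Hs_sum_measurable[of "{1..n}"] by (intro integral_distr) auto
  ultimately show ?thesis by simp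
qed

lemma tail_lim_0: "(tail \<longlongrightarrow> 0) at_top"
proof -
  obtain C t0 where C: "C > 0" "t0 > 0" "\<And>t. t \<ge> t0 \<Longrightarrow> tail t \<le> C * t powr (\<alpha> / 2 - \<alpha>)"
    using G_le_powr[of "\<alpha> / 2"] \<alpha>_pos by auto
  have "eventually (\<lambda>t. norm (tail t) \<le> C * t powr (\<alpha> / 2 - \<alpha>)) at_top"
    using C(3) by (auto simp: eventually_at_top_linorder)
  moreover have "((\<lambda>t. C * t powr (\<alpha> / 2 - \<alpha>)) \<longlongrightarrow> 0) at_top"
    using \<alpha>_pos C(1) by (intro tendsto_mult_right_zero tendsto_neg_powr filterlim_ident) auto
  ultimately show ?thesis by (rule Lim_null_comparison)
qed

lemma tail_scaled_lim_0: "c > 0 \<Longrightarrow> filterlim b at_top sequentially \<Longrightarrow> (\<lambda>n. tail (c * b n)) \<longlonglongrightarrow> 0"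
  by (rule filterlim_compose[OF tail_lim_0]) (rule filterlim_tendsto_pos_mult_at_top[OF tendsto_const])

text \<open>The deviation bound with \<open>k = 0\<close>, together with the probability that some
  summand exceeds the cut, which is of order \<open>exc n\<close>.\<close>

lemma sum_over_M:
  assumes \<delta>: "\<delta> > 0"
  shows "(\<lambda>n. prob {w \<in> space P. norm (\<Sum>j=1..n. Hs j w) > \<delta> * M n}) \<longlonglongrightarrow> 0"
proof -
  obtain \<epsilon> where \<epsilon>: "\<epsilon> > 0" "\<epsilon> < 1" "(\<lambda>n. prob {w \<in> space P.
    norm (\<Sum>j=1..n. if norm (Hs j w) \<le> \<epsilon> * M n then Hs j w else 0) > \<delta> * M n} / exc n ^ 0) \<longlonglongrightarrow> 0"
    using truncated_sum_deviation[OF \<delta>, of 0] by blast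
  define T where "T = (\<lambda>n w. \<Sum>j=1..n. if norm (Hs j w) \<le> \<epsilon> * M n then Hs j w else 0)"
  have t: "(\<lambda>x. if norm x \<le> y then x else 0 :: 'a) \<in> borel_measurable borel" for y
    by measurable
  have T [measurable]: "T n \<in> borel_measurable P" for n
    unfolding T_def by (intro borel_measurable_sum measurable_compose[OF Hs_measurable t]) auto
  obtain C where C: "C > 0" "eventually (\<lambda>n. tail (\<epsilon> * M n) \<le> C * tail (M n)) sequentially"
    using eventually_tail_scale[OF \<epsilon>(1)] by auto
  have "eventually (\<lambda>n. norm (prob {w \<in> space P. norm (\<Sum>j=1..n. Hs j w) > \<delta> * M n})
    \<le> prob {w \<in> space P. norm (T n w) > \<delta> * M n} + C * exc n) sequentially"
    using C(2)
  proof eventually_elim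
    case (elim n)
    let ?E = "{w \<in> space P. \<exists>j\<in>{1..n}. norm (Hs j w) > \<epsilon> * M n}"
    have E: "?E \<in> sets P"
    proof -
      have "?E = (\<Union>j\<in>{1..n}. {w \<in> space P. norm (Hs j w) > \<epsilon> * M n})" by auto
      also have "\<dots> \<in> sets P"
        using Hs_measurable by (intro sets.finite_UN) (auto intro!: borel_measurable_less)
      finally show ?thesis .
    qed
    have "prob {w \<in> space P. norm (\<Sum>j=1..n. Hs j w) > \<delta> * M n}
        \<le> prob ({w \<in> space P. norm (T n w) > \<delta> * M n} \<union> ?E)"
    proof (rule finite_measure_mono)
      show "{w \<in> space P. norm (\<Sum>j=1..n. Hs j w) > \<delta> * M n} \<subseteq> {w \<in> space P. norm (T n w) > \<delta> * M n} \<union> ?E"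
      proof
        fix w assume w: "w \<in> {w \<in> space P. norm (\<Sum>j=1..n. Hs j w) > \<delta> * M n}"
        show "w \<in> {w \<in> space P. norm (T n w) > \<delta> * M n} \<union> ?E"
        proof (cases "w \<in> ?E")
          case False
          then have "T n w = (\<Sum>j=1..n. Hs j w)"
            unfolding T_def using w by (intro sum.cong) (auto simp: not_less)
          with w show ?thesis by simp
        qed simp
      qed
      show "{w \<in> space P. norm (T n w) > \<delta> * M n} \<union> ?E \<in> sets P" using E by (intro sets.Un) simp_all
    qed
    also have "\<dots> \<le> prob {w \<in> space P. norm (T n w) > \<delta> * M n} + prob ?E"
      using E by (intro measure_Un_le) simp_all
    also have "prob ?E \<le> real n * tail (\<epsilon> * M n)"
      using prob_exists_le[of "{1..n}" "\<epsilon> * M n"] by simp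
    also have "\<dots> \<le> real n * (C * tail (M n))" using elim by (intro mult_left_mono) auto
    finally show ?case by (simp add: exc_def mult_ac)
  qed
  moreover have "(\<lambda>n. prob {w \<in> space P. norm (T n w) > \<delta> * M n} + C * exc n) \<longlonglongrightarrow> 0"
  proof (rule tendsto_add_zero)
    show "(\<lambda>n. prob {w \<in> space P. norm (T n w) > \<delta> * M n}) \<longlonglongrightarrow> 0"
      using \<epsilon>(3) unfolding T_def power_0 div_by_1 .
    show "(\<lambda>n. C * exc n) \<longlonglongrightarrow> 0" by (rule tendsto_mult_right_zero[OF exc_lim])
  qed
  ultimately show ?thesis by (rule Lim_null_comparison)
qed

text \<open>Otherwise the limit \<open>V\<close> would vanish along a subsequence, by \<open>sum_over_M\<close>.\<close>

lemma B_over_M: "(\<lambda>n. B n / M n) \<longlonglongrightarrow> 0"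
proof -
  define S where "S = (\<lambda>n w. \<Sum>j=1..n. Hs j w)"
  define f where "f = (\<lambda>x::'a. min 1 (norm x))"
  have f: "continuous_on UNIV f" "\<And>x. \<bar>f x\<bar> \<le> 1" "\<And>x. f x \<ge> 0"
    unfolding f_def by (auto intro!: continuous_intros)
  have fm [measurable]: "f \<in> borel_measurable borel" using f(1) by (rule borel_measurable_continuous_onI)
  define E where "E = expectation (\<lambda>w. f (V w))"
  have E: "E > 0"
  proof -
    have "E \<ge> 0" unfolding E_def using f by (intro Bochner_Integration.integral_nonneg) auto
    moreover have "E \<noteq> 0"
    proof
      assume "E = 0"
      then have "AE w in P. f (V w) = 0"
        unfolding E_def using f
        by (subst (asm) integral_nonneg_eq_0_iff_AE) (auto intro!: integrable_const_bound[where B = 1])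
      then have "AE w in P. V w = 0"
        by eventually_elim (auto simp: f_def min_def split: if_splits)
      with V_nonzero show False by simp
    qed
    ultimately show ?thesis by simp
  qed
  have 1: "eventually (\<lambda>n. expectation (\<lambda>w. f (S n w /\<^sub>R B n)) > E / 2) sequentially"
    using expectation_stable_limit[OF f(1,2)] E unfolding E_def[symmetric] S_def by (intro
        order_tendstoD) auto
  \<comment> \<open>If \<open>B n \<ge> c * M n\<close>, then \<open>f\<close> of the normalised sum
    is at most \<open>E / 4\<close> outside an event of probability below \<open>E / 4\<close>. Its
    expectation would stay below \<open>E / 2\<close>, although it tends to
    \<open>E\<close>.\<close>
  have small: "eventually (\<lambda>n. B n < c * M n) sequentially" if c: "c > 0" for c
  proof -
    have "E / 4 * c > 0" using E c by simp
    from order_tendstoD(2)[OF sum_over_M[OF this], of "E / 4"] E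
    have "eventually (\<lambda>n. prob {w \<in> space P. norm (S n w) > E / 4 * c * M n} < E / 4) sequentially"
      by (simp add: S_def)
    with 1 show ?thesis
    proof eventually_elim
      case (elim n)
      have m [measurable]: "S n \<in> borel_measurable P"
        using Hs_sum_measurable[of "{1..n}"] by (simp add: S_def)
      show ?case
      proof (rule ccontr)
        assume "\<not> B n < c * M n"
        then have Bn: "B n \<ge> c * M n" by simp
        have "expectation (\<lambda>w. f (S n w /\<^sub>R B n))
          \<le> expectation (\<lambda>w. E / 4 + indicator {w \<in> space P. norm (S n w) > E / 4 * c * M n} w)"
        proof (rule integral_mono)
          show "integrable P (\<lambda>w. f (S n w /\<^sub>R B n))"
            using f by (intro integrable_const_bound[where B = 1]) auto
          show "integrable P (\<lambda>w. E / 4 + indicat_real {w \<in> space P. norm (S n w) > E / 4 * c * M n} w)"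
            by (intro Bochner_Integration.integrable_add integrable_real_indicator)
              (auto simp: emeasure_eq_measure)
          fix w assume w: "w \<in> space P"
          show "f (S n w /\<^sub>R B n) \<le> E / 4 + indicat_real {w \<in> space P. norm (S n w) > E / 4 * c * M n} w"
          proof (cases "norm (S n w) > E / 4 * c * M n")
            case True
            then show ?thesis using w f(2)[of "S n w /\<^sub>R B n"] E by simp
          next
            case False
            then have "norm (S n w) \<le> E / 4 * (c * M n)" by simp
            also have "\<dots> \<le> E / 4 * B n" using Bn E by (intro mult_left_mono) auto
            finally have "norm (S n w /\<^sub>R B n) \<le> E / 4"
              using B_pos[of n] by (simp add: field_simps)
            then show ?thesis using False by (simp add: f_def)
          qed
        qed
        also have "\<dots> = E / 4 + prob {w \<in> space P. norm (S n w) > E / 4 * c * M n}"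
          by (subst Bochner_Integration.integral_add)
            (auto simp: emeasure_eq_measure prob_space intro!: integrable_real_indicator)
        finally show False using elim by simp
      qed
    qed
  qed
  show ?thesis
  proof (rule order_tendstoI)
    fix y :: real assume "y < 0"
    show "eventually (\<lambda>n. B n / M n > y) sequentially"
      using eventually_ge_1 by eventually_elim (use M_pos B_pos \<open>y < 0\<close> in \<open>force intro: less_trans[of y 0]\<close>)
  next
    fix y :: real assume y: "0 < y"
    show "eventually (\<lambda>n. B n / M n < y) sequentially"
      using small[OF y] eventually_ge_1 by eventually_elim (use M_pos in \<open>auto simp: field_simps\<close>)
  qed
qed

text \<open>With \<open>k\<close> indices set aside the sum has \<open>n - k\<close> terms but is
  still normalised by \<open>B n\<close>. The at most \<open>k\<close> missing terms are small
  relative to \<open>B n\<close> with high probability, and the Lipschitz bound on \<open>f\<close>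
  does the rest.\<close>

lemma expectation_shifted_stable_limit:
  fixes f :: "'a \<Rightarrow> real"
  assumes f: "\<And>x. \<bar>f x\<bar> \<le> 1" "\<And>x y. \<bar>f x - f y\<bar> \<le> D * dist x y"
  shows "(\<lambda>n. expectation (\<lambda>w. f ((\<Sum>j=1..n-k. Hs j w) /\<^sub>R B n))) \<longlonglongrightarrow> expectation (\<lambda>w. f (V w))"
proof -
  define S where "S = (\<lambda>n w. \<Sum>j=1..n. Hs j w)"
  have D: "D \<ge> 0"
  proof -
    obtain b :: 'a where "b \<in> Basis" using nonempty_Basis by blast
    then have "dist b 0 = 1" by simp
    with f(2)[of b 0] show ?thesis by simp
  qed
  have fc: "continuous_on UNIV f"
    by (rule lipschitz_on_continuous_on[of D]) (use f(2) D in \<open>auto intro!: lipschitz_onI simp: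
        dist_real_def\<close>)
  have fm [measurable]: "f \<in> borel_measurable borel" using fc by (rule borel_measurable_continuous_onI)
  have m [measurable]: "S n \<in> borel_measurable P" for n 
    using Hs_sum_measurable[of "{1..n}"] by (simp add: S_def)
  have int: "integrable P (\<lambda>w. f (S m w /\<^sub>R b))" for m b
    using f by (intro integrable_const_bound[where B = 1]) auto
  have diff0: "(\<lambda>n. expectation (\<lambda>w. f (S (n - k) w /\<^sub>R B n)) - expectation (\<lambda>w. f (S n w /\<^sub>R B n))) \<longlonglongrightarrow> 0"
  proof (rule LIMSEQ_I)
    fix e :: real assume e: "e > 0"
    define \<eta> where "\<eta> = e / (2 * (D + 1))"
    have \<eta>: "\<eta> > 0" "D * \<eta> < e / 2"
    proof -
      have "\<eta> * (D + 1) = e / 2" unfolding \<eta>_def using D by (simp add: field_simps)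
      moreover show "\<eta> > 0" unfolding \<eta>_def using e D by simp
      ultimately show "D * \<eta> < e / 2" by (simp add: algebra_simps)
    qed
    define c where "c = \<eta> / (real k + 1)"
    have c: "c > 0" unfolding c_def using \<eta> by simp
    have "(\<lambda>n. 2 * (real k * tail (c * B n))) \<longlonglongrightarrow> 2 * (real k * 0)"
      by (intro tendsto_mult tendsto_const tail_scaled_lim_0[OF c B_lim])
    then have "eventually (\<lambda>n. 2 * (real k * tail (c * B n)) < e / 2) sequentially"
      by (rule order_tendstoD) (use e in simp)
    then have "eventually (\<lambda>n. norm (expectation (\<lambda>w. f (S (n - k) w /\<^sub>R B n)) - expectation (\<lambda>w. f
        (S n w /\<^sub>R B n)) - 0) < e) sequentially"
    proof eventually_elim
      case (elim n)
      let ?C = "{n - k + 1..n}"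
      define E where "E = {w \<in> space P. \<exists>j\<in>?C. norm (Hs j w) > c * B n}"
      have E: "E \<in> sets P"
      proof -
        have "E = (\<Union>j\<in>?C. {w \<in> space P. norm (Hs j w) > c * B n})" by (auto simp: E_def)
        also have "\<dots> \<in> sets P"
          using Hs_measurable by (intro sets.finite_UN) (auto intro!: borel_measurable_less)
        finally show ?thesis .
      qed
      have split: "S n w = S (n - k) w + (\<Sum>j\<in>?C. Hs j w)" for w
        unfolding S_def by (subst sum.union_disjoint[symmetric]) (auto intro!: sum.cong)
      have "norm (expectation (\<lambda>w. f (S (n - k) w /\<^sub>R B n)) - expectation (\<lambda>w. f (S n w /\<^sub>R B n)))
          = norm (expectation (\<lambda>w. f (S (n - k) w /\<^sub>R B n) - f (S n w /\<^sub>R B n)))"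
        by (subst Bochner_Integration.integral_diff) (auto intro: int)
      also have "\<dots> \<le> expectation (\<lambda>w. norm (f (S (n - k) w /\<^sub>R B n) - f (S n w /\<^sub>R B n)))"
        by (rule integral_norm_bound)
      also have "\<dots> \<le> expectation (\<lambda>w. D * \<eta> + 2 * indicator E w)"
      proof (rule integral_mono)
        show "integrable P (\<lambda>w. norm (f (S (n - k) w /\<^sub>R B n) - f (S n w /\<^sub>R B n)))"
          by (intro integrable_norm Bochner_Integration.integrable_diff int)
        show "integrable P (\<lambda>w. D * \<eta> + 2 * indicat_real E w)"
          using E by (intro Bochner_Integration.integrable_add integrable_mult_right
              integrable_real_indicator)
            (auto simp: emeasure_eq_measure)
        fix w assume w: "w \<in> space P"
        show "norm (f (S (n - k) w /\<^sub>R B n) - f (S n w /\<^sub>R B n)) \<le> D * \<eta> + 2 * indicat_real E w"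
        proof (cases "w \<in> E")
          case True
          have "\<bar>f (S (n - k) w /\<^sub>R B n) - f (S n w /\<^sub>R B n)\<bar> \<le> 2"
            using f(1)[of "S (n - k) w /\<^sub>R B n"] f(1)[of "S n w /\<^sub>R B n"] by linarith
          moreover have "D * \<eta> \<ge> 0" using \<eta> D by simp
          ultimately show ?thesis using True by simp
        next
          case False
          then have le: "norm (Hs j w) \<le> c * B n" if "j \<in> ?C" for j
            using that w by (force simp: E_def)
          have "norm (\<Sum>j\<in>?C. Hs j w) \<le> real (card ?C) * (c * B n)"
            using sum_norm_bound[of ?C "\<lambda>j. Hs j w" "c * B n"] le by simp
          also have "\<dots> \<le> (real k + 1) * (c * B n)"
            using c B_pos[of n] by (intro mult_right_mono) auto
          also have "\<dots> = \<eta> * B n" by (simp add: c_def)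
          finally have "dist (S (n - k) w /\<^sub>R B n) (S n w /\<^sub>R B n) \<le> \<eta>"
            using B_pos[of n] unfolding split dist_norm
            by (simp add: scaleR_right_diff_distrib[symmetric] field_simps)
          then have "D * dist (S (n - k) w /\<^sub>R B n) (S n w /\<^sub>R B n) \<le> D * \<eta>"
            using D by (intro mult_left_mono)
          with f(2)[of "S (n - k) w /\<^sub>R B n" "S n w /\<^sub>R B n"] False show ?thesis by simp
        qed
      qed
      also have "\<dots> = D * \<eta> + 2 * prob E"
        using E by (subst Bochner_Integration.integral_add)
          (auto simp: emeasure_eq_measure prob_space intro!: integrable_real_indicator)
      also have "prob E \<le> real k * tail (c * B n)"
      proof -
        have "prob E \<le> real (card ?C) * tail (c * B n)"
          unfolding E_def by (rule prob_exists_le) auto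
        also have "\<dots> \<le> real k * tail (c * B n)" by (intro mult_right_mono) auto
        finally show ?thesis .
      qed
      finally show ?case using elim \<eta> by simp
    qed
    then show "\<exists>no. \<forall>n\<ge>no. norm (expectation (\<lambda>w. f (S (n - k) w /\<^sub>R B n)) - expectation (\<lambda>w. f (S n
        w /\<^sub>R B n)) - 0) < e"
      by (simp add: eventually_sequentially)
  qed
  have "(\<lambda>n. (expectation (\<lambda>w. f (S (n - k) w /\<^sub>R B n)) - expectation (\<lambda>w. f (S n w /\<^sub>R B n)))
      + expectation (\<lambda>w. f (S n w /\<^sub>R B n))) \<longlonglongrightarrow> 0 + expectation (\<lambda>w. f (V w))"
    using tendsto_add[OF diff0 expectation_stable_limit[OF fc f(1)]] by (simp add: S_def)
  then show ?thesis by (simp add: S_def)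
qed

end

section \<open>Overshoots without exactly \<open>k\<close> large summands\<close>

context heavy_tailed_sample
begin

lemma prob_all_in:
  assumes A: "finite A" "A \<subseteq> {1..}" and B: "\<And>j. j \<in> A \<Longrightarrow> B j \<in> sets borel"
  shows "{w \<in> space P. \<forall>j\<in>A. Hs j w \<in> B j} \<in> sets P"
    and "prob {w \<in> space P. \<forall>j\<in>A. Hs j w \<in> B j} = (\<Prod>j\<in>A. prob {w \<in> space P. H w \<in> B j})"
proof -
  have m: "Hs j -` B j \<inter> space P \<in> sets P" if "j \<in> A" for j
    using that A B Hs_measurable[of j] by (auto intro!: measurable_sets)
  show "{w \<in> space P. \<forall>j\<in>A. Hs j w \<in> B j} \<in> sets P"
  proof (rule sets.sets_Collect_finite_All[OF _ A(1)])
    show "{w \<in> space P. Hs j w \<in> B j} \<in> sets P" if "j \<in> A" for j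
      using m[OF that] by (simp add: vimage_def Int_def conj_commute)
  qed
  show "prob {w \<in> space P. \<forall>j\<in>A. Hs j w \<in> B j} = (\<Prod>j\<in>A. prob {w \<in> space P. H w \<in> B j})"
  proof (cases "A = {}")
    case False
    have "{w \<in> space P. \<forall>j\<in>A. Hs j w \<in> B j} = (\<Inter>j\<in>A. Hs j -` B j \<inter> space P)"
      using False by auto
    also have "prob \<dots> = (\<Prod>j\<in>A. prob (Hs j -` B j \<inter> space P))"
      using A B False by (intro indep_varsD[OF Hs_indep]) auto
    also have "\<dots> = (\<Prod>j\<in>A. prob {w \<in> space P. H w \<in> B j})"
    proof (rule prod.cong[OF refl])
      fix j assume "j \<in> A"
      moreover have "Hs j -` B j \<inter> space P = {w \<in> space P. Hs j w \<in> B j}" by auto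
      ultimately show "prob (Hs j -` B j \<inter> space P) = prob {w \<in> space P. H w \<in> B j}"
        using A B prob_Hs[of j "B j"] by auto
    qed
    finally show ?thesis .
  qed (simp add: prob_space)
qed

lemma prob_all_big:
  assumes "finite A" "A \<subseteq> {1..}"
  shows "prob {w \<in> space P. \<forall>j\<in>A. norm (Hs j w) > t} = tail t ^ card A"
  using prob_all_in(2)[OF assms, of "\<lambda>_. {x. norm x > t}"] by simp

lemma sets_all_big:
  assumes "finite A" "A \<subseteq> {1..}"
  shows "{w \<in> space P. \<forall>j\<in>A. norm (Hs j w) > t} \<in> sets P"
  using prob_all_in(1)[OF assms, of "\<lambda>_. {x. norm x > t}"] by simp

definition big :: "real \<Rightarrow> nat \<Rightarrow> 'w \<Rightarrow> nat set" where
  "big t n w = {j \<in> {1..n}. norm (Hs j w) > t}"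

lemma finite_big [simp]: "finite (big t n w)"
  by (simp add: big_def)

definition subsets_of_size :: "nat \<Rightarrow> nat \<Rightarrow> nat set set" where
  "subsets_of_size n m = {A. A \<subseteq> {1..n} \<and> card A = m}"

lemma finite_subsets_of_size [simp]: "finite (subsets_of_size n m)"
  unfolding subsets_of_size_def by (rule finite_subset[of _ "Pow {1..n}"]) auto

lemma card_subsets_of_size: "card (subsets_of_size n m) = n choose m"
  unfolding subsets_of_size_def using n_subsets[of "{1..n}" m] by simp

lemma subsets_of_sizeD:
  assumes "A \<in> subsets_of_size n m"
  shows "finite A" "A \<subseteq> {1..}" "A \<subseteq> {1..n}" "card A = m"
  using assms finite_subset[of A "{1..n}"] by (auto simp: subsets_of_size_def)

lemma choose_le_power: "real (n choose m) \<le> real n ^ m / fact m"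
proof -
  have "real ((n choose m) * fact m) \<le> real (n ^ m)"
    using binomial_fact_pow[of n m] by (simp only: of_nat_le_iff)
  then show ?thesis by (simp add: field_simps)
qed

lemma choose_le_power': "real (n choose m) \<le> real n ^ m"
proof -
  have "real n ^ m / fact m \<le> real n ^ m / 1"
    by (intro divide_left_mono) (auto simp: fact_ge_1)
  with choose_le_power[of n m] show ?thesis by linarith
qed

lemma sets_big_card: "{w \<in> space P. card (big t n w) \<ge> m} \<in> sets P"
  and prob_big_card_ge: "prob {w \<in> space P. card (big t n w) \<ge> m} \<le> (real n * tail t) ^ m"
proof -
  have eq: "{w \<in> space P. card (big t n w) \<ge> m} =
      (\<Union>A\<in>subsets_of_size n m. {w \<in> space P. \<forall>j\<in>A. norm (Hs j w) > t})" (is "?L = ?R")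
  proof (intro equalityI subsetI)
    fix w assume w: "w \<in> ?L"
    then obtain A where "A \<subseteq> big t n w" "card A = m" "finite A"
      using obtain_subset_with_card_n[of m "big t n w"] by auto
    then have "A \<in> subsets_of_size n m" "\<forall>j\<in>A. norm (Hs j w) > t"
      by (auto simp: big_def subsets_of_size_def)
    then show "w \<in> ?R" using w by blast
  next
    fix w assume "w \<in> ?R"
    then obtain A where A: "A \<in> subsets_of_size n m" "\<forall>j\<in>A. norm (Hs j w) > t" "w \<in> space P" by auto
    then have "A \<subseteq> big t n w" by (auto simp: big_def subsets_of_size_def)
    then have "card A \<le> card (big t n w)" by (intro card_mono) auto
    then show "w \<in> ?L" using A by (auto simp: subsets_of_size_def)
  qed
  have m: "{w \<in> space P. \<forall>j\<in>A. norm (Hs j w) > t} \<in> sets P" if "A \<in> subsets_of_size n m" for A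
    by (rule sets_all_big[OF subsets_of_sizeD(1,2)[OF that]])
  show "?L \<in> sets P"
    unfolding eq by (intro sets.finite_UN finite_subsets_of_size m)
  have "prob ?L \<le> (\<Sum>A\<in>subsets_of_size n m. prob {w \<in> space P. \<forall>j\<in>A. norm (Hs j w) > t})"
    unfolding eq using m by (intro finite_measure_subadditive_finite) auto
  also have "\<dots> = (\<Sum>A\<in>subsets_of_size n m. tail t ^ m)"
  proof (rule sum.cong[OF refl])
    fix A assume A: "A \<in> subsets_of_size n m"
    show "prob {w \<in> space P. \<forall>j\<in>A. norm (Hs j w) > t} = tail t ^ m"
      using prob_all_big[OF subsets_of_sizeD(1,2)[OF A]] subsets_of_sizeD(4)[OF A] by simp
  qed
  also have "\<dots> = real (n choose m) * tail t ^ m" by (simp add: card_subsets_of_size)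
  also have "\<dots> \<le> real n ^ m * tail t ^ m"
    by (intro mult_right_mono choose_le_power') auto
  finally show "prob ?L \<le> (real n * tail t) ^ m" by (simp add: power_mult_distrib)
qed

end

text \<open>\<open>ltail\<close> stands for the tail of \<open>L\<close> and \<sigma> for the
  spectral measure. The independence of the two families is packaged as the product formula
  \<open>prob_big_and_Ls\<close>, and the spectral limit as the one-sided bound
  \<open>directions\<close>.\<close>

locale soft_overshoot = stably_attracted_sample P H \<alpha> Hs M V B
  for P :: "'w measure" and H :: "'w \<Rightarrow> 'a::euclidean_space" and \<alpha> :: real and Hs M V B +
  fixes Ls :: "nat \<Rightarrow> 'w \<Rightarrow> real" and ltail :: "real \<Rightarrow> real" and \<sigma> :: "'a measure" and k :: nat
  assumes Ls_measurable: "\<And>j. j \<ge> 1 \<Longrightarrow> Ls j \<in> borel_measurable P"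
    and Ls_nonneg: "\<And>j w. j \<ge> 1 \<Longrightarrow> w \<in> space P \<Longrightarrow> Ls j w \<ge> 0"
    and prob_big_and_Ls: "\<And>A t j x. finite A \<Longrightarrow> A \<subseteq> {1..} \<Longrightarrow> j \<ge> 1 \<Longrightarrow>
      prob {w \<in> space P. (\<forall>i\<in>A. norm (Hs i w) > t) \<and> Ls j w > x} = tail t ^ card A * ltail x"
    and ltail_nonneg: "\<And>x. ltail x \<ge> 0"
    and ltail_small: "ltail \<in> o[at_top](\<lambda>x. tail x ^ (k - 1))"
    and \<sigma>_prob: "prob_space \<sigma>"
    and \<sigma>_sets: "sets \<sigma> = sets (restrict_space borel (sphere 0 1))"
    and directions: "\<And>F e. closed F \<Longrightarrow> F \<subseteq> sphere 0 1 \<Longrightarrow> e > 0 \<Longrightarrow>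
      eventually (\<lambda>t. prob {w \<in> space P. norm (H w) > t \<and> sgn (H w) \<in> F}
        \<le> (measure \<sigma> F + e) * tail t) at_top"
    and k_ge_2: "k \<ge> 2"
begin

abbreviation S :: "nat \<Rightarrow> 'w \<Rightarrow> 'a" where
  "S \<equiv> trunc_sum M Hs Ls"

abbreviation X :: "nat \<Rightarrow> nat \<Rightarrow> 'w \<Rightarrow> 'a" where
  "X n j w \<equiv> soft_truncate (M n) (Hs j w) (Ls j w)"

lemma S_measurable [measurable]: "S n \<in> borel_measurable P"
proof -
  have "(\<lambda>w. X n j w) \<in> borel_measurable P" if "j \<in> {1..n}" for j
  proof -
    have [measurable]: "Hs j \<in> borel_measurable P" "Ls j \<in> borel_measurable P"
      using that Hs_measurable Ls_measurable by auto
    show ?thesis unfolding soft_truncate_def by measurable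
  qed
  then show ?thesis unfolding trunc_sum_def[abs_def] by (rule borel_measurable_sum)
qed

text \<open>Regular variation moves the tail of \<open>H\<close> from \<open>c * M n\<close> to
  \<open>M n\<close> at the cost of a convergent factor.\<close>

lemma ltail_ratio:
  assumes c: "c > 0"
  shows "(\<lambda>n. ltail (c * M n) / tail (M n) ^ (k - 1)) \<longlonglongrightarrow> 0"
proof -
  have "((\<lambda>x. ltail x / tail x ^ (k - 1)) \<longlongrightarrow> 0) at_top"
    using ltail_small by (rule smalloD_tendsto)
  moreover have "filterlim (\<lambda>n. c * M n) at_top sequentially"
    by (rule filterlim_tendsto_pos_mult_at_top[OF tendsto_const c M_lim])
  ultimately have 1: "(\<lambda>n. ltail (c * M n) / tail (c * M n) ^ (k - 1)) \<longlonglongrightarrow> 0"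
    by (rule filterlim_compose)
  have "(\<lambda>n. (ltail (c * M n) / tail (c * M n) ^ (k - 1)) * (tail (c * M n) / tail (M n)) ^ (k - 1))
      \<longlonglongrightarrow> 0 * (c powr (- \<alpha>)) ^ (k - 1)"
    by (intro tendsto_mult 1 tendsto_power tail_ratio_lim c)
  moreover have "(ltail (c * M n) / tail (c * M n) ^ (k - 1)) * (tail (c * M n) / tail (M n)) ^ (k - 1)
      = ltail (c * M n) / tail (M n) ^ (k - 1)" for n
    using G_pos[of "c * M n"] by (simp add: power_divide)
  ultimately show ?thesis by simp
qed

lemma norm_soft_truncate_le:
  assumes "m > 0" "l \<ge> 0"
  shows "norm (soft_truncate m h l :: 'a) \<le> min (norm h) m + (if norm h > m then l else 0)"
  using assms by (auto simp: soft_truncate_def norm_sgn)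

text \<open>Pathwise accounting: the remainder and the excesses use up at most
  \<open>\<delta> * M n\<close>, and at most \<open>k\<close> summands, each capped at
  \<open>M n\<close>, must supply the rest. Hence there are exactly \<open>k\<close> of them and
  each exceeds \<open>(1 - \<delta>) * M n\<close>; since not all exceed \<open>M n\<close>, one
  lies in the thin shell in between.\<close>

lemma overshoot_cases:
  assumes w: "w \<in> space P" and n: "n \<ge> 1" and \<epsilon>: "0 < \<epsilon>" "\<epsilon> < 1" and \<delta>: "0 < \<delta>" "\<delta> < 1"
    and over: "norm (S n w) > real k * M n"
    and few: "card (big (\<epsilon> * M n) n w) \<le> k"
    and rest: "norm (\<Sum>j=1..n. if norm (Hs j w) \<le> \<epsilon> * M n then Hs j w else 0) \<le> \<delta> / 2 * M n"
    and excess: "\<And>j. j \<in> {1..n} \<Longrightarrow> norm (Hs j w) > M n \<Longrightarrow> Ls j w \<le> \<delta> / (2 * real k) * M n"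
    and notk: "card (big (M n) n w) \<noteq> k"
  shows "\<exists>A\<in>subsets_of_size n k. \<exists>i\<in>A. norm (Hs i w) \<le> M n \<and> (\<forall>j\<in>A. norm (Hs j w) > (1 - \<delta>) * M n)"
proof -
  have Mn: "M n > 0" using M_pos n by simp
  have kp: "real k > 0" using k_ge_2 by simp
  define J where "J = big (\<epsilon> * M n) n w"
  have J: "finite J" "J \<subseteq> {1..n}" "card J \<le> k" using few by (auto simp: J_def big_def)
  define m where "m = (\<lambda>j. min (norm (Hs j w)) (M n))"
  have "\<epsilon> * M n < 1 * M n" using \<epsilon> Mn by (intro mult_strict_right_mono) auto
  then have small: "X n j w = Hs j w" if "norm (Hs j w) \<le> \<epsilon> * M n" for j
    using that by (simp add: soft_truncate_def)
  have "S n w = (\<Sum>j\<in>{1..n} - J. X n j w) + (\<Sum>j\<in>J. X n j w)"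
    unfolding trunc_sum_def using J by (intro sum.subset_diff) auto
  also have "(\<Sum>j\<in>{1..n} - J. X n j w) = (\<Sum>j=1..n. if norm (Hs j w) \<le> \<epsilon> * M n then Hs j w else 0)"
    by (rule sum.mono_neutral_cong_left) (auto simp: J_def big_def small)
  finally have "norm (S n w) \<le> \<delta> / 2 * M n + norm (\<Sum>j\<in>J. X n j w)"
    using rest norm_triangle_ineq by (metis (no_types, lifting) add_mono_thms_linordered_semiring(3)
        order_trans)
  also have "norm (\<Sum>j\<in>J. X n j w) \<le> (\<Sum>j\<in>J. m j + \<delta> / (2 * real k) * M n)"
  proof (rule sum_norm_le)
    fix j assume j: "j \<in> J"
    then have "norm (X n j w) \<le> m j + (if norm (Hs j w) > M n then Ls j w else 0)"
      unfolding m_def using J(2) Ls_nonneg w Mn by (intro norm_soft_truncate_le) auto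
    also have "(if norm (Hs j w) > M n then Ls j w else 0) \<le> \<delta> / (2 * real k) * M n"
      using excess[of j] j J(2) \<delta> Mn kp by auto
    finally show "norm (X n j w) \<le> m j + \<delta> / (2 * real k) * M n" by simp
  qed
  also have "\<dots> = (\<Sum>j\<in>J. m j) + real (card J) * (\<delta> / (2 * real k) * M n)"
    by (simp add: sum.distrib)
  also have "real (card J) * (\<delta> / (2 * real k) * M n) \<le> real k * (\<delta> / (2 * real k) * M n)"
    using J(3) \<delta> Mn kp by (intro mult_right_mono) auto
  also have "\<dots> = \<delta> / 2 * M n" using kp by simp
  finally have sum_gt: "(\<Sum>j\<in>J. m j) > (real k - \<delta>) * M n"
    using over by (simp add: algebra_simps)
  have m_le: "m j \<le> M n" for j by (simp add: m_def)
  have card_J: "card J = k"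
  proof (rule ccontr)
    assume "card J \<noteq> k"
    then have "real (card J) \<le> real k - 1" using J(3) by linarith
    have "(\<Sum>j\<in>J. m j) \<le> real (card J) * M n" using m_le sum_bounded_above[of J m "M n"] by simp
    also have "\<dots> \<le> (real k - 1) * M n"
      using \<open>real (card J) \<le> real k - 1\<close> Mn by (intro mult_right_mono) auto
    also have "\<dots> \<le> (real k - \<delta>) * M n" using \<delta> Mn by (intro mult_right_mono) auto
    finally show False using sum_gt by simp
  qed
  have big_J: "norm (Hs i w) > (1 - \<delta>) * M n" if "i \<in> J" for i
  proof -
    have "(\<Sum>j\<in>J. m j) = m i + (\<Sum>j\<in>J - {i}. m j)" using that J by (simp add: sum.remove)
    also have "(\<Sum>j\<in>J - {i}. m j) \<le> real (card (J - {i})) * M n"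
      using m_le sum_bounded_above[of "J - {i}" m "M n"] by simp
    also have "real (card (J - {i})) = real k - 1" using that J card_J k_ge_2 by (simp add: of_nat_diff)
    finally have "m i > (1 - \<delta>) * M n" using sum_gt by (simp add: algebra_simps)
    then show ?thesis by (simp add: m_def)
  qed
  have "big (M n) n w \<subseteq> J" using \<open>\<epsilon> * M n < 1 * M n\<close> by (auto simp: J_def big_def)
  moreover have "big (M n) n w \<noteq> J" using notk card_J by auto
  ultimately obtain i where i: "i \<in> J" "i \<notin> big (M n) n w" by auto
  then have "norm (Hs i w) \<le> M n" using J(2) by (auto simp: big_def)
  then show ?thesis using i big_J J card_J by (auto simp: subsets_of_size_def)
qed

lemma prob_marginal_subset:
  assumes A: "A \<in> subsets_of_size n k" and i: "i \<in> A" and s: "s \<le> t"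
  shows "{w \<in> space P. norm (Hs i w) \<le> t \<and> (\<forall>j\<in>A. norm (Hs j w) > s)} \<in> sets P"
    and "prob {w \<in> space P. norm (Hs i w) \<le> t \<and> (\<forall>j\<in>A. norm (Hs j w) > s)}
      = (tail s - tail t) * tail s ^ (k - 1)"
proof -
  note A' = subsets_of_sizeD[OF A]
  define Bs where "Bs = (\<lambda>j. if j = i then {x::'a. s < norm x \<and> norm x \<le> t} else {x. norm x > s})"
  have 1: "{x::'a. s < norm x \<and> norm x \<le> t} \<in> sets borel" "{x::'a. s < norm x} \<in> sets borel"
    by measurable
  have Bs: "Bs j \<in> sets borel" for j using 1 by (cases "j = i") (simp_all add: Bs_def)
  have eq: "{w \<in> space P. norm (Hs i w) \<le> t \<and> (\<forall>j\<in>A. norm (Hs j w) > s)}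
      = {w \<in> space P. \<forall>j\<in>A. Hs j w \<in> Bs j}"
    using i by (auto simp: Bs_def)
  show "{w \<in> space P. norm (Hs i w) \<le> t \<and> (\<forall>j\<in>A. norm (Hs j w) > s)} \<in> sets P"
    unfolding eq by (rule prob_all_in(1)[OF A'(1,2) Bs])
  have "prob {w \<in> space P. \<forall>j\<in>A. Hs j w \<in> Bs j} = (\<Prod>j\<in>A. prob {w \<in> space P. H w \<in> Bs j})"
    by (rule prob_all_in(2)[OF A'(1,2) Bs])
  also have "\<dots> = prob {w \<in> space P. H w \<in> Bs i} * (\<Prod>j\<in>A - {i}. prob {w \<in> space P. H w \<in> Bs j})"
    using A'(1) i by (rule prod.remove)
  also have "(\<Prod>j\<in>A - {i}. prob {w \<in> space P. H w \<in> Bs j}) = (\<Prod>j\<in>A - {i}. tail s)"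
    by (intro prod.cong) (auto simp: Bs_def)
  also have "\<dots> = tail s ^ (k - 1)"
    unfolding prod_constant using A' i by (simp only: card_Diff_singleton)
  also have "prob {w \<in> space P. H w \<in> Bs i} = tail s - tail t"
  proof -
    have "{w \<in> space P. H w \<in> Bs i} = {w \<in> space P. norm (H w) > s} - {w \<in> space P. norm (H w) > t}"
      by (auto simp: Bs_def)
    also have "prob \<dots> = tail s - tail t"
      using s by (intro finite_measure_Diff) auto
    finally show ?thesis .
  qed
  finally show "prob {w \<in> space P. norm (Hs i w) \<le> t \<and> (\<forall>j\<in>A. norm (Hs j w) > s)}
      = (tail s - tail t) * tail s ^ (k - 1)"
    unfolding eq .
qed

lemma sets_overshoot_big: "{w \<in> space P. norm (S n w) > c \<and> card (big t n w) \<noteq> m} \<in> sets P"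
proof -
  have "{w \<in> space P. card (big t n w) = m} =
      {w \<in> space P. card (big t n w) \<ge> m} - {w \<in> space P. card (big t n w) \<ge> Suc m}" by auto
  then have "{w \<in> space P. card (big t n w) = m} \<in> sets P" using sets_big_card by auto
  moreover have "{w \<in> space P. norm (S n w) > c} \<in> sets P" by measurable
  moreover have "{w \<in> space P. norm (S n w) > c \<and> card (big t n w) \<noteq> m} =
      {w \<in> space P. norm (S n w) > c} - {w \<in> space P. card (big t n w) = m}" by auto
  ultimately show ?thesis by auto
qed

lemma overshoot_residual_bound:
  assumes n: "n \<ge> 1" and \<epsilon>: "0 < \<epsilon>" "\<epsilon> < 1" and \<delta>: "0 < \<delta>" "\<delta> < 1"
  shows "prob {w \<in> space P. norm (S n w) > real k * M n \<and> card (big (M n) n w) \<noteq> k} \<le>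
    (real n * tail (\<epsilon> * M n)) ^ (Suc k) +
    prob {w \<in> space P. norm (\<Sum>j=1..n. if norm (Hs j w) \<le> \<epsilon> * M n then Hs j w else 0) > \<delta> / 2 * M n} +
    exc n * ltail (\<delta> / (2 * real k) * M n) +
    real n ^ k * (real k * ((tail ((1 - \<delta>) * M n) - tail (M n)) * tail ((1 - \<delta>) * M n) ^ (k - 1)))"
proof -
  have Mn: "M n > 0" using M_pos n by simp
  define x where "x = \<delta> / (2 * real k) * M n"
  define s where "s = (1 - \<delta>) * M n"
  have s: "s \<le> M n" unfolding s_def using \<delta> Mn by (simp add: algebra_simps)
  define E1 where "E1 = {w \<in> space P. card (big (\<epsilon> * M n) n w) \<ge> Suc k}"
  define R where "R = (\<lambda>w. \<Sum>j=1..n. if norm (Hs j w) \<le> \<epsilon> * M n then Hs j w else 0)"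
  define E2 where "E2 = {w \<in> space P. norm (R w) > \<delta> / 2 * M n}"
  \<comment> \<open>An excess matters only if the same summand is large. This supplies the factor
    \<open>tail (M n)\<close> that complements the \<open>k - 1\<close> factors in the assumption on
    \<open>ltail\<close>.\<close>
  define E3 where "E3 = (\<Union>j\<in>{1..n}. {w \<in> space P. (\<forall>i\<in>{j}. norm (Hs i w) > M n) \<and> Ls j w > x})"
  define E where "E = (\<lambda>A i. {w \<in> space P. norm (Hs i w) \<le> M n \<and> (\<forall>j\<in>A. norm (Hs j w) > s)})"
  define E4 where "E4 = (\<Union>A\<in>subsets_of_size n k. \<Union>i\<in>A. E A i)"
  have t: "(\<lambda>x. if norm x \<le> y then x else 0 :: 'a) \<in> borel_measurable borel" for y
    by measurable
  have R [measurable]: "R \<in> borel_measurable P"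
    unfolding R_def by (intro borel_measurable_sum measurable_compose[OF Hs_measurable t]) auto
  have m1: "E1 \<in> sets P" unfolding E1_def by (rule sets_big_card)
  have m2: "E2 \<in> sets P" unfolding E2_def by measurable
  have m3': "{w \<in> space P. (\<forall>i\<in>{j}. norm (Hs i w) > M n) \<and> Ls j w > x} \<in> sets P" if "j \<in> {1..n}" for j
  proof -
    have [measurable]: "Hs j \<in> borel_measurable P" "Ls j \<in> borel_measurable P"
      using that Hs_measurable Ls_measurable by auto
    show ?thesis by simp
  qed
  have m3: "E3 \<in> sets P" unfolding E3_def by (intro sets.finite_UN m3') auto
  have m4': "E A i \<in> sets P" if "A \<in> subsets_of_size n k" "i \<in> A" for A i
    unfolding E_def by (rule prob_marginal_subset(1)[OF that s])
  have m4'': "(\<Union>i\<in>A. E A i) \<in> sets P" if "A \<in> subsets_of_size n k" for A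
    using that subsets_of_sizeD(1) by (intro sets.finite_UN m4') auto
  have m4: "E4 \<in> sets P" unfolding E4_def by (intro sets.finite_UN m4'') auto
  have "{w \<in> space P. norm (S n w) > real k * M n \<and> card (big (M n) n w) \<noteq> k} \<subseteq> E1 \<union> E2 \<union> E3 \<union> E4"
  proof
    fix w assume w: "w \<in> {w \<in> space P. norm (S n w) > real k * M n \<and> card (big (M n) n w) \<noteq> k}"
    show "w \<in> E1 \<union> E2 \<union> E3 \<union> E4"
    proof (rule ccontr)
      assume neg: "w \<notin> E1 \<union> E2 \<union> E3 \<union> E4"
      have "\<exists>A\<in>subsets_of_size n k. \<exists>i\<in>A. norm (Hs i w) \<le> M n \<and> (\<forall>j\<in>A. norm (Hs j w) > (1 - \<delta>) * M n)"
      proof (rule overshoot_cases[OF _ n \<epsilon> \<delta>])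
        show "Ls j w \<le> \<delta> / (2 * real k) * M n" if "j \<in> {1..n}" "norm (Hs j w) > M n" for j
        proof -
          have "w \<notin> {w \<in> space P. (\<forall>i\<in>{j}. norm (Hs i w) > M n) \<and> Ls j w > x}"
            using neg that(1) unfolding E3_def by blast
          then show ?thesis using w that(2) by (auto simp: x_def not_less)
        qed
        show "card (big (\<epsilon> * M n) n w) \<le> k" using neg w by (auto simp: E1_def)
        show "norm (\<Sum>j=1..n. if norm (Hs j w) \<le> \<epsilon> * M n then Hs j w else 0) \<le> \<delta> / 2 * M n"
          using neg w unfolding E2_def R_def by auto
      qed (use w in auto)
      then have "w \<in> E4" using w unfolding E4_def E_def s_def by blast
      with neg show False by simp
    qed
  qed
  then have "prob {w \<in> space P. norm (S n w) > real k * M n \<and> card (big (M n) n w) \<noteq> k}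
      \<le> prob (E1 \<union> E2 \<union> E3 \<union> E4)"
    using m1 m2 m3 m4 by (intro finite_measure_mono) auto
  also have "\<dots> \<le> prob E1 + prob E2 + prob E3 + prob E4"
    using m1 m2 m3 m4 measure_Un_le[of "E1 \<union> E2 \<union> E3" P E4] measure_Un_le[of "E1 \<union> E2" P E3]
      measure_Un_le[of E1 P E2] by auto
  also have "prob E1 \<le> (real n * tail (\<epsilon> * M n)) ^ (Suc k)"
    unfolding E1_def by (rule prob_big_card_ge)
  also have "prob E3 \<le> exc n * ltail x"
  proof -
    have "prob E3 \<le> (\<Sum>j\<in>{1..n}. prob {w \<in> space P. (\<forall>i\<in>{j}. norm (Hs i w) > M n) \<and> Ls j w > x})"
      unfolding E3_def using m3' by (intro finite_measure_subadditive_finite) auto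
    also have "\<dots> = (\<Sum>j\<in>{1..n}. tail (M n) ^ card {j} * ltail x)"
      by (intro sum.cong prob_big_and_Ls refl) auto
    finally show ?thesis by (simp add: exc_def)
  qed
  also have "prob E4 \<le> real n ^ k * (real k * ((tail s - tail (M n)) * tail s ^ (k - 1)))"
  proof -
    let ?q = "(tail s - tail (M n)) * tail s ^ (k - 1)"
    have q: "?q \<ge> 0" using G_antimono[OF s] by simp
    have "prob E4 \<le> (\<Sum>A\<in>subsets_of_size n k. prob (\<Union>i\<in>A. E A i))"
      unfolding E4_def using m4'' by (intro finite_measure_subadditive_finite) auto
    also have "\<dots> \<le> (\<Sum>A\<in>subsets_of_size n k. real k * ?q)"
    proof (rule sum_mono)
      fix A assume A: "A \<in> subsets_of_size n k"
      have "prob (\<Union>i\<in>A. E A i) \<le> (\<Sum>i\<in>A. prob (E A i))"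
        using m4'[OF A] subsets_of_sizeD(1)[OF A] by (intro finite_measure_subadditive_finite) auto
      also have "\<dots> = (\<Sum>i\<in>A. ?q)"
        unfolding E_def by (intro sum.cong refl prob_marginal_subset(2)[OF A _ s])
      also have "\<dots> = real k * ?q" using subsets_of_sizeD(4)[OF A] by simp
      finally show "prob (\<Union>i\<in>A. E A i) \<le> real k * ?q" .
    qed
    also have "\<dots> = real (n choose k) * (real k * ?q)" by (simp add: card_subsets_of_size)
    also have "\<dots> \<le> real n ^ k * (real k * ?q)"
      using q by (intro mult_right_mono choose_le_power') auto
    finally show ?thesis .
  qed
  finally show ?thesis by (simp add: E2_def R_def x_def s_def)
qed

text \<open>\<delta> is fixed first, to make the shell term small, and \<epsilon> is then chosen for
  this \<delta> by the deviation bound. The other terms vanish for fixed \<delta> and \<epsilon>;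
  having \<open>k + 1\<close> large summands costs an extra factor \<open>exc n\<close>.\<close>

lemma overshoot_residual:
  "(\<lambda>n. prob {w \<in> space P. norm (S n w) > real k * M n \<and> card (big (M n) n w) \<noteq> k} / exc n ^ k) \<longlonglongrightarrow> 0"
proof (rule LIMSEQ_I)
  fix e :: real assume e: "e > 0"
  \<comment> \<open>The limit of the normalised shell term; it vanishes at \<delta> = 0 because the
    shell becomes empty.\<close>
  define g where "g = (\<lambda>\<delta>. real k * (((1 - \<delta>) powr (- \<alpha>) - 1) * ((1 - \<delta>) powr (- \<alpha>)) ^ (k - 1)))"
  have "(g \<longlongrightarrow> real k * (((1 - 0) powr (- \<alpha>) - 1) * ((1 - 0) powr (- \<alpha>)) ^ (k - 1))) (at_right 0)"
    unfolding g_def by (intro tendsto_intros) auto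
  then have "eventually (\<lambda>\<delta>. g \<delta> < e) (at_right 0)"
    by (rule order_tendstoD) (use e in simp)
  moreover have "eventually (\<lambda>\<delta>::real. \<delta> \<in> {0<..<1}) (at_right 0)"
    by (rule eventually_at_right_real) simp
  ultimately have "eventually (\<lambda>\<delta>. g \<delta> < e \<and> \<delta> \<in> {0<..<1}) (at_right 0)" by (rule eventually_conj)
  then obtain \<delta> where \<delta>: "g \<delta> < e" "0 < \<delta>" "\<delta> < 1"
    using eventually_happens[of _ "at_right (0::real)"] by auto
  have "\<delta> / 2 > 0" using \<delta> by simp
  then obtain \<epsilon> where \<epsilon>: "0 < \<epsilon>" "\<epsilon> < 1" "(\<lambda>n. prob {w \<in> space P.
    norm (\<Sum>j=1..n. if norm (Hs j w) \<le> \<epsilon> * M n then Hs j w else 0) > \<delta> / 2 * M n} / exc n ^ k) \<longlonglongrightarrow> 0"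
    using truncated_sum_deviation by blast
  define T where "T = (\<lambda>n. exc n * (tail (\<epsilon> * M n) / tail (M n)) ^ Suc k +
    prob {w \<in> space P. norm (\<Sum>j=1..n. if norm (Hs j w) \<le> \<epsilon> * M n then Hs j w else 0) > \<delta> / 2 * M n}
        / exc n ^ k +
    ltail (\<delta> / (2 * real k) * M n) / tail (M n) ^ (k - 1) +
    real k * ((tail ((1 - \<delta>) * M n) / tail (M n) - 1) * (tail ((1 - \<delta>) * M n) / tail (M n)) ^ (k - 1)))"
  have "T \<longlonglongrightarrow> 0 * (\<epsilon> powr (- \<alpha>)) ^ Suc k + 0 + 0 +
      real k * (((1 - \<delta>) powr (- \<alpha>) - 1) * ((1 - \<delta>) powr (- \<alpha>)) ^ (k - 1))"
    unfolding T_def using \<delta> \<epsilon> k_ge_2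
    by (intro tendsto_add tendsto_mult tendsto_power tendsto_diff tendsto_const exc_lim tail_ratio_lim
        ltail_ratio \<epsilon>(3)) auto
  then have "T \<longlonglongrightarrow> g \<delta>" by (simp add: g_def)
  then have "eventually (\<lambda>n. T n < e) sequentially" by (rule order_tendstoD) (rule \<delta>(1))
  then have "eventually (\<lambda>n. norm (prob {w \<in> space P. norm (S n w) > real k * M n \<and> card (big (M n)
      n w) \<noteq> k} / exc n ^ k - 0) < e) sequentially"
    using eventually_ge_1
  proof eventually_elim
    case (elim n)
    let ?p = "prob {w \<in> space P. norm (S n w) > real k * M n \<and> card (big (M n) n w) \<noteq> k}"
    let ?r = "prob {w \<in> space P. norm (\<Sum>j=1..n. if norm (Hs j w) \<le> \<epsilon> * M n then Hs j w else 0) > \<delta> / 2 * M n}"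
    define p where "p = tail (M n)"
    define t1 where "t1 = tail (\<epsilon> * M n)"
    define t2 where "t2 = tail ((1 - \<delta>) * M n)"
    define l where "l = ltail (\<delta> / (2 * real k) * M n)"
    have p: "p > 0" unfolding p_def by (rule G_pos)
    have np: "real n > 0" using elim by simp
    have ex: "exc n = real n * p" by (simp add: exc_def p_def)
    obtain k' where k': "k = Suc k'" using k_ge_2 by (cases k) auto
    have k'1: "k' \<ge> 1" using k_ge_2 k' by simp
    have a1: "(real n * t1) ^ Suc k / exc n ^ k = exc n * (t1 / p) ^ Suc k"
      using p np by (simp add: ex power_mult_distrib power_divide)
    have l0: "l \<ge> 0" unfolding l_def by (rule ltail_nonneg)
    \<comment> \<open>The power of \<open>n\<close> gained in the denominator is simply dropped:
      \<open>exc n \<ge> tail (M n)\<close> is enough.\<close>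
    have a3: "exc n * l / exc n ^ k \<le> l / p ^ (k - 1)"
    proof -
      have "exc n * l / exc n ^ k = l / exc n ^ k'"
        using p np by (simp add: k' ex)
      also have "\<dots> \<le> l / p ^ k'"
      proof (rule divide_left_mono)
        have "1 * p \<le> real n * p" using elim p by (intro mult_right_mono) auto
        then show "p ^ k' \<le> exc n ^ k'" unfolding ex using p by (intro power_mono) auto
      qed (use l0 p np ex in auto)
      finally show ?thesis by (simp add: k')
    qed
    have a4: "real n ^ k * (real k * ((t2 - p) * t2 ^ (k - 1))) / exc n ^ k
        = real k * ((t2 / p - 1) * (t2 / p) ^ (k - 1))"
    proof -
      have "(t2 / p - 1) * (t2 / p) ^ k' = (t2 - p) * t2 ^ k' / p ^ Suc k'"
        using p by (simp add: power_divide diff_divide_distrib[symmetric] field_simps)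
      moreover have "real n ^ k * (real k * ((t2 - p) * t2 ^ k')) / exc n ^ k
          = real k * ((t2 - p) * t2 ^ k' / p ^ k)"
        using np p by (simp add: ex power_mult_distrib)
      ultimately show ?thesis by (simp add: k')
    qed
    have "?p \<le> (real n * t1) ^ (Suc k) + ?r + exc n * l + real n ^ k * (real k * ((t2 - p) * t2 ^ (k - 1)))"
      unfolding t1_def t2_def l_def p_def
      by (rule overshoot_residual_bound[OF elim(2) \<epsilon>(1,2) \<delta>(2,3)])
    then have "?p / exc n ^ k \<le> ((real n * t1) ^ (Suc k) + ?r + exc n * l
        + real n ^ k * (real k * ((t2 - p) * t2 ^ (k - 1)))) / exc n ^ k"
      using exc_nonneg[of n] by (intro divide_right_mono) auto
    also have "\<dots> = (real n * t1) ^ (Suc k) / exc n ^ k + ?r / exc n ^ k + exc n * l / exc n ^ k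
        + real n ^ k * (real k * ((t2 - p) * t2 ^ (k - 1))) / exc n ^ k"
      by (simp only: add_divide_distrib)
    also have "\<dots> \<le> T n"
      unfolding a1 a4 using a3 unfolding T_def t1_def t2_def l_def p_def by linarith
    finally have "?p / exc n ^ k < e" using elim by linarith
    moreover have "?p / exc n ^ k \<ge> 0" using exc_nonneg[of n] by simp
    ultimately show ?case by simp
  qed
  then show "\<exists>no. \<forall>n\<ge>no. norm (prob {w \<in> space P. norm (S n w) > real k * M n \<and> card (big (M n) n w)
      \<noteq> k} / exc n ^ k - 0) < e"
    by (simp add: eventually_sequentially)
qed

end

section \<open>Overshoots with exactly \<open>k\<close> large summands\<close>

text \<open>
  The parallelogram law makes the unit vectors close to each other; expanding the square of the norm
  and using that their sum has norm at most \<open>card A\<close> leaves the sign condition on \<open>\<theta> i \<bullet> v\<close>.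
\<close>

lemma overshoot_geometry:
  fixes \<theta> :: "nat \<Rightarrow> 'a::euclidean_space"
  assumes A: "finite A" "i \<in> A" and unit: "\<And>j. j \<in> A \<Longrightarrow> norm (\<theta> j) = 1"
    and \<beta>: "\<beta> > 0" and z: "norm (v + y) \<le> Z" and y: "norm y \<le> \<tau>"
    and over: "norm ((\<Sum>j\<in>A. \<theta> j) + \<beta> *\<^sub>R (v + y)) > real (card A)"
    and small1: "\<beta> * Z \<le> 2" and small2: "\<beta> * Z\<^sup>2 + 2 * sqrt (\<beta> * Z) * Z \<le> \<tau>"
    and small3: "2 * (2 * sqrt (\<beta> * Z) + \<beta> * Z) \<le> \<tau>"
  shows "\<And>j. j \<in> A \<Longrightarrow> dist (\<theta> i) (\<theta> j) \<le> \<tau>"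
    and "\<theta> i \<bullet> v \<ge> - 2 * \<tau>"
    and "dist (sgn ((\<Sum>j\<in>A. \<theta> j) + \<beta> *\<^sub>R (v + y))) (\<theta> i) \<le> \<tau>"
proof -
  define k where "k = real (card A)"
  define T where "T = (\<Sum>j\<in>A. \<theta> j)"
  \<comment> \<open>The parallelogram law gives this radius: two unit vectors whose sum has norm at
    least \<open>2 - \<beta> * Z\<close> differ by at most the square root of
    \<open>4 * \<beta> * Z\<close>. For fixed \<open>Z\<close> all smallness conditions hold once
    \<beta> is small.\<close>
  define \<rho> where "\<rho> = 2 * sqrt (\<beta> * Z)"
  define x where "x = v + y"
  have k1: "k \<ge> 1" unfolding k_def using A by (auto simp: Suc_le_eq card_gt_0_iff)
  have Z: "Z \<ge> 0" using norm_ge_zero z by (rule order_trans)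
  have bZ: "\<beta> * Z \<ge> 0" using \<beta> Z by simp
  have \<rho>0: "\<rho> \<ge> 0" unfolding \<rho>_def using bZ by simp
  have nx: "norm (\<beta> *\<^sub>R x) \<le> \<beta> * Z" using z \<beta> by (simp add: x_def mult_left_mono)
  have T_le: "norm T \<le> k"
    unfolding T_def k_def using sum_norm_bound[of A \<theta> 1] unit by simp
  have T_ge: "norm T > k - \<beta> * Z"
    using over norm_triangle_ineq[of T "\<beta> *\<^sub>R x"] nx by (simp add: T_def x_def k_def)
  have close: "dist (\<theta> i) (\<theta> j) \<le> \<rho>" if j: "j \<in> A" for j
  proof (cases "j = i")
    case False
    have "T = \<theta> i + (\<theta> j + (\<Sum>l\<in>A - {i} - {j}. \<theta> l))"
      unfolding T_def using A j False by (simp add: sum.remove[of A i] sum.remove[of "A - {i}" j])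
    then have "norm T \<le> norm (\<theta> i + \<theta> j) + norm (\<Sum>l\<in>A - {i} - {j}. \<theta> l)"
      by (metis add.assoc norm_triangle_ineq)
    also have "norm (\<Sum>l\<in>A - {i} - {j}. \<theta> l) \<le> real (card (A - {i} - {j}))"
      using sum_norm_bound[of "A - {i} - {j}" \<theta> 1] unit by simp
    also have "real (card (A - {i} - {j})) = k - 2"
    proof -
      have "{i, j} \<subseteq> A" using A j by simp
      then have "card {i, j} \<le> card A" using A by (intro card_mono)
      moreover have "card (A - {i} - {j}) = card A - 2"
        using A j False by (simp add: card_Diff_singleton)
      ultimately show ?thesis using False unfolding k_def by (simp add: of_nat_diff)
    qed
    finally have "norm (\<theta> i + \<theta> j) \<ge> 2 - \<beta> * Z" using T_ge by simp
    then have "(2 - \<beta> * Z)\<^sup>2 \<le> (norm (\<theta> i + \<theta> j))\<^sup>2"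
      using small1 by (intro power_mono) auto
    moreover have "(norm (\<theta> i + \<theta> j))\<^sup>2 + (norm (\<theta> i - \<theta> j))\<^sup>2 = 4"
      using unit[OF A(2)] unit[OF j]
      by (simp add: power2_norm_eq_inner inner_add_left inner_add_right inner_diff_left
          inner_diff_right norm_eq_1)
    moreover have "(2 - \<beta> * Z)\<^sup>2 \<ge> 4 - 4 * (\<beta> * Z)"
      by (simp add: power2_diff)
    ultimately have "(norm (\<theta> i - \<theta> j))\<^sup>2 \<le> 4 * (\<beta> * Z)" by linarith
    then have "norm (\<theta> i - \<theta> j) \<le> sqrt (4 * (\<beta> * Z))" by (rule real_le_rsqrt)
    also have "\<dots> = \<rho>" unfolding \<rho>_def by (simp add: real_sqrt_mult)
    finally show ?thesis by (simp add: dist_norm)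
  qed (use \<rho>0 in simp)
  have "r \<le> 2 * (r + q)" if "0 \<le> r" "0 \<le> q" for r q :: real using that by simp
  from this[OF \<rho>0 bZ] have "\<rho> \<le> 2 * (\<rho> + \<beta> * Z)" .
  also have "\<dots> \<le> \<tau>" using small3 unfolding \<rho>_def .
  finally have \<rho>\<tau>: "\<rho> \<le> \<tau>" .
  show "dist (\<theta> i) (\<theta> j) \<le> \<tau>" if "j \<in> A" for j using close[OF that] \<rho>\<tau> by simp
  have diff: "norm (T - k *\<^sub>R \<theta> i) \<le> k * \<rho>"
  proof -
    have "T - k *\<^sub>R \<theta> i = (\<Sum>j\<in>A. \<theta> j - \<theta> i)"
      by (simp add: T_def k_def sum_subtractf scaleR_conv_of_real sum_constant_scaleR)
    also have "norm \<dots> \<le> k * \<rho>"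
      unfolding k_def using close by (intro sum_norm_bound) (simp add: dist_norm norm_minus_commute)
    finally show ?thesis .
  qed
  have "k\<^sup>2 < (norm (T + \<beta> *\<^sub>R x))\<^sup>2"
    using over k1 by (intro power_strict_mono) (auto simp: T_def x_def k_def)
  also have "\<dots> = (norm T)\<^sup>2 + 2 * \<beta> * (T \<bullet> x) + \<beta>\<^sup>2 * (norm x)\<^sup>2"
    unfolding power2_norm_eq_inner
    by (simp add: inner_add_left inner_add_right inner_commute power2_eq_square algebra_simps)
  also have "(norm T)\<^sup>2 \<le> k\<^sup>2" using T_le by (intro power_mono) auto
  also have "\<beta>\<^sup>2 * (norm x)\<^sup>2 \<le> \<beta>\<^sup>2 * Z\<^sup>2"
    using z by (intro mult_left_mono power_mono) (auto simp: x_def)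
  finally have "0 < \<beta> * (2 * (T \<bullet> x) + \<beta> * Z\<^sup>2)" by (simp add: algebra_simps power2_eq_square)
  then have Tx: "2 * (T \<bullet> x) + \<beta> * Z\<^sup>2 > 0" using \<beta> by (simp add: zero_less_mult_iff)
  have "T \<bullet> x = k * (\<theta> i \<bullet> x) + (T - k *\<^sub>R \<theta> i) \<bullet> x" by (simp add: inner_diff_left)
  also have "(T - k *\<^sub>R \<theta> i) \<bullet> x \<le> norm (T - k *\<^sub>R \<theta> i) * norm x" by (rule norm_cauchy_schwarz)
  also have "\<dots> \<le> (k * \<rho>) * Z" using diff z \<rho>0 k1 by (intro mult_mono) (auto simp: x_def)
  finally have "0 < k * (2 * (\<theta> i \<bullet> x) + 2 * (\<rho> * Z)) + \<beta> * Z\<^sup>2" using Tx by (simp add: algebra_simps)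
  also have "\<beta> * Z\<^sup>2 \<le> k * (\<beta> * Z\<^sup>2)" using k1 \<beta> mult_right_mono[of 1 k "\<beta> * Z\<^sup>2"] by simp
  finally have "0 < k * (2 * (\<theta> i \<bullet> x) + 2 * (\<rho> * Z) + \<beta> * Z\<^sup>2)" by (simp add: algebra_simps)
  then have "0 < 2 * (\<theta> i \<bullet> x) + 2 * (\<rho> * Z) + \<beta> * Z\<^sup>2" using k1 by (simp add: zero_less_mult_iff)
  moreover have "\<beta> * Z\<^sup>2 \<ge> 0" using \<beta> by simp
  ultimately have "\<theta> i \<bullet> x \<ge> - \<tau>" using small2 unfolding \<rho>_def[symmetric] by linarith
  moreover have "\<theta> i \<bullet> y \<le> norm (\<theta> i) * norm y" by (rule norm_cauchy_schwarz)
  ultimately show "\<theta> i \<bullet> v \<ge> - 2 * \<tau>"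
    using y unit[OF A(2)] by (simp add: x_def inner_add_right)
  define U where "U = T + \<beta> *\<^sub>R x"
  have U: "norm U > k" using over by (simp add: U_def T_def x_def k_def)
  have near: "norm (U - k *\<^sub>R \<theta> i) \<le> k * (\<rho> + \<beta> * Z)"
  proof -
    have "norm (U - k *\<^sub>R \<theta> i) \<le> norm (T - k *\<^sub>R \<theta> i) + norm (\<beta> *\<^sub>R x)"
      unfolding U_def using norm_triangle_ineq[of "T - k *\<^sub>R \<theta> i" "\<beta> *\<^sub>R x"] by (simp add: algebra_simps)
    also have "\<dots> \<le> k * \<rho> + 1 * (\<beta> * Z)" using diff nx by simp
    also have "\<dots> \<le> k * \<rho> + k * (\<beta> * Z)" using k1 bZ by (intro add_left_mono mult_right_mono) auto
    finally show ?thesis by (simp add: algebra_simps)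
  qed
  have "k * norm (sgn U - \<theta> i) = norm (k *\<^sub>R sgn U - k *\<^sub>R \<theta> i)"
    using k1 by (simp add: scaleR_right_diff_distrib[symmetric])
  also have "\<dots> \<le> norm (k *\<^sub>R sgn U - U) + norm (U - k *\<^sub>R \<theta> i)"
    using norm_triangle_ineq[of "k *\<^sub>R sgn U - U" "U - k *\<^sub>R \<theta> i"] by simp
  \<comment> \<open>The point of norm \<open>k\<close> on the ray of \<open>U\<close> is at distance
    \<open>norm U - k\<close>, which is at most the distance from \<open>U\<close> to
    \<open>k *\<^sub>R \<theta> i\<close>; this accounts for the factor 2.\<close>
  also have "norm (k *\<^sub>R sgn U - U) = norm U - k"
  proof -
    have "U \<noteq> 0" using U k1 by auto
    then have "U = norm U *\<^sub>R sgn U" by (simp add: sgn_div_norm)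
    then have "k *\<^sub>R sgn U - U = (k - norm U) *\<^sub>R sgn U" by (simp add: scaleR_left_diff_distrib)
    then show ?thesis using U k1 by (auto simp: norm_sgn)
  qed
  also have "\<dots> \<le> norm (U - k *\<^sub>R \<theta> i)"
    using norm_triangle_ineq2[of U "k *\<^sub>R \<theta> i"] unit[OF A(2)] k1 by simp
  finally have "k * norm (sgn U - \<theta> i) \<le> 2 * (k * (\<rho> + \<beta> * Z))" using near by simp
  also have "\<dots> = k * (2 * (\<rho> + \<beta> * Z))" by (rule mult.left_commute)
  finally have "k * norm (sgn U - \<theta> i) \<le> k * (2 * (\<rho> + \<beta> * Z))" .
  then have "norm (sgn U - \<theta> i) \<le> 2 * (\<rho> + \<beta> * Z)"
    using k1 by (subst (asm) mult_le_cancel_left_pos) auto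
  then show "dist (sgn ((\<Sum>j\<in>A. \<theta> j) + \<beta> *\<^sub>R (v + y))) (\<theta> i) \<le> \<tau>"
    using small3 by (simp add: dist_norm U_def T_def x_def \<rho>_def)
qed

section \<open>Lipschitz cutoffs for directions and half-spaces\<close>

definition clamp01 :: "real \<Rightarrow> real" where
  "clamp01 x = max 0 (min 1 x)"

lemma clamp01_bounds [simp]: "0 \<le> clamp01 x" "clamp01 x \<le> 1" "\<bar>clamp01 x\<bar> \<le> 1" "\<bar>1 - clamp01 x\<bar> \<le> 1"
  by (auto simp: clamp01_def)

lemma clamp01_eq_1 [simp]: "x \<ge> 1 \<Longrightarrow> clamp01 x = 1"
  and clamp01_eq_0 [simp]: "x \<le> 0 \<Longrightarrow> clamp01 x = 0"
  by (auto simp: clamp01_def)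

lemma clamp01_lipschitz: "\<bar>clamp01 x - clamp01 y\<bar> \<le> \<bar>x - y\<bar>"
  by (auto simp: clamp01_def)

lemma continuous_on_clamp01 [continuous_intros]:
  "continuous_on S f \<Longrightarrow> continuous_on S (\<lambda>x. clamp01 (f x))"
  unfolding clamp01_def by (intro continuous_intros)

lemma clamp01_measurable [measurable]: "clamp01 \<in> borel_measurable borel"
  unfolding clamp01_def[abs_def] by measurable

text \<open>For positive \<tau>, a majorant of the indicator of \<open>F\<close>: 1 within distance
  \<tau> and 0 beyond \<open>2 * \<tau>\<close>.\<close>

definition near_set :: "real \<Rightarrow> 'a::euclidean_space set \<Rightarrow> 'a \<Rightarrow> real" where
  "near_set \<tau> F s = clamp01 (2 - infdist s F / \<tau>)"

definition near_point :: "real \<Rightarrow> 'a::euclidean_space \<Rightarrow> 'a \<Rightarrow> real" where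
  "near_point \<tau> s t = clamp01 (2 - dist s t / \<tau>)"

text \<open>For positive \<tau>, the first factor is 1 for
  \<open>s \<bullet> v \<ge> - 2 * \<tau>\<close> and 0 for
  \<open>s \<bullet> v \<le> - 3 * \<tau>\<close>. The cut at radius \<open>K + 1\<close> makes the
  product Lipschitz in \<open>s\<close> uniformly in \<open>v\<close>.\<close>

definition ahead :: "real \<Rightarrow> real \<Rightarrow> 'a::euclidean_space \<Rightarrow> 'a \<Rightarrow> real" where
  "ahead \<tau> K s v = clamp01 (3 + (s \<bullet> v) / \<tau>) * clamp01 (K + 1 - norm v)"

lemma near_set_bounds [simp]: "0 \<le> near_set \<tau> F s" "near_set \<tau> F s \<le> 1" "\<bar>near_set \<tau> F s\<bar> \<le> 1"
  by (auto simp: near_set_def)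

lemma near_point_bounds [simp]: "0 \<le> near_point \<tau> s t" "near_point \<tau> s t \<le> 1" "\<bar>near_point \<tau> s t\<bar> \<le> 1"
  by (auto simp: near_point_def)

lemma ahead_bounds [simp]: "0 \<le> ahead \<tau> K s v" "ahead \<tau> K s v \<le> 1" "\<bar>ahead \<tau> K s v\<bar> \<le> 1"
  by (auto simp: ahead_def mult_le_one)

lemma continuous_on_near_set: "continuous_on A (near_set \<tau> F)"
  unfolding near_set_def divide_inverse by (intro continuous_intros)

lemma near_set_measurable [measurable]: "near_set \<tau> F \<in> borel_measurable borel"
  by (rule borel_measurable_continuous_onI[OF continuous_on_near_set])

lemma near_point_measurable:
  "(\<lambda>z::'a::euclidean_space \<times> 'a. near_point \<tau> (fst z) (snd z)) \<in> borel_measurable (borel \<Otimes>\<^sub>M borel)"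
  unfolding near_point_def by measurable

lemma ahead_measurable:
  "(\<lambda>z::'a::euclidean_space \<times> 'a. ahead \<tau> K (fst z) (snd z)) \<in> borel_measurable (borel \<Otimes>\<^sub>M borel)"
  unfolding ahead_def by measurable

lemma near_point_measurable2 [measurable]: "near_point \<tau> s \<in> borel_measurable borel"
  unfolding near_point_def by measurable

lemma ahead_measurable2 [measurable]: "ahead \<tau> K s \<in> borel_measurable borel"
  unfolding ahead_def by measurable

context soft_overshoot
begin

definition exceed :: "nat \<Rightarrow> 'w \<Rightarrow> real" where
  "exceed n = indicator {w \<in> space P. norm (H w) > M n}"

lemma exceed_measurable [measurable]: "exceed n \<in> borel_measurable P"
  unfolding exceed_def by measurable

text \<open>
  Given the direction \<open>s\<close> of the first large summand, each of the other \<open>k - 1\<close> large summands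
  contributes a factor \<open>u_emp\<close> and the sum of all remaining ones a factor \<open>\<psi>_emp\<close>.
\<close>

definition u_emp :: "real \<Rightarrow> nat \<Rightarrow> 'a \<Rightarrow> real" where
  "u_emp \<tau> n s = expectation (\<lambda>w. exceed n w * near_point \<tau> s (sgn (H w))) / tail (M n)"

definition \<psi>_emp :: "real \<Rightarrow> real \<Rightarrow> nat \<Rightarrow> 'a \<Rightarrow> real" where
  "\<psi>_emp \<tau> K n s = expectation (\<lambda>w. ahead \<tau> K s ((\<Sum>j=1..n-k. Hs j w) /\<^sub>R B n))"

definition main_emp :: "real \<Rightarrow> real \<Rightarrow> 'a set \<Rightarrow> nat \<Rightarrow> real" where
  "main_emp \<tau> K F n = expectation (\<lambda>w. exceed n w *
     (near_set \<tau> F (sgn (H w)) * u_emp \<tau> n (sgn (H w)) ^ (k - 1) * \<psi>_emp \<tau> K n (sgn (H w)))) / tail (M n)"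

definition far_emp :: "real \<Rightarrow> nat \<Rightarrow> real" where
  "far_emp K n = expectation (\<lambda>w. 1 - clamp01 (K + 1 - norm ((\<Sum>j=1..n-k. Hs j w) /\<^sub>R B n)))"

text \<open>If \<open>v\<close> has norm above \<open>K + 1\<close>, the first summand is 1.
  Otherwise the geometric lemma applies with \<open>Z = K + 2\<close>, as \<open>y\<close> has norm
  at most \<tau> \<le> 1. It makes all direction cutoffs equal to 1, and the radial cutoff enters
  the two summands with opposite signs, so they add up to 1.\<close>

lemma overshoot_pointwise:
  assumes w: "w \<in> space P" and n: "n \<ge> 1" and A: "A \<in> subsets_of_size n k" "i \<in> A"
    and \<tau>: "0 < \<tau>" "\<tau> \<le> 1" and K: "K > 0"
    and big: "big (M n) n w = A" and over: "norm (S n w) > real k * M n" and dir: "sgn (S n w) \<in> F"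
    and Ls: "\<And>j. j \<in> A \<Longrightarrow> Ls j w \<le> \<tau> * B n / real k"
    and small1: "B n / M n * (K + 2) \<le> 2"
    and small2: "B n / M n * (K + 2)\<^sup>2 + 2 * sqrt (B n / M n * (K + 2)) * (K + 2) \<le> \<tau>"
    and small3: "2 * (2 * sqrt (B n / M n * (K + 2)) + B n / M n * (K + 2)) \<le> \<tau>"
  shows "1 \<le> (1 - clamp01 (K + 1 - norm ((\<Sum>j\<in>{1..n} - A. Hs j w) /\<^sub>R B n))) +
    near_set \<tau> F (sgn (Hs i w)) * (\<Prod>j\<in>A - {i}. near_point \<tau> (sgn (Hs i w)) (sgn (Hs j w))) *
      ahead \<tau> K (sgn (Hs i w)) ((\<Sum>j\<in>{1..n} - A. Hs j w) /\<^sub>R B n)"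
proof -
  note A' = subsets_of_sizeD[OF A(1)]
  define v where "v = (\<Sum>j\<in>{1..n} - A. Hs j w) /\<^sub>R B n"
  define y where "y = (\<Sum>j\<in>A. Ls j w *\<^sub>R sgn (Hs j w)) /\<^sub>R B n"
  define \<theta> where "\<theta> = (\<lambda>j. sgn (Hs j w))"
  define \<beta> where "\<beta> = B n / M n"
  have Mn: "M n > 0" using M_pos n by simp
  have Bn: "B n > 0" by (rule B_pos)
  have kp: "real k > 0" using k_ge_2 by simp
  have bigA: "norm (Hs j w) > M n" if "j \<in> A" for j using big that by (auto simp: big_def)
  have smallA: "norm (Hs j w) \<le> M n" if "j \<in> {1..n} - A" for j using big that by (auto simp: big_def)
  have unit: "norm (\<theta> j) = 1" if "j \<in> A" for j
  proof -
    have "Hs j w \<noteq> 0" using bigA[OF that] Mn by auto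
    then show ?thesis by (simp add: \<theta>_def norm_sgn)
  qed
  show ?thesis
  proof (cases "norm v \<le> K + 1")
    case False
    then show ?thesis unfolding v_def[symmetric]
      by (simp add: add_increasing2 mult_nonneg_nonneg prod_nonneg)
  next
    case True
    have Sw: "S n w = M n *\<^sub>R ((\<Sum>j\<in>A. \<theta> j) + \<beta> *\<^sub>R (v + y))"
    proof -
      have "S n w = (\<Sum>j\<in>{1..n} - A. X n j w) + (\<Sum>j\<in>A. X n j w)"
        unfolding trunc_sum_def using A' by (intro sum.subset_diff) auto
      also have "(\<Sum>j\<in>{1..n} - A. X n j w) = (\<Sum>j\<in>{1..n} - A. Hs j w)"
        using smallA by (intro sum.cong refl) (simp add: soft_truncate_def)
      also have "(\<Sum>j\<in>A. X n j w) = (\<Sum>j\<in>A. M n *\<^sub>R \<theta> j + Ls j w *\<^sub>R sgn (Hs j w))"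
      proof (rule sum.cong[OF refl])
        fix j assume "j \<in> A"
        from bigA[OF this] show "X n j w = M n *\<^sub>R \<theta> j + Ls j w *\<^sub>R sgn (Hs j w)"
          by (simp add: soft_truncate_def \<theta>_def scaleR_add_left)
      qed
      also have "\<dots> = M n *\<^sub>R (\<Sum>j\<in>A. \<theta> j) + (\<Sum>j\<in>A. Ls j w *\<^sub>R sgn (Hs j w))"
        by (simp add: sum.distrib scaleR_sum_right)
      also have "(\<Sum>j\<in>{1..n} - A. Hs j w) = B n *\<^sub>R v" using Bn by (simp add: v_def)
      also have "(\<Sum>j\<in>A. Ls j w *\<^sub>R sgn (Hs j w)) = B n *\<^sub>R y" using Bn by (simp add: y_def)
      finally show ?thesis using Mn by (simp add: \<beta>_def scaleR_add_right algebra_simps)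
    qed
    have ny: "norm y \<le> \<tau>"
    proof -
      have "norm (\<Sum>j\<in>A. Ls j w *\<^sub>R sgn (Hs j w)) \<le> real (card A) * (\<tau> * B n / real k)"
      proof (rule sum_norm_bound)
        fix j assume j: "j \<in> A"
        have "Ls j w \<ge> 0" using Ls_nonneg w A'(2) j by auto
        then show "norm (Ls j w *\<^sub>R sgn (Hs j w)) \<le> \<tau> * B n / real k"
          using Ls[OF j] unit[OF j] by (simp add: \<theta>_def)
      qed
      then have "norm (\<Sum>j\<in>A. Ls j w *\<^sub>R sgn (Hs j w)) \<le> \<tau> * B n" using kp A'(4) by simp
      then show ?thesis using Bn by (simp add: y_def field_simps)
    qed
    have nz: "norm (v + y) \<le> K + 2"
      using norm_triangle_ineq[of v y] True ny \<tau> by linarith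
    have over': "norm ((\<Sum>j\<in>A. \<theta> j) + \<beta> *\<^sub>R (v + y)) > real (card A)"
      using over Mn unfolding Sw A'(4) by (simp add: mult.commute)
    have \<beta>: "\<beta> > 0" using Bn Mn by (simp add: \<beta>_def)
    note geo = overshoot_geometry[OF A'(1) A(2) unit \<beta> nz ny over'
        small1[folded \<beta>_def] small2[folded \<beta>_def] small3[folded \<beta>_def]]
    have "sgn (S n w) = sgn ((\<Sum>j\<in>A. \<theta> j) + \<beta> *\<^sub>R (v + y))"
      unfolding Sw using Mn by (simp add: sgn_scaleR)
    then have "infdist (\<theta> i) F \<le> \<tau>"
      using geo(3) dir by (intro infdist_le2[of "sgn (S n w)"]) (auto simp: dist_commute)
    then have 1: "near_set \<tau> F (\<theta> i) = 1" using \<tau> by (simp add: near_set_def)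
    have 2: "(\<Prod>j\<in>A - {i}. near_point \<tau> (\<theta> i) (\<theta> j)) = 1"
    proof (rule prod.neutral, rule ballI)
      fix j assume "j \<in> A - {i}"
      then have "dist (\<theta> i) (\<theta> j) \<le> \<tau>" using geo(1) by auto
      then show "near_point \<tau> (\<theta> i) (\<theta> j) = 1" using \<tau> by (simp add: near_point_def)
    qed
    have "(\<theta> i \<bullet> v) / \<tau> \<ge> - 2" using geo(2) \<tau> by (simp add: field_simps)
    then have 3: "ahead \<tau> K (\<theta> i) v = clamp01 (K + 1 - norm v)" by (simp add: ahead_def)
    show ?thesis unfolding v_def[symmetric] using 1 2 3 by (simp add: \<theta>_def)
  qed
qed

lemma u_emp_bounds: "0 \<le> u_emp \<tau> n s" "u_emp \<tau> n s \<le> 1"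
proof -
  have p: "tail (M n) > 0" by (rule G_pos)
  have int: "integrable P (\<lambda>w. exceed n w * near_point \<tau> s (sgn (H w)))"
    by (rule integrable_const_bound[where B = 1]) (auto simp: exceed_def indicator_def)
  show "0 \<le> u_emp \<tau> n s"
    unfolding u_emp_def by (intro divide_nonneg_nonneg Bochner_Integration.integral_nonneg)
      (auto simp: exceed_def)
  have "expectation (\<lambda>w. exceed n w * near_point \<tau> s (sgn (H w))) \<le> expectation (exceed n)"
    by (intro integral_mono int) (auto simp: exceed_def indicator_def)
  also have "\<dots> = tail (M n)" unfolding exceed_def by simp
  finally show "u_emp \<tau> n s \<le> 1" unfolding u_emp_def using p by simp
qed

lemma \<psi>_emp_bounds: "0 \<le> \<psi>_emp \<tau> K n s" "\<psi>_emp \<tau> K n s \<le> 1"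
proof -
  have m [measurable]: "(\<lambda>w. \<Sum>j=1..n-k. Hs j w) \<in> borel_measurable P"
    using Hs_sum_measurable[of "{1..n-k}"] by simp
  have int: "integrable P (\<lambda>w. ahead \<tau> K s ((\<Sum>j=1..n-k. Hs j w) /\<^sub>R B n))"
    by (rule integrable_const_bound[where B = 1]) (auto simp del: One_nat_def)
  show "0 \<le> \<psi>_emp \<tau> K n s" unfolding \<psi>_emp_def by (intro Bochner_Integration.integral_nonneg) auto
  have "\<psi>_emp \<tau> K n s \<le> expectation (\<lambda>w. 1)"
    unfolding \<psi>_emp_def by (intro integral_mono int) auto
  then show "\<psi>_emp \<tau> K n s \<le> 1" by (simp add: prob_space)
qed

text \<open>The pointwise bound is integrated over the event that all indices of \<open>A\<close>
  are large. That the others are small is dropped: this only enlarges the event, and it leaves the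
  remaining sum unconditioned, hence independent of the large summands.\<close>

lemma main_term_subset:
  assumes n: "n \<ge> 1" and A: "A \<in> subsets_of_size n k"
    and \<tau>: "0 < \<tau>" "\<tau> \<le> 1" and K: "K > 0"
    and small1: "B n / M n * (K + 2) \<le> 2"
    and small2: "B n / M n * (K + 2)\<^sup>2 + 2 * sqrt (B n / M n * (K + 2)) * (K + 2) \<le> \<tau>"
    and small3: "2 * (2 * sqrt (B n / M n * (K + 2)) + B n / M n * (K + 2)) \<le> \<tau>"
  shows "prob {w \<in> space P. norm (S n w) > real k * M n \<and> sgn (S n w) \<in> F \<and> big (M n) n w = A} \<le>
    tail (M n) ^ k * (real k * ltail (\<tau> * B n / real k) + far_emp K n + main_emp \<tau> K F n)"
proof -
  note A' = subsets_of_sizeD[OF A]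
  define x where "x = \<tau> * B n / real k"
  define p where "p = tail (M n)"
  \<comment> \<open>Any element of \<open>A\<close> can provide the reference direction.\<close>
  define i where "i = Min A"
  have "A \<noteq> {}" using A'(4) k_ge_2 by auto
  then have i: "i \<in> A" unfolding i_def using A'(1) by simp
  have i1: "i \<ge> 1" using i A'(2) by auto
  define C where "C = {1..n} - A"
  have C: "finite C" "C \<subseteq> {1..}" "A \<inter> C = {}" by (auto simp: C_def)
  have cardC: "card C = n - k" unfolding C_def using A' by (simp add: card_Diff_subset)
  define v where "v = (\<lambda>w. (\<Sum>j\<in>C. Hs j w) /\<^sub>R B n)"
  have vm [measurable]: "v \<in> borel_measurable P"
    unfolding v_def using Hs_sum_measurable[OF C(2)] by measurable
  define D where "D = {w \<in> space P. \<forall>j\<in>A. norm (Hs j w) > M n}"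
  have D: "D \<in> sets P" unfolding D_def by (rule sets_all_big[OF A'(1,2)])
  define W where "W = {w \<in> space P. norm (S n w) > real k * M n \<and> sgn (S n w) \<in> F \<and> big (M n) n w = A}"
  define E where "E = (\<lambda>j. {w \<in> space P. (\<forall>i\<in>A. norm (Hs i w) > M n) \<and> Ls j w > x})"
  have E: "E j \<in> sets P" if "j \<in> A" for j
  proof -
    have [measurable]: "Ls j \<in> borel_measurable P" using that A'(2) Ls_measurable by auto
    have "E j = D \<inter> {w \<in> space P. Ls j w > x}" by (auto simp: E_def D_def)
    then show ?thesis using D by simp
  qed
  define g where "g = (\<lambda>w. (1 - clamp01 (K + 1 - norm (v w))) +
    near_set \<tau> F (sgn (Hs i w)) * (\<Prod>j\<in>A - {i}. near_point \<tau> (sgn (Hs i w)) (sgn (Hs j w))) *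
      ahead \<tau> K (sgn (Hs i w)) (v w))"
  have g0: "g w \<ge> 0" for w
    unfolding g_def by (auto intro!: add_nonneg_nonneg mult_nonneg_nonneg prod_nonneg)
  define a1 where "a1 = (\<lambda>x. indicator {x::'a. norm x > M n} x :: real)"
  have a1 [measurable]: "a1 \<in> borel_measurable borel" unfolding a1_def by measurable
  have a1b: "0 \<le> a1 x" "a1 x \<le> 1" "\<bar>a1 x\<bar> \<le> 1" for x by (auto simp: a1_def indicator_def)
  have a1H: "a1 (H w) = exceed n w" if "w \<in> space P" for w
    using that by (simp add: a1_def exceed_def indicator_def)
  have indD: "indicator D w = (\<Prod>j\<in>A. a1 (Hs j w))" if "w \<in> space P" for w
    using that A'(1) by (auto simp: D_def a1_def indicator_def prod_zero_iff)
  have indD': "indicator D w = a1 (Hs i w) * (\<Prod>j\<in>A - {i}. a1 (Hs j w))" if "w \<in> space P" for w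
    unfolding indD[OF that] using A'(1) i by (rule prod.remove)
  define T1 where "T1 = (\<lambda>w. (\<Prod>j\<in>A. a1 (Hs j w)) * (1 - clamp01 (K + 1 - norm ((\<Sum>j\<in>C. Hs j w) /\<^sub>R B n))))"
  define c where "c = (\<lambda>x::'a. a1 x * near_set \<tau> F (sgn x))"
  define a where "a = (\<lambda>(x::'a) (y::'a). a1 y * near_point \<tau> (sgn x) (sgn y))"
  define b where "b = (\<lambda>(x::'a) (z::'a). ahead \<tau> K (sgn x) (z /\<^sub>R B n))"
  define T2 where "T2 = (\<lambda>w. c (Hs i w) * ((\<Prod>j\<in>A - {i}. a (Hs i w) (Hs j w)) * b (Hs i w) (\<Sum>j\<in>C. Hs j w)))"
  have Dg: "indicator D w * g w = T1 w + T2 w" if "w \<in> space P" for w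
  proof -
    have "indicator D w * (1 - clamp01 (K + 1 - norm (v w))) = T1 w"
      by (simp only: indD[OF that] T1_def v_def)
    moreover have "indicator D w * (near_set \<tau> F (sgn (Hs i w)) *
        (\<Prod>j\<in>A - {i}. near_point \<tau> (sgn (Hs i w)) (sgn (Hs j w))) * ahead \<tau> K (sgn (Hs i w)) (v w)) = T2 w"
      by (simp add: indD'[OF that] T2_def c_def a_def b_def v_def prod.distrib)
    ultimately show ?thesis by (simp add: g_def distrib_left)
  qed
  have cm [measurable]: "c \<in> borel_measurable borel" unfolding c_def by measurable
  have am: "(\<lambda>z. a (fst z) (snd z)) \<in> borel_measurable borel"
    unfolding a_def borel_prod[symmetric]
    by (intro borel_measurable_times measurable_compose[OF _ near_point_measurable, of "\<lambda>z. (sgn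
        (fst z), sgn (snd z))", simplified])
      measurable
  have bm: "(\<lambda>z. b (fst z) (snd z)) \<in> borel_measurable borel"
    unfolding b_def borel_prod[symmetric]
    by (intro measurable_compose[OF _ ahead_measurable, of "\<lambda>z. (sgn (fst z), snd z /\<^sub>R B n)", simplified])
      measurable
  have cb: "\<bar>c x\<bar> \<le> 1" for x unfolding c_def abs_mult using a1b by (intro mult_le_one) auto
  have ab: "\<bar>a x y\<bar> \<le> 1" for x y unfolding a_def abs_mult using a1b by (intro mult_le_one) auto
  have bb: "\<bar>b x y\<bar> \<le> 1" for x y unfolding b_def by simp
  have Him: "Hs j \<in> borel_measurable P" if "j \<in> A" for j using that A'(2) Hs_measurable by auto
  have T1_int: "integrable P T1"
  proof (rule integrable_const_bound[where B = 1])
    have "\<bar>T1 w\<bar> \<le> 1" for w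
      unfolding T1_def abs_mult abs_prod using a1b by (intro mult_le_one prod_le_1) auto
    then show "AE w in P. norm (T1 w) \<le> 1" by simp
    show "T1 \<in> borel_measurable P"
    proof -
      have T1': "T1 = (\<lambda>w. (\<Prod>j\<in>A. a1 (Hs j w)) * (1 - clamp01 (K + 1 - norm (v w))))"
        by (simp only: T1_def v_def)
      show ?thesis
        unfolding T1' using measurable_compose[OF Him a1]
        by (intro borel_measurable_times borel_measurable_prod) auto
    qed
  qed
  have T2_int: "integrable P T2"
  proof (rule integrable_const_bound[where B = 1])
    have "\<bar>T2 w\<bar> \<le> 1" for w
      unfolding T2_def abs_mult abs_prod using ab bb cb
      by (intro mult_le_one prod_le_1 mult_nonneg_nonneg prod_nonneg) auto
    then show "AE w in P. norm (T2 w) \<le> 1" by simp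
    have 1: "(\<lambda>w. a (Hs i w) (Hs j w)) \<in> borel_measurable P" if "j \<in> A" for j
      using measurable_compose[OF measurable_Pair[OF Him[OF i] Him[OF that]] am[unfolded
          borel_prod[symmetric]]] by simp
    have 2: "(\<lambda>w. b (Hs i w) (\<Sum>j\<in>C. Hs j w)) \<in> borel_measurable P"
      using measurable_compose[OF measurable_Pair[OF Him[OF i] Hs_sum_measurable[OF C(2)]]
          bm[unfolded borel_prod[symmetric]]] by simp
    show "T2 \<in> borel_measurable P"
      unfolding T2_def using 1 2
      by (intro borel_measurable_times borel_measurable_prod measurable_compose[OF Him[OF i] cm]) auto
  qed
  have ET1: "expectation T1 = p ^ k * far_emp K n"
  proof -
    have "expectation T1 = expectation (\<lambda>w. a1 (H w)) ^ card A *
        expectation (\<lambda>w. 1 - clamp01 (K + 1 - norm ((\<Sum>j\<in>C. Hs j w) /\<^sub>R B n)))"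
      unfolding T1_def
      by (rule expectation_split[OF A'(1,2) C, of a1 "\<lambda>z. 1 - clamp01 (K + 1 - norm (z /\<^sub>R B n))"])
        (use a1b in auto)
    also have "expectation (\<lambda>w. a1 (H w)) = p"
      unfolding p_def by (subst Bochner_Integration.integral_cong[OF refl a1H]) (auto simp: exceed_def)
    also have "expectation (\<lambda>w. 1 - clamp01 (K + 1 - norm ((\<Sum>j\<in>C. Hs j w) /\<^sub>R B n))) = far_emp K n"
      unfolding far_emp_def
      by (rule expectation_sum_card[OF C(1,2), of "{1..n-k}" "\<lambda>z. 1 - clamp01 (K + 1 - norm (z /\<^sub>R B n))"])
        (auto simp: cardC)
    finally show ?thesis by (simp add: A'(4))
  qed
  have ET2: "expectation T2 = p ^ k * main_emp \<tau> K F n"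
  proof -
    have p0: "p > 0" unfolding p_def by (rule G_pos)
    have ea: "expectation (\<lambda>w'. a x (H w')) = p * u_emp \<tau> n (sgn x)" for x
    proof -
      have "expectation (\<lambda>w'. a x (H w')) = expectation (\<lambda>w. exceed n w * near_point \<tau> (sgn x) (sgn (H w)))"
        by (intro Bochner_Integration.integral_cong refl) (simp add: a_def a1H)
      then show ?thesis using p0 by (simp add: u_emp_def p_def)
    qed
    have eb: "expectation (\<lambda>w'. b x (\<Sum>j\<in>C. Hs j w')) = \<psi>_emp \<tau> K n (sgn x)" for x
      unfolding \<psi>_emp_def b_def
      by (rule expectation_sum_card[OF C(1,2), of "{1..n-k}" "\<lambda>z. ahead \<tau> K (sgn x) (z /\<^sub>R B n)"])
        (auto simp: cardC)
    have "expectation T2 = expectation (\<lambda>w. c (H w) * (expectation (\<lambda>w'. a (H w) (H w')) ^ card (A - {i}) *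
      expectation (\<lambda>w'. b (H w) (\<Sum>j\<in>C. Hs j w'))))"
      unfolding T2_def
      by (rule expectation_split_leading[OF i1 _ _ _ _ C(1,2) _ cm am bm cb ab bb])
        (use i C A' in auto)
    also have "\<dots> = expectation (\<lambda>w. p ^ (k - 1) * (exceed n w *
      (near_set \<tau> F (sgn (H w)) * u_emp \<tau> n (sgn (H w)) ^ (k - 1) * \<psi>_emp \<tau> K n (sgn (H w)))))"
      using i A'(1,4) by (intro Bochner_Integration.integral_cong refl)
        (simp add: ea eb c_def a1H power_mult_distrib)
    also have "\<dots> = p ^ (k - 1) * (p * main_emp \<tau> K F n)"
      using p0 by (simp add: main_emp_def p_def)
    also have "\<dots> = p ^ k * main_emp \<tau> K F n"
      using k_ge_2 by (cases k) auto
    finally show ?thesis .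
  qed
  have W_le: "indicator W w \<le> (\<Sum>j\<in>A. indicator (E j) w) + (T1 w + T2 w)" if w: "w \<in> space P" for w
  proof (cases "w \<in> W \<and> (\<forall>j\<in>A. Ls j w \<le> x)")
    case True
    then have "w \<in> D" using w by (auto simp: W_def D_def big_def)
    moreover have "1 \<le> g w"
      unfolding g_def v_def C_def
      by (rule overshoot_pointwise[OF w n A i \<tau> K _ _ _ _ small1 small2 small3])
        (use True in \<open>auto simp: W_def x_def\<close>)
    ultimately have "1 \<le> indicator D w * g w" by simp
    then have "1 \<le> T1 w + T2 w" using Dg[OF w] by simp
    moreover have "(\<Sum>j\<in>A. indicat_real (E j) w) \<ge> 0" by (intro sum_nonneg) auto
    ultimately show ?thesis using True by simp
  next
    case False
    have T: "T1 w + T2 w \<ge> 0"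
      unfolding Dg[OF w, symmetric] using g0[of w] by simp
    show ?thesis
    proof (cases "w \<in> W")
      case True
      then obtain j where j: "j \<in> A" "Ls j w > x" using False by force
      then have "w \<in> E j" using True by (auto simp: E_def W_def big_def)
      then have "1 \<le> (\<Sum>j\<in>A. indicat_real (E j) w)"
        using member_le_sum[of j A "\<lambda>j. indicat_real (E j) w"] j A'(1) by simp
      then show ?thesis using T True by simp
    next
      case False
      have "(\<Sum>j\<in>A. indicat_real (E j) w) \<ge> 0" by (intro sum_nonneg) auto
      then show ?thesis using T False by simp
    qed
  qed
  have sumE_int: "integrable P (\<lambda>w. \<Sum>j\<in>A. indicat_real (E j) w)"
    using E by (intro Bochner_Integration.integrable_sum integrable_real_indicator) (auto simp:
        emeasure_eq_measure)
  have T12_int: "integrable P (\<lambda>w. T1 w + T2 w)"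
    using T1_int T2_int by (rule Bochner_Integration.integrable_add)
  have "prob W \<le> expectation (\<lambda>w. (\<Sum>j\<in>A. indicator (E j) w) + (T1 w + T2 w))"
  proof (cases "W \<in> sets P")
    case True
    then have "prob W = expectation (indicator W)" by simp
    also have "\<dots> \<le> expectation (\<lambda>w. (\<Sum>j\<in>A. indicator (E j) w) + (T1 w + T2 w))"
      using True W_le sumE_int T1_int T2_int
      by (intro integral_mono Bochner_Integration.integrable_add integrable_real_indicator)
        (auto simp: emeasure_eq_measure)
    finally show ?thesis .
  next
    \<comment> \<open>\<open>F\<close> is arbitrary here, so \<open>W\<close> may fail to be
      measurable; its measure is then 0 by convention, and nonnegativity of the integrand
      suffices.\<close>
    case False
    have "0 \<le> (\<Sum>j\<in>A. indicat_real (E j) w) + (T1 w + T2 w)" if "w \<in> space P" for w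
      using W_le[OF that] indicator_pos_le[of W w] by (rule order_trans[rotated])
    then have "0 \<le> expectation (\<lambda>w. (\<Sum>j\<in>A. indicator (E j) w) + (T1 w + T2 w))"
      by (rule Bochner_Integration.integral_nonneg)
    then show ?thesis using False by (simp add: measure_notin_sets)
  qed
  also have "\<dots> = (\<Sum>j\<in>A. prob (E j)) + (expectation T1 + expectation T2)"
    using E T1_int T2_int sumE_int T12_int
    by (simp add: Bochner_Integration.integral_add Bochner_Integration.integral_sum emeasure_eq_measure)
  also have "(\<Sum>j\<in>A. prob (E j)) = (\<Sum>j\<in>A. p ^ k * ltail x)"
  proof (rule sum.cong[OF refl])
    fix j assume "j \<in> A"
    then have "j \<ge> 1" using A'(2) by auto
    then show "prob (E j) = p ^ k * ltail x"
      using prob_big_and_Ls[OF A'(1,2), of j "M n" x] by (simp add: E_def p_def A'(4))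
  qed
  also have "\<dots> = p ^ k * (real k * ltail x)" by (simp add: A'(4))
  finally show ?thesis
    unfolding W_def ET1 ET2 x_def p_def by (simp add: distrib_left)
qed

end

section \<open>The upper bound\<close>

lemma lipschitz_continuous_on:
  fixes u :: "'a::metric_space \<Rightarrow> real"
  assumes "\<And>s t. s \<in> K \<Longrightarrow> t \<in> K \<Longrightarrow> \<bar>u s - u t\<bar> \<le> D * dist s t" "D \<ge> 0"
  shows "continuous_on K u"
  by (rule lipschitz_on_continuous_on[of D]) (use assms in \<open>auto intro!: lipschitz_onI simp: dist_real_def\<close>)

lemma near_point_lipschitz:
  assumes "\<tau> > 0"
  shows "\<bar>near_point \<tau> s x - near_point \<tau> t x\<bar> \<le> 1 / \<tau> * dist s t"
proof -
  have "\<bar>near_point \<tau> s x - near_point \<tau> t x\<bar> \<le> \<bar>(2 - dist s x / \<tau>) - (2 - dist t x / \<tau>)\<bar>"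
    unfolding near_point_def by (rule clamp01_lipschitz)
  also have "\<dots> = \<bar>dist t x - dist s x\<bar> / \<tau>" using assms by (simp add: diff_divide_distrib[symmetric])
  also have "\<dots> \<le> dist s t / \<tau>"
    using assms abs_dist_diff_le[of t x s] by (intro divide_right_mono) (auto simp: dist_commute)
  finally show ?thesis by simp
qed

lemma ahead_lipschitz_direction:
  assumes "\<tau> > 0" "K > 0"
  shows "\<bar>ahead \<tau> K s v - ahead \<tau> K t v\<bar> \<le> (K + 1) / \<tau> * dist s t"
proof (cases "norm v \<le> K + 1")
  case True
  have "\<bar>ahead \<tau> K s v - ahead \<tau> K t v\<bar>
      = \<bar>clamp01 (3 + (s \<bullet> v) / \<tau>) - clamp01 (3 + (t \<bullet> v) / \<tau>)\<bar> * clamp01 (K + 1 - norm v)"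
    by (simp add: ahead_def left_diff_distrib[symmetric] abs_mult)
  also have "\<dots> \<le> \<bar>(3 + (s \<bullet> v) / \<tau>) - (3 + (t \<bullet> v) / \<tau>)\<bar> * 1"
    by (intro mult_mono clamp01_lipschitz) auto
  also have "\<dots> = \<bar>(s - t) \<bullet> v\<bar> / \<tau>"
    using assms by (simp add: inner_diff_left diff_divide_distrib[symmetric])
  also have "\<dots> \<le> (norm (s - t) * (K + 1)) / \<tau>"
    using assms Cauchy_Schwarz_ineq2[of "s - t" v] mult_left_mono[OF True, of "norm (s - t)"]
    by (intro divide_right_mono) auto
  finally show ?thesis by (simp add: dist_norm mult.commute)
qed (use assms in \<open>simp add: ahead_def\<close>)

lemma ahead_lipschitz:
  assumes "\<tau> > 0" "norm s = 1"
  shows "\<bar>ahead \<tau> K s v - ahead \<tau> K s w\<bar> \<le> (1 / \<tau> + 1) * dist v w"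
proof -
  define a where "a = (\<lambda>v. clamp01 (3 + (s \<bullet> v) / \<tau>))"
  define c where "c = (\<lambda>v::'a. clamp01 (K + 1 - norm v))"
  have "\<bar>a v - a w\<bar> \<le> \<bar>(3 + (s \<bullet> v) / \<tau>) - (3 + (s \<bullet> w) / \<tau>)\<bar>"
    unfolding a_def by (rule clamp01_lipschitz)
  also have "\<dots> = \<bar>s \<bullet> (v - w)\<bar> / \<tau>"
    using assms by (simp add: inner_diff_right diff_divide_distrib[symmetric])
  also have "\<dots> \<le> dist v w / \<tau>"
    using assms Cauchy_Schwarz_ineq2[of s "v - w"] by (intro divide_right_mono) (auto simp: dist_norm)
  finally have 1: "\<bar>a v - a w\<bar> \<le> dist v w / \<tau>" .
  have "\<bar>c v - c w\<bar> \<le> \<bar>(K + 1 - norm v) - (K + 1 - norm w)\<bar>"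
    unfolding c_def by (rule clamp01_lipschitz)
  also have "\<dots> \<le> dist v w" using norm_triangle_ineq3[of w v] by (simp add: dist_norm norm_minus_commute)
  finally have 2: "\<bar>c v - c w\<bar> \<le> dist v w" .
  have "ahead \<tau> K s v - ahead \<tau> K s w = (a v - a w) * c v + a w * (c v - c w)"
    by (simp add: ahead_def a_def c_def algebra_simps)
  also have "\<bar>\<dots>\<bar> \<le> \<bar>a v - a w\<bar> * \<bar>c v\<bar> + \<bar>a w\<bar> * \<bar>c v - c w\<bar>"
    by (rule order_trans[OF abs_triangle_ineq]) (simp add: abs_mult)
  also have "\<dots> \<le> (dist v w / \<tau>) * 1 + 1 * dist v w"
    using assms by (intro add_mono mult_mono 1 2) (auto simp: a_def c_def)
  finally show ?thesis by (simp add: algebra_simps)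
qed

section \<open>Limits of the empirical factors and the bound at fixed cutoff parameters\<close>

context soft_overshoot
begin

definition u_lim :: "real \<Rightarrow> 'a \<Rightarrow> real" where
  "u_lim \<tau> s = (\<integral>t. near_point \<tau> s t \<partial>\<sigma>)"

definition \<psi>_lim :: "real \<Rightarrow> real \<Rightarrow> 'a \<Rightarrow> real" where
  "\<psi>_lim \<tau> K s = expectation (\<lambda>w. ahead \<tau> K s (V w))"

definition far_lim :: "real \<Rightarrow> real" where
  "far_lim K = expectation (\<lambda>w. 1 - clamp01 (K + 1 - norm (V w)))"

text \<open>\<epsilon> absorbs the uniform errors of \<open>u_emp\<close> and
  \<open>\<psi>_emp\<close>. Capping at 1 costs nothing, as both are at most 1, and keeps the
  function in the unit interval for \<open>direction_integral\<close>.\<close>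

definition main_fun :: "real \<Rightarrow> real \<Rightarrow> real \<Rightarrow> 'a set \<Rightarrow> 'a \<Rightarrow> real" where
  "main_fun \<tau> K \<epsilon> F s = near_set \<tau> F s * min 1 (u_lim \<tau> s + \<epsilon>) ^ (k - 1) * min 1 (\<psi>_lim \<tau> K s + \<epsilon>)"

lemma \<sigma>_measurable:
  fixes f :: "'a \<Rightarrow> real"
  shows "f \<in> borel_measurable borel \<Longrightarrow> f \<in> borel_measurable \<sigma>"
  by (subst measurable_cong_sets[OF \<sigma>_sets refl]) (rule measurable_restrict_space1)

lemma space_\<sigma>: "space \<sigma> = sphere 0 1"
  using sets_eq_imp_space_eq[OF \<sigma>_sets] by (simp add: space_restrict_space)

lemma near_point_integrable: "integrable \<sigma> (near_point \<tau> s)"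
proof -
  interpret \<sigma>: prob_space \<sigma> by (rule \<sigma>_prob)
  show ?thesis by (rule \<sigma>.integrable_const_bound[where B = 1]) (auto intro: \<sigma>_measurable)
qed

lemma u_lim_nonneg: "u_lim \<tau> s \<ge> 0"
  unfolding u_lim_def by (intro Bochner_Integration.integral_nonneg) auto

lemma \<psi>_lim_nonneg: "\<psi>_lim \<tau> K s \<ge> 0"
  unfolding \<psi>_lim_def by (intro Bochner_Integration.integral_nonneg) auto

lemma u_lim_lipschitz:
  assumes \<tau>: "\<tau> > 0"
  shows "\<bar>u_lim \<tau> s - u_lim \<tau> t\<bar> \<le> 1 / \<tau> * dist s t"
proof -
  interpret \<sigma>: prob_space \<sigma> by (rule \<sigma>_prob)
  have "u_lim \<tau> s - u_lim \<tau> t = (\<integral>x. near_point \<tau> s x - near_point \<tau> t x \<partial>\<sigma>)"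
    unfolding u_lim_def by (rule Bochner_Integration.integral_diff[symmetric]) (rule near_point_integrable)+
  also have "\<bar>\<dots>\<bar> \<le> (\<integral>x. \<bar>near_point \<tau> s x - near_point \<tau> t x\<bar> \<partial>\<sigma>)"
    by (rule integral_abs_bound)
  also have "\<dots> \<le> (\<integral>x. 1 / \<tau> * dist s t \<partial>\<sigma>)"
    by (intro integral_mono integrable_abs Bochner_Integration.integrable_diff near_point_integrable
        near_point_lipschitz \<tau>) auto
  finally show ?thesis by (simp add: \<sigma>.prob_space)
qed

lemma ahead_V_integrable: "integrable P (\<lambda>w. ahead \<tau> K s (V w))"
  by (rule integrable_const_bound[where B = 1]) auto

lemma \<psi>_lim_lipschitz:
  assumes \<tau>: "\<tau> > 0" and K: "K > 0"
  shows "\<bar>\<psi>_lim \<tau> K s - \<psi>_lim \<tau> K t\<bar> \<le> (K + 1) / \<tau> * dist s t"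
proof -
  have "\<psi>_lim \<tau> K s - \<psi>_lim \<tau> K t = expectation (\<lambda>w. ahead \<tau> K s (V w) - ahead \<tau> K t (V w))"
    unfolding \<psi>_lim_def by (rule Bochner_Integration.integral_diff[symmetric]) (rule ahead_V_integrable)+
  also have "\<bar>\<dots>\<bar> \<le> expectation (\<lambda>w. \<bar>ahead \<tau> K s (V w) - ahead \<tau> K t (V w)\<bar>)"
    by (rule integral_abs_bound)
  also have "\<dots> \<le> expectation (\<lambda>w. (K + 1) / \<tau> * dist s t)"
    by (intro integral_mono integrable_abs Bochner_Integration.integrable_diff ahead_V_integrable
        ahead_lipschitz_direction \<tau> K) auto
  finally show ?thesis by (simp add: prob_space)
qed

lemma u_emp_lipschitz:
  assumes \<tau>: "\<tau> > 0"
  shows "\<bar>u_emp \<tau> n s - u_emp \<tau> n t\<bar> \<le> 1 / \<tau> * dist s t"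
proof -
  have p: "tail (M n) > 0" by (rule G_pos)
  have int: "integrable P (\<lambda>w. exceed n w * near_point \<tau> s (sgn (H w)))" for s
    by (rule integrable_const_bound[where B = 1]) (auto simp: exceed_def indicator_def)
  have ie: "integrable P (exceed n)" unfolding exceed_def by simp
  have "expectation (\<lambda>w. exceed n w * near_point \<tau> s (sgn (H w))) - expectation (\<lambda>w. exceed n w *
      near_point \<tau> t (sgn (H w)))
      = expectation (\<lambda>w. exceed n w * near_point \<tau> s (sgn (H w)) - exceed n w * near_point \<tau> t (sgn (H w)))"
    by (rule Bochner_Integration.integral_diff[symmetric]) (rule int)+
  also have "\<bar>\<dots>\<bar> \<le> expectation (\<lambda>w. \<bar>exceed n w * near_point \<tau> s (sgn (H w)) - exceed n w *
      near_point \<tau> t (sgn (H w))\<bar>)"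
    by (rule integral_abs_bound)
  also have "\<dots> \<le> expectation (\<lambda>w. exceed n w * (1 / \<tau> * dist s t))"
  proof (intro integral_mono integrable_abs Bochner_Integration.integrable_diff int)
    show "integrable P (\<lambda>w. exceed n w * (1 / \<tau> * dist s t))" using ie by simp
    show "\<bar>exceed n w * near_point \<tau> s (sgn (H w)) - exceed n w * near_point \<tau> t (sgn (H w))\<bar>
        \<le> exceed n w * (1 / \<tau> * dist s t)" for w
      using near_point_lipschitz[OF \<tau>, of s "sgn (H w)" t] by (auto simp: exceed_def indicator_def)
  qed
  also have "\<dots> = tail (M n) * (1 / \<tau> * dist s t)"
    by (simp add: exceed_def)
  finally show ?thesis
    unfolding u_emp_def diff_divide_distrib[symmetric] abs_divide using p by (simp add: field_simps)
qed

lemma \<psi>_emp_lipschitz: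
  assumes \<tau>: "\<tau> > 0" and K: "K > 0"
  shows "\<bar>\<psi>_emp \<tau> K n s - \<psi>_emp \<tau> K n t\<bar> \<le> (K + 1) / \<tau> * dist s t"
proof -
  define v where "v = (\<lambda>w. (\<Sum>j=1..n-k. Hs j w) /\<^sub>R B n)"
  have [measurable]: "v \<in> borel_measurable P"
    unfolding v_def using Hs_sum_measurable[of "{1..n-k}"] by simp
  have int: "integrable P (\<lambda>w. ahead \<tau> K s (v w))" for s
    by (rule integrable_const_bound[where B = 1]) auto
  have eq: "\<psi>_emp \<tau> K n s = expectation (\<lambda>w. ahead \<tau> K s (v w))" for s
    by (simp only: \<psi>_emp_def v_def)
  have "\<psi>_emp \<tau> K n s - \<psi>_emp \<tau> K n t = expectation (\<lambda>w. ahead \<tau> K s (v w) - ahead \<tau> K t (v w))"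
    unfolding eq
    by (rule Bochner_Integration.integral_diff[symmetric]) (rule int)+
  also have "\<bar>\<dots>\<bar> \<le> expectation (\<lambda>w. \<bar>ahead \<tau> K s (v w) - ahead \<tau> K t (v w)\<bar>)"
    by (rule integral_abs_bound)
  also have "\<dots> \<le> expectation (\<lambda>w. (K + 1) / \<tau> * dist s t)"
    by (intro integral_mono integrable_abs Bochner_Integration.integrable_diff int
        ahead_lipschitz_direction \<tau> K) auto
  finally show ?thesis by (simp add: prob_space)
qed

text \<open>The portmanteau bound for the law of the direction given an exceedance, written as a
  restricted measure with prefactor \<open>1 / tail (M n)\<close>.\<close>

lemma direction_integral:
  assumes f: "continuous_on (sphere 0 1) f" "\<And>x. x \<in> sphere 0 1 \<Longrightarrow> 0 \<le> f x \<and> f x \<le> (1::real)" and e: "e > 0"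
  shows "eventually (\<lambda>n. expectation (\<lambda>w. exceed n w * f (sgn (H w))) / tail (M n) \<le> (\<integral>s. f s \<partial>\<sigma>) +
      e) sequentially"
proof -
  interpret \<sigma>: prob_space \<sigma> by (rule \<sigma>_prob)
  \<comment> \<open>\<open>M 0\<close> need not be positive; the maximum with 0 excludes
    \<open>H w = 0\<close> for every \<open>n\<close>, so that directions lie on the sphere.\<close>
  define A where "A = (\<lambda>n. {w \<in> space P. norm (H w) > max 0 (M n)})"
  have A [measurable]: "A n \<in> sets P" for n unfolding A_def by measurable
  have X: "(\<lambda>w. sgn (H w)) \<in> measurable (restrict_space P (A n)) (restrict_space borel (sphere 0 1))" for n
    by (rule sgn_vimage_sphere_measurable) (auto simp: A_def)
  have "eventually (\<lambda>n. (1 / tail (M n)) * (\<integral>w. f (sgn (H w)) \<partial>restrict_space P (A n)) \<le> (\<integral>s. f s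
      \<partial>\<sigma>) + e) sequentially"
  proof (rule portmanteau_upper[where K = "sphere 0 1" and X = "\<lambda>_ w. sgn (H w)"])
    show "finite_measure (restrict_space P (A n))" for n
      by (rule finite_measure_restrict_space) (auto simp: finite_measure_axioms A)
    show "finite_measure \<sigma>" by (rule \<sigma>.finite_measure)
    fix F :: "'a set" and e :: real assume F: "closed F" "F \<subseteq> sphere 0 1" and e: "e > 0"
    have Fm [measurable]: "F \<in> sets borel" using F by simp
    have "eventually (\<lambda>n. prob {w \<in> space P. norm (H w) > M n \<and> sgn (H w) \<in> F} \<le> (measure \<sigma> F + e) *
        tail (M n)) sequentially"
      using eventually_compose_filterlim[OF directions[OF F e] M_lim] .
    then show "eventually (\<lambda>n. 1 / tail (M n) * measure (restrict_space P (A n))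
        ((\<lambda>w. sgn (H w)) -` F \<inter> space (restrict_space P (A n))) \<le> measure \<sigma> F + e) sequentially"
    proof eventually_elim
      case (elim n)
      have "measure (restrict_space P (A n)) ((\<lambda>w. sgn (H w)) -` F \<inter> space (restrict_space P (A n)))
          = prob ((\<lambda>w. sgn (H w)) -` F \<inter> space (restrict_space P (A n)))"
        by (rule measure_restrict_space) (auto simp: space_restrict_space A_def)
      also have "\<dots> \<le> prob {w \<in> space P. norm (H w) > M n \<and> sgn (H w) \<in> F}"
        by (rule finite_measure_mono) (auto simp: space_restrict_space A_def)
      also have "\<dots> \<le> (measure \<sigma> F + e) * tail (M n)" by (rule elim)
      finally show ?case using G_pos[of "M n"] by (simp add: field_simps)
    qed
  qed (use f e X \<sigma>_sets in auto)
  then show ?thesis using eventually_ge_1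
  proof eventually_elim
    case (elim n)
    have "(\<integral>w. f (sgn (H w)) \<partial>restrict_space P (A n)) = expectation (\<lambda>w. indicator (A n) w *\<^sub>R f (sgn (H w)))"
      by (rule integral_restrict_space) auto
    also have "\<dots> = expectation (\<lambda>w. exceed n w * f (sgn (H w)))"
      using M_pos elim by (intro Bochner_Integration.integral_cong refl)
        (auto simp: exceed_def A_def indicator_def max_def less_imp_le)
    finally show ?case using elim by simp
  qed
qed

lemma u_emp_upper:
  assumes \<tau>: "\<tau> > 0" and e: "e > 0"
  shows "eventually (\<lambda>n. \<forall>s\<in>sphere 0 1. u_emp \<tau> n s \<le> u_lim \<tau> s + e) sequentially"
proof (rule equi_lipschitz_upper_uniform[where D = "1 / \<tau>"])
  show "eventually (\<lambda>n. u_emp \<tau> n s \<le> u_lim \<tau> s + e) sequentially" if "e > 0" for s e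
    unfolding u_emp_def u_lim_def
  proof (rule direction_integral[OF _ _ that])
    show "continuous_on (sphere 0 1) (near_point \<tau> s)"
      unfolding near_point_def divide_inverse by (intro continuous_intros)
  qed auto
qed (use \<tau> e u_emp_lipschitz u_lim_lipschitz in auto)

lemma \<psi>_emp_upper:
  assumes \<tau>: "\<tau> > 0" and K: "K > 0" and e: "e > 0"
  shows "eventually (\<lambda>n. \<forall>s\<in>sphere 0 1. \<psi>_emp \<tau> K n s \<le> \<psi>_lim \<tau> K s + e) sequentially"
proof (rule equi_lipschitz_upper_uniform[where D = "(K + 1) / \<tau>"])
  fix s :: 'a and e :: real assume s: "s \<in> sphere 0 1" and e: "e > 0"
  have "(\<lambda>n. \<psi>_emp \<tau> K n s) \<longlonglongrightarrow> \<psi>_lim \<tau> K s"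
    unfolding \<psi>_emp_def \<psi>_lim_def
    by (rule expectation_shifted_stable_limit[where D = "1 / \<tau> + 1"]) (use s \<tau> ahead_lipschitz in auto)
  then have "eventually (\<lambda>n. \<psi>_emp \<tau> K n s < \<psi>_lim \<tau> K s + e) sequentially"
    by (rule order_tendstoD) (use e in simp)
  then show "eventually (\<lambda>n. \<psi>_emp \<tau> K n s \<le> \<psi>_lim \<tau> K s + e) sequentially"
    by (rule eventually_mono) simp
qed (use \<tau> K e \<psi>_emp_lipschitz \<psi>_lim_lipschitz in auto)

lemma far_emp_lim: "far_emp K \<longlonglongrightarrow> far_lim K"
proof -
  have "\<bar>(1 - clamp01 (K + 1 - norm x)) - (1 - clamp01 (K + 1 - norm y))\<bar> \<le> 1 * dist x y" for x y :: 'a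
  proof -
    have "\<bar>(1 - clamp01 (K + 1 - norm x)) - (1 - clamp01 (K + 1 - norm y))\<bar>
        = \<bar>clamp01 (K + 1 - norm y) - clamp01 (K + 1 - norm x)\<bar>" by simp
    also have "\<dots> \<le> \<bar>(K + 1 - norm y) - (K + 1 - norm x)\<bar>" by (rule clamp01_lipschitz)
    also have "\<dots> \<le> dist x y" using norm_triangle_ineq3[of x y] by (simp add: dist_norm)
    finally show ?thesis by simp
  qed
  then show ?thesis
    unfolding far_emp_def[abs_def] far_lim_def
    by (intro expectation_shifted_stable_limit[where f = "\<lambda>x. 1 - clamp01 (K + 1 - norm x)" and D = 1]) auto
qed

lemma main_fun_continuous:
  assumes "\<tau> > 0" "K > 0"
  shows "continuous_on (sphere 0 1) (main_fun \<tau> K \<epsilon> F)"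
proof -
  have "continuous_on (sphere 0 1) (u_lim \<tau>)"
    by (rule lipschitz_continuous_on[where D = "1 / \<tau>"]) (use assms u_lim_lipschitz in auto)
  moreover have "continuous_on (sphere 0 1) (\<psi>_lim \<tau> K)"
    by (rule lipschitz_continuous_on[where D = "(K + 1) / \<tau>"]) (use assms \<psi>_lim_lipschitz in auto)
  ultimately show ?thesis
    unfolding main_fun_def by (intro continuous_intros continuous_on_near_set)
qed

lemma main_fun_bounds:
  assumes "\<epsilon> > 0"
  shows "0 \<le> main_fun \<tau> K \<epsilon> F s" "main_fun \<tau> K \<epsilon> F s \<le> 1"
  unfolding main_fun_def using assms u_lim_nonneg[of \<tau> s] \<psi>_lim_nonneg[of \<tau> K s]
  by (auto intro!: mult_nonneg_nonneg mult_le_one power_le_one)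

text \<open>The uniform bounds replace the empirical factors by their limits plus \<epsilon> at the
  random direction. What is left is a fixed continuous function of that direction.\<close>

lemma main_emp_upper:
  assumes \<tau>: "\<tau> > 0" and K: "K > 0" and \<epsilon>: "\<epsilon> > 0" and e: "e > 0"
  shows "eventually (\<lambda>n. main_emp \<tau> K F n \<le> (\<integral>s. main_fun \<tau> K \<epsilon> F s \<partial>\<sigma>) + e) sequentially"
proof -
  have "eventually (\<lambda>n. expectation (\<lambda>w. exceed n w * main_fun \<tau> K \<epsilon> F (sgn (H w))) / tail (M n)
      \<le> (\<integral>s. main_fun \<tau> K \<epsilon> F s \<partial>\<sigma>) + e) sequentially"
    using main_fun_bounds[OF \<epsilon>] by (intro direction_integral main_fun_continuous \<tau> K e) auto
  with u_emp_upper[OF \<tau> \<epsilon>] \<psi>_emp_upper[OF \<tau> K \<epsilon>] show ?thesis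
    using eventually_ge_1
  proof eventually_elim
    case (elim n)
    have p: "tail (M n) > 0" by (rule G_pos)
    have Mn: "M n > 0" using M_pos elim by simp
    let ?f = "\<lambda>w. near_set \<tau> F (sgn (H w)) * u_emp \<tau> n (sgn (H w)) ^ (k - 1) * \<psi>_emp \<tau> K n (sgn (H w))"
    have uc: "continuous_on UNIV (u_emp \<tau> n)"
      by (rule lipschitz_continuous_on[where D = "1 / \<tau>"]) (use \<tau> u_emp_lipschitz in auto)
    have pc: "continuous_on UNIV (\<psi>_emp \<tau> K n)"
      by (rule lipschitz_continuous_on[where D = "(K + 1) / \<tau>"]) (use \<tau> K \<psi>_emp_lipschitz in auto)
    have [measurable]: "u_emp \<tau> n \<in> borel_measurable borel" "\<psi>_emp \<tau> K n \<in> borel_measurable borel"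
      using uc pc by (auto intro: borel_measurable_continuous_onI)
    have uc': "continuous_on UNIV (u_lim \<tau>)"
      by (rule lipschitz_continuous_on[where D = "1 / \<tau>"]) (use \<tau> u_lim_lipschitz in auto)
    have pc': "continuous_on UNIV (\<psi>_lim \<tau> K)"
      by (rule lipschitz_continuous_on[where D = "(K + 1) / \<tau>"]) (use \<tau> K \<psi>_lim_lipschitz in auto)
    have "continuous_on UNIV (main_fun \<tau> K \<epsilon> F)"
      unfolding main_fun_def using uc' pc' by (intro continuous_intros continuous_on_near_set)
    then have [measurable]: "main_fun \<tau> K \<epsilon> F \<in> borel_measurable borel" by (rule
        borel_measurable_continuous_onI)
    have f_bounds: "0 \<le> ?f w" "?f w \<le> 1" for w
      using u_emp_bounds \<psi>_emp_bounds by (auto intro!: mult_nonneg_nonneg mult_le_one power_le_one)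
    have "expectation (\<lambda>w. exceed n w * ?f w) \<le> expectation (\<lambda>w. exceed n w * main_fun \<tau> K \<epsilon> F (sgn (H w)))"
    proof (rule integral_mono)
      show "integrable P (\<lambda>w. exceed n w * ?f w)"
      proof (rule integrable_const_bound[where B = 1])
        show "AE w in P. norm (exceed n w * ?f w) \<le> 1"
          using f_bounds by (intro AE_I2) (auto simp: exceed_def indicator_def)
      qed measurable
      show "integrable P (\<lambda>w. exceed n w * main_fun \<tau> K \<epsilon> F (sgn (H w)))"
      proof (rule integrable_const_bound[where B = 1])
        show "AE w in P. norm (exceed n w * main_fun \<tau> K \<epsilon> F (sgn (H w))) \<le> 1"
          using main_fun_bounds[OF \<epsilon>] by (intro AE_I2) (auto simp: exceed_def indicator_def)
      qed measurable
      fix w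
      show "exceed n w * ?f w \<le> exceed n w * main_fun \<tau> K \<epsilon> F (sgn (H w))"
      proof (cases "norm (H w) > M n")
        case True
        then have "H w \<noteq> 0" using Mn by auto
        then have s: "sgn (H w) \<in> sphere 0 1" by (simp add: norm_sgn)
        have "?f w \<le> main_fun \<tau> K \<epsilon> F (sgn (H w))"
          unfolding main_fun_def using elim(1,2) s u_emp_bounds \<psi>_emp_bounds
            u_lim_nonneg[of \<tau> "sgn (H w)"] \<epsilon>
          by (intro mult_mono power_mono) auto
        then show ?thesis by (intro mult_left_mono) (auto simp: exceed_def)
      qed (simp add: exceed_def)
    qed
    then have "main_emp \<tau> K F n \<le> expectation (\<lambda>w. exceed n w * main_fun \<tau> K \<epsilon> F (sgn (H w))) / tail (M n)"
      unfolding main_emp_def using p by (intro divide_right_mono) auto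
    also have "\<dots> \<le> (\<integral>s. main_fun \<tau> K \<epsilon> F s \<partial>\<sigma>) + e"
      by (rule elim)
    finally show ?case .
  qed
qed

abbreviation ratio :: "nat \<Rightarrow> 'a set \<Rightarrow> real" where
  "ratio n F \<equiv> overshoot_ratio P H M S k n F"

text \<open>Outside the residual event the large indices form one set of size \<open>k\<close>. All
  such sets obey the same bound, and the binomial count against \<open>n ^ k\<close> produces the
  factor \<open>1 / fact k\<close>.\<close>

lemma ratio_upper:
  assumes F: "closed F" and \<tau>: "0 < \<tau>" "\<tau> \<le> 1" and K: "K > 0" and \<epsilon>: "\<epsilon> > 0" and e: "e > 0"
  shows "eventually (\<lambda>n. ratio n F \<le> (far_lim K + (\<integral>s. main_fun \<tau> K \<epsilon> F s \<partial>\<sigma>)) / fact k + e) sequentially"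
proof -
  define R where "R = far_lim K + (\<integral>s. main_fun \<tau> K \<epsilon> F s \<partial>\<sigma>)"
  have [measurable]: "F \<in> sets borel" using F by simp
  have kp: "real k > 0" using k_ge_2 by simp
  define \<beta> where "\<beta> = (\<lambda>n. B n / M n)"
  have \<beta>: "\<beta> \<longlonglongrightarrow> 0" unfolding \<beta>_def by (rule B_over_M)
  have lim1: "(\<lambda>n. \<beta> n * (K + 2)) \<longlonglongrightarrow> 0 * (K + 2)"
    by (intro tendsto_intros \<beta>)
  have e1: "eventually (\<lambda>n. \<beta> n * (K + 2) < 2) sequentially"
    by (rule order_tendstoD[OF lim1]) simp
  have "(\<lambda>n. \<beta> n * (K + 2)\<^sup>2 + 2 * sqrt (\<beta> n * (K + 2)) * (K + 2)) \<longlonglongrightarrow> 0 * (K + 2)\<^sup>2 + 2 * sqrt (0 *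
      (K + 2)) * (K + 2)"
    by (intro tendsto_intros \<beta>)
  then have e2: "eventually (\<lambda>n. \<beta> n * (K + 2)\<^sup>2 + 2 * sqrt (\<beta> n * (K + 2)) * (K + 2) < \<tau>) sequentially"
    by (rule order_tendstoD) (use \<tau> in simp)
  have "(\<lambda>n. 2 * (2 * sqrt (\<beta> n * (K + 2)) + \<beta> n * (K + 2))) \<longlonglongrightarrow> 2 * (2 * sqrt (0 * (K + 2)) + 0 * (K + 2))"
    by (intro tendsto_intros \<beta>)
  then have e3: "eventually (\<lambda>n. 2 * (2 * sqrt (\<beta> n * (K + 2)) + \<beta> n * (K + 2)) < \<tau>) sequentially"
    by (rule order_tendstoD) (use \<tau> in simp)
  have e4: "eventually (\<lambda>n. far_emp K n < far_lim K + e / 4) sequentially"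
    by (rule order_tendstoD[OF far_emp_lim]) (use e in simp)
  have ltail0: "(ltail \<longlongrightarrow> 0) at_top"
  proof -
    have "((\<lambda>x. ltail x / tail x ^ (k - 1)) \<longlongrightarrow> 0) at_top"
      using ltail_small by (rule smalloD_tendsto)
    then have "((\<lambda>x. ltail x / tail x ^ (k - 1) * tail x ^ (k - 1)) \<longlongrightarrow> 0 * 0 ^ (k - 1)) at_top"
      by (intro tendsto_mult tendsto_power tail_lim_0)
    moreover have "ltail x / tail x ^ (k - 1) * tail x ^ (k - 1) = ltail x" for x
      using G_pos[of x] by simp
    ultimately show ?thesis by simp
  qed
  have "filterlim (\<lambda>n. \<tau> / real k * B n) at_top sequentially"
    by (rule filterlim_tendsto_pos_mult_at_top[OF tendsto_const _ B_lim]) (use \<tau> kp in simp)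
  from filterlim_compose[OF ltail0 this]
  have "(\<lambda>n. real k * ltail (\<tau> * B n / real k)) \<longlonglongrightarrow> real k * 0"
    by (intro tendsto_mult tendsto_const) simp
  then have e5: "eventually (\<lambda>n. real k * ltail (\<tau> * B n / real k) < e / 4) sequentially"
    by (rule order_tendstoD) (use e in simp)
  have e6: "eventually (\<lambda>n. prob {w \<in> space P. norm (S n w) > real k * M n \<and> card (big (M n) n w) \<noteq>
      k} / exc n ^ k < e / 4) sequentially"
    by (rule order_tendstoD[OF overshoot_residual]) (use e in simp)
  have e7: "eventually (\<lambda>n. main_emp \<tau> K F n \<le> (\<integral>s. main_fun \<tau> K \<epsilon> F s \<partial>\<sigma>) + e / 4) sequentially"
    by (rule main_emp_upper[OF \<tau>(1) K \<epsilon>]) (use e in simp)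
  show ?thesis
    using e1 e2 e3 e4 e5 e6 e7 eventually_ge_1
  proof eventually_elim
    case (elim n)
    define Q where "Q = {w \<in> space P. norm (S n w) > real k * M n \<and> card (big (M n) n w) \<noteq> k}"
    define W where "W = (\<lambda>A. {w \<in> space P. norm (S n w) > real k * M n \<and> sgn (S n w) \<in> F \<and> big (M n)
        n w = A})"
    \<comment> \<open>Three quarters of \<open>e\<close> cover the excesses, the far part and the
      main integral; the last quarter is for the residual event \<open>Q\<close>.\<close>
    define r where "r = tail (M n) ^ k * (R + 3 / 4 * e)"
    have ex: "exc n > 0" using elim exc_pos by simp
    have Q: "Q \<in> sets P" unfolding Q_def by (rule sets_overshoot_big)
    have Wm: "W A \<in> sets P" if "A \<in> subsets_of_size n k" for A
    proof -
      have h: "(\<lambda>w. Hs j w) \<in> borel_measurable P" if "j \<in> {1..n}" for j using that Hs_measurable by simp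
      have "{w \<in> space P. big (M n) n w = A} = {w \<in> space P. \<forall>j\<in>{1..n}. norm (Hs j w) > M n \<longleftrightarrow> j \<in> A}"
        using that by (auto simp: big_def subsets_of_size_def)
      also have "\<dots> \<in> sets P"
        using h by (intro sets.sets_Collect_finite_All) (auto intro!: sets.sets_Collect)
      finally have "{w \<in> space P. big (M n) n w = A} \<in> sets P" .
      moreover have "{w \<in> space P. norm (S n w) > real k * M n \<and> sgn (S n w) \<in> F} \<in> sets P" by measurable
      moreover have "W A = {w \<in> space P. norm (S n w) > real k * M n \<and> sgn (S n w) \<in> F} \<inter> {w \<in> space
          P. big (M n) n w = A}"
        by (auto simp: W_def)
      ultimately show ?thesis by auto
    qed
    have "{w \<in> space P. norm (S n w) > real k * M n \<and> sgn (S n w) \<in> F} \<subseteq> Q \<union> (\<Union>A\<in>subsets_of_size n k. W A)"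
      by (auto simp: Q_def W_def subsets_of_size_def big_def)
    then have "prob {w \<in> space P. norm (S n w) > real k * M n \<and> sgn (S n w) \<in> F}
        \<le> prob (Q \<union> (\<Union>A\<in>subsets_of_size n k. W A))"
      using Q Wm by (intro finite_measure_mono sets.Un sets.finite_UN) auto
    also have "\<dots> \<le> prob Q + prob (\<Union>A\<in>subsets_of_size n k. W A)"
      using Q Wm by (intro measure_Un_le sets.finite_UN) auto
    also have "prob (\<Union>A\<in>subsets_of_size n k. W A) \<le> (\<Sum>A\<in>subsets_of_size n k. prob (W A))"
      using Wm by (intro finite_measure_subadditive_finite) auto
    also have "\<dots> \<le> (\<Sum>A\<in>subsets_of_size n k. r)"
    proof (rule sum_mono)
      fix A assume A: "A \<in> subsets_of_size n k"
      have "prob (W A) \<le> tail (M n) ^ k * (real k * ltail (\<tau> * B n / real k) + far_emp K n +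
          main_emp \<tau> K F n)"
        unfolding W_def
        by (rule main_term_subset[OF elim(8) A \<tau> K]) (use elim(1,2,3) in \<open>auto simp: \<beta>_def less_imp_le\<close>)
      also have "\<dots> \<le> r"
        unfolding r_def R_def using elim(4,5,7) by (intro mult_left_mono) auto
      finally show "prob (W A) \<le> r" .
    qed
    also have "\<dots> = real (n choose k) * r" by (simp add: card_subsets_of_size)
    also have "\<dots> \<le> real n ^ k / fact k * r"
    proof (rule mult_right_mono[OF choose_le_power])
      have "0 \<le> far_lim K" unfolding far_lim_def by (intro Bochner_Integration.integral_nonneg) auto
      moreover have "0 \<le> (\<integral>s. main_fun \<tau> K \<epsilon> F s \<partial>\<sigma>)"
        using main_fun_bounds[OF \<epsilon>] by (intro Bochner_Integration.integral_nonneg) auto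
      ultimately show "0 \<le> r" unfolding r_def R_def using e by simp
    qed
    also have "\<dots> = exc n ^ k * ((R + 3 / 4 * e) / fact k)"
      by (simp add: r_def exc_def power_mult_distrib)
    finally have "prob {w \<in> space P. norm (S n w) > real k * M n \<and> sgn (S n w) \<in> F} / exc n ^ k
        \<le> (prob Q + exc n ^ k * ((R + 3 / 4 * e) / fact k)) / exc n ^ k"
      using ex by (intro divide_right_mono) auto
    also have "\<dots> = prob Q / exc n ^ k + (R + 3 / 4 * e) / fact k"
      using ex by (simp add: add_divide_distrib)
    also have "\<dots> \<le> R / fact k + e"
    proof -
      have "3 / 4 * e / fact k \<le> 3 / 4 * e / 1" using e by (intro divide_left_mono) (auto simp: fact_ge_1)
      moreover have "(R + 3 / 4 * e) / fact k = R / fact k + 3 / 4 * e / fact k"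
        by (rule add_divide_distrib)
      ultimately show ?thesis using elim(6) unfolding Q_def[symmetric] by linarith
    qed
    finally show ?case unfolding overshoot_ratio_def exc_def R_def .
  qed
qed

end

section \<open>Removal of the cutoffs, with widths and errors \<open>1 / Suc m\<close> and radius
  \<open>Suc m\<close>\<close>

lemma eventually_real_Suc_mult_ge:
  fixes x c :: real
  assumes "x > 0"
  shows "eventually (\<lambda>m. c \<le> real (Suc m) * x) sequentially"
proof -
  obtain m0 where "c / x < real m0" using reals_Archimedean2 by blast
  then have m0: "c < real m0 * x" using assms by (simp add: field_simps)
  have "c \<le> real (Suc m) * x" if "m \<ge> m0" for m
  proof -
    have "real m0 * x \<le> real (Suc m) * x" using that assms by (intro mult_right_mono) auto
    with m0 show ?thesis by linarith
  qed
  then show ?thesis by (auto simp: eventually_sequentially)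
qed

context soft_overshoot
begin

lemma far_lim_tendsto: "(\<lambda>m. far_lim (real (Suc m))) \<longlonglongrightarrow> 0"
proof -
  have "(\<lambda>m. far_lim (real (Suc m))) \<longlonglongrightarrow> expectation (\<lambda>w. 0)"
    unfolding far_lim_def
  proof (rule integral_dominated_convergence[where w = "\<lambda>_. 1"])
    show "AE w in P. (\<lambda>m. 1 - clamp01 (real (Suc m) + 1 - norm (V w))) \<longlonglongrightarrow> 0"
    proof (rule AE_I2)
      fix w
      have "eventually (\<lambda>m. norm (V w) \<le> real (Suc m) * 1) sequentially"
        by (rule eventually_real_Suc_mult_ge) simp
      then have "eventually (\<lambda>m. 1 - clamp01 (real (Suc m) + 1 - norm (V w)) = 0) sequentially"
        by eventually_elim simp
      then show "(\<lambda>m. 1 - clamp01 (real (Suc m) + 1 - norm (V w))) \<longlonglongrightarrow> 0"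
        by (rule tendsto_eventually)
    qed
  qed auto
  then show ?thesis by simp
qed

lemma near_point_tendsto: "(\<lambda>m. near_point (1 / real (Suc m)) s t) \<longlonglongrightarrow> indicator {s} t"
proof (cases "t = s")
  case True
  then show ?thesis by (simp add: near_point_def)
next
  case False
  then have "dist s t > 0" by simp
  then have "eventually (\<lambda>m. 2 \<le> real (Suc m) * dist s t) sequentially"
    by (rule eventually_real_Suc_mult_ge)
  then have "eventually (\<lambda>m. near_point (1 / real (Suc m)) s t = indicator {s} t) sequentially"
    by eventually_elim (use False in \<open>simp add: near_point_def mult.commute\<close>)
  then show ?thesis by (rule tendsto_eventually)
qed

lemma near_set_tendsto:
  assumes "closed F" "F \<noteq> {}"
  shows "(\<lambda>m. near_set (1 / real (Suc m)) F s) \<longlonglongrightarrow> indicator F s"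
proof (cases "s \<in> F")
  case True
  then show ?thesis by (simp add: near_set_def)
next
  case False
  then have "infdist s F > 0" using assms by (simp add: infdist_pos_not_in_closed)
  then have "eventually (\<lambda>m. 2 \<le> real (Suc m) * infdist s F) sequentially"
    by (rule eventually_real_Suc_mult_ge)
  then have "eventually (\<lambda>m. near_set (1 / real (Suc m)) F s = indicator F s) sequentially"
    by eventually_elim (use False in \<open>simp add: near_set_def mult.commute\<close>)
  then show ?thesis by (rule tendsto_eventually)
qed

text \<open>On the boundary \<open>s \<bullet> v = 0\<close> the cutoff stays at 1 in the limit,
  which is why the closed half-space appears in the upper bound.\<close>

lemma ahead_tendsto:
  "(\<lambda>m. ahead (1 / real (Suc m)) (real (Suc m)) s v) \<longlonglongrightarrow> (if s \<bullet> v \<ge> 0 then 1 else 0)"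
proof (cases "s \<bullet> v \<ge> 0")
  case True
  have "eventually (\<lambda>m. norm v \<le> real (Suc m) * 1) sequentially"
    by (rule eventually_real_Suc_mult_ge) simp
  then have "eventually (\<lambda>m. ahead (1 / real (Suc m)) (real (Suc m)) s v = (if s \<bullet> v \<ge> 0 then 1 else
      0)) sequentially"
    by eventually_elim (use True in \<open>simp add: ahead_def\<close>)
  then show ?thesis by (rule tendsto_eventually)
next
  case False
  then have "- (s \<bullet> v) > 0" by simp
  then have "eventually (\<lambda>m. 3 \<le> real (Suc m) * - (s \<bullet> v)) sequentially"
    by (rule eventually_real_Suc_mult_ge)
  then have "eventually (\<lambda>m. ahead (1 / real (Suc m)) (real (Suc m)) s v = (if s \<bullet> v \<ge> 0 then 1 else
      0)) sequentially"
    by eventually_elim (use False in \<open>simp add: ahead_def mult.commute\<close>)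
  then show ?thesis by (rule tendsto_eventually)
qed

definition halfspace_prob :: "'a \<Rightarrow> real" where
  "halfspace_prob s = \<P>(w in P. s \<bullet> V w \<ge> 0)"

lemma halfspace_prob_bounds: "0 \<le> halfspace_prob s" "halfspace_prob s \<le> 1"
  by (auto simp: halfspace_prob_def)

lemma sets_singleton_\<sigma>: "s \<in> sphere 0 1 \<Longrightarrow> {s} \<in> sets \<sigma>"
  unfolding \<sigma>_sets by (subst sets_restrict_space_iff) auto

lemma u_lim_tendsto:
  assumes s: "s \<in> sphere 0 1"
  shows "(\<lambda>m. u_lim (1 / real (Suc m)) s) \<longlonglongrightarrow> measure \<sigma> {s}"
proof -
  interpret \<sigma>: prob_space \<sigma> by (rule \<sigma>_prob)
  have "(\<lambda>m. u_lim (1 / real (Suc m)) s) \<longlonglongrightarrow> (\<integral>t. indicator {s} t \<partial>\<sigma>)"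
    unfolding u_lim_def
  proof (rule integral_dominated_convergence[where w = "\<lambda>_. 1"])
    show "indicator {s} \<in> borel_measurable \<sigma>" using sets_singleton_\<sigma>[OF s] by simp
    show "AE t in \<sigma>. (\<lambda>m. near_point (1 / real (Suc m)) s t) \<longlonglongrightarrow> indicator {s} t"
      using near_point_tendsto by (intro AE_I2)
    show "near_point (1 / real (Suc m)) s \<in> borel_measurable \<sigma>" for m
      by (intro \<sigma>_measurable) measurable
  qed auto
  then show ?thesis using s by (simp add: space_\<sigma>)
qed

lemma \<psi>_lim_tendsto: "(\<lambda>m. \<psi>_lim (1 / real (Suc m)) (real (Suc m)) s) \<longlonglongrightarrow> halfspace_prob s"
proof -
  have "(\<lambda>m. \<psi>_lim (1 / real (Suc m)) (real (Suc m)) s) \<longlonglongrightarrow> expectation (\<lambda>w. indicator {w \<in> space P. s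
      \<bullet> V w \<ge> 0} w)"
    unfolding \<psi>_lim_def
  proof (rule integral_dominated_convergence[where w = "\<lambda>_. 1"])
    show "AE w in P. (\<lambda>m. ahead (1 / real (Suc m)) (real (Suc m)) s (V w)) \<longlonglongrightarrow> indicator {w \<in> space P.
        s \<bullet> V w \<ge> 0} w"
    proof (rule AE_I2)
      fix w assume "w \<in> space P"
      then have "indicator {w \<in> space P. s \<bullet> V w \<ge> 0} w = (if s \<bullet> V w \<ge> 0 then 1 else 0 :: real)" by simp
      with ahead_tendsto[of s "V w"]
      show "(\<lambda>m. ahead (1 / real (Suc m)) (real (Suc m)) s (V w)) \<longlonglongrightarrow> indicator {w \<in> space P. s \<bullet> V w \<ge> 0} w"
        by simp
    qed
  qed auto
  then show ?thesis by (simp add: halfspace_prob_def)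
qed

definition limit_density :: "'a set \<Rightarrow> 'a \<Rightarrow> real" where
  "limit_density F s = indicator F s * measure \<sigma> {s} ^ (k - 1) * halfspace_prob s"

lemma limit_density_bounds: "0 \<le> limit_density F s" "limit_density F s \<le> 1"
proof -
  interpret \<sigma>: prob_space \<sigma> by (rule \<sigma>_prob)
  show "0 \<le> limit_density F s" "limit_density F s \<le> 1"
    unfolding limit_density_def using halfspace_prob_bounds
    by (auto intro!: mult_le_one power_le_one)
qed

lemma main_fun_measurable:
  assumes "\<tau> > 0" "K > 0"
  shows "main_fun \<tau> K \<epsilon> F \<in> borel_measurable \<sigma>"
  by (subst measurable_cong_sets[OF \<sigma>_sets refl])
    (rule borel_measurable_continuous_on_restrict[OF main_fun_continuous[OF assms]])

lemma main_fun_tendsto: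
  assumes F: "closed F" "F \<noteq> {}" and s: "s \<in> sphere 0 1"
  shows "(\<lambda>m. main_fun (1 / real (Suc m)) (real (Suc m)) (1 / real (Suc m)) F s) \<longlonglongrightarrow> limit_density F s"
proof -
  interpret \<sigma>: prob_space \<sigma> by (rule \<sigma>_prob)
  have inv: "(\<lambda>m. 1 / real (Suc m)) \<longlonglongrightarrow> 0"
    using LIMSEQ_inverse_real_of_nat by (simp add: inverse_eq_divide)
  have "(\<lambda>m. main_fun (1 / real (Suc m)) (real (Suc m)) (1 / real (Suc m)) F s) \<longlonglongrightarrow>
      indicator F s * min 1 (measure \<sigma> {s} + 0) ^ (k - 1) * min 1 (halfspace_prob s + 0)"
    unfolding main_fun_def
    by (intro tendsto_mult tendsto_power tendsto_min tendsto_add tendsto_const near_set_tendsto F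
        u_lim_tendsto s \<psi>_lim_tendsto inv)
  then show ?thesis by (simp add: limit_density_def halfspace_prob_bounds min_absorb2)
qed

text \<open>Measurability of the atom masses as a function of \<open>s\<close> comes from the limit:
  the density is a pointwise limit of continuous functions on the sphere.\<close>

lemma limit_density_measurable:
  assumes "closed F" "F \<noteq> {}"
  shows "limit_density F \<in> borel_measurable \<sigma>"
proof (rule borel_measurable_LIMSEQ_real)
  show "(\<lambda>m. main_fun (1 / real (Suc m)) (real (Suc m)) (1 / real (Suc m)) F s) \<longlonglongrightarrow> limit_density F s"
    if "s \<in> space \<sigma>" for s using main_fun_tendsto[OF assms] that by (simp add: space_\<sigma>)
qed (rule main_fun_measurable; simp)

lemma main_fun_integral_tendsto:
  assumes F: "closed F" "F \<noteq> {}"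
  shows "(\<lambda>m. \<integral>s. main_fun (1 / real (Suc m)) (real (Suc m)) (1 / real (Suc m)) F s \<partial>\<sigma>)
    \<longlonglongrightarrow> (\<integral>s. limit_density F s \<partial>\<sigma>)"
proof (rule integral_dominated_convergence[where w = "\<lambda>_. 1"])
  interpret \<sigma>: prob_space \<sigma> by (rule \<sigma>_prob)
  show "limit_density F \<in> borel_measurable \<sigma>" by (rule limit_density_measurable[OF F])
  show "main_fun (1 / real (Suc m)) (real (Suc m)) (1 / real (Suc m)) F \<in> borel_measurable \<sigma>" for m
    by (rule main_fun_measurable) simp_all
  show "integrable \<sigma> (\<lambda>_. 1::real)" by simp
  show "AE s in \<sigma>. (\<lambda>m. main_fun (1 / real (Suc m)) (real (Suc m)) (1 / real (Suc m)) F s) \<longlonglongrightarrow>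
      limit_density F s"
    using main_fun_tendsto[OF F] by (intro AE_I2) (simp add: space_\<sigma>)
  show "AE s in \<sigma>. norm (main_fun (1 / real (Suc m)) (real (Suc m)) (1 / real (Suc m)) F s) \<le> 1" for m
    using main_fun_bounds[of "1 / real (Suc m)" "1 / real (Suc m)" "real (Suc m)" F] by (intro AE_I2) simp
qed

text \<open>The density vanishes off the countably many atoms of \<open>\<sigma>\<close>, so the integral is a sum.\<close>

lemma limit_density_integral:
  assumes F: "closed F" "F \<noteq> {}" "F \<subseteq> sphere 0 1"
  shows "(\<integral>s. limit_density F s \<partial>\<sigma>) = fact k * Gamma_fun P V \<sigma> k F"
proof -
  interpret \<sigma>: prob_space \<sigma> by (rule \<sigma>_prob)
  define f where "f = limit_density F"
  define T where "T = {s \<in> F. measure \<sigma> {s} \<noteq> 0}"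
  have T: "countable T"
    unfolding T_def by (rule countable_subset[OF _ \<sigma>.countable_support]) auto
  have fm: "f \<in> borel_measurable \<sigma>" unfolding f_def by (rule limit_density_measurable[OF F(1,2)])
  have f0: "f s \<ge> 0" "f s \<le> 1" for s unfolding f_def by (rule limit_density_bounds)+
  have fz: "f s = 0" if "s \<notin> T" for s
    using that k_ge_2 by (auto simp: f_def limit_density_def T_def indicator_def power_0_left)
  have Ts: "{t} \<in> sets \<sigma>" if "t \<in> T" for t using that F(3) by (intro sets_singleton_\<sigma>) (auto simp: T_def)
  \<comment> \<open>Writing \<open>f\<close> as a countable sum of multiples of singleton indicators
    lets the integral against \<sigma> be interchanged with the sum over \<open>T\<close>.\<close>
  have point: "(\<integral>\<^sup>+t. ennreal (f t) * indicator {t} x \<partial>count_space T) = ennreal (f x)" for x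
  proof (cases "x \<in> T")
    case True
    have "(\<integral>\<^sup>+t. ennreal (f t) * indicator {t} x \<partial>count_space T)
        = (\<integral>\<^sup>+t. ennreal (f t) * indicator {x} t \<partial>count_space T)"
      by (intro nn_integral_cong) (auto simp: indicator_def)
    also have "\<dots> = ennreal (f x) * emeasure (count_space T) {x}"
      using True by (intro nn_integral_indicator_singleton) auto
    finally show ?thesis using True by simp
  next
    case False
    then have "(\<integral>\<^sup>+t. ennreal (f t) * indicator {t} x \<partial>count_space T) = (\<integral>\<^sup>+t. 0 \<partial>count_space T)"
      by (intro nn_integral_cong) (auto simp: indicator_def)
    then show ?thesis using fz[OF False] by simp
  qed
  have "ennreal (\<integral>s. f s \<partial>\<sigma>) = (\<integral>\<^sup>+s. ennreal (f s) \<partial>\<sigma>)"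
    using f0 fm by (intro nn_integral_eq_integral[symmetric] \<sigma>.integrable_const_bound[where B = 1]) auto
  also have "\<dots> = (\<integral>\<^sup>+s. (\<integral>\<^sup>+t. ennreal (f t) * indicator {t} s \<partial>count_space T) \<partial>\<sigma>)"
    by (simp add: point)
  also have "\<dots> = (\<integral>\<^sup>+t. (\<integral>\<^sup>+s. ennreal (f t) * indicator {t} s \<partial>\<sigma>) \<partial>count_space T)"
    using Ts by (intro nn_integral_count_space_nn_integral[OF T]) auto
  also have "\<dots> = (\<integral>\<^sup>+t. ennreal (f t * measure \<sigma> {t}) \<partial>count_space T)"
    using Ts f0 by (intro nn_integral_cong)
      (auto simp: nn_integral_cmult_indicator \<sigma>.emeasure_eq_measure ennreal_mult)
  finally have eq: "(\<integral>\<^sup>+t. ennreal (f t * measure \<sigma> {t}) \<partial>count_space T) = ennreal (\<integral>s. f s \<partial>\<sigma>)" by simp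
  have int: "integrable (count_space T) (\<lambda>t. f t * measure \<sigma> {t})"
    by (rule integrableI_nonneg) (use f0 eq in auto)
  then have abs: "Infinite_Set_Sum.abs_summable_on (\<lambda>t. f t * measure \<sigma> {t}) T"
    by (simp add: abs_summable_on_def)
  have "ennreal (\<integral>s. f s \<partial>\<sigma>) = ennreal (\<integral>t. f t * measure \<sigma> {t} \<partial>count_space T)"
    unfolding eq[symmetric] using int f0 by (intro nn_integral_eq_integral) auto
  then have "(\<integral>s. f s \<partial>\<sigma>) = (\<integral>t. f t * measure \<sigma> {t} \<partial>count_space T)"
    using f0 by (subst (asm) ennreal_inj) (auto intro!: Bochner_Integration.integral_nonneg)
  also have "\<dots> = infsum (\<lambda>t. f t * measure \<sigma> {t}) T"
    using abs by (simp add: infsetsum_infsum flip: infsetsum_def)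
  also have "\<dots> = infsum (\<lambda>s. \<P>(w in P. s \<bullet> V w \<ge> 0) * measure \<sigma> {s} ^ k) F"
  proof (rule infsum_cong_neutral)
    have pk: "x ^ (k - 1) * x = x ^ k" for x :: real
      using k_ge_2 by (intro power_minus_mult) simp
    show "f t * measure \<sigma> {t} = \<P>(w in P. t \<bullet> V w \<ge> 0) * measure \<sigma> {t} ^ k" if "t \<in> T \<inter> F" for t
      using that pk[of "measure \<sigma> {t}"] by (simp add: f_def limit_density_def halfspace_prob_def mult_ac)
    show "\<P>(w in P. t \<bullet> V w \<ge> 0) * measure \<sigma> {t} ^ k = 0" if "t \<in> F - T" for t
      using that k_ge_2 by (auto simp: T_def)
  qed (auto simp: T_def)
  finally show ?thesis by (simp add: f_def Gamma_fun_def)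
qed

text \<open>The index \<open>m\<close> of the cutoffs is fixed first, close to the limit, and
  \<open>n\<close> grows afterwards. The empty set is treated apart because \<open>infdist\<close>
  to it is 0, so the cutoffs would not vanish.\<close>

lemma ratio_upper_closed:
  assumes F: "closed F" "F \<subseteq> sphere 0 1" and e: "e > 0"
  shows "eventually (\<lambda>n. ratio n F \<le> Gamma_fun P V \<sigma> k F + e) sequentially"
proof (cases "F = {}")
  case True
  then show ?thesis using e by (simp add: overshoot_ratio_def Gamma_fun_def)
next
  case False
  let ?R = "\<lambda>m. (far_lim (real (Suc m)) + (\<integral>s. main_fun (1 / real (Suc m)) (real (Suc m)) (1 / real
      (Suc m)) F s \<partial>\<sigma>)) / fact k"
  have "?R \<longlonglongrightarrow> (0 + fact k * Gamma_fun P V \<sigma> k F) / fact k"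
    using main_fun_integral_tendsto[OF F(1) False] unfolding limit_density_integral[OF F(1) False F(2)]
    by (intro tendsto_divide tendsto_add far_lim_tendsto tendsto_const) auto
  then have "eventually (\<lambda>m. ?R m < Gamma_fun P V \<sigma> k F + e / 2) sequentially"
    by (rule order_tendstoD) (use e in simp)
  then obtain m where m: "?R m < Gamma_fun P V \<sigma> k F + e / 2" by (auto simp: eventually_sequentially)
  have "eventually (\<lambda>n. ratio n F \<le> ?R m + e / 2) sequentially"
    by (rule ratio_upper[OF F(1)]) (use e in auto)
  then show ?thesis by (rule eventually_mono) (use m in linarith)
qed

end

section \<open>The lower bound\<close>

lemma choose_over_power_lim: "(\<lambda>n. real (n choose k) / real n ^ k) \<longlonglongrightarrow> 1 / fact k"
proof -
  have "(\<lambda>n. (\<Prod>i<k. 1 - real i / real n) / fact k) \<longlonglongrightarrow> (\<Prod>i<k. 1 - 0) / fact k"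
    by (intro tendsto_divide tendsto_prod tendsto_diff tendsto_const tendsto_divide_0[OF tendsto_const]
        filterlim_at_top_imp_at_infinity filterlim_real_sequentially) auto
  moreover have "eventually (\<lambda>n. (\<Prod>i<k. 1 - real i / real n) / fact k = real (n choose k) / real n ^
      k) sequentially"
    using eventually_ge_at_top[of 1]
  proof eventually_elim
    case (elim n)
    have "real (n choose k) = (\<Prod>i<k. real n - real i) / fact k"
      by (simp add: binomial_gbinomial gbinomial_prod_rev atLeast0LessThan)
    also have "(\<Prod>i<k. real n - real i) = (\<Prod>i<k. real n * (1 - real i / real n))"
      using elim by (intro prod.cong) (auto simp: field_simps)
    also have "\<dots> = real n ^ k * (\<Prod>i<k. 1 - real i / real n)" by (simp add: prod.distrib)
    finally show ?case using elim by simp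
  qed
  ultimately show ?thesis using Lim_transform_eventually by fastforce
qed

context soft_overshoot
begin

definition atom_tail :: "'a \<Rightarrow> nat \<Rightarrow> real" where
  "atom_tail s n = prob {w \<in> space P. norm (H w) > M n \<and> sgn (H w) = s}"

text \<open>In contrast to \<open>\<psi>_emp\<close> this is a minorant: for positive \<tau> the
  cutoff vanishes where \<open>s \<bullet> v \<le> 0\<close> and reaches 1 at
  \<open>s \<bullet> v = \<tau>\<close>.\<close>

definition pos_emp :: "real \<Rightarrow> 'a \<Rightarrow> nat \<Rightarrow> real" where
  "pos_emp \<tau> s n = expectation (\<lambda>w. clamp01 ((s \<bullet> ((\<Sum>j=1..n-k. Hs j w) /\<^sub>R B n)) / \<tau>))"

definition aligned :: "nat \<Rightarrow> 'a \<Rightarrow> nat set \<Rightarrow> 'w set" where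
  "aligned n s A = {w \<in> space P. (\<forall>j\<in>A. norm (Hs j w) > M n \<and> sgn (Hs j w) = s) \<and>
     (\<forall>j\<in>{1..n} - A. norm (Hs j w) \<le> M n) \<and> s \<bullet> (\<Sum>j\<in>{1..n} - A. Hs j w) > 0}"

text \<open>Projection onto \<open>s\<close> is enough: the large summands contribute at least
  \<open>k * M n\<close>, the excesses only help, and the rest has positive component.\<close>

lemma aligned_overshoot:
  assumes n: "n \<ge> 1" and A: "A \<in> subsets_of_size n k" and s: "norm s = 1" and w: "w \<in> aligned n s A"
  shows "norm (S n w) > real k * M n" "sgn (S n w) \<in> sphere 0 1"
proof -
  note A' = subsets_of_sizeD[OF A]
  have Mn: "M n > 0" using M_pos n by simp
  have wP: "w \<in> space P" using w by (simp add: aligned_def)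
  have "S n w = (\<Sum>j\<in>{1..n} - A. X n j w) + (\<Sum>j\<in>A. X n j w)"
    unfolding trunc_sum_def using A' by (intro sum.subset_diff) auto
  also have "(\<Sum>j\<in>{1..n} - A. X n j w) = (\<Sum>j\<in>{1..n} - A. Hs j w)"
    using w by (intro sum.cong refl) (auto simp: soft_truncate_def aligned_def)
  also have "(\<Sum>j\<in>A. X n j w) = (\<Sum>j\<in>A. (M n + Ls j w) *\<^sub>R s)"
  proof (rule sum.cong[OF refl])
    fix j assume "j \<in> A"
    then have "norm (Hs j w) > M n" "sgn (Hs j w) = s" using w by (auto simp: aligned_def)
    then show "X n j w = (M n + Ls j w) *\<^sub>R s" by (simp add: soft_truncate_def)
  qed
  finally have "s \<bullet> S n w = s \<bullet> (\<Sum>j\<in>{1..n} - A. Hs j w) + (\<Sum>j\<in>A. M n + Ls j w)"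
    using s by (simp add: inner_add_right inner_sum_right norm_eq_1)
  moreover have "s \<bullet> (\<Sum>j\<in>{1..n} - A. Hs j w) > 0" using w by (simp add: aligned_def)
  moreover have "(\<Sum>j\<in>A. M n + Ls j w) \<ge> (\<Sum>j\<in>A. M n)"
    using A'(2) wP Ls_nonneg by (intro sum_mono) auto
  ultimately have "s \<bullet> S n w > real k * M n" using A'(4) by simp
  also have "s \<bullet> S n w \<le> norm s * norm (S n w)" by (rule norm_cauchy_schwarz)
  finally show 1: "norm (S n w) > real k * M n" using s by simp
  have "real k * M n \<ge> 0" using Mn by simp
  with 1 have "S n w \<noteq> 0" by auto
  then show "sgn (S n w) \<in> sphere 0 1" by (simp add: norm_sgn)
qed

text \<open>Without the demand that the other summands be small, the event contains one whose
  probability is bounded by a product through independence. Subtracting the cases with one more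
  large summand costs at most a further factor \<open>exc n\<close>, which tends to 0.\<close>

lemma aligned_prob:
  assumes n: "n \<ge> 1" and A: "A \<in> subsets_of_size n k" and \<tau>: "\<tau> > 0"
  shows "aligned n s A \<in> sets P"
    and "prob (aligned n s A) \<ge> atom_tail s n ^ k * max 0 (pos_emp \<tau> s n - exc n)"
proof -
  note A' = subsets_of_sizeD[OF A]
  define C where "C = {1..n} - A"
  have C: "finite C" "C \<subseteq> {1..}" "A \<inter> C = {}" by (auto simp: C_def)
  have cardC: "card C = n - k" unfolding C_def using A' by (simp add: card_Diff_subset)
  define Bs where "Bs = {x::'a. norm x > M n \<and> sgn x = s}"
  have Bs [measurable]: "Bs \<in> sets borel" unfolding Bs_def by measurable
  define r where "r = prob {w \<in> space P. H w \<in> Bs}"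
  have r: "r = atom_tail s n" by (simp add: r_def atom_tail_def Bs_def)
  define D where "D = {w \<in> space P. \<forall>j\<in>A. Hs j w \<in> Bs}"
  have D: "D \<in> sets P" unfolding D_def by (rule prob_all_in(1)[OF A'(1,2)]) simp
  define v where "v = (\<lambda>w. \<Sum>j\<in>C. Hs j w)"
  have vm [measurable]: "v \<in> borel_measurable P" unfolding v_def by (rule Hs_sum_measurable[OF C(2)])
  define U where "U = D \<inter> {w \<in> space P. s \<bullet> v w > 0}"
  have U: "U \<in> sets P" unfolding U_def using D by measurable
  define Gj where "Gj = (\<lambda>j. {w \<in> space P. \<forall>i\<in>insert j A. Hs i w \<in> (if i = j then {x. norm x > M n}
      else Bs)})"
  have Gj: "Gj j \<in> sets P" "prob (Gj j) = r ^ k * tail (M n)" if j: "j \<in> C" for j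
  proof -
    have jA: "j \<notin> A" "insert j A \<subseteq> {1..}" "finite (insert j A)" using j C A' by auto
    have m: "(if i = j then {x. norm x > M n} else Bs) \<in> sets borel" for i by simp
    show "Gj j \<in> sets P" unfolding Gj_def by (rule prob_all_in(1)[OF jA(3,2) m])
    have "prob (Gj j) = (\<Prod>i\<in>insert j A. prob {w \<in> space P. H w \<in> (if i = j then {x. norm x > M n} else Bs)})"
      unfolding Gj_def by (rule prob_all_in(2)[OF jA(3,2) m])
    also have "\<dots> = tail (M n) * (\<Prod>i\<in>A. prob {w \<in> space P. H w \<in> (if i = j then {x. norm x > M n} else Bs)})"
      using jA A' by simp
    also have "(\<Prod>i\<in>A. prob {w \<in> space P. H w \<in> (if i = j then {x. norm x > M n} else Bs)}) = (\<Prod>i\<in>A. r)"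
      using jA by (intro prod.cong refl) (auto simp: r_def)
    finally show "prob (Gj j) = r ^ k * tail (M n)" by (simp add: A'(4))
  qed
  have eq: "aligned n s A = U - (\<Union>j\<in>C. Gj j)"
  proof (intro equalityI subsetI)
    fix w assume w: "w \<in> aligned n s A"
    then have "w \<notin> Gj j" if "j \<in> C" for j
      using that by (force simp: aligned_def Gj_def C_def)
    then show "w \<in> U - (\<Union>j\<in>C. Gj j)" using w by (auto simp: aligned_def U_def D_def Bs_def v_def C_def)
  next
    fix w assume w: "w \<in> U - (\<Union>j\<in>C. Gj j)"
    have "norm (Hs j w) \<le> M n" if "j \<in> C" for j
    proof (rule ccontr)
      assume "\<not> norm (Hs j w) \<le> M n"
      then have "w \<in> Gj j" using w by (auto simp: Gj_def U_def D_def)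
      with w that show False by blast
    qed
    then show "w \<in> aligned n s A" using w by (auto simp: aligned_def U_def D_def Bs_def v_def C_def)
  qed
  have GU: "(\<Union>j\<in>C. Gj j) \<in> sets P" using Gj C by (intro sets.finite_UN) auto
  show sets: "aligned n s A \<in> sets P" unfolding eq using U GU by auto
  have probU: "prob U \<ge> r ^ k * pos_emp \<tau> s n"
  proof -
    define a where "a = (\<lambda>x. indicator Bs x :: real)"
    define b where "b = (\<lambda>z::'a. clamp01 ((s \<bullet> (z /\<^sub>R B n)) / \<tau>))"
    have [measurable]: "a \<in> borel_measurable borel" "b \<in> borel_measurable borel"
      unfolding a_def b_def by measurable
    have "expectation (\<lambda>w. (\<Prod>j\<in>A. a (Hs j w)) * b (\<Sum>j\<in>C. Hs j w)) =
      expectation (\<lambda>w. a (H w)) ^ card A * expectation (\<lambda>w. b (\<Sum>j\<in>C. Hs j w))"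
      by (rule expectation_split[OF A'(1,2) C]) (auto simp: a_def b_def indicator_def)
    also have "expectation (\<lambda>w. a (H w)) = r"
    proof -
      have "expectation (\<lambda>w. a (H w)) = expectation (indicator {w \<in> space P. H w \<in> Bs})"
        by (intro Bochner_Integration.integral_cong refl) (simp add: a_def indicator_def)
      then show ?thesis by (simp add: r_def)
    qed
    also have "expectation (\<lambda>w. b (\<Sum>j\<in>C. Hs j w)) = pos_emp \<tau> s n"
      unfolding pos_emp_def b_def
      by (rule expectation_sum_card[OF C(1,2), of "{1..n-k}" "\<lambda>z. clamp01 ((s \<bullet> (z /\<^sub>R B n)) / \<tau>)"])
        (auto simp: cardC)
    finally have "r ^ k * pos_emp \<tau> s n = expectation (\<lambda>w. (\<Prod>j\<in>A. a (Hs j w)) * b (v w))"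
      by (simp add: A'(4) v_def)
    also have "\<dots> \<le> expectation (indicator U)"
    proof (rule integral_mono)
      have am: "(\<lambda>w. a (Hs j w)) \<in> borel_measurable P" if "j \<in> A" for j
        using that A'(2) Hs_measurable[of j] by (auto intro!: measurable_compose[OF Hs_measurable])
      have "\<bar>(\<Prod>j\<in>A. a (Hs j w)) * b (v w)\<bar> \<le> 1" for w
        unfolding abs_mult abs_prod
        by (intro mult_le_one prod_le_1) (auto simp: a_def b_def indicator_def)
      then show "integrable P (\<lambda>w. (\<Prod>j\<in>A. a (Hs j w)) * b (v w))"
        using am by (intro integrable_const_bound[where B = 1] borel_measurable_times
            borel_measurable_prod) auto
      show "integrable P (indicat_real U)"
        using U by (intro integrable_real_indicator) (auto simp: emeasure_eq_measure)
      fix w assume w: "w \<in> space P"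
      show "(\<Prod>j\<in>A. a (Hs j w)) * b (v w) \<le> indicator U w"
      proof (cases "w \<in> U")
        case True
        have "(\<Prod>j\<in>A. a (Hs j w)) * b (v w) \<le> 1"
          by (intro mult_le_one prod_le_1 prod_nonneg) (auto simp: a_def b_def indicator_def)
        then show ?thesis using True by simp
      next
        case False
        then consider j where "j \<in> A" "Hs j w \<notin> Bs" | "s \<bullet> v w \<le> 0"
          using w by (force simp: U_def D_def)
        then have z: "(\<Prod>j\<in>A. a (Hs j w)) * b (v w) = 0"
        proof cases
          case 1
          then have "(\<Prod>j\<in>A. a (Hs j w)) = 0" using A'(1) by (intro prod_zero bexI[of _ j]) (auto simp: a_def)
          then show ?thesis by simp
        next
          case 2
          have "(s \<bullet> (v w /\<^sub>R B n)) / \<tau> \<le> 0"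
            using 2 \<tau> B_pos[of n] by (simp add: divide_le_0_iff mult_le_0_iff)
          then have "b (v w) = 0" by (simp add: b_def)
          then show ?thesis by simp
        qed
        show ?thesis unfolding z using False by simp
      qed
    qed
    also have "\<dots> = prob U" using U by simp
    finally show ?thesis .
  qed
  have probG: "prob (\<Union>j\<in>C. Gj j) \<le> r ^ k * exc n"
  proof -
    have "prob (\<Union>j\<in>C. Gj j) \<le> (\<Sum>j\<in>C. prob (Gj j))"
      using Gj C by (intro finite_measure_subadditive_finite) auto
    also have "\<dots> = real (n - k) * (r ^ k * tail (M n))" using Gj(2) by (simp add: cardC)
    also have "\<dots> \<le> real n * (r ^ k * tail (M n))"
      by (intro mult_right_mono) (auto simp: r_def)
    finally show ?thesis by (simp add: exc_def mult_ac)
  qed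
  have "prob U \<le> prob (aligned n s A \<union> (\<Union>j\<in>C. Gj j))"
    using eq by (intro finite_measure_mono sets.Un[OF sets GU]) auto
  also have "\<dots> \<le> prob (aligned n s A) + prob (\<Union>j\<in>C. Gj j)"
    using sets GU by (rule measure_Un_le)
  finally have "prob (aligned n s A) \<ge> r ^ k * (pos_emp \<tau> s n - exc n)"
    using probU probG by (simp add: right_diff_distrib)
  moreover have "prob (aligned n s A) \<ge> 0" by simp
  ultimately show "prob (aligned n s A) \<ge> atom_tail s n ^ k * max 0 (pos_emp \<tau> s n - exc n)"
    unfolding r[symmetric] by (auto simp: max_def)
qed

text \<open>Aligned events for different pairs are disjoint: \<open>A\<close> is recovered as the
  set of large indices and \<open>s\<close> as their common direction. The probabilities may
  therefore be added over the atoms in \<open>T\<close> without loss.\<close>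

lemma ratio_ge_atoms:
  assumes n: "n \<ge> 1" and T: "finite T" "T \<subseteq> sphere 0 1" and \<tau>: "\<And>s. s \<in> T \<Longrightarrow> \<tau> s > 0"
  shows "ratio n (sphere 0 1) \<ge> (\<Sum>s\<in>T. real (n choose k) / real n ^ k *
    (atom_tail s n / tail (M n)) ^ k * max 0 (pos_emp (\<tau> s) s n - exc n))"
proof -
  have ex: "exc n > 0" using n exc_pos by simp
  have [measurable]: "sphere (0::'a) 1 \<in> sets borel" by (rule borel_closed) simp
  define I where "I = T \<times> subsets_of_size n k"
  have I: "finite I" using T by (simp add: I_def)
  define W where "W = (\<lambda>z. aligned n (fst z) (snd z))"
  have Wm: "W z \<in> sets P" if "z \<in> I" for z
    using that aligned_prob(1)[OF n _ zero_less_one] by (auto simp: W_def I_def)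
  have det: "A = big (M n) n w \<and> (\<forall>j\<in>A. sgn (Hs j w) = s)"
    if "w \<in> aligned n s A" "A \<in> subsets_of_size n k" for w s A
  proof -
    note w = that(1)[unfolded aligned_def]
    have "j \<in> big (M n) n w" if "j \<in> A" for j
      using that w subsets_of_sizeD(3)[OF \<open>A \<in> subsets_of_size n k\<close>] unfolding big_def by blast
    moreover have "j \<in> A" if "j \<in> big (M n) n w" for j
    proof (rule ccontr)
      assume "j \<notin> A"
      then have "norm (Hs j w) \<le> M n" using that w unfolding big_def by blast
      then show False using that by (simp add: big_def)
    qed
    ultimately show ?thesis using w by blast
  qed
  have disj: "disjoint_family_on W I"
    unfolding disjoint_family_on_def
  proof (intro ballI impI)
    fix y z assume y: "y \<in> I" and z: "z \<in> I" and ne: "y \<noteq> z"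
    show "W y \<inter> W z = {}"
    proof (rule ccontr)
      assume "W y \<inter> W z \<noteq> {}"
      then obtain w where w: "w \<in> aligned n (fst y) (snd y)" "w \<in> aligned n (fst z) (snd z)"
        by (auto simp: W_def)
      have sy: "snd y \<in> subsets_of_size n k" and sz: "snd z \<in> subsets_of_size n k"
        using y z by (auto simp: I_def)
      have A: "snd y = snd z" using det[OF w(1) sy] det[OF w(2) sz] by simp
      obtain j where "j \<in> snd y" using subsets_of_sizeD(4)[OF sy] k_ge_2 by fastforce
      then have "fst y = fst z" using det[OF w(1) sy] det[OF w(2) sz] A by auto
      with A ne show False by (simp add: prod_eq_iff)
    qed
  qed
  have "(\<Sum>s\<in>T. real (n choose k) * (atom_tail s n ^ k * max 0 (pos_emp (\<tau> s) s n - exc n)))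
      = (\<Sum>s\<in>T. \<Sum>A\<in>subsets_of_size n k. atom_tail s n ^ k * max 0 (pos_emp (\<tau> s) s n - exc n))"
    by (simp add: card_subsets_of_size)
  also have "\<dots> \<le> (\<Sum>s\<in>T. \<Sum>A\<in>subsets_of_size n k. prob (aligned n s A))"
    using \<tau> by (intro sum_mono aligned_prob(2)[OF n]) auto
  also have "\<dots> = (\<Sum>z\<in>I. prob (W z))"
    unfolding I_def W_def using T by (subst sum.cartesian_product) (simp add: case_prod_beta')
  also have "\<dots> = prob (\<Union>z\<in>I. W z)"
    using I Wm disj by (intro finite_measure_finite_Union[symmetric]) auto
  also have "\<dots> \<le> prob {w \<in> space P. norm (S n w) > real k * M n \<and> sgn (S n w) \<in> sphere 0 1}"
  proof (rule finite_measure_mono)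
    show "(\<Union>z\<in>I. W z) \<subseteq> {w \<in> space P. norm (S n w) > real k * M n \<and> sgn (S n w) \<in> sphere 0 1}"
    proof
      fix w assume "w \<in> (\<Union>z\<in>I. W z)"
      then obtain s A where sA: "s \<in> T" "A \<in> subsets_of_size n k" "w \<in> aligned n s A"
        by (auto simp: I_def W_def)
      then have "norm s = 1" using T by auto
      from aligned_overshoot[OF n sA(2) this sA(3)] sA(3)
      show "w \<in> {w \<in> space P. norm (S n w) > real k * M n \<and> sgn (S n w) \<in> sphere 0 1}"
        by (simp add: aligned_def)
    qed
    show "{w \<in> space P. norm (S n w) > real k * M n \<and> sgn (S n w) \<in> sphere 0 1} \<in> sets P" by measurable
  qed
  finally have "(\<Sum>s\<in>T. real (n choose k) * (atom_tail s n ^ k * max 0 (pos_emp (\<tau> s) s n - exc n)))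
      / exc n ^ k
      \<le> ratio n (sphere 0 1)"
    unfolding overshoot_ratio_def exc_def[symmetric] using ex by (intro divide_right_mono) auto
  moreover have "(\<Sum>s\<in>T. real (n choose k) * (atom_tail s n ^ k * max 0 (pos_emp (\<tau> s) s n - exc n)))
      / exc n ^ k
      = (\<Sum>s\<in>T. real (n choose k) / real n ^ k *
          (atom_tail s n / tail (M n)) ^ k * max 0 (pos_emp (\<tau> s) s n - exc n))"
    unfolding sum_divide_distrib
    by (intro sum.cong refl) (simp add: exc_def power_mult_distrib power_divide)
  ultimately show ?thesis by simp
qed

lemma pos_emp_lim:
  assumes \<tau>: "\<tau> > 0" and s: "norm s = 1"
  shows "pos_emp \<tau> s \<longlonglongrightarrow> expectation (\<lambda>w. clamp01 ((s \<bullet> V w) / \<tau>))"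
  unfolding pos_emp_def[abs_def]
proof (rule expectation_shifted_stable_limit[where f = "\<lambda>v. clamp01 ((s \<bullet> v) / \<tau>)" and D = "1 / \<tau>"])
  fix x y :: 'a
  have "\<bar>clamp01 ((s \<bullet> x) / \<tau>) - clamp01 ((s \<bullet> y) / \<tau>)\<bar> \<le> \<bar>(s \<bullet> x) / \<tau> - (s \<bullet> y) / \<tau>\<bar>"
    by (rule clamp01_lipschitz)
  also have "\<dots> = \<bar>s \<bullet> (x - y)\<bar> / \<tau>"
    using \<tau> by (simp add: inner_diff_right diff_divide_distrib[symmetric])
  also have "\<dots> \<le> dist x y / \<tau>"
    using \<tau> s Cauchy_Schwarz_ineq2[of s "x - y"] by (intro divide_right_mono) (auto simp: dist_norm)
  finally show "\<bar>clamp01 ((s \<bullet> x) / \<tau>) - clamp01 ((s \<bullet> y) / \<tau>)\<bar> \<le> 1 / \<tau> * dist x y" by simp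
qed simp

text \<open>The limit of \<open>pos_emp\<close> tends to the probability of the open half-space as
  \<tau> shrinks; the assumption \<open>null\<close> identifies it with the closed one used in the
  upper bound.\<close>

lemma atom_term_lower:
  assumes s: "s \<in> sphere 0 1" and pos: "measure \<sigma> {s} > 0" and e: "e > 0"
    and atom: "\<And>e. e > 0 \<Longrightarrow> eventually (\<lambda>n. atom_tail s n \<ge> (measure \<sigma> {s} - e) * tail (M n)) sequentially"
    and null: "\<P>(w in P. s \<bullet> V w = 0) = 0"
  shows "\<exists>\<tau>>0. eventually (\<lambda>n. real (n choose k) / real n ^ k *
    (atom_tail s n / tail (M n)) ^ k * max 0 (pos_emp \<tau> s n - exc n)
      > halfspace_prob s * measure \<sigma> {s} ^ k / fact k - e) sequentially"
proof -
  let ?m = "measure \<sigma> {s}"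
  define y where "y = (\<lambda>m. expectation (\<lambda>w. clamp01 ((s \<bullet> V w) / (1 / real (Suc m)))))"
  have y0: "y m \<ge> 0" for m unfolding y_def by (intro Bochner_Integration.integral_nonneg) auto
  have "y \<longlonglongrightarrow> expectation (\<lambda>w. indicator {w \<in> space P. s \<bullet> V w > 0} w)"
    unfolding y_def
  proof (rule integral_dominated_convergence[where w = "\<lambda>_. 1"])
    show "AE w in P. (\<lambda>m. clamp01 ((s \<bullet> V w) / (1 / real (Suc m)))) \<longlonglongrightarrow> indicator {w \<in> space P. s \<bullet> V w > 0} w"
    proof (rule AE_I2)
      fix w assume w: "w \<in> space P"
      show "(\<lambda>m. clamp01 ((s \<bullet> V w) / (1 / real (Suc m)))) \<longlonglongrightarrow> indicator {w \<in> space P. s \<bullet> V w > 0} w"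
      proof (cases "s \<bullet> V w > 0")
        case True
        then have "eventually (\<lambda>m. 1 \<le> real (Suc m) * (s \<bullet> V w)) sequentially"
          by (rule eventually_real_Suc_mult_ge)
        then have "eventually (\<lambda>m. clamp01 ((s \<bullet> V w) / (1 / real (Suc m))) = indicator {w \<in> space
            P. s \<bullet> V w > 0} w) sequentially"
          by eventually_elim (use True w in \<open>simp add: mult.commute\<close>)
        then show ?thesis by (rule tendsto_eventually)
      next
        case False
        then have "clamp01 ((s \<bullet> V w) / (1 / real (Suc m))) = 0" for m
          by (intro clamp01_eq_0) (simp add: mult_nonpos_nonneg)
        then show ?thesis using False by simp
      qed
    qed
  qed auto
  moreover have "expectation (\<lambda>w. indicator {w \<in> space P. s \<bullet> V w > 0} w) = halfspace_prob s"
  proof -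
    have "{w \<in> space P. s \<bullet> V w \<ge> 0} = {w \<in> space P. s \<bullet> V w > 0} \<union> {w \<in> space P. s \<bullet> V w = 0}" by auto
    also have "prob \<dots> = prob {w \<in> space P. s \<bullet> V w > 0} + prob {w \<in> space P. s \<bullet> V w = 0}"
      by (intro finite_measure_Union) auto
    finally show ?thesis using null by (simp add: halfspace_prob_def)
  qed
  ultimately have y: "y \<longlonglongrightarrow> halfspace_prob s" by simp
  have inv: "(\<lambda>m. 1 / real (Suc m)) \<longlonglongrightarrow> 0"
    using LIMSEQ_inverse_real_of_nat by (simp add: inverse_eq_divide)
  have "(\<lambda>m. 1 / fact k * max 0 (?m - 1 / real (Suc m)) ^ k * y m) \<longlonglongrightarrow> 1 / fact k * max 0 (?m - 0) ^ k
      * halfspace_prob s"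
    by (intro tendsto_mult tendsto_const tendsto_power tendsto_max tendsto_diff inv y)
  then have "eventually (\<lambda>m. 1 / fact k * max 0 (?m - 1 / real (Suc m)) ^ k * y m
      > halfspace_prob s * ?m ^ k / fact k - e) sequentially"
    by (rule order_tendstoD) (use e pos in \<open>simp add: mult.commute\<close>)
  then obtain m where m: "1 / fact k * max 0 (?m - 1 / real (Suc m)) ^ k * y m
      > halfspace_prob s * ?m ^ k / fact k - e" by (auto simp: eventually_sequentially)
  \<comment> \<open>One parameter serves both as the width in \<open>pos_emp\<close> and as the loss
    allowed in the mass of the atom.\<close>
  define \<tau> where "\<tau> = 1 / real (Suc m)"
  have \<tau>: "\<tau> > 0" by (simp add: \<tau>_def)
  have "pos_emp \<tau> s \<longlonglongrightarrow> y m"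
    unfolding y_def \<tau>_def using s by (intro pos_emp_lim) auto
  then have "(\<lambda>n. real (n choose k) / real n ^ k * max 0 (?m - \<tau>) ^ k * max 0 (pos_emp \<tau> s n - exc n))
      \<longlonglongrightarrow> 1 / fact k * max 0 (?m - \<tau>) ^ k * max 0 (y m - 0)"
    by (intro tendsto_mult tendsto_const choose_over_power_lim tendsto_max tendsto_diff exc_lim)
  then have "eventually (\<lambda>n. real (n choose k) / real n ^ k * max 0 (?m - \<tau>) ^ k * max 0 (pos_emp \<tau>
      s n - exc n)
      > halfspace_prob s * ?m ^ k / fact k - e) sequentially"
    by (rule order_tendstoD) (use m y0[of m] in \<open>simp add: \<tau>_def max_absorb2\<close>)
  then have "eventually (\<lambda>n. real (n choose k) / real n ^ k *
    (atom_tail s n / tail (M n)) ^ k * max 0 (pos_emp \<tau> s n - exc n)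
      > halfspace_prob s * ?m ^ k / fact k - e) sequentially"
    using atom[OF \<tau>]
  proof eventually_elim
    case (elim n)
    have p: "tail (M n) > 0" by (rule G_pos)
    have "?m - \<tau> \<le> atom_tail s n / tail (M n)" using elim(2) p by (simp add: field_simps)
    moreover have "0 \<le> atom_tail s n / tail (M n)" by (simp add: atom_tail_def)
    ultimately have "max 0 (?m - \<tau>) ^ k \<le> (atom_tail s n / tail (M n)) ^ k"
      by (intro power_mono) auto
    then have "real (n choose k) / real n ^ k * max 0 (?m - \<tau>) ^ k * max 0 (pos_emp \<tau> s n - exc n)
        \<le> real (n choose k) / real n ^ k * (atom_tail s n / tail (M n)) ^ k * max 0 (pos_emp \<tau> s n - exc n)"
      by (intro mult_right_mono mult_left_mono) auto
    with elim(1) show ?case by linarith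
  qed
  with \<tau> show ?thesis by blast
qed

lemma Gamma_summable:
  "(\<lambda>s. \<P>(w in P. s \<bullet> V w \<ge> 0) * measure \<sigma> {s} ^ k) summable_on (sphere 0 1)"
proof -
  interpret \<sigma>: prob_space \<sigma> by (rule \<sigma>_prob)
  have bound: "sum (\<lambda>s. \<P>(w in P. s \<bullet> V w \<ge> 0) * measure \<sigma> {s} ^ k) F \<le> 1"
    if F: "finite F" "F \<subseteq> sphere 0 1" for F
  proof -
    have "sum (\<lambda>s. \<P>(w in P. s \<bullet> V w \<ge> 0) * measure \<sigma> {s} ^ k) F \<le> (\<Sum>s\<in>F. measure \<sigma> {s})"
    proof (rule sum_mono)
      fix s
      have "\<P>(w in P. s \<bullet> V w \<ge> 0) * measure \<sigma> {s} ^ k \<le> 1 * measure \<sigma> {s} ^ 1"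
        using k_ge_2 by (intro mult_mono power_decreasing) auto
      then show "\<P>(w in P. s \<bullet> V w \<ge> 0) * measure \<sigma> {s} ^ k \<le> measure \<sigma> {s}" by simp
    qed
    also have "\<dots> = measure \<sigma> F"
      using F sets_singleton_\<sigma> by (intro \<sigma>.finite_measure_eq_sum_singleton[symmetric]) auto
    also have "\<dots> \<le> 1" by simp
    finally show ?thesis .
  qed
  show ?thesis
    by (rule nonneg_bounded_partial_sums_imp_summable_on[where C = 1])
      (use bound in \<open>auto intro!: eventually_finite_subsets_at_top_weakI\<close>)
qed

text \<open>Finitely many atoms carry the sum up to \<open>e / 2\<close>, so only finitely many
  eventual bounds are combined.\<close>

lemma ratio_lower_total:
  assumes e: "e > 0"
    and atom: "\<And>s e. s \<in> sphere 0 1 \<Longrightarrow> e > 0 \<Longrightarrow>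
      eventually (\<lambda>n. atom_tail s n \<ge> (measure \<sigma> {s} - e) * tail (M n)) sequentially"
    and null: "\<And>s. s \<in> sphere 0 1 \<Longrightarrow> \<P>(w in P. s \<bullet> V w = 0) * measure \<sigma> {s} = 0"
  shows "eventually (\<lambda>n. ratio n (sphere 0 1) \<ge> Gamma_fun P V \<sigma> k (sphere 0 1) - e) sequentially"
proof -
  let ?f = "\<lambda>s. \<P>(w in P. s \<bullet> V w \<ge> 0) * measure \<sigma> {s} ^ k"
  have "(?f has_sum infsum ?f (sphere 0 1)) (sphere 0 1)"
    using Gamma_summable by (rule has_sum_infsum)
  then have "eventually (\<lambda>F. sum ?f F > infsum ?f (sphere 0 1) - e / 2) (finite_subsets_at_top (sphere 0 1))"
    unfolding has_sum_def by (rule order_tendstoD) (use e in simp)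
  then obtain T0 where T0: "finite T0" "T0 \<subseteq> sphere 0 1" "sum ?f T0 > infsum ?f (sphere 0 1) - e / 2"
    by (auto simp: eventually_finite_subsets_at_top)
  \<comment> \<open>Points of zero mass contribute nothing, and at the others the product hypothesis
    \<open>null\<close> really gives a null hyperplane.\<close>
  define T where "T = {s \<in> T0. measure \<sigma> {s} > 0}"
  have T: "finite T" "T \<subseteq> sphere 0 1" using T0 by (auto simp: T_def)
  have sumT: "sum ?f T = sum ?f T0"
  proof (rule sum.mono_neutral_left)
    show "\<forall>s\<in>T0 - T. ?f s = 0"
      using k_ge_2 by (auto simp: T_def not_less measure_le_0_iff)
  qed (use T0 in \<open>auto simp: T_def\<close>)
  \<comment> \<open>The added 1 covers the case of empty \<open>T\<close>.\<close>
  define c where "c = e / (2 * (real (card T) + 1))"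
  have c: "c > 0" "real (card T) * c \<le> e / 2"
  proof -
    show "c > 0" using e by (simp add: c_def)
    have "c * (real (card T) + 1) = e / 2" unfolding c_def by (simp add: field_simps)
    then show "real (card T) * c \<le> e / 2" using \<open>c > 0\<close> by (simp add: algebra_simps)
  qed
  have "\<forall>s\<in>T. \<exists>\<tau>>0. eventually (\<lambda>n. real (n choose k) / real n ^ k *
    (atom_tail s n / tail (M n)) ^ k * max 0 (pos_emp \<tau> s n - exc n)
      > halfspace_prob s * measure \<sigma> {s} ^ k / fact k - c) sequentially"
  proof
    fix s assume s: "s \<in> T"
    then have s1: "s \<in> sphere 0 1" and pos: "measure \<sigma> {s} > 0" using T by (auto simp: T_def)
    show "\<exists>\<tau>>0. eventually (\<lambda>n. real (n choose k) / real n ^ k *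
      (atom_tail s n / tail (M n)) ^ k * max 0 (pos_emp \<tau> s n - exc n)
        > halfspace_prob s * measure \<sigma> {s} ^ k / fact k - c) sequentially"
      by (rule atom_term_lower[OF s1 pos c(1) atom[OF s1]]) (use null[OF s1] pos in auto)
  qed
  from bchoice[OF this] obtain \<tau> where \<tau>: "\<forall>s\<in>T. \<tau> s > 0 \<and> eventually (\<lambda>n. real (n choose k) / real n ^ k *
    (atom_tail s n / tail (M n)) ^ k * max 0 (pos_emp (\<tau> s) s n - exc n)
      > halfspace_prob s * measure \<sigma> {s} ^ k / fact k - c) sequentially" ..
  have "eventually (\<lambda>n. \<forall>s\<in>T. real (n choose k) / real n ^ k *
    (atom_tail s n / tail (M n)) ^ k * max 0 (pos_emp (\<tau> s) s n - exc n)
      > halfspace_prob s * measure \<sigma> {s} ^ k / fact k - c) sequentially"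
    using T \<tau> by (intro eventually_ball_finite) blast+
  then show ?thesis using eventually_ge_1
  proof eventually_elim
    case (elim n)
    have "Gamma_fun P V \<sigma> k (sphere 0 1) = infsum ?f (sphere 0 1) / fact k"
      by (simp add: Gamma_fun_def)
    also have "\<dots> \<le> (sum ?f T + e / 2) / fact k"
      using T0(3) sumT by (intro divide_right_mono) auto
    also have "\<dots> \<le> sum ?f T / fact k + e / 2"
    proof -
      have "e / 2 / fact k \<le> e / 2 / 1" using e by (intro divide_left_mono) (auto simp: fact_ge_1)
      then show ?thesis unfolding add_divide_distrib by linarith
    qed
    also have "sum ?f T / fact k = (\<Sum>s\<in>T. (halfspace_prob s * measure \<sigma> {s} ^ k / fact k - c)) +
        real (card T) * c"
      by (simp add: sum_divide_distrib halfspace_prob_def sum_subtractf)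
    also have "\<dots> \<le> (\<Sum>s\<in>T. real (n choose k) / real n ^ k *
      (atom_tail s n / tail (M n)) ^ k * max 0 (pos_emp (\<tau> s) s n - exc n)) + e / 2"
      using elim(1) c(2) by (intro add_mono sum_mono) (auto simp: less_imp_le)
    also have "\<dots> \<le> ratio n (sphere 0 1) + e / 2"
      using ratio_ge_atoms[OF elim(2) T, of \<tau>] \<tau> by simp
    finally show ?case by simp
  qed
qed

end

text \<open>After an affine change the test function \<open>g\<close> takes values in the unit
  interval, and the upper bound applies to both \<open>g\<close> and \<open>1 - g\<close>.
  Convergence of the total masses turns the second into a lower bound for \<open>g\<close>.\<close>

lemma weak_conv_on_of_closed_and_total:
  fixes N :: "nat \<Rightarrow> 'a::euclidean_space measure" and N0 :: "'a measure"
  assumes K: "closed K"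
    and N: "\<And>n. finite_measure (N n)" "\<And>n. sets (N n) = sets (restrict_space borel K)"
    and N0: "finite_measure N0" "sets N0 = sets (restrict_space borel K)"
    and upper: "\<And>F e. closed F \<Longrightarrow> F \<subseteq> K \<Longrightarrow> e > 0 \<Longrightarrow>
      eventually (\<lambda>n. measure (N n) F \<le> measure N0 F + e) sequentially"
    and total: "\<And>e. e > 0 \<Longrightarrow> eventually (\<lambda>n. measure (N n) K \<ge> measure N0 K - e) sequentially"
  shows "weak_conv_on K N N0"
  unfolding weak_conv_on_def
proof (intro conjI allI impI)
  interpret N0: finite_measure N0 by (rule N0)
  have sp: "space (N n) = K" for n using sets_eq_imp_space_eq[OF N(2)] by (simp add: space_restrict_space)
  have sp0: "space N0 = K" using sets_eq_imp_space_eq[OF N0(2)] by (simp add: space_restrict_space)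
  fix f :: "'a \<Rightarrow> real" assume f: "continuous_on K f \<and> bounded (f ` K)"
  obtain c where c: "c > 0" "\<And>x. x \<in> K \<Longrightarrow> \<bar>f x\<bar> \<le> c"
    using f bounded_pos[of "f ` K"] by auto
  define g where "g = (\<lambda>x. (f x + c) / (2 * c))"
  have g: "continuous_on K g" unfolding g_def using f c by (intro continuous_intros) auto
  have gb: "0 \<le> g x \<and> g x \<le> 1" if "x \<in> K" for x
    using c(2)[OF that] c(1) by (auto simp: g_def divide_simps abs_le_iff)
  have gm: "g \<in> borel_measurable L" if "sets L = sets (restrict_space borel K)" for L
    using borel_measurable_continuous_on_restrict[OF g] by (subst measurable_cong_sets[OF that refl])
  have gi: "integrable (N n) g" for n
    by (rule finite_measure.integrable_const_bound[OF N(1), where B = 1])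
      (use gb gm[OF N(2)] in \<open>auto simp: sp\<close>)
  have gi0: "integrable N0 g"
    by (rule N0.integrable_const_bound[where B = 1]) (use gb gm[OF N0(2)] in \<open>auto simp: sp0\<close>)
  have idm: "(\<lambda>x. x) \<in> measurable (N n) (restrict_space borel K)" for n
    by (rule measurable_ident_sets[OF N(2)])
  have port: "eventually (\<lambda>n. (\<integral>x. h x \<partial>N n) \<le> (\<integral>x. h x \<partial>N0) + e) sequentially"
    if "continuous_on K h" "\<And>x. x \<in> K \<Longrightarrow> 0 \<le> h x \<and> h x \<le> (1::real)" "e > 0" for h e
  proof -
    have "eventually (\<lambda>n. 1 * (\<integral>x. h x \<partial>N n) \<le> (\<integral>x. h x \<partial>N0) + e) sequentially"
    proof (rule portmanteau_upper[where X = "\<lambda>_ x. x" and K = K])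
      fix F :: "'a set" and e :: real assume F: "closed F" "F \<subseteq> K" "e > 0"
      then have "(\<lambda>x. x) -` F \<inter> space (N n) = F" for n by (auto simp: sp)
      then show "eventually (\<lambda>n. 1 * measure (N n) ((\<lambda>x. x) -` F \<inter> space (N n)) \<le> measure N0 F + e)
          sequentially"
        using upper[OF F] by simp
    qed (use that K N N0 idm in auto)
    then show ?thesis by simp
  qed
  have lim_total: "(\<lambda>n. measure (N n) K) \<longlonglongrightarrow> measure N0 K"
  proof (rule order_tendstoI)
    fix y assume "y < measure N0 K"
    then show "eventually (\<lambda>n. y < measure (N n) K) sequentially"
      using total[of "(measure N0 K - y) / 2"] by (auto elim!: eventually_mono simp: field_simps)
  next
    fix y assume "measure N0 K < y"
    then show "eventually (\<lambda>n. measure (N n) K < y) sequentially"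
      using upper[OF K order_refl, of "(y - measure N0 K) / 2"] by (auto elim!: eventually_mono
          simp: field_simps)
  qed
  have ci: "integrable (N n) (\<lambda>_. y)" for n and y :: real
    by (rule finite_measure.integrable_const[OF N(1)])
  have compl: "(\<integral>x. 1 - g x \<partial>N n) = measure (N n) K - (\<integral>x. g x \<partial>N n)" for n
    using gi ci by (subst Bochner_Integration.integral_diff) (auto simp: sp)
  have compl0: "(\<integral>x. 1 - g x \<partial>N0) = measure N0 K - (\<integral>x. g x \<partial>N0)"
    using gi0 by (subst Bochner_Integration.integral_diff) (auto simp: sp0)
  have lim_g: "(\<lambda>n. \<integral>x. g x \<partial>N n) \<longlonglongrightarrow> (\<integral>x. g x \<partial>N0)"
  proof (rule order_tendstoI)
    fix y assume y: "y < (\<integral>x. g x \<partial>N0)"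
    \<comment> \<open>Two errors of size \<open>e\<close> occur, one from \<open>1 - g\<close> and
      one from the total mass; a third of the gap leaves the inequality strict.\<close>
    define e where "e = ((\<integral>x. g x \<partial>N0) - y) / 3"
    have e: "e > 0" using y by (simp add: e_def)
    have "eventually (\<lambda>n. (\<integral>x. 1 - g x \<partial>N n) \<le> (\<integral>x. 1 - g x \<partial>N0) + e) sequentially"
      using g gb e by (intro port continuous_intros) auto
    then show "eventually (\<lambda>n. y < (\<integral>x. g x \<partial>N n)) sequentially"
      using total[OF e]
    proof eventually_elim
      case (elim n)
      then show ?case using e unfolding compl compl0 e_def by argo
    qed
  next
    fix y assume y: "(\<integral>x. g x \<partial>N0) < y"
    have "eventually (\<lambda>n. (\<integral>x. g x \<partial>N n) \<le> (\<integral>x. g x \<partial>N0) + (y - (\<integral>x. g x \<partial>N0)) / 2) sequentially"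
      using y by (intro port g gb) auto
    then show "eventually (\<lambda>n. (\<integral>x. g x \<partial>N n) < y) sequentially"
      using y by (auto elim!: eventually_mono simp: field_simps)
  qed
  have fg: "f x = 2 * c * g x - c" for x using c(1) by (simp add: g_def)
  have If: "(\<integral>x. f x \<partial>N n) = 2 * c * (\<integral>x. g x \<partial>N n) - c * measure (N n) K" for n
    unfolding fg using gi ci by (subst Bochner_Integration.integral_diff) (auto simp: sp)
  have If0: "(\<integral>x. f x \<partial>N0) = 2 * c * (\<integral>x. g x \<partial>N0) - c * measure N0 K"
    unfolding fg using gi0 by (subst Bochner_Integration.integral_diff) (auto simp: sp0)
  show "(\<lambda>n. \<integral>x. f x \<partial>N n) \<longlonglongrightarrow> (\<integral>x. f x \<partial>N0)"
    unfolding If If0 by (intro tendsto_intros lim_g lim_total)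
qed (use N N0 in auto)

section \<open>Interpretation of the locales and derivation of both conclusions\<close>

theorem theorem2p4:
  fixes P :: "'w measure"
    and H V :: "'w \<Rightarrow> 'a::euclidean_space" and Hs :: "nat \<Rightarrow> 'w \<Rightarrow> 'a"
    and L :: "'w \<Rightarrow> real" and Ls :: "nat \<Rightarrow> 'w \<Rightarrow> real"
    and \<mu> :: "'a measure" and a M :: "nat \<Rightarrow> real" and \<alpha> :: real and k :: nat
  assumes P: "prob_space P"
    and H_rv: "H \<in> borel_measurable P"
    \<comment> \<open>regular variation of \<open>H\<close>\<close>
    and mu_radon: "radon_on (- {0}) \<mu>"
    and mu_nonnull: "emeasure \<mu> (space \<mu>) \<noteq> 0"
    and a_lim: "filterlim a at_top sequentially"
    and H_reg_var: "vague_conv_on punctured_compactification (scaled_law P H a) (extend_by_zero \<mu>)"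
    and alpha_pos: "\<alpha> > 0"
    and mu_homogeneous: "\<And>c A. c > 0 \<Longrightarrow> A \<in> sets \<mu> \<Longrightarrow>
          emeasure \<mu> ((\<lambda>x. c *\<^sub>R x) ` A) = ennreal (c powr (- \<alpha>)) * emeasure \<mu> A"
    and H_symmetric: "\<alpha> = 1 \<Longrightarrow> distr P borel (\<lambda>w. - H w) = distr P borel H"
    and H_centered: "\<alpha> > 1 \<Longrightarrow> has_bochner_integral P H 0"
    \<comment> \<open>the sequences \<open>H\<^sub>1, H\<^sub>2, \<dots>\<close> and \<open>L, L\<^sub>1, L\<^sub>2, \<dots>\<close>\<close>
    and Hs_indep: "prob_space.indep_vars P (\<lambda>_. borel) Hs {1..}"
    and Hs_law: "\<And>j. j \<ge> 1 \<Longrightarrow> distr P borel (Hs j) = distr P borel H"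
    and L_indep: "prob_space.indep_vars P (\<lambda>_. borel) (\<lambda>j. if j = 0 then L else Ls j) UNIV"
    and Ls_law: "\<And>j. j \<ge> 1 \<Longrightarrow> distr P borel (Ls j) = distr P borel L"
    and L_nonneg: "\<And>w. w \<in> space P \<Longrightarrow> L w \<ge> 0"
    and Ls_nonneg: "\<And>j w. j \<ge> 1 \<Longrightarrow> w \<in> space P \<Longrightarrow> Ls j w \<ge> 0"
    and H_L_indep: "prob_space.indep_set P
          (sets (vimage_algebra (space P) (\<lambda>w. (H w, \<lambda>j\<in>{1..}. Hs j w))
            (borel \<Otimes>\<^sub>M (\<Pi>\<^sub>M j\<in>{1..}. borel))))
          (sets (vimage_algebra (space P) (\<lambda>w. (L w, \<lambda>j\<in>{1..}. Ls j w))
            (borel \<Otimes>\<^sub>M (\<Pi>\<^sub>M j\<in>{1..}. borel))))"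
    \<comment> \<open>truncation levels in the soft truncation regime\<close>
    and M_pos: "\<And>n. n \<ge> 1 \<Longrightarrow> M n > 0"
    and M_lim: "filterlim M at_top sequentially"
    and soft: "(\<lambda>n. real n * \<P>(w in P. norm (H w) > M n)) \<longlonglongrightarrow> 0"
    and soft_eq_2: "\<alpha> = 2 \<Longrightarrow>
          \<exists>\<gamma>>0. filterlim (\<lambda>n. M n / sqrt (real n powr (1 + \<gamma>))) at_top sequentially"
    and soft_gt_2: "\<alpha> > 2 \<Longrightarrow>
          filterlim (\<lambda>n. M n / sqrt (real n * ln (M n))) at_top sequentially"
    \<comment> \<open>the stable limit \<open>V\<close>\<close>
    and V_rv: "V \<in> borel_measurable P"
    and V_stable: "stable_law (min \<alpha> 2) (distr P borel V)"
    and V_limit: "\<exists>B. (\<forall>n. B n > 0) \<and> filterlim B at_top sequentially \<and>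
          weak_conv_on UNIV (\<lambda>n. distr P borel (\<lambda>w. (\<Sum>j=1..n. Hs j w) /\<^sub>R B n))
            (distr P borel V)"
    and k: "k \<ge> 2"
    and L_tail: "(\<lambda>x. \<P>(w in P. L w > x)) \<in> o[at_top](\<lambda>x. \<P>(w in P. norm (H w) > x) ^ (k - 1))"
  shows "(\<forall>F. closed F \<and> F \<subseteq> sphere 0 1 \<longrightarrow>
            limsup (\<lambda>n. ereal (overshoot_ratio P H M (trunc_sum M Hs Ls) k n F))
              \<le> ereal (Gamma_fun P V (spectral_measure \<mu>) k F)) \<and>
         ((\<forall>s\<in>sphere 0 1.
             Liminf at_top (\<lambda>t. ereal (\<P>(w in P. norm (H w) > t \<and> sgn (H w) = s) /
                                        \<P>(w in P. norm (H w) > t)))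
               \<ge> ereal (measure (spectral_measure \<mu>) {s})) \<and>
          (\<forall>s\<in>sphere 0 1.
             \<P>(w in P. s \<bullet> V w = 0) * measure (spectral_measure \<mu>) {s} = 0) \<longrightarrow>
          weak_conv_on (sphere 0 1)
            (\<lambda>n. sphere_measure (\<lambda>A. ennreal (overshoot_ratio P H M (trunc_sum M Hs Ls) k n A)))
            (sphere_measure (\<lambda>A. ennreal (Gamma_fun P V (spectral_measure \<mu>) k A))))"
proof -
  interpret prob_space P by (rule P)
  obtain B where B: "\<And>n. B n > 0" "filterlim B at_top sequentially"
    "weak_conv_on UNIV (\<lambda>n. distr P borel (\<lambda>w. (\<Sum>j=1..n. Hs j w) /\<^sub>R B n)) (distr P borel V)"
    using V_limit by auto
  interpret scalings: vaguely_convergent_scalings P H \<mu> a \<alpha>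
    by unfold_locales (rule H_rv mu_radon mu_nonnull a_lim H_reg_var alpha_pos mu_homogeneous; assumption)+
  interpret rv: regularly_varying_vector P H \<alpha> by (rule scalings.regularly_varying)
  interpret sample: heavy_tailed_sample P H \<alpha> Hs
    by unfold_locales (use Hs_indep Hs_law in auto)
  define \<sigma> where "\<sigma> = spectral_measure \<mu>"
  interpret \<sigma>: prob_space \<sigma>
    unfolding \<sigma>_def by (rule scalings.prob_space_spectral_measure)
  have L_measurable: "L \<in> borel_measurable P" and Ls_measurable: "\<And>j. j \<ge> 1 \<Longrightarrow> Ls j \<in> borel_measurable P"
    using L_indep unfolding indep_vars_def by (auto dest: bspec[of _ _ 0] bspec[of _ _ "Suc _"]
        split: if_splits)
  \<comment> \<open>Stability excludes point masses, in particular the one at 0; this is what makes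
    \<open>B n\<close> negligible against \<open>M n\<close>.\<close>
  have V_nonzero: "\<not> (AE w in P. V w = 0)"
  proof
    assume AE: "AE w in P. V w = 0"
    have "distr P borel V = distr P borel (\<lambda>_. 0)"
      by (rule distr_cong_AE) (use AE V_rv in auto)
    also have "\<dots> = return borel 0" by (rule distr_const) simp
    finally show False using V_stable by (auto simp: stable_law_def)
  qed
  interpret soft_overshoot P H \<alpha> Hs M V B Ls "\<lambda>x. \<P>(w in P. L w > x)" \<sigma> k
  proof unfold_locales
    show "prob {w \<in> space P. (\<forall>i\<in>A. norm (Hs i w) > t) \<and> Ls j w > x} =
        \<P>(w in P. norm (H w) > t) ^ card A * \<P>(w in P. L w > x)"
      if A: "finite A" "A \<subseteq> {1..}" and j: "j \<ge> 1" for A t j x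
    proof -
      let ?N = "\<Pi>\<^sub>M j\<in>{1..}. borel :: 'a measure"
      let ?NL = "\<Pi>\<^sub>M j\<in>{1..}. borel :: real measure"
      let ?f = "\<lambda>w. (H w, \<lambda>j\<in>{1..}. Hs j w)"
      let ?g = "\<lambda>w. (L w, \<lambda>j\<in>{1..}. Ls j w)"
      \<comment> \<open>Cylinder sets that leave the first coordinate (\<open>H\<close> or
        \<open>L\<close>) free, so that the joint independence hypothesis applies to their
        preimages.\<close>
      define Z where "Z = {z \<in> space (borel \<Otimes>\<^sub>M ?N :: ('a \<times> (nat \<Rightarrow> 'a)) measure). \<forall>i\<in>A. norm (snd z i) > t}"
      define Y where "Y = {z \<in> space (borel \<Otimes>\<^sub>M ?NL :: (real \<times> (nat \<Rightarrow> real)) measure). snd z j > x}"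
      have comp: "(\<lambda>z. snd z i) \<in> borel_measurable (borel \<Otimes>\<^sub>M ?N :: ('a \<times> (nat \<Rightarrow> 'a)) measure)" if
          "i \<in> A" for i
        using that A(2) by (intro measurable_compose[OF measurable_snd measurable_component_singleton]) auto
      have Z: "Z \<in> sets (borel \<Otimes>\<^sub>M ?N)"
        unfolding Z_def using comp A(1) by (intro sets.sets_Collect_finite_All) (auto intro!:
            borel_measurable_less)
      have "(\<lambda>z. snd z j) \<in> borel_measurable (borel \<Otimes>\<^sub>M ?NL :: (real \<times> (nat \<Rightarrow> real)) measure)"
        using j by (intro measurable_compose[OF measurable_snd measurable_component_singleton]) auto
      then have Y: "Y \<in> sets (borel \<Otimes>\<^sub>M ?NL)"
        unfolding Y_def by measurable
      have fZ: "?f -` Z \<inter> space P = {w \<in> space P. \<forall>i\<in>A. norm (Hs i w) > t}"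
        using A(2) by (auto simp: Z_def space_pair_measure space_PiM)
      have gY: "?g -` Y \<inter> space P = {w \<in> space P. Ls j w > x}"
        using j by (auto simp: Y_def space_pair_measure space_PiM)
      have "prob {w \<in> space P. (\<forall>i\<in>A. norm (Hs i w) > t) \<and> Ls j w > x} = prob ((?f -` Z \<inter> space P) \<inter>
          (?g -` Y \<inter> space P))"
        unfolding fZ gY by (intro arg_cong[where f = prob]) auto
      also have "\<dots> = prob (?f -` Z \<inter> space P) * prob (?g -` Y \<inter> space P)"
        by (rule indep_setD[OF H_L_indep]) (intro in_vimage_algebra Z Y)+
      also have "prob (?f -` Z \<inter> space P) = rv.tail t ^ card A"
        unfolding fZ by (rule sample.prob_all_big[OF A])
      also have "prob (?g -` Y \<inter> space P) = measure (distr P borel (Ls j)) {x<..}"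
        unfolding gY using Ls_measurable[OF j] by (subst measure_distr) (auto intro!: arg_cong[where
            f = prob])
      also have "\<dots> = \<P>(w in P. L w > x)"
        unfolding Ls_law[OF j] using L_measurable by (subst measure_distr) (auto intro!:
            arg_cong[where f = prob])
      finally show ?thesis .
    qed
    show "sets \<sigma> = sets (restrict_space borel (sphere 0 1))" by (simp add: \<sigma>_def spectral_measure_def)
    show "eventually (\<lambda>t. \<P>(w in P. norm (H w) > t \<and> sgn (H w) \<in> F)
        \<le> (measure \<sigma> F + e) * \<P>(w in P. norm (H w) > t)) at_top"
      if "closed F" "F \<subseteq> sphere 0 1" "e > 0" for F e
      unfolding \<sigma>_def by (rule scalings.limsup_directions[OF that])
  qed (use Hs_indep Hs_law H_symmetric H_centered M_pos M_lim soft soft_eq_2 soft_gt_2 V_rv V_nonzero B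
      Ls_measurable Ls_nonneg L_tail k in auto)
  let ?S = "trunc_sum M Hs Ls"
  let ?R = "\<lambda>n. sphere_measure (\<lambda>A. ennreal (overshoot_ratio P H M ?S k n A))"
  let ?G = "sphere_measure (\<lambda>A. ennreal (Gamma_fun P V \<sigma> k A)) :: 'a measure"
  \<comment> \<open>This covers every \<open>n\<close>, including 0, where the sign of
    \<open>M 0\<close> is unknown: the total mass is either the given real value or 0, should
    additivity fail.\<close>
  have fin: "finite_measure (sphere_measure (\<lambda>A. ennreal (m A)) :: 'a measure)" for m
    by (rule finite_measureI) (simp add: sphere_measure_def emeasure_measure_of_conv)
  have meas: "measure (?R n) A = overshoot_ratio P H M ?S k n A"
    if "n \<ge> 1" "A \<in> sets (restrict_space borel (sphere 0 1))" for n A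
  proof -
    have "overshoot_ratio P H M ?S k n A \<ge> 0" by (simp add: overshoot_ratio_def)
    moreover have "M n \<ge> 0" using M_pos[OF that(1)] by simp
    ultimately show ?thesis
      using emeasure_overshoot_ratio[OF P S_measurable _ that(2)] by (simp add: measure_def)
  qed
  have meas0: "measure ?G A = Gamma_fun P V \<sigma> k A"
    if "A \<in> sets (restrict_space borel (sphere 0 1))" for A
  proof -
    have "Gamma_fun P V \<sigma> k A \<ge> 0" 
      unfolding Gamma_fun_def by (intro mult_nonneg_nonneg infsum_nonneg) auto
    then show ?thesis
      using emeasure_Gamma[OF P \<sigma>.finite_measure \<sigma>_sets _ that, of k V] k by (simp add: measure_def)
  qed
  have sph: "sphere 0 1 \<in> sets (restrict_space borel (sphere (0::'a) 1))"
    by (subst sets_restrict_space_iff) auto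
  show ?thesis
    unfolding \<sigma>_def[symmetric]
  proof (intro conjI allI impI)
    fix F :: "'a set" assume F: "closed F \<and> F \<subseteq> sphere 0 1"
    show "limsup (\<lambda>n. ereal (overshoot_ratio P H M ?S k n F)) \<le> ereal (Gamma_fun P V \<sigma> k F)"
    proof (rule ereal_le_epsilon2)
      fix e :: real assume e: "e > 0"
      have "eventually (\<lambda>n. ereal (overshoot_ratio P H M ?S k n F) \<le> ereal (Gamma_fun P V \<sigma> k F +
          e)) sequentially"
        using ratio_upper_closed[of F e] F e by simp
      then have "limsup (\<lambda>n. ereal (overshoot_ratio P H M ?S k n F)) \<le> ereal (Gamma_fun P V \<sigma> k F + e)"
        by (rule Limsup_bounded)
      then show "limsup (\<lambda>n. ereal (overshoot_ratio P H M ?S k n F)) \<le> ereal (Gamma_fun P V \<sigma> k F) + ereal e"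
        by simp
    qed
  next
    assume hyp: "(\<forall>s\<in>sphere 0 1. Liminf at_top (\<lambda>t. ereal (\<P>(w in P. norm (H w) > t \<and> sgn (H w) = s) /
        \<P>(w in P. norm (H w) > t))) \<ge> ereal (measure \<sigma> {s})) \<and>
      (\<forall>s\<in>sphere 0 1. \<P>(w in P. s \<bullet> V w = 0) * measure \<sigma> {s} = 0)"
    have atom: "eventually (\<lambda>n. atom_tail s n \<ge> (measure \<sigma> {s} - e) * rv.tail (M n)) sequentially"
      if s: "s \<in> sphere 0 1" and e: "e > 0" for s e
    proof -
      have "ereal (measure \<sigma> {s}) \<le> Liminf at_top (\<lambda>t. ereal (\<P>(w in P. norm (H w) > t \<and> sgn (H w) = s) /
          \<P>(w in P. norm (H w) > t)))"
        using hyp s by blast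
      moreover have "ereal (measure \<sigma> {s} - e) < ereal (measure \<sigma> {s})" using e by simp
      ultimately have "eventually (\<lambda>t. ereal (measure \<sigma> {s} - e) < ereal (\<P>(w in P. norm (H w) > t \<and>
          sgn (H w) = s) /
          \<P>(w in P. norm (H w) > t))) at_top"
        unfolding le_Liminf_iff by blast
      from eventually_compose_filterlim[OF this M_lim] show ?thesis
      proof eventually_elim
        case (elim n)
        then show ?case using rv.G_pos[of "M n"] by (simp add: atom_tail_def pos_less_divide_eq less_imp_le)
      qed
    qed
    show "weak_conv_on (sphere 0 1) ?R ?G"
    proof (rule weak_conv_on_of_closed_and_total)
      fix F :: "'a set" and e :: real assume F: "closed F" "F \<subseteq> sphere 0 1" and e: "e > 0"
      have Fs: "F \<in> sets (restrict_space borel (sphere 0 1))"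
        using F by (subst sets_restrict_space_iff) auto
      show "eventually (\<lambda>n. measure (?R n) F \<le> measure ?G F + e) sequentially"
        using ratio_upper_closed[OF F e] eventually_ge_1
        by eventually_elim (simp only: meas[OF _ Fs] meas0[OF Fs])
    next
      fix e :: real assume e: "e > 0"
      have "eventually (\<lambda>n. overshoot_ratio P H M ?S k n (sphere 0 1) \<ge> Gamma_fun P V \<sigma> k (sphere 0
          1) - e) sequentially"
        using hyp by (intro ratio_lower_total[OF e atom]) auto
      then show "eventually (\<lambda>n. measure (?R n) (sphere 0 1) \<ge> measure ?G (sphere 0 1) - e) sequentially"
        using eventually_ge_1 by eventually_elim (simp only: meas[OF _ sph] meas0[OF sph])
    qed (use fin in auto)
  qed
qed

end
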